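(* Let $\mathbb{F}$ be an algebraically closed field of arbitrary characteristic. Let $G$ be an abelian group. Let $R=\bigoplus_{g\in G}R_g$ be a grading of the matrix algebra $R=M_n(\mathbb{F})$. Then the $G$-graded algebra $R$ is isomorphic to some $\mathcal{M}(G,T,\beta,\kappa,\gamma)$, where $T\subset G$ is a (finite) subgroup, $\beta:T\times T\to\mathbb{F}^\times$ is a nondegenerate alternating bicharacter, $\kappa=(k_1,\ldots,k_s)$ is a tuple of positive integers and $\gamma=(g_1,\ldots,g_s)$ is a tuple of elements of $G$ with $g_i^{-1}g_j\notin T$ for all $i\neq j$, with $|\kappa|\sqrt{|T|}=n$. Two $G$-graded algebras $\mathcal{M}(G,T_1,\beta_1,\kappa_1,\gamma_1)$ and $\mathcal{M}(G,T_2,\beta_2,\kappa_2,\gamma_2)$ are isomorphic if and only if $T_1=T_2$, $\beta_1=\beta_2$ and $(\kappa_1,\gamma_1)\sim(\kappa_2,\gamma_2)$.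
   Context: **Gradings.** A $G$-grading on an algebra $U$ is a decomposition $U=\bigoplus_{g\in G}U_g$ into subspaces with $U_gU_h\subset U_{gh}$; isomorphisms of $G$-graded algebras are algebra isomorphisms mapping the component of degree $g$ onto the component of degree $g$ for every $g\in G$. **Bicharacters and standard realizations.** An alternating bicharacter $\beta:T\times T\to\mathbb{F}^\times$ on an abelian group $T$ is a map multiplicative in each variable with $\beta(t,t)=1$ for all $t$; it is nondegenerate if $\beta(u,t)=1$ for all $u\in T$ implies $t=e$. For finite $T$ and nondegenerate $\beta$ there is a decomposition $T=H_1'\times H_1''\times\cdots\times H_r'\times H_r''$ with $H_i'=\langle a_i\rangle$, $H_i''=\langle b_i\rangle$ cyclic of the same order $\ell_i$, such that $\varepsilon_i:=\beta(a_i,b_i)$ is a primitive $\ell_i$-th root of unity and all other values of $\beta$ on pairs of generators from different pairs are $1$. Let $X_i=\mathrm{diag}(\varepsilon_i^{\ell_i-1},\ldots,\varepsilon_i,1)\in M_{\ell_i}(\mathbb{F})$ and let $Y_i\in M_{\ell_i}(\mathbb{F})$ have entries $1$ at positions $(j,j+1)$, $1\le j<\ell_i$, and $(\ell_i,1)$, and $0$ elsewhere. Grade $M_{\ell_i}(\mathbb{F})$ by $\deg X_i=a_i$, $\deg Y_i=b_i$. Then $D=M_{\ell_1}(\mathbb{F})\otimes\cdots\otimes M_{\ell_r}(\mathbb{F})$ with the tensor product grading is called a standard realization of the division graded algebra with support $T$ and bicharacter $\beta$ (each $D_t$, $t\in T$, is one-dimensional; up to isomorphism of graded algebras $D$ depends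 only on $T$ and $\beta$). **The graded algebra $\mathcal{M}(G,T,\beta,\kappa,\gamma)$.** Let $T\subset G$ be a finite subgroup, $\beta:T\times T\to\mathbb{F}^\times$ a nondegenerate alternating bicharacter, $D$ a standard realization of the division graded algebra with support $T$ and bicharacter $\beta$, $\kappa=(k_1,\ldots,k_s)$ positive integers, $|\kappa|=k_1+\cdots+k_s$, $\gamma=(g_1,\ldots,g_s)$ with $g_i\in G$, $g_i^{-1}g_j\notin T$ for $i\neq j$. Let $C=M_{|\kappa|}(\mathbb{F})$ and let $e_1,\ldots,e_s\in C$ be the diagonal idempotents of the block decomposition determined by $\kappa$. Then $\mathcal{M}(G,T,\beta,\kappa,\gamma)$ is the algebra $C\otimes D$ graded by letting $U\otimes d$ have degree $g_i^{-1}tg_j$ for $U\in e_iCe_j$ and $d\in D_t$. **Equivalence.** $(\kappa,\gamma)\sim(\widetilde\kappa,\widetilde\gamma)$ means that $\kappa$ and $\widetilde\kappa$ have the same number of components $s$ and there exist $g\in G$ and a permutation $\pi$ of $\{1,\ldots,s\}$ such that $\widetilde{k}_i=k_{\pi(i)}$ and $\widetilde{g}_i\equiv g_{\pi(i)}g\pmod{T}$ for all $i=1,\ldots,s$. *)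

theory Defs
  imports
    "HOL-Algebra.QuotRing"
    "HOL-Algebra.Multiplicative_Group"
    "HOL-Combinatorics.Permutations"
    "Jordan_Normal_Form.VS_Connect"
begin

text \<open>
  The group \<open>G\<close> is a locale-style abelian group. The field is a type \<open>'f\<close>, viewed as
  the ring record \<open>class_ring\<close>, and \<open>M_n('f)\<close> is \<open>module_mat TYPE('f) n n\<close>, whose record
  carries the addition, the multiplication, the unit and the scalar multiplication.
\<close>

section \<open>Graded algebras\<close>

text \<open>
  A grading on \<open>U\<close> is the family \<open>\<Gamma>\<close> of its homogeneous components; only the values of
  \<open>\<Gamma>\<close> on \<open>carrier G\<close> matter. Since \<open>G\<close> may be infinite, directness of the sum is unique
  representability as a sum with finite support.
\<close>

definition graded_algebra ::
  "('g, 'm) monoid_scheme \<Rightarrow> ('k, 'r) ring_scheme \<Rightarrow> ('k, 'u, 'q) module_scheme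
    \<Rightarrow> ('g \<Rightarrow> 'u set) \<Rightarrow> bool"
  where "graded_algebra G K U \<Gamma> \<longleftrightarrow>
    (\<forall>g\<in>carrier G. VectorSpace.subspace K (\<Gamma> g) U) \<and>
    (\<forall>x\<in>carrier U. \<exists>!f. f \<in> (\<Pi>\<^sub>E g\<in>carrier G. \<Gamma> g) \<and>
        finite {g \<in> carrier G. f g \<noteq> \<zero>\<^bsub>U\<^esub>} \<and>
        x = (\<Oplus>\<^bsub>U\<^esub> g \<in> {g \<in> carrier G. f g \<noteq> \<zero>\<^bsub>U\<^esub>}. f g)) \<and>
    (\<forall>g\<in>carrier G. \<forall>h\<in>carrier G. \<forall>x\<in>\<Gamma> g. \<forall>y\<in>\<Gamma> h.
        x \<otimes>\<^bsub>U\<^esub> y \<in> \<Gamma> (g \<otimes>\<^bsub>G\<^esub> h))"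

definition graded_isomorphic ::
  "('g, 'm) monoid_scheme \<Rightarrow> ('k, 'r) ring_scheme
    \<Rightarrow> ('k, 'u, 'q) module_scheme \<Rightarrow> ('g \<Rightarrow> 'u set)
    \<Rightarrow> ('k, 'v, 'p) module_scheme \<Rightarrow> ('g \<Rightarrow> 'v set) \<Rightarrow> bool"
  where "graded_isomorphic G K U \<Gamma> V \<Delta> \<longleftrightarrow>
    (\<exists>\<phi> \<in> ring_iso U V \<inter> module_hom K U V. \<forall>g\<in>carrier G. \<phi> ` \<Gamma> g = \<Delta> g)"


section \<open>Bicharacters\<close>

text \<open>A bicharacter on \<open>T\<close> is a total function, of which only the values on \<open>T \<times> T\<close> matter.\<close>

definition alternating_bicharacter ::
  "('g, 'm) monoid_scheme \<Rightarrow> 'g set \<Rightarrow> ('g \<Rightarrow> 'g \<Rightarrow> 'f::field) \<Rightarrow> bool"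
  where "alternating_bicharacter G T \<beta> \<longleftrightarrow>
    (\<forall>s\<in>T. \<forall>t\<in>T. \<beta> s t \<noteq> 0) \<and>
    (\<forall>s\<in>T. \<forall>t\<in>T. \<forall>u\<in>T. \<beta> (s \<otimes>\<^bsub>G\<^esub> t) u = \<beta> s u * \<beta> t u \<and>
                        \<beta> u (s \<otimes>\<^bsub>G\<^esub> t) = \<beta> u s * \<beta> u t) \<and>
    (\<forall>t\<in>T. \<beta> t t = 1)"

definition nondegenerate ::
  "('g, 'm) monoid_scheme \<Rightarrow> 'g set \<Rightarrow> ('g \<Rightarrow> 'g \<Rightarrow> 'f::field) \<Rightarrow> bool"
  where "nondegenerate G T \<beta> \<longleftrightarrow> (\<forall>t\<in>T. (\<forall>u\<in>T. \<beta> u t = 1) \<longrightarrow> t = \<one>\<^bsub>G\<^esub>)"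

definition primitive_root_of_unity :: "nat \<Rightarrow> 'f::field \<Rightarrow> bool"
  where "primitive_root_of_unity l \<epsilon> \<longleftrightarrow>
    0 < l \<and> \<epsilon> ^ l = 1 \<and> (\<forall>k. 0 < k \<and> k < l \<longrightarrow> \<epsilon> ^ k \<noteq> 1)"

text \<open>
  \<open>ab\<close> lists the pairs of generators \<open>(a\<^sub>i, b\<^sub>i)\<close>. The \<open>bij_betw\<close> clause says that \<open>T\<close> is the
  internal direct product of the cyclic subgroups generated by all the \<open>a\<^sub>i\<close> and \<open>b\<^sub>i\<close>.
\<close>

definition symplectic_decomposition ::
  "('g, 'm) monoid_scheme \<Rightarrow> 'g set \<Rightarrow> ('g \<Rightarrow> 'g \<Rightarrow> 'f::field) \<Rightarrow> ('g \<times> 'g) list \<Rightarrow> bool"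
  where "symplectic_decomposition G T \<beta> ab \<longleftrightarrow>
    (\<forall>(a, b)\<in>set ab. a \<in> T \<and> b \<in> T \<and> group.ord G a = group.ord G b \<and>
        primitive_root_of_unity (group.ord G a) (\<beta> a b)) \<and>
    bij_betw (\<lambda>x. \<Otimes>\<^bsub>G\<^esub> i \<in> {..<length ab}. fst (x i) \<otimes>\<^bsub>G\<^esub> snd (x i))
      (\<Pi>\<^sub>E i\<in>{..<length ab}. generate G {fst (ab ! i)} \<times> generate G {snd (ab ! i)}) T \<and>
    (\<forall>i<length ab. \<forall>j<length ab. i \<noteq> j \<longrightarrow>
        (\<forall>x\<in>{fst (ab ! i), snd (ab ! i)}. \<forall>y\<in>{fst (ab ! j), snd (ab ! j)}. \<beta> x y = 1))"


section \<open>Standard realizations\<close>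

abbreviation mat_span :: "nat \<Rightarrow> 'f::field mat set \<Rightarrow> 'f mat set"
  where "mat_span n \<equiv> LinearCombinations.module.span class_ring (module_mat TYPE('f) n n)"

text \<open>
  The tensor product \<open>M_m \<otimes> M_n\<close> is realized on \<open>M_(mn)\<close>, where the pure tensor of \<open>A\<close> and
  \<open>B\<close> is the Kronecker product.
\<close>

definition kronecker :: "'f::field mat \<Rightarrow> 'f mat \<Rightarrow> 'f mat"
  where "kronecker A B = mat (dim_row A * dim_row B) (dim_col A * dim_col B)
    (\<lambda>(i, j). A $$ (i div dim_row B, j div dim_col B) * B $$ (i mod dim_row B, j mod dim_col B))"

definition tensor_grading ::
  "('g, 'm) monoid_scheme \<Rightarrow> nat \<Rightarrow> ('g \<Rightarrow> 'f::field mat set) \<Rightarrow> nat \<Rightarrow> ('g \<Rightarrow> 'f mat set)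
    \<Rightarrow> 'g \<Rightarrow> 'f mat set"
  where "tensor_grading G m \<Gamma> n \<Delta> g = mat_span (m * n)
    {kronecker A B | A B h k. h \<in> carrier G \<and> k \<in> carrier G \<and> A \<in> \<Gamma> h \<and> B \<in> \<Delta> k \<and>
       h \<otimes>\<^bsub>G\<^esub> k = g}"

definition X_mat :: "nat \<Rightarrow> 'f::field \<Rightarrow> 'f mat"
  where "X_mat l \<epsilon> = mat_diag l (\<lambda>i. \<epsilon> ^ (l - 1 - i))"

definition Y_mat :: "nat \<Rightarrow> 'f::field mat"
  where "Y_mat l = mat l l (\<lambda>(i, j). if j = Suc i \<or> (i = l - 1 \<and> j = 0) then 1 else 0)"

text \<open>
  The grading of \<open>M_l\<close> determined by \<open>deg X = a\<close> and \<open>deg Y = b\<close>; the monomials in \<open>X\<close> and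
  \<open>Y\<close> span \<open>M_l\<close>.
\<close>

definition XY_grading ::
  "('g, 'm) monoid_scheme \<Rightarrow> nat \<Rightarrow> 'f::field \<Rightarrow> 'g \<Rightarrow> 'g \<Rightarrow> 'g \<Rightarrow> 'f mat set"
  where "XY_grading G l \<epsilon> a b g = mat_span l
    {X_mat l \<epsilon> ^\<^sub>m u * Y_mat l ^\<^sub>m v | u v. a [^]\<^bsub>G\<^esub> (u::nat) \<otimes>\<^bsub>G\<^esub> b [^]\<^bsub>G\<^esub> (v::nat) = g}"

fun std_dim :: "('g, 'm) monoid_scheme \<Rightarrow> ('g \<times> 'g) list \<Rightarrow> nat"
  where
    "std_dim G [] = 1"
  | "std_dim G ((a, b) # ab) = group.ord G a * std_dim G ab"

text \<open>The empty tensor product is the field \<open>M_1\<close> with the trivial grading.\<close>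

fun std_grading ::
  "('g, 'm) monoid_scheme \<Rightarrow> ('g \<Rightarrow> 'g \<Rightarrow> 'f::field) \<Rightarrow> ('g \<times> 'g) list \<Rightarrow> 'g \<Rightarrow> 'f mat set"
  where
    "std_grading G \<beta> [] = (\<lambda>g. if g = \<one>\<^bsub>G\<^esub> then carrier_mat 1 1 else {0\<^sub>m 1 1})"
  | "std_grading G \<beta> ((a, b) # ab) =
       tensor_grading G (group.ord G a) (XY_grading G (group.ord G a) (\<beta> a b) a b)
         (std_dim G ab) (std_grading G \<beta> ab)"


section \<open>The graded algebras \<open>M(G, T, \<beta>, \<kappa>, \<gamma>)\<close>\<close>

definition M_data ::
  "('g, 'm) monoid_scheme \<Rightarrow> 'g set \<Rightarrow> ('g \<Rightarrow> 'g \<Rightarrow> 'f::field) \<Rightarrow> nat list \<Rightarrow> 'g list \<Rightarrow> bool"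
  where "M_data G T \<beta> \<kappa> \<gamma> \<longleftrightarrow>
    subgroup T G \<and> finite T \<and> alternating_bicharacter G T \<beta> \<and> nondegenerate G T \<beta> \<and>
    \<kappa> \<noteq> [] \<and> length \<gamma> = length \<kappa> \<and> (\<forall>k\<in>set \<kappa>. 0 < k) \<and> set \<gamma> \<subseteq> carrier G \<and>
    (\<forall>i<length \<gamma>. \<forall>j<length \<gamma>. i \<noteq> j \<longrightarrow> inv\<^bsub>G\<^esub> (\<gamma> ! i) \<otimes>\<^bsub>G\<^esub> (\<gamma> ! j) \<notin> T)"

definition block_idem :: "nat list \<Rightarrow> nat \<Rightarrow> 'f::field mat"
  where "block_idem \<kappa> i = mat_diag (sum_list \<kappa>)
    (\<lambda>p. if sum_list (take i \<kappa>) \<le> p \<and> p < sum_list (take (Suc i) \<kappa>) then 1 else 0)"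

definition M_algebra ::
  "('g, 'm) monoid_scheme \<Rightarrow> nat list \<Rightarrow> ('g \<times> 'g) list \<Rightarrow> ('f::field, 'f mat) module"
  where "M_algebra G \<kappa> ab =
    module_mat TYPE('f) (sum_list \<kappa> * std_dim G ab) (sum_list \<kappa> * std_dim G ab)"

text \<open>
  The parameter \<open>ab\<close> selects the standard realization \<open>D\<close> of the division graded algebra
  with support \<open>T\<close> and bicharacter \<open>\<beta>\<close>.
\<close>

definition M_grading ::
  "('g, 'm) monoid_scheme \<Rightarrow> 'g set \<Rightarrow> ('g \<Rightarrow> 'g \<Rightarrow> 'f::field) \<Rightarrow> nat list \<Rightarrow> 'g list
    \<Rightarrow> ('g \<times> 'g) list \<Rightarrow> 'g \<Rightarrow> 'f mat set"
  where "M_grading G T \<beta> \<kappa> \<gamma> ab g = mat_span (sum_list \<kappa> * std_dim G ab)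
    {kronecker U d | U d i j t.
       i < length \<kappa> \<and> j < length \<kappa> \<and> t \<in> T \<and>
       U \<in> {block_idem \<kappa> i * A * block_idem \<kappa> j | A. A \<in> carrier_mat (sum_list \<kappa>) (sum_list \<kappa>)} \<and>
       d \<in> std_grading G \<beta> ab t \<and>
       inv\<^bsub>G\<^esub> (\<gamma> ! i) \<otimes>\<^bsub>G\<^esub> t \<otimes>\<^bsub>G\<^esub> (\<gamma> ! j) = g}"

definition M_equiv ::
  "('g, 'm) monoid_scheme \<Rightarrow> 'g set \<Rightarrow> nat list \<Rightarrow> 'g list \<Rightarrow> nat list \<Rightarrow> 'g list \<Rightarrow> bool"
  where "M_equiv G T \<kappa> \<gamma> \<kappa>' \<gamma>' \<longleftrightarrow>
    length \<kappa> = length \<kappa>' \<and>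
    (\<exists>g\<in>carrier G. \<exists>\<pi>. \<pi> permutes {..<length \<kappa>} \<and>
       (\<forall>i<length \<kappa>. \<kappa>' ! i = \<kappa> ! \<pi> i \<and>
          T #>\<^bsub>G\<^esub> (\<gamma>' ! i) = T #>\<^bsub>G\<^esub> (\<gamma> ! \<pi> i \<otimes>\<^bsub>G\<^esub> g)))"

end

(*
  A matrix algebra is prime, so a minimal graded one-sided ideal of the graded algebra R has a
  homogeneous idempotent e for which D = e R e is a graded division algebra. Since the field is
  algebraically closed, every component of D is at most a line; the support T is a finite subgroup,
  and the commutation of homogeneous elements of D is a nondegenerate alternating bicharacter beta.
  Translating e by homogeneous elements gives a basis B p q t of R that multiplies like
  E_pq (x) X_t, with B p q t of degree (g p)^-1 t (g q). Such a basis determines R up to graded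
  isomorphism from T, beta and the multiset of cosets T g_p: two cocycles with the same commutator
  differ by a symmetric one, and a symmetric cocycle with values in an algebraically closed field
  is a coboundary. Conversely an isomorphism preserves the dimensions of the components
  e_p R_h, which are the multiplicities of the cosets T g_q; up to a common shift these are the data
  (kappa, gamma). A hyperbolic pair can be split off any nondegenerate beta, which provides the
  decomposition of T and, with the clock and shift matrices X and Y, the standard realization.
*)
theory Submission imports Defs
begin

section \<open>Algebras over a field\<close>

text \<open>The unit of a corner is not the unit of the ambient ring, so every notion below is
  relative to a subset \<open>A\<close> and, where needed, to an explicit unit. Commutativity of
  \<open>G\<close> acts through conjugation: all idempotents \<open>e p\<close> cut out corners with
  the same support \<open>T\<close>, so \<open>T\<close> and \<open>\<beta>\<close> do not depend on
  the idempotent, whereas \<open>g\<close> is determined only up to order, a common shift and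
  factors in \<open>T\<close>. The function \<open>coset_mult\<close> forgets these choices except
  the shift; hence both directions of the comparison are phrased with it, and the blocks enter only
  at the end. The constants \<open>\<sigma>\<close> depend on the choice of homogeneous generators,
  and only their commutator survives. Nothing is divided by the order of \<open>T\<close>: linear
  independence comes from Artin's argument, and extracting roots needs only one root of each
  polynomial, not distinct ones. Two isomorphic algebras are compared without knowing the
  automorphisms of a matrix algebra: it suffices to find idempotents \<open>E\<close>,
  \<open>F\<close>, one from each side, for which \<open>E * F * E\<close> and
  \<open>F * E * F\<close> are the same nonzero multiple of \<open>E\<close> and of
  \<open>F\<close>.\<close>

locale assoc_algebra = vector_space scale
  for scale :: "'f::field \<Rightarrow> 'a::ring_1 \<Rightarrow> 'a" (infixr "*s" 75) +
  assumes mult_scale_left [simp]: "(c *s x) * y = c *s (x * y)"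
    and mult_scale_right [simp]: "x * (c *s y) = c *s (x * y)"
begin

definition alg_iso :: "('a \<Rightarrow> 'a) \<Rightarrow> 'a set \<Rightarrow> 'a set \<Rightarrow> bool"
  where "alg_iso \<phi> A A' \<longleftrightarrow> bij_betw \<phi> A A' \<and>
    (\<forall>x\<in>A. \<forall>y\<in>A. \<phi> (x + y) = \<phi> x + \<phi> y \<and> \<phi> (x * y) = \<phi> x * \<phi> y) \<and>
    (\<forall>c. \<forall>x\<in>A. \<phi> (c *s x) = c *s \<phi> x)"

lemma mult_left_span:
  assumes "x \<in> span S" "\<And>s. s \<in> S \<Longrightarrow> a * s \<in> span V"
  shows "a * x \<in> span V"
  using assms(1)
proof (induction rule: span_induct_alt)
  case base
  then show ?case by (simp add: span_zero)
next
  case (step c x y)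
  then show ?case by (simp add: distrib_left span_add span_scale assms(2))
qed

lemma mult_right_span:
  assumes "x \<in> span S" "\<And>s. s \<in> S \<Longrightarrow> s * a \<in> span V"
  shows "x * a \<in> span V"
  using assms(1)
proof (induction rule: span_induct_alt)
  case base
  then show ?case by (simp add: span_zero)
next
  case (step c x y)
  then show ?case by (simp add: distrib_right span_add span_scale assms(2))
qed

lemma mult_span:
  assumes "x \<in> span S" "y \<in> span V" "\<And>s v. s \<in> S \<Longrightarrow> v \<in> V \<Longrightarrow> s * v \<in> span W"
  shows "x * y \<in> span W"
  by (rule mult_right_span[OF assms(1)], rule mult_left_span[OF assms(2)], rule assms(3))

lemma subspace_image_mult_right: "subspace V \<Longrightarrow> subspace ((\<lambda>r. r * x) ` V)"
  unfolding subspace_def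
  by (auto simp flip: distrib_right mult_scale_left intro: rev_image_eqI[of 0])

text \<open>Linearity of \<open>f\<close> is required only on \<open>U\<close>, because the maps
  compared later are controlled only on a corner of the ambient ring. The finite set
  \<open>F\<close> keeps \<open>dim V\<close> meaningful: an infinite basis would have
  \<open>card\<close> equal to 0.\<close>

lemma dim_le_of_inj:
  assumes fin: "finite F" "V \<subseteq> span F" and V: "subspace V" and U: "subspace U"
    and lin: "\<And>x y. x \<in> U \<Longrightarrow> y \<in> U \<Longrightarrow> f (x + y) = f x + f y"
      "\<And>c x. x \<in> U \<Longrightarrow> f (c *s x) = c *s f x"
    and inj: "\<And>x. x \<in> U \<Longrightarrow> f x = 0 \<Longrightarrow> x = 0"
    and into: "f ` U \<subseteq> V"
  shows "dim U \<le> dim V"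
proof -
  obtain B where B: "B \<subseteq> U" "independent B" "U \<subseteq> span B" "card B = dim U"
    using basis_exists by blast
  have f0: "f 0 = 0" using lin(2)[of 0 0] U by (simp add: subspace_0)
  have fsum: "f (\<Sum>b\<in>S. c b *s b) = (\<Sum>b\<in>S. c b *s f b)" if "finite S" "S \<subseteq> U" for S c
    using that
  proof (induction S)
    case (insert b S)
    have "(\<Sum>b\<in>S. c b *s b) \<in> U"
      using insert by (intro subspace_sum[OF U] subspace_scale[OF U]) auto
    then show ?case using insert U lin by (simp add: subspace_scale)
  qed (simp add: f0)
  have injf: "inj_on f U"
  proof (rule inj_onI)
    fix x y assume xy: "x \<in> U" "y \<in> U" "f x = f y"
    have "(-1) *s y \<in> U" using xy U subspace_scale by blast
    then have "f (x + (-1) *s y) = f x + (-1) *s f y" using xy lin by metis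
    then have "f (x - y) = 0" using xy by simp
    then show "x = y" using inj[of "x - y"] xy U by (simp add: subspace_diff)
  qed
  then have injB: "inj_on f B" using B(1) inj_on_subset by blast
  have ind: "independent (f ` B)"
    unfolding independent_explicit_finite_subsets
  proof (intro allI impI ballI)
    fix S u v assume S: "S \<subseteq> f ` B" "finite S" "(\<Sum>v\<in>S. u v *s v) = 0" "v \<in> S"
    define S' where "S' = {b\<in>B. f b \<in> S}"
    have im: "S = f ` S'" using S(1) unfolding S'_def by auto
    have injS': "inj_on f S'" using injB inj_on_subset unfolding S'_def by (metis Collect_subset)
    have finS': "finite S'" using S(2) im injS' finite_imageD by blast
    have subS': "S' \<subseteq> U" using B(1) unfolding S'_def by auto
    have "0 = (\<Sum>b\<in>S'. u (f b) *s f b)" using S(3) unfolding im by (simp add: sum.reindex[OF injS'])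
    also have "\<dots> = f (\<Sum>b\<in>S'. u (f b) *s b)" by (rule fsum[OF finS' subS', symmetric])
    finally have f0: "f (\<Sum>b\<in>S'. u (f b) *s b) = 0" ..
    have "(\<Sum>b\<in>S'. u (f b) *s b) \<in> U"
      using subS' by (intro subspace_sum[OF U] subspace_scale[OF U]) auto
    then have "(\<Sum>b\<in>S'. u (f b) *s b) = 0" using f0 by (rule inj)
    moreover have "S' \<subseteq> B" by (auto simp: S'_def)
    ultimately have "\<forall>b\<in>S'. u (f b) = 0"
      using B(2)[unfolded independent_explicit_finite_subsets, rule_format, of S' "\<lambda>b. u (f b)"] finS'
      by blast
    then show "u v = 0" using im S(4) by auto
  qed
  obtain C where C: "C \<subseteq> V" "independent C" "V \<subseteq> span C" "card C = dim V"
    using basis_exists by blast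
  have finC: "finite C" using independent_span_bound[OF fin(1) C(2)] C(1) fin(2) by blast
  have "f ` B \<subseteq> span C" using B(1) into C(3) by blast
  then have "card (f ` B) \<le> card C" using independent_span_bound[OF finC ind] by blast
  then show ?thesis using B C card_image[OF injB] by simp
qed

text \<open>A vector of \<open>V\<close> outside \<open>U\<close> would enlarge a basis of
  \<open>U\<close> to an independent subset of \<open>V\<close> with more than \<open>dim V\<close>
  elements.\<close>

lemma subspace_eq_if_dim_le:
  assumes fin: "finite F" "V \<subseteq> span F" and "subspace U" "subspace V" "U \<subseteq> V" "dim V \<le> dim U"
  shows "U = V"
proof (rule ccontr)
  assume "U \<noteq> V"
  then obtain v where v: "v \<in> V" "v \<notin> U" using assms by auto
  obtain B where B: "B \<subseteq> U" "independent B" "U \<subseteq> span B" "card B = dim U"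
    using basis_exists by blast
  have "span B = U" using B assms(3) by (metis span_minimal subset_antisym)
  then have ind: "independent (insert v B)" using v B by (simp add: independent_insertI)
  obtain C where C: "C \<subseteq> V" "independent C" "V \<subseteq> span C" "card C = dim V"
    using basis_exists by blast
  have finC: "finite C" using independent_span_bound[OF fin(1) C(2)] C(1) fin(2) by blast
  have "insert v B \<subseteq> span C" using v B C assms by blast
  note le = independent_span_bound[OF finC ind this]
  have "v \<notin> B" using v B by auto
  then have "card (insert v B) = Suc (dim U)" using B(4) le by simp
  then show False using le C(4) assms(6) by linarith
qed

end

section \<open>A ring containing all matrix algebras\<close>

text \<open>
  The matrix algebras of all sizes are corners of the ring of linear operators on
  the space of sequences. This puts them into a single type of class \<open>ring_1\<close>.
\<close>

typedef (overloaded) 'f op =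
  "{f :: (nat \<Rightarrow> 'f::field) \<Rightarrow> nat \<Rightarrow> 'f.
      (\<forall>v w. f (\<lambda>i. v i + w i) = (\<lambda>i. f v i + f w i)) \<and> (\<forall>c v. f (\<lambda>i. c * v i) = (\<lambda>i. c * f v i))}"
  morphisms app Op
  by (rule exI[of _ "\<lambda>v. v"]) auto

setup_lifting type_definition_op

instantiation op :: (field) ring_1
begin
lift_definition zero_op :: "'a op" is "\<lambda>v i. 0" by auto
lift_definition one_op :: "'a op" is "\<lambda>v. v" by auto
lift_definition plus_op :: "'a op \<Rightarrow> 'a op \<Rightarrow> 'a op" is "\<lambda>f g v i. f v i + g v i"
  by (auto simp: algebra_simps)
lift_definition minus_op :: "'a op \<Rightarrow> 'a op \<Rightarrow> 'a op" is "\<lambda>f g v i. f v i - g v i"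
  by (auto simp: algebra_simps)
lift_definition uminus_op :: "'a op \<Rightarrow> 'a op" is "\<lambda>f v i. - f v i"
  by (auto simp: algebra_simps)
lift_definition times_op :: "'a op \<Rightarrow> 'a op \<Rightarrow> 'a op" is "\<lambda>f g v. f (g v)"
  by auto
lemmas op_rep_eq = zero_op.rep_eq one_op.rep_eq plus_op.rep_eq minus_op.rep_eq uminus_op.rep_eq
  times_op.rep_eq

lemma op_eqI: "(\<And>v i. app f v i = app g v i) \<Longrightarrow> f = g"
  by (auto simp flip: app_inject)

lemma app_add: "app f (\<lambda>i. v i + w i) = (\<lambda>i. app f v i + app f w i)"
  using app[of f] by simp

instance
proof
  have "app 0 (\<lambda>_. 1) 0 \<noteq> app (1 :: 'a op) (\<lambda>_. 1) 0" by (simp add: op_rep_eq)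
  then show "(0 :: 'a op) \<noteq> 1" by metis
next
  fix a b c :: "'a op"
  show "a * b * c = a * (b * c)" by (rule op_eqI) (simp add: op_rep_eq)
  show "1 * a = a" by (rule op_eqI) (simp add: op_rep_eq)
  show "a * 1 = a" by (rule op_eqI) (simp add: op_rep_eq)
  show "a + b + c = a + (b + c)" by (rule op_eqI) (simp add: op_rep_eq)
  show "a + b = b + a" by (rule op_eqI) (simp add: op_rep_eq)
  show "0 + a = a" by (rule op_eqI) (simp add: op_rep_eq)
  show "- a + a = 0" by (rule op_eqI) (simp add: op_rep_eq)
  show "a - b = a + - b" by (rule op_eqI) (simp add: op_rep_eq)
  show "(a + b) * c = a * c + b * c" by (rule op_eqI) (simp add: op_rep_eq)
  show "a * (b + c) = a * b + a * c" by (rule op_eqI) (simp add: op_rep_eq app_add)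
qed
end

lift_definition scale_op :: "'f::field \<Rightarrow> 'f op \<Rightarrow> 'f op" is "\<lambda>c f v i. c * f v i"
  by (auto simp: algebra_simps)

lemma app_scale: "app f (\<lambda>i. c * v i) = (\<lambda>i. c * app f v i)"
  using app[of f] by simp

interpretation op: assoc_algebra scale_op
proof
  fix a b :: 'a and x y :: "'a op"
  show "scale_op a (x + y) = scale_op a x + scale_op a y"
    by (rule op_eqI) (simp add: op_rep_eq scale_op.rep_eq distrib_left)
  show "scale_op (a + b) x = scale_op a x + scale_op b x"
    by (rule op_eqI) (simp add: op_rep_eq scale_op.rep_eq distrib_right)
  show "scale_op a (scale_op b x) = scale_op (a * b) x"
    by (rule op_eqI) (simp add: op_rep_eq scale_op.rep_eq mult.assoc)
  show "scale_op 1 x = x"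
    by (rule op_eqI) (simp add: op_rep_eq scale_op.rep_eq)
  show "scale_op a x * y = scale_op a (x * y)"
    by (rule op_eqI) (simp add: op_rep_eq scale_op.rep_eq)
  show "x * scale_op a y = scale_op a (x * y)"
    by (rule op_eqI) (simp add: op_rep_eq scale_op.rep_eq app_scale)
qed

text \<open>The first \<open>n\<close> coordinates carry the matrix and all others are ignored in
  the argument and 0 in the value. Hence the identity matrix becomes a projection different from 1,
  which is the unit of its corner.\<close>

lift_definition emb :: "nat \<Rightarrow> 'f::field mat \<Rightarrow> 'f op" is
  "\<lambda>n A v i. if i < n then \<Sum>j<n. A $$ (i, j) * v j else 0"
  by (auto simp: algebra_simps sum.distrib sum_distrib_left)

context
  fixes n :: nat
begin

lemma emb_add:
  "A \<in> carrier_mat n n \<Longrightarrow> B \<in> carrier_mat n n \<Longrightarrow> emb n (A + B) = emb n A + emb n B"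
  by (rule op_eqI) (simp add: emb.rep_eq op_rep_eq distrib_right sum.distrib)

lemma emb_smult: "A \<in> carrier_mat n n \<Longrightarrow> emb n (c \<cdot>\<^sub>m A) = scale_op c (emb n A)"
  by (rule op_eqI) (simp add: emb.rep_eq scale_op.rep_eq sum_distrib_left mult.assoc)

lemma emb_zero: "emb n (0\<^sub>m n n) = 0"
  by (rule op_eqI) (simp add: emb.rep_eq op_rep_eq)

lemma emb_mult:
  assumes "A \<in> carrier_mat n n" "B \<in> carrier_mat n n"
  shows "emb n (A * B) = emb n A * emb n B"
proof (rule op_eqI)
  fix v i
  have "(\<Sum>j<n. (A * B) $$ (i, j) * v j) = (\<Sum>k<n. A $$ (i, k) * (\<Sum>j<n. B $$ (k, j) * v j))"
    if "i < n"
  proof -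
    have "(\<Sum>j<n. (A * B) $$ (i, j) * v j) = (\<Sum>j<n. \<Sum>k<n. A $$ (i, k) * B $$ (k, j) * v j)"
      using assms that
      by (intro sum.cong) (auto simp: scalar_prod_def sum_distrib_right atLeast0LessThan)
    also have "\<dots> = (\<Sum>k<n. \<Sum>j<n. A $$ (i, k) * B $$ (k, j) * v j)" by (rule sum.swap)
    finally show ?thesis by (simp add: sum_distrib_left mult.assoc)
  qed
  then show "app (emb n (A * B)) v i = app (emb n A * emb n B) v i"
    by (auto simp: emb.rep_eq op_rep_eq intro!: sum.cong)
qed

lemma emb_inj: "inj_on (emb n) (carrier_mat n n)"
proof (rule inj_onI)
  fix A B :: "'f::field mat"
  assume AB: "A \<in> carrier_mat n n" "B \<in> carrier_mat n n" "emb n A = emb n B"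
  have "A $$ (i, j) = B $$ (i, j)" if "i < n" "j < n" for i j
  proof -
    \<comment> \<open>Applying the operators to the \<open>j\<close>-th unit sequence recovers
      column \<open>j\<close>.\<close>
    have "app (emb n A) (\<lambda>k. if k = j then 1 else 0) i = app (emb n B) (\<lambda>k. if k = j then 1 else 0) i"
      using AB by simp
    then show ?thesis using that by (simp add: emb.rep_eq if_distrib cong: if_cong)
  qed
  then show "A = B" using AB by (intro eq_matI) auto
qed

definition corner :: "'f::field op set" where "corner = emb n ` carrier_mat n n"

definition unit_mat :: "nat \<Rightarrow> nat \<Rightarrow> 'f::field mat"
  where "unit_mat p q = mat n n (\<lambda>(i, j). if i = p \<and> j = q then 1 else 0)"

lemma unit_mat_carrier [simp]: "unit_mat p q \<in> carrier_mat n n"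
  by (simp add: unit_mat_def)

end

section \<open>Graded matrix bases\<close>

text \<open>
  \<open>B p q t\<close> plays the role of \<open>E\<^sub>p\<^sub>q \<otimes> X\<^sub>t\<close>, where \<open>X\<^sub>s X\<^sub>t = \<sigma> s t X\<^sub>s\<^sub>t\<close>. The degrees \<open>g p\<close> may
  repeat, so a block structure is not part of the data; it is recovered from the numbers
  \<open>coset_mult T k g u\<close>.
\<close>

definition (in comm_group) coset_mult :: "'a set \<Rightarrow> nat \<Rightarrow> (nat \<Rightarrow> 'a) \<Rightarrow> 'a \<Rightarrow> nat"
  where "coset_mult T k g u = card {q. q < k \<and> u \<otimes> inv (g q) \<in> T}"

lemma (in group) mult_inv_mult [simp]:
  "x \<in> carrier G \<Longrightarrow> y \<in> carrier G \<Longrightarrow> x \<otimes> (inv x \<otimes> y) = y"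
  "x \<in> carrier G \<Longrightarrow> y \<in> carrier G \<Longrightarrow> inv x \<otimes> (x \<otimes> y) = y"
  by (simp_all flip: m_assoc)

text \<open>This is where commutativity of \<open>G\<close> pays off: conjugation by
  \<open>g p\<close> does not change degrees, so the diagonal corners of a graded matrix basis all
  have support \<open>T\<close>.\<close>

lemma (in comm_group) conj_eq:
  "x \<in> carrier G \<Longrightarrow> y \<in> carrier G \<Longrightarrow> x \<otimes> y \<otimes> inv x = y"
  "x \<in> carrier G \<Longrightarrow> y \<in> carrier G \<Longrightarrow> inv x \<otimes> y \<otimes> x = y"
  by (simp_all add: m_assoc m_comm[of y])

text \<open>In a fixed matrix position \<open>p\<close>, \<open>q\<close> the degree
  \<open>h\<close> leaves only one candidate for \<open>t\<close>.\<close>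

lemma (in group) inv_mult_mult_eq_iff:
  assumes "x \<in> carrier G" "y \<in> carrier G" "t \<in> carrier G" "h \<in> carrier G"
  shows "inv x \<otimes> t \<otimes> y = h \<longleftrightarrow> t = x \<otimes> h \<otimes> inv y"
proof
  assume "inv x \<otimes> t \<otimes> y = h"
  then have "x \<otimes> h \<otimes> inv y = x \<otimes> (inv x \<otimes> (t \<otimes> (y \<otimes> inv y)))"
    using assms by (simp add: m_assoc del: r_inv mult_inv_mult flip: \<open>inv x \<otimes> t \<otimes> y = h\<close>)
  then show "t = x \<otimes> h \<otimes> inv y" using assms by simp
next
  assume "t = x \<otimes> h \<otimes> inv y"
  then have "inv x \<otimes> t \<otimes> y = inv x \<otimes> (x \<otimes> (h \<otimes> (inv y \<otimes> y)))"
    using assms by (simp add: m_assoc del: l_inv mult_inv_mult)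
  then show "inv x \<otimes> t \<otimes> y = h" using assms by simp
qed

context
  fixes G :: "('g, 'm) monoid_scheme" (structure) and T and \<beta> :: "'g \<Rightarrow> 'g \<Rightarrow> 'f::field"
  assumes G: "comm_group G" and T: "subgroup T G" and bichar: "alternating_bicharacter G T \<beta>"
begin

interpretation comm_group G by (rule G)
interpretation T: subgroup T G by (rule T)

lemma bichar_nz: "s \<in> T \<Longrightarrow> t \<in> T \<Longrightarrow> \<beta> s t \<noteq> 0"
  using bichar by (auto simp: alternating_bicharacter_def)

lemma bichar_mult:
  "s \<in> T \<Longrightarrow> t \<in> T \<Longrightarrow> u \<in> T \<Longrightarrow> \<beta> (s \<otimes> t) u = \<beta> s u * \<beta> t u"
  "s \<in> T \<Longrightarrow> t \<in> T \<Longrightarrow> u \<in> T \<Longrightarrow> \<beta> u (s \<otimes> t) = \<beta> u s * \<beta> u t"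
  using bichar by (auto simp: alternating_bicharacter_def)

lemma bichar_diag: "t \<in> T \<Longrightarrow> \<beta> t t = 1"
  using bichar by (auto simp: alternating_bicharacter_def)

lemma bichar_one: "u \<in> T \<Longrightarrow> \<beta> \<one> u = 1" "u \<in> T \<Longrightarrow> \<beta> u \<one> = 1"
  using bichar_mult[of \<one> \<one> u] bichar_nz[of \<one> u] bichar_nz[of u \<one>] by auto

lemma bichar_inv:
  assumes "s \<in> T" "t \<in> T"
  shows "\<beta> (inv s) t = inverse (\<beta> s t)" "\<beta> t (inv s) = inverse (\<beta> t s)"
  using bichar_mult[of s "inv s" t] bichar_one[OF assms(2)] assms
  by (auto simp: inverse_unique)

text \<open>Expanding \<open>\<beta> (s \<otimes> t) (s \<otimes> t) = 1\<close> leaves only the two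
  mixed factors.\<close>

lemma bichar_skew: "s \<in> T \<Longrightarrow> t \<in> T \<Longrightarrow> \<beta> s t * \<beta> t s = 1"
  using bichar_mult(1)[of s t "s \<otimes> t"] bichar_mult(2)[of s t] bichar_diag[of "s \<otimes> t"]
  by (simp add: bichar_diag)

lemma bichar_pow:
  fixes n :: nat
  assumes "s \<in> T" "t \<in> T"
  shows "\<beta> (s [^] n) t = \<beta> s t ^ n" "\<beta> t (s [^] n) = \<beta> t s ^ n"
proof -
  have pow: "s [^] m \<in> T" for m :: nat using assms by (induction m) auto
  show "\<beta> (s [^] n) t = \<beta> s t ^ n" "\<beta> t (s [^] n) = \<beta> t s ^ n"
    using assms pow by (induction n) (auto simp: bichar_one bichar_mult)
qed

text \<open>Nondegeneracy is applied to the quotient \<open>s \<otimes> inv t\<close>.\<close>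

lemma bichar_separates:
  assumes nondeg: "nondegenerate G T \<beta>" and "s \<in> T" "t \<in> T" "s \<noteq> t"
  shows "\<exists>u\<in>T. \<beta> u s \<noteq> \<beta> u t"
proof (rule ccontr)
  assume "\<not> ?thesis"
  then have "\<beta> u (s \<otimes> inv t) = 1" if "u \<in> T" for u
    using assms that bichar_nz[of u t] by (simp add: bichar_mult bichar_inv)
  then have "s \<otimes> inv t = \<one>" using assms unfolding nondegenerate_def by auto
  then show False using assms by (metis T.mem_carrier T.m_inv_closed inv_inv inv_equality)
qed

end

text \<open>Linear independence of the \<open>B p q t\<close> is a consequence of
  \<open>B_mult\<close>, \<open>B_nz\<close> and \<open>nondeg\<close>, not a part of the
  definition. The cocycle \<open>\<sigma>\<close> is not normalised, so that any choice of
  homogeneous generators fits.\<close>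

locale graded_matrix_basis = assoc_algebra scale + comm_group G
  for scale :: "'f::field \<Rightarrow> 'a::ring_1 \<Rightarrow> 'a" (infixr "*s" 75)
    and G :: "('g, 'm) monoid_scheme" (structure) +
  fixes T :: "'g set" and \<beta> :: "'g \<Rightarrow> 'g \<Rightarrow> 'f" and k :: nat and g :: "nat \<Rightarrow> 'g"
    and A :: "'a set" and \<Gamma> :: "'g \<Rightarrow> 'a set"
    and B :: "nat \<Rightarrow> nat \<Rightarrow> 'g \<Rightarrow> 'a" and \<sigma> :: "'g \<Rightarrow> 'g \<Rightarrow> 'f"
  assumes subgroup_T: "subgroup T G" and finite_T: "finite T"
    and bichar: "alternating_bicharacter G T \<beta>" and nondeg: "nondegenerate G T \<beta>"
    and k_pos: "0 < k" and g_closed [simp, intro]: "\<And>p. p < k \<Longrightarrow> g p \<in> carrier G"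
    and B_mult: "\<And>p q p' q' s t. p < k \<Longrightarrow> q < k \<Longrightarrow> p' < k \<Longrightarrow> q' < k \<Longrightarrow> s \<in> T \<Longrightarrow> t \<in> T \<Longrightarrow>
      B p q s * B p' q' t = (if q = p' then \<sigma> s t *s B p q' (s \<otimes> t) else 0)"
    and \<sigma>_nz: "\<And>s t. s \<in> T \<Longrightarrow> t \<in> T \<Longrightarrow> \<sigma> s t \<noteq> 0"
    and \<sigma>_comm: "\<And>s t. s \<in> T \<Longrightarrow> t \<in> T \<Longrightarrow> \<sigma> s t = \<beta> s t * \<sigma> t s"
    and B_nz: "\<And>p q t. p < k \<Longrightarrow> q < k \<Longrightarrow> t \<in> T \<Longrightarrow> B p q t \<noteq> 0"
    and A_span: "A = span {B p q t | p q t. p < k \<and> q < k \<and> t \<in> T}"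
    and \<Gamma>_span: "\<And>h. h \<in> carrier G \<Longrightarrow>
      \<Gamma> h = span {B p q t | p q t. p < k \<and> q < k \<and> t \<in> T \<and> inv (g p) \<otimes> t \<otimes> g q = h}"
begin

lemma T_closed [simp, intro]: "t \<in> T \<Longrightarrow> t \<in> carrier G"
  using subgroup_T by (rule subgroup.mem_carrier)

lemma T_mult [simp, intro]: "s \<in> T \<Longrightarrow> t \<in> T \<Longrightarrow> s \<otimes> t \<in> T"
  using subgroup_T by (rule subgroup.m_closed)

lemma T_one [simp, intro]: "\<one> \<in> T"
  using subgroup_T by (rule subgroup.one_closed)

lemma T_inv [simp, intro]: "t \<in> T \<Longrightarrow> inv t \<in> T"
  using subgroup_T by (rule subgroup.m_inv_closed)

text \<open>Associativity for three diagonal basis elements, with coefficients compared by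
  \<open>B_nz\<close>.\<close>

lemma \<sigma>_cocycle:
  assumes "s \<in> T" "t \<in> T" "u \<in> T"
  shows "\<sigma> s t * \<sigma> (s \<otimes> t) u = \<sigma> t u * \<sigma> s (t \<otimes> u)"
proof -
  have "B 0 0 s * B 0 0 t * B 0 0 u = B 0 0 s * (B 0 0 t * B 0 0 u)" by (rule mult.assoc)
  then have "(\<sigma> s t * \<sigma> (s \<otimes> t) u) *s B 0 0 (s \<otimes> t \<otimes> u)
      = (\<sigma> t u * \<sigma> s (t \<otimes> u)) *s B 0 0 (s \<otimes> t \<otimes> u)"
    using assms k_pos by (simp add: B_mult m_assoc)
  then show ?thesis using B_nz[of 0 0 "s \<otimes> t \<otimes> u"] k_pos assms by simp
qed

text \<open>The cocycle identity makes \<open>\<sigma>\<close> constant on pairs with a trivial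
  entry. This constant is the factor by which \<open>B p p \<one>\<close> fails to be
  idempotent.\<close>

definition \<sigma>\<^sub>1 :: 'f where "\<sigma>\<^sub>1 = \<sigma> \<one> \<one>"

lemma \<sigma>\<^sub>1_nz: "\<sigma>\<^sub>1 \<noteq> 0"
  by (simp add: \<sigma>\<^sub>1_def \<sigma>_nz)

lemma \<sigma>_one_left: "t \<in> T \<Longrightarrow> \<sigma> \<one> t = \<sigma>\<^sub>1"
  using \<sigma>_cocycle[of \<one> \<one> t] \<sigma>_nz[of \<one> t] by (simp add: \<sigma>\<^sub>1_def)

lemma \<sigma>_one_right: "t \<in> T \<Longrightarrow> \<sigma> t \<one> = \<sigma>\<^sub>1"
  using \<sigma>_cocycle[of t \<one> \<one>] \<sigma>_nz[of t \<one>] by (simp add: \<sigma>\<^sub>1_def)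

definition e :: "nat \<Rightarrow> 'a" where "e p = inverse \<sigma>\<^sub>1 *s B p p \<one>"

lemma e_B: "p < k \<Longrightarrow> q < k \<Longrightarrow> r < k \<Longrightarrow> t \<in> T \<Longrightarrow> e p * B q r t = (if p = q then B p r t else 0)"
  by (simp add: e_def B_mult \<sigma>_one_left \<sigma>\<^sub>1_nz)

lemma B_e: "p < k \<Longrightarrow> q < k \<Longrightarrow> r < k \<Longrightarrow> t \<in> T \<Longrightarrow> B q r t * e p = (if r = p then B q p t else 0)"
  by (simp add: e_def B_mult \<sigma>_one_right \<sigma>\<^sub>1_nz)

lemma e_e: "p < k \<Longrightarrow> q < k \<Longrightarrow> e p * e q = (if p = q then e p else 0)"
  by (auto simp: e_def B_mult \<sigma>_one_left \<sigma>\<^sub>1_nz)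

lemma e_idem: "p < k \<Longrightarrow> e p * e p = e p"
  by (simp add: e_e)

lemma e_nz: "p < k \<Longrightarrow> e p \<noteq> 0"
  by (simp add: e_def B_nz \<sigma>\<^sub>1_nz)

lemma B_in_A: "p < k \<Longrightarrow> q < k \<Longrightarrow> t \<in> T \<Longrightarrow> B p q t \<in> A"
  unfolding A_span by (rule span_base) auto

lemma subspace_A: "subspace A" unfolding A_span by (rule subspace_span)

lemma subspace_\<Gamma>: "h \<in> carrier G \<Longrightarrow> subspace (\<Gamma> h)" by (simp add: \<Gamma>_span)

lemma \<Gamma>_subset: "h \<in> carrier G \<Longrightarrow> \<Gamma> h \<subseteq> A"
  unfolding A_span \<Gamma>_span by (rule span_mono) auto

lemma deg_diag: "p < k \<Longrightarrow> t \<in> T \<Longrightarrow> inv (g p) \<otimes> t \<otimes> g p = t"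
  by (simp add: conj_eq)

lemma B_diag_in_\<Gamma>: "p < k \<Longrightarrow> t \<in> T \<Longrightarrow> B p p t \<in> \<Gamma> t"
  by (subst \<Gamma>_span) (auto intro!: span_base deg_diag exI[of _ p] exI[of _ t])

lemma e_in_\<Gamma>: "p < k \<Longrightarrow> e p \<in> \<Gamma> \<one>"
  unfolding e_def using B_diag_in_\<Gamma>[of p \<one>] subspace_\<Gamma>[of \<one>] by (simp add: subspace_scale)

lemma A_mult: "x \<in> A \<Longrightarrow> y \<in> A \<Longrightarrow> x * y \<in> A"
  unfolding A_span
proof (erule mult_span, assumption, clarsimp simp: B_mult span_zero, rule span_scale, rule span_base)
  fix p q q' t s assume "p < k" "q' < k" "t \<in> T" "s \<in> T"
  then show "B p q' (t \<otimes> s) \<in> {B p q t |p q t. p < k \<and> q < k \<and> t \<in> T}" by blast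
qed

lemma deg_mult:
  assumes "p < k" "q < k" "r < k" "s \<in> T" "t \<in> T"
  shows "(inv (g p) \<otimes> s \<otimes> g q) \<otimes> (inv (g q) \<otimes> t \<otimes> g r) = inv (g p) \<otimes> (s \<otimes> t) \<otimes> g r"
  using assms by (simp add: m_assoc)

lemma \<Gamma>_mult:
  assumes "h \<in> carrier G" "h' \<in> carrier G" "x \<in> \<Gamma> h" "y \<in> \<Gamma> h'"
  shows "x * y \<in> \<Gamma> (h \<otimes> h')"
proof -
  let ?S = "\<lambda>h. {B p q t |p q t. p < k \<and> q < k \<and> t \<in> T \<and> inv (g p) \<otimes> t \<otimes> g q = h}"
  have "x * y \<in> span (?S (h \<otimes> h'))"
  proof (rule mult_span[OF assms(3,4)[unfolded \<Gamma>_span[OF assms(1)] \<Gamma>_span[OF assms(2)]]])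
    fix x y assume "x \<in> ?S h" "y \<in> ?S h'"
    then obtain p q s p' q' t where xy: "x = B p q s" "p < k" "q < k" "s \<in> T"
      "inv (g p) \<otimes> s \<otimes> g q = h" "y = B p' q' t" "p' < k" "q' < k" "t \<in> T"
      "inv (g p') \<otimes> t \<otimes> g q' = h'" by blast
    show "x * y \<in> span (?S (h \<otimes> h'))"
    proof (cases "q = p'")
      case True
      then have "inv (g p) \<otimes> (s \<otimes> t) \<otimes> g q' = h \<otimes> h'" 
        using deg_mult[OF xy(2,3,8,4,9)] xy(5,10) by simp
      then have "B p q' (s \<otimes> t) \<in> ?S (h \<otimes> h')" using xy by blast
      then show ?thesis using xy True by (simp add: B_mult span_scale span_base)
    qed (use xy in \<open>simp add: B_mult span_zero\<close>)
  qed
  then show ?thesis using assms by (simp add: \<Gamma>_span)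
qed

definition unit :: 'a where "unit = (\<Sum>p<k. e p)"

lemma mult_unit: "x \<in> A \<Longrightarrow> x * unit = x"
  unfolding A_span
proof (induction rule: span_induct_alt)
  case (step c x y)
  then obtain p q t where x: "x = B p q t" "p < k" "q < k" "t \<in> T" by blast
  have "x * unit = (\<Sum>r<k. if r = q then x else 0)"
    unfolding unit_def sum_distrib_left using x by (intro sum.cong) (auto simp: B_e)
  also have "\<dots> = x" using x by simp
  finally show ?case using step by (simp add: distrib_right)
qed simp

lemmas \<beta>_separates = bichar_separates[OF comm_group_axioms subgroup_T bichar nondeg]

text \<open>Artin's argument for the independence of characters, applied to conjugation by \<open>B p p u\<close>.\<close>
lemma B_diag_independent:
  assumes "finite S" "S \<subseteq> T" "p < k" "(\<Sum>t\<in>S. c t *s B p p t) = 0"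
  shows "\<forall>t\<in>S. c t = 0"
  using assms(1,2,4)
proof (induction S arbitrary: c)
  case (insert x S)
  let ?X = "B p p"
  have comm: "?X u * ?X t = \<beta> u t *s (?X t * ?X u)" if "u \<in> T" "t \<in> T" for u t
    using that assms(3) m_comm[of u t] \<sigma>_comm[of u t] by (simp add: B_mult)
  \<comment> \<open>Moving \<open>?X u\<close> through the relation multiplies the term of
    \<open>t\<close> by \<open>\<beta> u t\<close>. Subtracting \<open>\<beta> u x\<close> times the
    relation removes the term of \<open>x\<close>.\<close>
  have zero: "(\<beta> u t - \<beta> u x) * c t = 0" if "u \<in> T" "t \<in> S" for u t
  proof -
    have "0 = ?X u * (\<Sum>t\<in>insert x S. c t *s ?X t)
          - (\<beta> u x *s (\<Sum>t\<in>insert x S. c t *s ?X t)) * ?X u"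
      unfolding insert.prems(2) by simp
    also have "\<dots> = (\<Sum>t\<in>insert x S. c t *s (?X u * ?X t) - (\<beta> u x * c t) *s (?X t * ?X u))"
      by (simp only: sum_distrib_left sum_distrib_right scale_sum_right mult_scale_left
          mult_scale_right scale_scale sum_subtractf)
    also have "\<dots> = (\<Sum>t\<in>insert x S. ((\<beta> u t - \<beta> u x) * c t) *s (?X t * ?X u))"
    proof (rule sum.cong[OF refl])
      fix t assume "t \<in> insert x S"
      then have "t \<in> T" using insert by auto
      then show "c t *s (?X u * ?X t) - (\<beta> u x * c t) *s (?X t * ?X u)
          = ((\<beta> u t - \<beta> u x) * c t) *s (?X t * ?X u)"
        unfolding comm[OF that(1) \<open>t \<in> T\<close>] scale_scale left_diff_distrib
          scale_left_diff_distrib[symmetric] by (simp only: mult.commute)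
    qed
    also have "\<dots> = (\<Sum>t\<in>S. ((\<beta> u t - \<beta> u x) * c t) *s (?X t * ?X u))"
      using insert by simp
    \<comment> \<open>Right multiplication by \<open>?X (inv u)\<close> turns each
      \<open>?X t * ?X u\<close> into a nonzero multiple of \<open>?X t\<close>, so that the
      induction hypothesis applies.\<close>
    finally have "0 = (\<Sum>t\<in>S. ((\<beta> u t - \<beta> u x) * c t) *s (?X t * ?X u)) * ?X (inv u)" by simp
    also have "\<dots> = (\<Sum>t\<in>S. ((\<beta> u t - \<beta> u x) * c t * \<sigma> u (inv u) * \<sigma> t \<one>) *s ?X t)"
      unfolding sum_distrib_right
    proof (rule sum.cong[OF refl])
      fix t assume "t \<in> S"
      then have "t \<in> T" using insert by auto
      then show "((\<beta> u t - \<beta> u x) * c t) *s (?X t * ?X u) * ?X (inv u)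
          = ((\<beta> u t - \<beta> u x) * c t * \<sigma> u (inv u) * \<sigma> t \<one>) *s ?X t"
        using that(1) assms(3) B_mult[of p p p p u "inv u"] B_mult[of p p p p t \<one>]
        by (simp add: mult.assoc del: scale_cancel_right scale_cancel_left)
    qed
    finally have "(\<Sum>t\<in>S. ((\<beta> u t - \<beta> u x) * c t * \<sigma> u (inv u) * \<sigma> t \<one>) *s ?X t) = 0" ..
    then have "\<forall>t\<in>S. (\<beta> u t - \<beta> u x) * c t * \<sigma> u (inv u) * \<sigma> t \<one> = 0"
      using insert.IH[of "\<lambda>t. (\<beta> u t - \<beta> u x) * c t * \<sigma> u (inv u) * \<sigma> t \<one>"] insert.prems by blast
    moreover have "t \<in> T" using that insert by auto
    ultimately show ?thesis using that \<sigma>_nz[of u "inv u"] \<sigma>_nz[of t \<one>] by auto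
  qed
  have S0: "c t = 0" if "t \<in> S" for t
  proof -
    have "t \<in> T" "x \<in> T" "t \<noteq> x" using that insert by auto
    then obtain u where "u \<in> T" "\<beta> u t \<noteq> \<beta> u x" using \<beta>_separates by blast
    then show ?thesis using zero[of u t] that by simp
  qed
  then have "c x *s ?X x = 0" using insert by simp
  then have "c x = 0" using B_nz[of p p x] insert assms(3) by auto
  then show ?case using S0 by auto
qed simp

definition I :: "(nat \<times> nat \<times> 'g) set" where "I = {..<k} \<times> {..<k} \<times> T"

definition Bt :: "nat \<times> nat \<times> 'g \<Rightarrow> 'a" where "Bt = (\<lambda>(p, q, t). B p q t)"

lemma finite_I: "finite I" using finite_T by (simp add: I_def)

lemma card_I: "card I = k * k * card T" by (simp add: I_def card_cartesian_product)

text \<open>Multiplying by \<open>e p\<close> and \<open>e q\<close> leaves only the terms in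
  position \<open>p\<close>, \<open>q\<close>. The further factor \<open>B q p \<one>\<close> moves
  them to the diagonal, where \<open>B_diag_independent\<close> applies.\<close>

lemma B_independent:
  assumes "(\<Sum>i\<in>I. c i *s Bt i) = 0" "i \<in> I"
  shows "c i = 0"
proof -
  obtain p q t where i: "i = (p, q, t)" "p < k" "q < k" "t \<in> T" using assms(2) by (auto simp: I_def)
  have "0 = e p * (\<Sum>i\<in>I. c i *s Bt i) * e q * B q p \<one>" using assms(1) by simp
  also have "\<dots> = (\<Sum>i\<in>I. c i *s (e p * Bt i * e q * B q p \<one>))"
    by (simp only: sum_distrib_left sum_distrib_right mult_scale_left mult_scale_right)
  also have "\<dots> = (\<Sum>i\<in>(\<lambda>t. (p, q, t)) ` T. c i *s (e p * Bt i * e q * B q p \<one>))"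
    using finite_I i
    by (intro sum.mono_neutral_right) (auto simp: I_def Bt_def e_B B_e split: if_splits)
  also have "\<dots> = (\<Sum>t\<in>T. c (p, q, t) *s (e p * Bt (p, q, t) * e q * B q p \<one>))"
    by (subst sum.reindex) (auto simp: inj_on_def)
  also have "\<dots> = (\<Sum>t\<in>T. (c (p, q, t) * \<sigma> t \<one>) *s B p p t)"
    using i by (intro sum.cong) (auto simp: Bt_def e_B B_e B_mult)
  finally have "(\<Sum>t\<in>T. (c (p, q, t) * \<sigma> t \<one>) *s B p p t) = 0" ..
  then have "\<forall>t\<in>T. c (p, q, t) * \<sigma> t \<one> = 0"
    by (rule B_diag_independent[OF finite_T subset_refl i(2)])
  then show ?thesis using i \<sigma>_nz[of t \<one>] by auto
qed

lemma inj_Bt: "inj_on Bt I"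
proof (rule inj_onI, rule ccontr)
  fix i j assume ij: "i \<in> I" "j \<in> I" "Bt i = Bt j" "i \<noteq> j"
  \<comment> \<open>Two equal basis elements would satisfy the relation with coefficients 1 and
    -1.\<close>
  let ?c = "\<lambda>l. if l = i then 1 else if l = j then - 1 else 0 :: 'f"
  have "(\<Sum>l\<in>I. ?c l *s Bt l) = (\<Sum>l\<in>{i, j}. ?c l *s Bt l)"
    using ij finite_I by (intro sum.mono_neutral_right) auto
  also have "\<dots> = 0" using ij by simp
  finally have "?c i = 0" using B_independent[of ?c i] ij by blast
  then show False by simp
qed

lemma independent_Bt: "independent (Bt ` I)"
proof (rule independent_if_scalars_zero)
  show "finite (Bt ` I)" using finite_I by simp
  fix f x assume H: "(\<Sum>x\<in>Bt ` I. f x *s x) = 0" "x \<in> Bt ` I"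
  have "(\<Sum>i\<in>I. f (Bt i) *s Bt i) = 0" using H(1) by (simp add: sum.reindex[OF inj_Bt])
  then have "\<forall>i\<in>I. f (Bt i) = 0" using B_independent[of "\<lambda>i. f (Bt i)"] by blast
  then show "f x = 0" using H(2) by blast
qed

lemma Bt_image: "{B p q t | p q t. p < k \<and> q < k \<and> t \<in> T \<and> P p q t} = Bt ` {(p, q, t) \<in> I. P p q t}"
  unfolding Bt_def I_def by force

lemma A_span_Bt: "A = span (Bt ` I)"
  using Bt_image[of "\<lambda>p q t. True"] by (simp add: A_span)

lemma dim_A: "dim A = k * k * card T"
  by (simp only: A_span_Bt dim_span_eq_card_independent[OF independent_Bt] card_image[OF inj_Bt] card_I)

text \<open>Position and degree determine \<open>t\<close>, so a homogeneous component cut down by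
  two idempotents is at most a line. This rigidity turns products of idempotents into
  scalars.\<close>

lemma compress:
  assumes "p < k" "q < k" "h \<in> carrier G" "x \<in> \<Gamma> h"
  shows "e p * x * e q \<in> span (if g p \<otimes> h \<otimes> inv (g q) \<in> T then {B p q (g p \<otimes> h \<otimes> inv (g q))} else {})"
proof (rule mult_right_span[of _ "(\<lambda>x. e p * x) ` {B p q t | p q t. p < k \<and> q < k \<and> t \<in> T \<and> inv (g p) \<otimes> t \<otimes> g q = h}"])
  let ?S = "{B p q t | p q t. p < k \<and> q < k \<and> t \<in> T \<and> inv (g p) \<otimes> t \<otimes> g q = h}"
  show "e p * x \<in> span ((\<lambda>x. e p * x) ` ?S)"
    using assms(4) unfolding \<Gamma>_span[OF assms(3)] by (rule mult_left_span) (auto intro!: span_base)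
  fix s assume "s \<in> (\<lambda>x. e p * x) ` ?S"
  then obtain p' q' t where s: "s = e p * B p' q' t" "p' < k" "q' < k" "t \<in> T"
    "inv (g p') \<otimes> t \<otimes> g q' = h" by blast
  show "s * e q \<in> span (if g p \<otimes> h \<otimes> inv (g q) \<in> T then {B p q (g p \<otimes> h \<otimes> inv (g q))} else {})"
  proof (cases "p' = p \<and> q' = q")
    case True
    have "g p \<otimes> h \<otimes> inv (g q) = t"
      using s True assms inv_mult_mult_eq_iff[of "g p" "g q" t h] by auto
    then show ?thesis using True s assms by (auto simp: e_B B_e intro!: span_base)
  next
    case False
    then show ?thesis using s assms by (auto simp: e_B B_e span_zero)
  qed
qed

lemma compress_diag:
  assumes "p < k" "h \<in> carrier G" "x \<in> \<Gamma> h"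
  shows "e p * x * e p \<in> span (if h \<in> T then {B p p h} else {})"
  using compress[of p p h x] assms unfolding conj_eq(1)[OF g_closed[OF assms(1)] assms(2)] by simp

lemma row_component:
  assumes "p < k" "h \<in> carrier G"
  shows "(\<lambda>x. e p * x) ` \<Gamma> h = span (Bt ` {(p', q, t) \<in> I. p' = p \<and> inv (g p) \<otimes> t \<otimes> g q = h})"
    (is "?L = span (Bt ` ?J)")
proof
  show "?L \<subseteq> span (Bt ` ?J)"
  proof clarify
    fix x assume "x \<in> \<Gamma> h"
    then show "e p * x \<in> span (Bt ` ?J)"
      unfolding \<Gamma>_span[OF assms(2)]
    proof (rule mult_left_span)
      fix s assume "s \<in> {B p q t |p q t. p < k \<and> q < k \<and> t \<in> T \<and> inv (g p) \<otimes> t \<otimes> g q = h}"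
      then obtain p' q t where s: "s = B p' q t" "p' < k" "q < k" "t \<in> T"
        "inv (g p') \<otimes> t \<otimes> g q = h" by blast
      show "e p * s \<in> span (Bt ` ?J)"
      proof (cases "p' = p")
        case True
        then have "s = Bt (p, q, t)" "(p, q, t) \<in> ?J" using s by (auto simp: Bt_def I_def)
        moreover have "e p * s = s" using s True by (simp add: e_B)
        ultimately show ?thesis by (simp only:) (intro span_base imageI)
      qed (use s assms in \<open>simp add: e_B span_zero\<close>)
    qed
  qed
  show "span (Bt ` ?J) \<subseteq> ?L"
  proof
    fix x assume x: "x \<in> span (Bt ` ?J)"
    have "span (Bt ` ?J) \<subseteq> \<Gamma> h"
      unfolding \<Gamma>_span[OF assms(2)] by (rule span_mono) (auto simp: Bt_def I_def)
    moreover have "e p * x = x"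
      using x by (induction rule: span_induct_alt) (auto simp: Bt_def I_def distrib_left e_B assms)
    ultimately have "x = e p * x" "x \<in> \<Gamma> h" using x by auto
    then show "x \<in> ?L" by (rule image_eqI)
  qed
qed

text \<open>Column \<open>q\<close> contributes one dimension if
  \<open>g p \<otimes> h \<otimes> inv (g q)\<close> lies in \<open>T\<close>, and nothing
  otherwise. Thus the coset multiplicities are dimensions and can be compared by linear
  maps.\<close>

lemma dim_row_component:
  assumes "p < k" "h \<in> carrier G"
  shows "dim ((\<lambda>x. e p * x) ` \<Gamma> h) = coset_mult T k g (g p \<otimes> h)"
proof -
  let ?J = "{(p', q, t) \<in> I. p' = p \<and> inv (g p) \<otimes> t \<otimes> g q = h}"
  have sub: "?J \<subseteq> I" by auto
  have "dim ((\<lambda>x. e p * x) ` \<Gamma> h) = card (Bt ` ?J)"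
    unfolding row_component[OF assms]
    by (rule dim_span_eq_card_independent) (rule independent_mono[OF independent_Bt image_mono[OF sub]])
  also have "\<dots> = card ?J" by (rule card_image[OF inj_on_subset[OF inj_Bt sub]])
  also have "?J = (\<lambda>q. (p, q, g p \<otimes> h \<otimes> inv (g q))) ` {q. q < k \<and> g p \<otimes> h \<otimes> inv (g q) \<in> T}"
  proof -
    show ?thesis
      using assms by (auto simp: I_def image_iff m_assoc)
  qed
  also have "card \<dots> = coset_mult T k g (g p \<otimes> h)"
    unfolding coset_mult_def by (rule card_image) (auto simp: inj_on_def)
  finally show ?thesis .
qed

end

section \<open>Isomorphic graded matrix algebras have the same data\<close>

context assoc_algebra
begin

lemma in_span_singleton: "x \<in> span {y} \<longleftrightarrow> (\<exists>c. x = c *s y)"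
  by (simp add: span_breakdown_eq)

lemma alg_iso_inverse:
  assumes "alg_iso \<phi> A A'" "subspace A" "\<And>x y. x \<in> A \<Longrightarrow> y \<in> A \<Longrightarrow> x * y \<in> A"
  shows "alg_iso (inv_into A \<phi>) A' A"
proof -
  let ?\<psi> = "inv_into A \<phi>"
  have bij: "bij_betw \<phi> A A'" using assms by (simp add: alg_iso_def)
  have \<psi>: "\<And>x. x \<in> A \<Longrightarrow> ?\<psi> (\<phi> x) = x" using bij by (simp add: bij_betw_def)
  have surj: "\<exists>x\<in>A. y = \<phi> x" if "y \<in> A'" for y using bij that by (auto simp: bij_betw_def)
  have hom: "\<phi> (x + y) = \<phi> x + \<phi> y" "\<phi> (x * y) = \<phi> x * \<phi> y" "\<phi> (c *s x) = c *s \<phi> x"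
    if "x \<in> A" "y \<in> A" for x y c using assms(1) that by (auto simp: alg_iso_def)
  have closed: "x + y \<in> A" "x * y \<in> A" "c *s x \<in> A" if "x \<in> A" "y \<in> A" for x y c
    using assms that by (auto simp: subspace_add subspace_scale)
  have "?\<psi> (x + y) = ?\<psi> x + ?\<psi> y \<and> ?\<psi> (x * y) = ?\<psi> x * ?\<psi> y"
    if xy: "x \<in> A'" "y \<in> A'" for x y
  proof -
    obtain a b where ab: "a \<in> A" "b \<in> A" "x = \<phi> a" "y = \<phi> b" using surj xy by metis
    then show ?thesis using \<psi> closed by (simp flip: hom)
  qed
  moreover have "?\<psi> (c *s x) = c *s ?\<psi> x" if x: "x \<in> A'" for x c
  proof -
    obtain a where ab: "a \<in> A" "x = \<phi> a" using surj x by metis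
    then show ?thesis using \<psi> closed by (simp flip: hom)
  qed
  ultimately show ?thesis using bij_betw_inv_into[OF bij] by (auto simp: alg_iso_def)
qed

end

locale graded_matrix_basis_pair = assoc_algebra scale + comm_group G +
  M: graded_matrix_basis scale G T \<beta> k g A \<Gamma> B \<sigma> +
  M': graded_matrix_basis scale G T' \<beta>' k' g' A' \<Gamma>' B' \<sigma>'
  for scale :: "'f::field \<Rightarrow> 'a::ring_1 \<Rightarrow> 'a" (infixr "*s" 75)
    and G :: "('g, 'm) monoid_scheme" (structure)
    and T \<beta> k g A \<Gamma> B \<sigma> T' \<beta>' k' g' A' \<Gamma>' B' \<sigma>'
begin

text \<open>
  A primitive idempotent \<open>M.e p\<close> of the neutral component is matched with some \<open>M'.e i\<close>. The
  products with these two idempotents carry over the corner, which determines \<open>T\<close> and \<open>\<beta>\<close>,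
  and the row, whose homogeneous dimensions determine the coset multiplicities.
\<close>
lemma matched_corners:
  assumes iso: "alg_iso \<phi> A A'" and deg: "\<forall>h\<in>carrier G. \<phi> ` \<Gamma> h = \<Gamma>' h"
    and p: "p < k" and i: "i < k'" and c: "c \<noteq> 0"
    and efe: "\<phi> (M.e p) * M'.e i * \<phi> (M.e p) = c *s \<phi> (M.e p)"
  shows "T \<subseteq> T'" and "\<And>s t. s \<in> T \<Longrightarrow> t \<in> T \<Longrightarrow> \<beta> s t = \<beta>' s t"
    and "\<And>h. h \<in> carrier G \<Longrightarrow> coset_mult T k g (g p \<otimes> h) \<le> coset_mult T' k' g' (g' i \<otimes> h)"
proof -
  note deg = bspec[OF deg]
  have hom: "\<phi> (x + y) = \<phi> x + \<phi> y" "\<phi> (x * y) = \<phi> x * \<phi> y" if "x \<in> A" "y \<in> A" for x y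
    using iso that by (auto simp: alg_iso_def)
  have hom_scale: "\<phi> (a *s x) = a *s \<phi> x" if "x \<in> A" for x a
    using iso that by (auto simp: alg_iso_def)
  have \<phi>0: "\<phi> 0 = 0" using hom_scale[of 0 0] M.subspace_A by (simp add: subspace_0)
  have inj: "x = 0" if "x \<in> A" "\<phi> x = 0" for x
    using iso that \<phi>0 subspace_0[OF M.subspace_A] by (auto simp: alg_iso_def bij_betw_def inj_on_def)
  define E where "E = \<phi> (M.e p)"
  define F where "F = M'.e i"
  define X where "X t = \<phi> (B p p t)" for t
  have eA: "M.e p \<in> A" using M.e_in_\<Gamma>[OF p] M.\<Gamma>_subset[of \<one>] by auto
  have FF: "F * F = F" unfolding F_def by (rule M'.e_idem[OF i])
  have EFE: "E * F * E = c *s E" using efe by (simp add: E_def F_def)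
  have BA: "B p p t \<in> A" if "t \<in> T" for t using M.B_in_A p that by blast
  have EX: "E * X t = X t" and XE: "X t * E = X t" if "t \<in> T" for t
    using that p BA eA by (simp_all add: E_def X_def M.e_B M.B_e flip: hom)
  have X\<Gamma>: "X t \<in> \<Gamma>' t" if "t \<in> T" for t
    using deg[of t] M.B_diag_in_\<Gamma>[OF p that] that unfolding X_def by auto
  have Xnz: "X t \<noteq> 0" if "t \<in> T" for t
    using inj[OF BA[OF that]] M.B_nz[OF p p that] by (auto simp: X_def)
  have Xcomm: "X s * X t = \<beta> s t *s (X t * X s)" if "s \<in> T" "t \<in> T" for s t
  proof -
    have "B p p s * B p p t = \<beta> s t *s (B p p t * B p p s)"
      using that p M.\<sigma>_comm[of s t] m_comm[of s t] by (simp add: M.B_mult)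
    then have "\<phi> (B p p s * B p p t) = \<beta> s t *s \<phi> (B p p t * B p p s)"
      using BA that M.A_mult by (simp flip: hom_scale)
    then show ?thesis using BA that unfolding X_def by (simp add: hom)
  qed
  \<comment> \<open>Compression by \<open>F\<close> moves \<open>X t\<close> into a corner of the
    second algebra. Nothing is lost, since compressing back with \<open>E\<close> gives
    \<open>c * c\<close> times \<open>X t\<close>.\<close>
  define Y where "Y t = F * X t * F" for t
  have EYE: "E * Y t * E = (c * c) *s X t" if "t \<in> T" for t
  proof -
    have "E * Y t * E = E * F * (E * X t * E) * F * E"
      using EX XE that by (simp add: Y_def mult.assoc)
    also have "\<dots> = (E * F * E) * X t * (E * F * E)" by (simp only: mult.assoc)
    also have "\<dots> = (c * c) *s X t" using EX XE that by (simp add: EFE)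
    finally show ?thesis .
  qed
  have Yspan: "Y t \<in> span (if t \<in> T' then {B' i i t} else {})" and Ynz: "Y t \<noteq> 0"
    if "t \<in> T" for t
  proof -
    show "Y t \<in> span (if t \<in> T' then {B' i i t} else {})"
      unfolding Y_def F_def by (rule M'.compress_diag[OF i _ X\<Gamma>]) (use that in auto)
    show "Y t \<noteq> 0" using EYE[OF that] Xnz[OF that] c by auto
  qed
  show TT': "T \<subseteq> T'"
  proof
    fix t assume "t \<in> T"
    then show "t \<in> T'" using Yspan[of t] Ynz[of t] by (auto split: if_splits)
  qed
  show "\<beta> s t = \<beta>' s t" if st: "s \<in> T" "t \<in> T" for s t
  proof -
    \<comment> \<open>Writing \<open>X s = X s * E\<close> and \<open>X t = E * X t\<close> around
      \<open>F * F = F\<close> produces \<open>E * F * E\<close>. So compression is multiplicative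
      up to the factor \<open>c\<close>, which cancels in the commutator.\<close>
    have YY: "Y s * Y t = c *s (F * (X s * X t) * F)" if "s \<in> T" "t \<in> T" for s t
    proof -
      have "Y s * Y t = F * (X s * E) * (F * F) * (E * X t) * F"
        unfolding EX[OF that(2)] XE[OF that(1)] by (simp add: Y_def mult.assoc)
      also have "\<dots> = F * X s * (E * F * E) * X t * F" unfolding FF by (simp only: mult.assoc)
      also have "\<dots> = c *s (F * X s * E * X t * F)" by (simp add: EFE mult.assoc[of "F * X s" E, symmetric])
      also have "\<dots> = c *s (F * X s * (E * X t) * F)" by (simp only: mult.assoc)
      finally show ?thesis using EX[OF that(2)] by (simp add: mult.assoc)
    qed
    have eq: "Y s * Y t = \<beta> s t *s (Y t * Y s)"
      unfolding YY[OF st] YY[OF st(2,1)] Xcomm[OF st] by (simp add: mult.commute)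
    have st': "s \<in> T'" "t \<in> T'" using TT' st by auto
    obtain a b where ab: "Y s = a *s B' i i s" "Y t = b *s B' i i t"
      using Yspan[OF st(1)] Yspan[OF st(2)] st' by (auto simp: in_span_singleton)
    have nz: "a \<noteq> 0" "b \<noteq> 0" using Ynz[OF st(1)] Ynz[OF st(2)] ab by auto
    have "(a * b * \<sigma>' s t) *s B' i i (s \<otimes> t) = (\<beta> s t * (a * b * \<sigma>' t s)) *s B' i i (s \<otimes> t)"
      using eq st' i m_comm[of s t] st unfolding ab by (simp add: M'.B_mult mult.assoc mult.left_commute)
    then have "a * b * \<sigma>' s t = \<beta> s t * (a * b * \<sigma>' t s)"
      using M'.B_nz[OF i i, of "s \<otimes> t"] st' by (metis M'.T_mult scale_right_imp_eq)
    then have "\<sigma>' s t = \<beta> s t * \<sigma>' t s" using nz by simp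
    then show ?thesis using M'.\<sigma>_comm[OF st'] M'.\<sigma>_nz[OF st'(2,1)] by simp
  qed
  show "coset_mult T k g (g p \<otimes> h) \<le> coset_mult T' k' g' (g' i \<otimes> h)" if h: "h \<in> carrier G" for h
    unfolding M.dim_row_component[OF p h, symmetric] M'.dim_row_component[OF i h, symmetric]
  \<comment> \<open>Left multiplication by \<open>F\<close> carries the row of \<open>E\<close> into
    the row of \<open>F\<close>; it is injective because \<open>E * F\<close> acts on the row of
    \<open>E\<close> as the scalar \<open>c\<close>.\<close>
  proof (rule dim_le_of_inj[where f = "\<lambda>x. F * \<phi> x" and F = "M'.Bt ` M'.I"])
    let ?U = "(*) (M.e p) ` \<Gamma> h" and ?V = "(*) (M'.e i) ` \<Gamma>' h"
    have subA: "\<Gamma> h \<subseteq> A" "\<Gamma>' h \<subseteq> A'" using M.\<Gamma>_subset M'.\<Gamma>_subset h by auto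
    then have UA: "?U \<subseteq> A" using M.A_mult eA by auto
    show "finite (M'.Bt ` M'.I)" using M'.finite_I by simp
    show "?V \<subseteq> span (M'.Bt ` M'.I)"
      unfolding M'.A_span_Bt[symmetric]
      using subA M'.A_mult[of "M'.e i"] M'.e_in_\<Gamma>[OF i] M'.\<Gamma>_subset[of \<one>] by (auto simp: subset_iff)
    show "subspace ?V" unfolding M'.row_component[OF i h] by (rule subspace_span)
    show U: "subspace ?U" unfolding M.row_component[OF p h] by (rule subspace_span)
    show "F * \<phi> (x + y) = F * \<phi> x + F * \<phi> y" if "x \<in> ?U" "y \<in> ?U" for x y
      using that UA hom(1)[of x y] by (simp add: distrib_left subset_iff)
    show "F * \<phi> (a *s x) = a *s (F * \<phi> x)" if "x \<in> ?U" for a x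
      using that UA hom_scale[of x a] by (simp add: subset_iff)
    show "x = 0" if "x \<in> ?U" "F * \<phi> x = 0" for x
    proof -
      have xA: "x \<in> A" using that UA by auto
      have "M.e p * x = x" using that M.e_idem[OF p] by (auto simp flip: mult.assoc)
      then have "\<phi> x = E * \<phi> x" using hom(2)[OF eA xA] by (simp add: E_def)
      then have "c *s \<phi> x = E * F * E * \<phi> x" by (simp add: EFE)
      also have "\<dots> = E * (F * \<phi> x)" using \<open>\<phi> x = E * \<phi> x\<close> by (simp add: mult.assoc)
      finally show "x = 0" using that c inj xA by simp
    qed
    show "(\<lambda>x. F * \<phi> x) ` ?U \<subseteq> ?V"
    proof clarify
      fix z assume z: "z \<in> \<Gamma> h"
      have "\<phi> (M.e p * z) = E * \<phi> z" using z subA eA by (simp add: E_def hom subset_iff)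
      moreover have "E \<in> \<Gamma>' \<one>" using deg[of \<one>] M.e_in_\<Gamma>[OF p] unfolding E_def by auto
      moreover have "\<phi> z \<in> \<Gamma>' h" using deg[OF h] z by auto
      ultimately have "\<phi> (M.e p * z) \<in> \<Gamma>' h" using M'.\<Gamma>_mult[of \<one> h E "\<phi> z"] h by simp
      then show "F * \<phi> (M.e p * z) \<in> ?V" unfolding F_def by blast
    qed
  qed
qed

text \<open>The idempotents \<open>M'.e i\<close> add up to a right unit, so the compressions of the
  \<open>M'.e i\<close> by the image of \<open>M.e p\<close> cannot all vanish. Both compressed
  elements lie in neutral components of corners, which are lines.\<close>

lemma ex_matched_idempotents:
  assumes iso: "alg_iso \<phi> A A'" and deg: "\<forall>h\<in>carrier G. \<phi> ` \<Gamma> h = \<Gamma>' h"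
    and p: "p < k"
  obtains i c where "i < k'" "c \<noteq> 0" "\<phi> (M.e p) * M'.e i * \<phi> (M.e p) = c *s \<phi> (M.e p)"
    "M'.e i * \<phi> (M.e p) * M'.e i = c *s M'.e i"
proof -
  note deg = bspec[OF deg]
  have hom: "\<phi> (x + y) = \<phi> x + \<phi> y" "\<phi> (x * y) = \<phi> x * \<phi> y" if "x \<in> A" "y \<in> A" for x y
    using iso that by (auto simp: alg_iso_def)
  have hom_scale: "\<phi> (a *s x) = a *s \<phi> x" if "x \<in> A" for x a
    using iso that by (auto simp: alg_iso_def)
  have \<phi>0: "\<phi> 0 = 0" using hom_scale[of 0 0] M.subspace_A by (simp add: subspace_0)
  define E where "E = \<phi> (M.e p)"
  have eA: "M.e p \<in> A" using M.e_in_\<Gamma>[OF p] M.\<Gamma>_subset[of \<one>] by auto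
  have EA: "E \<in> A'" using iso eA by (auto simp: E_def alg_iso_def bij_betw_def)
  have Enz: "E \<noteq> 0"
    using iso M.e_nz[OF p] eA \<phi>0 subspace_0[OF M.subspace_A]
    by (auto simp: E_def alg_iso_def bij_betw_def inj_on_def)
  have EE: "E * E = E" using hom(2)[OF eA eA] M.e_idem[OF p] by (simp add: E_def)
  have "(\<Sum>i<k'. E * M'.e i * E) = E * M'.unit * E"
    by (simp add: M'.unit_def sum_distrib_left sum_distrib_right)
  also have "\<dots> = E" using M'.mult_unit[OF EA] EE by simp
  finally have "(\<Sum>i<k'. E * M'.e i * E) \<noteq> 0" using Enz by simp
  then obtain i where i: "i < k'" "E * M'.e i * E \<noteq> 0" by (metis (no_types, lifting) lessThan_iff sum.neutral)
  define F where "F = M'.e i"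
  have F1: "F \<in> \<Gamma>' \<one>" unfolding F_def by (rule M'.e_in_\<Gamma>[OF i(1)])
  then obtain z where z: "z \<in> \<Gamma> \<one>" "F = \<phi> z" using deg[of \<one>] by auto
  have zA: "z \<in> A" using z M.\<Gamma>_subset[of \<one>] by auto
  have "M.e p * z * M.e p \<in> span {B p p \<one>}" using M.compress_diag[OF p one_closed z(1)] by simp
  then obtain a where "M.e p * z * M.e p = a *s B p p \<one>" by (auto simp: in_span_singleton)
  also have "\<dots> = (a * M.\<sigma>\<^sub>1) *s M.e p" by (simp add: M.e_def M.\<sigma>\<^sub>1_nz)
  finally have "\<phi> (M.e p * z * M.e p) = (a * M.\<sigma>\<^sub>1) *s E" using eA hom_scale[of "M.e p"] by (simp add: E_def)
  then have EFE: "E * F * E = (a * M.\<sigma>\<^sub>1) *s E"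
    using eA zA M.A_mult by (simp add: hom E_def z)
  define c where "c = a * M.\<sigma>\<^sub>1"
  have c: "c \<noteq> 0" using i(2) EFE unfolding F_def c_def by auto
  have "E \<in> \<Gamma>' \<one>" using deg[of \<one>] M.e_in_\<Gamma>[OF p] unfolding E_def by auto
  then have "F * E * F \<in> span {B' i i \<one>}" using M'.compress_diag[OF i(1) one_closed] by (simp add: F_def)
  then obtain b where "F * E * F = b *s B' i i \<one>" by (auto simp: in_span_singleton)
  also have "\<dots> = (b * M'.\<sigma>\<^sub>1) *s F" by (simp add: F_def M'.e_def M'.\<sigma>\<^sub>1_nz)
  finally obtain d where FEF: "F * E * F = d *s F" by blast
  \<comment> \<open>Evaluating \<open>E * F * E * F * E\<close> in two ways identifies the two
    scalars.\<close>
  have "c *s (E * F * E) = E * (F * E * F) * E"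
    using EFE[folded c_def] by (metis mult.assoc mult_scale_left)
  also have "\<dots> = d *s (E * F * E)" by (simp add: FEF)
  finally have "c = d" using i(2) unfolding F_def by simp
  then show ?thesis using that[of i c] i(1) c EFE FEF unfolding c_def E_def F_def by simp
qed

lemma swap: "graded_matrix_basis_pair scale G T' \<beta>' k' g' A' \<Gamma>' B' \<sigma>' T \<beta> k g A \<Gamma> B \<sigma>"
  by intro_locales

text \<open>\<open>matched_corners\<close> gives only an inclusion and inequalities. The relation
  between the two matched idempotents is symmetric, so the same lemma applied to the inverse map
  gives the opposite ones. The common shift is the quotient of the degrees attached to the matched
  rows.\<close>

theorem same_data_if_iso:
  assumes iso: "alg_iso \<phi> A A'" and deg: "\<forall>h\<in>carrier G. \<phi> ` \<Gamma> h = \<Gamma>' h"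
  shows "T = T'" and "\<forall>s\<in>T. \<forall>t\<in>T. \<beta> s t = \<beta>' s t"
    and "\<exists>v\<in>carrier G. \<forall>u\<in>carrier G. coset_mult T k g u = coset_mult T' k' g' (u \<otimes> v)"
proof -
  interpret S: graded_matrix_basis_pair scale G T' \<beta>' k' g' A' \<Gamma>' B' \<sigma>' T \<beta> k g A \<Gamma> B \<sigma>
    by (rule swap)
  let ?\<psi> = "inv_into A \<phi>"
  have iso': "alg_iso ?\<psi> A' A"
    by (rule alg_iso_inverse[OF iso M.subspace_A M.A_mult])
  have \<psi>\<phi>: "?\<psi> (\<phi> x) = x" if "x \<in> A" for x
    using iso that by (simp add: alg_iso_def bij_betw_def)
  have deg': "\<forall>h\<in>carrier G. ?\<psi> ` \<Gamma>' h = \<Gamma> h"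
  proof
    fix h assume that: "h \<in> carrier G"
    have "?\<psi> ` (\<phi> ` \<Gamma> h) = (\<lambda>x. x) ` \<Gamma> h"
      unfolding image_image using \<psi>\<phi> M.\<Gamma>_subset[OF that] by (intro image_cong) auto
    then show "?\<psi> ` \<Gamma>' h = \<Gamma> h" using deg that by simp
  qed
  obtain i c where ic: "i < k'" "c \<noteq> 0" "\<phi> (M.e 0) * M'.e i * \<phi> (M.e 0) = c *s \<phi> (M.e 0)"
    "M'.e i * \<phi> (M.e 0) * M'.e i = c *s M'.e i"
    by (rule ex_matched_idempotents[OF iso deg M.k_pos])
  have eA: "M.e 0 \<in> A" using M.e_in_\<Gamma>[OF M.k_pos] M.\<Gamma>_subset[of \<one>] by auto
  have fA: "M'.e i \<in> A'" using M'.e_in_\<Gamma>[OF ic(1)] M'.\<Gamma>_subset[of \<one>] by auto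
  have EA: "\<phi> (M.e 0) \<in> A'" using iso eA by (auto simp: alg_iso_def bij_betw_def)
  have "?\<psi> (M'.e i * \<phi> (M.e 0) * M'.e i) = ?\<psi> (c *s M'.e i)" using ic(4) by simp
  then have ic': "?\<psi> (M'.e i) * M.e 0 * ?\<psi> (M'.e i) = c *s ?\<psi> (M'.e i)"
    using iso' fA EA M'.A_mult \<psi>\<phi>[OF eA] by (simp add: alg_iso_def)
  note m1 = matched_corners[OF iso deg M.k_pos ic(1,2,3)]
  note m2 = S.matched_corners[OF iso' deg' ic(1) M.k_pos ic(2) ic']
  show TT: "T = T'" using m1(1) m2(1) by blast
  show "\<forall>s\<in>T. \<forall>t\<in>T. \<beta> s t = \<beta>' s t" using m1(2) by blast
  show "\<exists>v\<in>carrier G. \<forall>u\<in>carrier G. coset_mult T k g u = coset_mult T' k' g' (u \<otimes> v)"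
  proof (intro bexI ballI)
    fix u assume u: "u \<in> carrier G"
    have gg: "g 0 \<in> carrier G" "g' i \<in> carrier G" using M.k_pos ic(1) by auto
    define h where "h = inv (g 0) \<otimes> u"
    have h: "h \<in> carrier G" "g 0 \<otimes> h = u" "u \<otimes> (inv (g 0) \<otimes> g' i) = g' i \<otimes> h"
      using u gg by (simp_all add: h_def m_ac)
    show "coset_mult T k g u = coset_mult T' k' g' (u \<otimes> (inv (g 0) \<otimes> g' i))"
      using m1(3)[OF h(1)] m2(3)[OF h(1)] unfolding h by simp
  qed (use M.k_pos ic(1) in simp)
qed

end

section \<open>Data with equal coset multiplicities give isomorphic algebras\<close>

context comm_group
begin

text \<open>Multiplication by \<open>a\<close> is injective, hence onto on a finite set, so the
  inverse of \<open>a\<close> is already in \<open>H\<close>.\<close>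

lemma subgroup_of_finite_closed:
  assumes "finite H" "H \<subseteq> carrier G" "\<one> \<in> H" "\<And>x y. x \<in> H \<Longrightarrow> y \<in> H \<Longrightarrow> x \<otimes> y \<in> H"
  shows "subgroup H G"
proof (rule subgroupI)
  fix a assume a: "a \<in> H"
  have "inj_on ((\<otimes>) a) H" using a assms(2) by (auto simp: inj_on_def subset_iff)
  then have "(\<otimes>) a ` H = H" using assms(1,4) a by (intro endo_inj_surj) auto
  then obtain b where b: "b \<in> H" "a \<otimes> b = \<one>" using assms(3) by (metis imageE)
  then have "inv a = b" using a assms(2) by (metis inv_equality m_comm subsetD)
  then show "inv a \<in> H" using b by simp
qed (use assms in auto)

text \<open>Elements of infinite order have \<open>ord\<close> 0, so positivity amounts to a
  coincidence between two powers.\<close>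

lemma ord_pos_if_finite_subgroup:
  assumes "subgroup T G" "finite T" "x \<in> T"
  shows "0 < ord x"
proof -
  have xc: "x \<in> carrier G" using assms by (simp add: subgroup.mem_carrier)
  have xT: "x [^] n \<in> T" for n :: nat
    using assms by (induction n) (auto simp: subgroup.one_closed subgroup.m_closed)
  have "\<not> inj (\<lambda>n::nat. x [^] n)"
    using xT assms(2) finite_subset[of "range (\<lambda>n::nat. x [^] n)" T] finite_imageD by blast
  then obtain i j :: nat where ij: "x [^] i = x [^] j" "i < j"
    by (metis injI linorder_neqE_nat)
  then have "x [^] i \<otimes> x [^] (j - i) = x [^] i \<otimes> \<one>"
    using xc nat_pow_mult[of x i "j - i"] ij by auto
  then have "x [^] (j - i) = \<one>" using xc by (metis Units_eq Units_l_cancel nat_pow_closed one_closed)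
  then have "ord x dvd j - i" using xc pow_eq_id by blast
  then show ?thesis using ij(2) by (intro gr0I) auto
qed

text \<open>
  The twisted products \<open>(a, s) (b, t) = (a b \<rho> s t, s t)\<close> form an extension of \<open>T\<close> by \<open>F\<^sup>\<times>\<close>. It
  splits because \<open>F\<^sup>\<times>\<close> is divisible: a section \<open>c\<close> over a subgroup extends along any \<open>x\<close>.
\<close>
lemma symmetric_cocycle_trivial:
  fixes \<rho> :: "'a \<Rightarrow> 'a \<Rightarrow> 'f::alg_closed_field"
  assumes T: "subgroup T G" and finT: "finite T"
    and nz: "\<And>s t. s \<in> T \<Longrightarrow> t \<in> T \<Longrightarrow> \<rho> s t \<noteq> 0"
    and sym: "\<And>s t. s \<in> T \<Longrightarrow> t \<in> T \<Longrightarrow> \<rho> s t = \<rho> t s"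
    and coc: "\<And>s t u. s \<in> T \<Longrightarrow> t \<in> T \<Longrightarrow> u \<in> T \<Longrightarrow> \<rho> s t * \<rho> (s \<otimes> t) u = \<rho> t u * \<rho> s (t \<otimes> u)"
  shows "\<exists>c. (\<forall>t\<in>T. c t \<noteq> 0) \<and> (\<forall>s\<in>T. \<forall>t\<in>T. c s * c t * \<rho> s t = c (s \<otimes> t))"
proof -
  interpret T: subgroup T G by (rule T)
  \<comment> \<open>\<open>good S c\<close> says that \<open>s\<close> maps to
    \<open>(c s, s)\<close> as a homomorphic section over the subgroup \<open>S\<close>.\<close>
  define good where "good S c \<longleftrightarrow> subgroup S G \<and> S \<subseteq> T \<and> (\<forall>t\<in>S. c t \<noteq> 0) \<and>
    (\<forall>s\<in>S. \<forall>t\<in>S. c s * c t * \<rho> s t = c (s \<otimes> t))" for S and c :: "'a \<Rightarrow> 'f"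
  \<comment> \<open>This is the law \<open>(s a) (s' a') = (s s') (a a')\<close> in the extension,
    which a symmetric \<open>\<rho>\<close> makes commutative.\<close>
  have four: "\<rho> s a * \<rho> s' a' * \<rho> (s \<otimes> a) (s' \<otimes> a') = \<rho> s s' * \<rho> a a' * \<rho> (s \<otimes> s') (a \<otimes> a')"
    if "s \<in> T" "a \<in> T" "s' \<in> T" "a' \<in> T" for s a s' a'
  proof -
    have "\<rho> s a * \<rho> (s \<otimes> a) (s' \<otimes> a') = \<rho> a (s' \<otimes> a') * \<rho> s (a \<otimes> (s' \<otimes> a'))"
      using that by (intro coc) auto
    moreover have "\<rho> a' s' * \<rho> a (a' \<otimes> s') = \<rho> a a' * \<rho> (a \<otimes> a') s'"
      using that by (intro coc[symmetric]) auto
    moreover have "\<rho> s s' * \<rho> (s \<otimes> s') (a \<otimes> a') = \<rho> s' (a \<otimes> a') * \<rho> s (s' \<otimes> (a \<otimes> a'))"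
      using that by (intro coc) auto
    moreover have "\<rho> a' s' = \<rho> s' a'" "\<rho> (a \<otimes> a') s' = \<rho> s' (a \<otimes> a')" "a' \<otimes> s' = s' \<otimes> a'"
      "a \<otimes> (s' \<otimes> a') = s' \<otimes> (a \<otimes> a')"
      using that sym m_comm m_lcomm by auto
    ultimately show ?thesis by (smt (verit) mult.assoc mult.commute)
  qed
  have \<rho>1: "\<rho> t \<one> = \<rho> \<one> \<one>" if "t \<in> T" for t
    using coc[of t \<one> \<one>] nz[of t \<one>] that by simp
  have extend: "\<exists>S' c'. good S' c' \<and> card S < card S'" if good: "good S c" and x: "x \<in> T" "x \<notin> S" for S c x
  proof -
    interpret S: subgroup S G using good by (simp add: good_def)
    have ST: "S \<subseteq> T" and cnz: "\<And>t. t \<in> S \<Longrightarrow> c t \<noteq> 0"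
      and cm: "\<And>s t. s \<in> S \<Longrightarrow> t \<in> S \<Longrightarrow> c s * c t * \<rho> s t = c (s \<otimes> t)"
      using good by (auto simp: good_def)
    have finS: "finite S" using ST finT finite_subset by auto
    have xc: "x \<in> carrier G" using x by auto
    have xT: "x [^] n \<in> T" for n :: nat using x by (induction n) auto
    have "ord x > 0" "x [^] ord x = \<one>"
      using ord_pos_if_finite_subgroup[OF T finT x(1)] xc by auto
    then have ex: "0 < ord x \<and> x [^] ord x \<in> S" by simp
    \<comment> \<open>The first positive power of \<open>x\<close> in \<open>S\<close> is where the
      values on powers of \<open>x\<close> have to agree with the section already given.\<close>
    define m where "m = (LEAST m::nat. 0 < m \<and> x [^] m \<in> S)"
    have m: "0 < m" "x [^] m \<in> S"
      using LeastI[of "\<lambda>m::nat. 0 < m \<and> x [^] m \<in> S", OF ex] by (simp_all add: m_def)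
    have m_least: "\<not> (0 < j \<and> j < m \<and> x [^] j \<in> S)" for j :: nat
      using not_less_Least[of j "\<lambda>m. 0 < m \<and> x [^] m \<in> S"] by (auto simp: m_def)
    \<comment> \<open>\<open>w1 n\<close> is the scalar part of the \<open>n\<close>-th power of
      \<open>(1, x)\<close>. The start value is forced:
      \<open>(inverse (\<rho> \<one> \<one>), \<one>)\<close> is the unit of the extension.\<close>
    define w1 where "w1 = rec_nat (inverse (\<rho> \<one> \<one>)) (\<lambda>n a. a * \<rho> (x [^] n) x)"
    have w1_simps: "w1 0 = inverse (\<rho> \<one> \<one>)" "\<And>n. w1 (Suc n) = w1 n * \<rho> (x [^] n) x"
      by (simp_all add: w1_def)
    have w1_nz: "w1 n \<noteq> 0" for n by (induction n) (use nz xT x in \<open>auto simp: w1_simps\<close>)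
    have "c (x [^] m) / w1 m \<noteq> 0" using cnz m w1_nz by simp
    \<comment> \<open>Replacing \<open>(1, x)\<close> by \<open>(\<mu>, x)\<close> multiplies the
      \<open>m\<close>-th power by \<open>\<mu> ^ m\<close>, so an \<open>m\<close>-th root corrects
      the mismatch at \<open>x [^] m\<close>.\<close>
    obtain \<mu> where \<mu>: "\<mu> ^ m = c (x [^] m) / w1 m" using nth_root_exists[OF m(1)] by blast
    define w where "w n = \<mu> ^ n * w1 n" for n
    have \<mu>nz: "\<mu> \<noteq> 0" using \<mu> \<open>c (x [^] m) / w1 m \<noteq> 0\<close> m(1) by (metis power_0_left less_numeral_extra(3))
    have wm: "w m = c (x [^] m)" using \<mu> w1_nz[of m] by (simp add: w_def)
    have w_nz: "w n \<noteq> 0" for n using w1_nz \<mu>nz by (simp add: w_def)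
    have w_add: "w n * w j * \<rho> (x [^] n) (x [^] j) = w (n + j)" for n j
    proof (induction j)
      case 0
      then show ?case using \<rho>1[OF xT[of n]] nz[of \<one> \<one>] by (simp add: w_def w1_simps)
    next
      case (Suc j)
      have "w n * w (Suc j) * \<rho> (x [^] n) (x [^] Suc j)
          = w n * (w j * \<mu>) * (\<rho> (x [^] j) x * \<rho> (x [^] n) (x [^] j \<otimes> x))"
        by (simp add: w_def w1_simps)
      also have "\<rho> (x [^] j) x * \<rho> (x [^] n) (x [^] j \<otimes> x)
          = \<rho> (x [^] n) (x [^] j) * \<rho> (x [^] n \<otimes> x [^] j) x"
        using coc[OF xT[of n] xT[of j] x(1)] by simp
      also have "w n * (w j * \<mu>) * (\<rho> (x [^] n) (x [^] j) * \<rho> (x [^] n \<otimes> x [^] j) x)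
          = (w n * w j * \<rho> (x [^] n) (x [^] j)) * (\<mu> * \<rho> (x [^] (n + j)) x)"
        using xc by (simp add: nat_pow_mult)
      also have "\<dots> = w (n + Suc j)" unfolding Suc.IH by (simp add: w_def w1_simps)
      finally show ?case .
    qed
    have w_mult: "w (m * q) = c (x [^] (m * q)) \<and> x [^] (m * q) \<in> S" for q
    proof (induction q)
      case 0
      have "c \<one> * c \<one> * \<rho> \<one> \<one> = c \<one>" using cm[of \<one> \<one>] by simp
      then have "c \<one> = inverse (\<rho> \<one> \<one>)" using cnz[of \<one>] nz[of \<one> \<one>] by (simp add: field_simps)
      then show ?case by (simp add: w_def w1_simps)
    next
      case (Suc q)
      have "x [^] (m * Suc q) = x [^] m \<otimes> x [^] (m * q)" using xc by (simp add: nat_pow_mult)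
      then show ?case using w_add[of m "m * q"] wm cm[of "x [^] m" "x [^] (m * q)"] Suc m by simp
    qed
    \<comment> \<open>By minimality of \<open>m\<close>, only multiples of \<open>m\<close> are
      exponents of powers lying in \<open>S\<close>, and there the agreement at
      \<open>x [^] m\<close> propagates.\<close>
    have w_S: "w j = c (x [^] j)" if "x [^] j \<in> S" for j :: nat
    proof -
      have "x [^] j = x [^] (j mod m) \<otimes> x [^] (m * (j div m))"
        using xc by (simp add: nat_pow_mult)
      then have "x [^] (j mod m) = x [^] j \<otimes> inv (x [^] (m * (j div m)))"
        using xc inv_solve_right[of "x [^] (j mod m)" "x [^] j" "x [^] (m * (j div m))"] by simp
      then have "x [^] (j mod m) \<in> S" using that w_mult[of "j div m"] by simp
      then have "j mod m = 0" using m_least[of "j mod m"] m(1) by auto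
      then have "j = m * (j div m)" by auto
      then show ?thesis using w_mult[of "j div m"] by simp
    qed
    \<comment> \<open>The scalar part of the product of \<open>(c s, s)\<close> with
      \<open>(w n, x [^] n)\<close>; it remains to see that it depends only on
      \<open>s \<otimes> x [^] n\<close>.\<close>
    define d where "d s n = c s * w n * \<rho> s (x [^] n)" for s n
    have d_nz: "d s n \<noteq> 0" if "s \<in> S" for s n using that cnz w_nz nz xT ST by (auto simp: d_def)
    have d_mult: "d s n * d s' n' * \<rho> (s \<otimes> x [^] n) (s' \<otimes> x [^] n') = d (s \<otimes> s') (n + n')"
      if "s \<in> S" "s' \<in> S" for s s' n n'
    proof -
      have "d s n * d s' n' * \<rho> (s \<otimes> x [^] n) (s' \<otimes> x [^] n')
          = c s * c s' * (w n * w n') * (\<rho> s (x [^] n) * \<rho> s' (x [^] n') * \<rho> (s \<otimes> x [^] n) (s' \<otimes> x [^] n'))"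
        by (simp add: d_def)
      also have "\<dots> = (c s * c s' * \<rho> s s') * (w n * w n' * \<rho> (x [^] n) (x [^] n'))
          * \<rho> (s \<otimes> s') (x [^] n \<otimes> x [^] n')"
        using that ST xT by (subst four) auto
      also have "\<dots> = d (s \<otimes> s') (n + n')"
        unfolding cm[OF that] w_add using xc by (simp add: d_def nat_pow_mult)
      finally show ?thesis .
    qed
    \<comment> \<open>For \<open>n \<le> n'\<close> the two factorisations differ by
      \<open>x [^] (n' - n)\<close>, which then lies in \<open>S\<close>, where \<open>c\<close> and
      \<open>w\<close> agree.\<close>
    have d_le: "d s n = d s' n'" if "s \<in> S" "s' \<in> S" "s \<otimes> x [^] n = s' \<otimes> x [^] n'" "n \<le> n'" for s s' n n'
    proof -
      define j where "j = n' - n"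
      have n': "n' = j + n" using that by (simp add: j_def)
      have "s \<otimes> x [^] n = (s' \<otimes> x [^] j) \<otimes> x [^] n"
        using that xc unfolding n' by (simp add: m_assoc nat_pow_mult)
      then have s: "s = s' \<otimes> x [^] j" using that xc
        by (metis S.mem_carrier m_closed nat_pow_closed right_cancel)
      then have "x [^] j = inv s' \<otimes> s" using that xc by simp
      then have z: "x [^] j \<in> S" using that by simp
      have "d s n = c (s' \<otimes> x [^] j) * w n * \<rho> (s' \<otimes> x [^] j) (x [^] n)" by (simp add: d_def s)
      also have "\<dots> = c s' * c (x [^] j) * w n * (\<rho> s' (x [^] j) * \<rho> (s' \<otimes> x [^] j) (x [^] n))"
        using cm[OF that(2) z] by (simp flip: cm[OF that(2) z])
      also have "\<rho> s' (x [^] j) * \<rho> (s' \<otimes> x [^] j) (x [^] n) = \<rho> (x [^] j) (x [^] n) * \<rho> s' (x [^] j \<otimes> x [^] n)"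
        using that ST xT by (intro coc) auto
      also have "c s' * c (x [^] j) * w n * (\<rho> (x [^] j) (x [^] n) * \<rho> s' (x [^] j \<otimes> x [^] n))
          = c s' * (w j * w n * \<rho> (x [^] j) (x [^] n)) * \<rho> s' (x [^] j \<otimes> x [^] n)"
        using w_S[OF z] by simp
      also have "\<dots> = d s' n'" unfolding w_add using xc by (simp add: d_def n' nat_pow_mult)
      finally show ?thesis .
    qed
    have d_eq: "d s n = d s' n'" if "s \<in> S" "s' \<in> S" "s \<otimes> x [^] n = s' \<otimes> x [^] n'" for s s' n n'
      using that d_le[of s s' n n'] d_le[of s' s n' n] by (cases "n \<le> n'") auto
    define S' where "S' = {s \<otimes> x [^] (n::nat) | s n. s \<in> S}"
    define c' where "c' y = (SOME a. \<exists>s n. s \<in> S \<and> y = s \<otimes> x [^] n \<and> a = d s n)" for y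
    have c': "c' (s \<otimes> x [^] n) = d s n" if s: "s \<in> S" for s n
      unfolding c'_def
    proof (rule some_equality)
      show "\<exists>s' n'. s' \<in> S \<and> s \<otimes> x [^] n = s' \<otimes> x [^] n' \<and> d s n = d s' n'" using s by blast
      fix a assume "\<exists>s' n'. s' \<in> S \<and> s \<otimes> x [^] n = s' \<otimes> x [^] n' \<and> a = d s' n'"
      then obtain s' n' where "s' \<in> S" "s \<otimes> x [^] n = s' \<otimes> x [^] n'" "a = d s' n'" by blast
      then show "a = d s n" using d_eq[OF s, of s' n n'] by simp
    qed
    have S'T: "S' \<subseteq> T" using ST xT by (auto simp: S'_def intro!: T.m_closed)
    have S'mult: "(s \<otimes> x [^] n) \<otimes> (s' \<otimes> x [^] n') = (s \<otimes> s') \<otimes> x [^] (n + n')"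
      if "s \<in> S" "s' \<in> S" for s s' and n n' :: nat
      using that xc m_lcomm[of "x [^] n" s' "x [^] n'"] by (simp add: m_assoc nat_pow_mult)
    have SS': "S \<subseteq> S'" unfolding S'_def
    proof
      fix s assume "s \<in> S"
      then show "s \<in> {s \<otimes> x [^] (n::nat) | s n. s \<in> S}"
        by (intro CollectI exI[of _ s] exI[of _ "0::nat"]) auto
    qed
    have subS': "subgroup S' G"
    proof (rule subgroup_of_finite_closed)
      show "finite S'" using S'T finT finite_subset by auto
      show "S' \<subseteq> carrier G" using S'T by auto
      show "\<one> \<in> S'" using SS' by auto
      fix a b assume "a \<in> S'" "b \<in> S'"
      then obtain s s' and n n' :: nat where "a = s \<otimes> x [^] n" "b = s' \<otimes> x [^] n'" "s \<in> S" "s' \<in> S"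
        unfolding S'_def by blast
      then show "a \<otimes> b \<in> S'" unfolding S'_def using S'mult by blast
    qed
    have "x = \<one> \<otimes> x [^] (1::nat)" using xc by simp
    then have "x \<in> S'" unfolding S'_def using S.one_closed by blast
    then have "card S < card S'"
      using SS' x(2) S'T finT by (metis finite_subset psubsetI psubset_card_mono)
    moreover have "good S' c'"
      unfolding good_def
    proof (intro conjI ballI subS' S'T)
      fix a assume "a \<in> S'"
      then obtain s and n :: nat where a: "a = s \<otimes> x [^] n" "s \<in> S" unfolding S'_def by blast
      show "c' a \<noteq> 0" using d_nz a c' by simp
      fix b assume "b \<in> S'"
      then obtain s' and n' :: nat where b: "b = s' \<otimes> x [^] n'" "s' \<in> S" unfolding S'_def by blast
      show "c' a * c' b * \<rho> a b = c' (a \<otimes> b)"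
        unfolding a b S'mult[OF a(2) b(2)] using d_mult[OF a(2) b(2)] c' a b by simp
    qed
    ultimately show ?thesis by blast
  qed
  have "good {\<one>} (\<lambda>_. inverse (\<rho> \<one> \<one>))"
    using nz[of \<one> \<one>] triv_subgroup by (simp add: good_def)
  moreover have bound: "card S \<le> card T" if "good S c" for S c
    using that finT by (auto simp: good_def intro: card_mono)
  \<comment> \<open>The sizes are bounded by \<open>card T\<close>, so a section over a largest
    subgroup exists, and \<open>extend\<close> forces that subgroup to be \<open>T\<close>.\<close>
  ultimately have "\<exists>S. (\<exists>c. good S c) \<and> (\<forall>S'. (\<exists>c. good S' c) \<longrightarrow> card S' \<le> card S)"
    by (intro ex_has_greatest_nat[of _ "{\<one>}" card "Suc (card T)"]) (auto simp: less_Suc_eq_le)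
  then obtain S c where Sc: "good S c" "\<And>S' c'. good S' c' \<Longrightarrow> card S' \<le> card S" by blast
  have "T \<subseteq> S" using extend[OF Sc(1)] Sc(2) by (meson linorder_not_less subsetI)
  then have "S = T" using Sc(1) by (auto simp: good_def)
  then show ?thesis using Sc(1) by (auto simp: good_def)
qed

end

section \<open>Gradings on central prime algebras\<close>

text \<open>Primeness is taken elementwise because in this form the middle factor can be chosen
  homogeneous. The unit \<open>u\<close> of \<open>A\<close> is in general not 1, and the finite set
  \<open>S\<close> bounds the size of every independent set in \<open>A\<close>.\<close>

locale graded_prime_algebra = assoc_algebra scale + comm_group G
  for scale :: "'f::alg_closed_field \<Rightarrow> 'a::ring_1 \<Rightarrow> 'a" (infixr "*s" 75)
    and G :: "('g, 'm) monoid_scheme" (structure) +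
  fixes A :: "'a set" and \<Gamma> :: "'g \<Rightarrow> 'a set" and u :: 'a and S :: "'a set"
  assumes subspace_A: "subspace A" and fin_S: "finite S" and A_fin: "A \<subseteq> span S"
    and A_mult: "\<And>x y. x \<in> A \<Longrightarrow> y \<in> A \<Longrightarrow> x * y \<in> A"
    and u_in_A: "u \<in> A" and u_nz: "u \<noteq> 0"
    and u_left: "\<And>x. x \<in> A \<Longrightarrow> u * x = x" and u_right: "\<And>x. x \<in> A \<Longrightarrow> x * u = x"
    and prime: "\<And>x y. x \<in> A \<Longrightarrow> y \<in> A \<Longrightarrow> x \<noteq> 0 \<Longrightarrow> y \<noteq> 0 \<Longrightarrow> \<exists>r\<in>A. x * r * y \<noteq> 0"
    and subspace_\<Gamma>: "\<And>h. h \<in> carrier G \<Longrightarrow> subspace (\<Gamma> h)"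
    and \<Gamma>_A: "\<And>h x. h \<in> carrier G \<Longrightarrow> x \<in> \<Gamma> h \<Longrightarrow> x \<in> A"
    and \<Gamma>_mult: "\<And>h h' x y. h \<in> carrier G \<Longrightarrow> h' \<in> carrier G \<Longrightarrow> x \<in> \<Gamma> h \<Longrightarrow> y \<in> \<Gamma> h' \<Longrightarrow> x * y \<in> \<Gamma> (h \<otimes> h')"
    and decomp: "\<And>x. x \<in> A \<Longrightarrow> \<exists>H f. finite H \<and> H \<subseteq> carrier G \<and> (\<forall>h\<in>H. f h \<in> \<Gamma> h) \<and> x = (\<Sum>h\<in>H. f h)"
    and direct: "\<And>H f h. finite H \<Longrightarrow> H \<subseteq> carrier G \<Longrightarrow> (\<forall>h\<in>H. f h \<in> \<Gamma> h) \<Longrightarrow> (\<Sum>h\<in>H. f h) = 0 \<Longrightarrow> h \<in> H \<Longrightarrow> f h = 0"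
begin

lemma pow_mult_in_A: "d \<in> A \<Longrightarrow> e \<in> A \<Longrightarrow> d ^ n * e \<in> A"
  by (induction n) (auto simp: A_mult mult.assoc)

text \<open>In a nonzero product \<open>x * r * y\<close> some homogeneous component of
  \<open>r\<close> already gives a nonzero product.\<close>

lemma homogeneous_prime:
  assumes "x \<in> A" "y \<in> A" "x \<noteq> 0" "y \<noteq> 0"
  obtains h r where "h \<in> carrier G" "r \<in> \<Gamma> h" "x * r * y \<noteq> 0"
proof -
  obtain r where r: "r \<in> A" "x * r * y \<noteq> 0" using prime assms by blast
  obtain H f where f: "finite H" "H \<subseteq> carrier G" "\<forall>h\<in>H. f h \<in> \<Gamma> h" "r = (\<Sum>h\<in>H. f h)"
    using decomp[OF r(1)] by blast
  have "(\<Sum>h\<in>H. x * f h * y) \<noteq> 0"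
    using r(2) unfolding f(4) by (simp add: sum_distrib_left sum_distrib_right)
  then obtain h where "h \<in> H" "x * f h * y \<noteq> 0" by (meson sum.neutral)
  then show ?thesis using that f by blast
qed

text \<open>In degree \<open>v\<close> of the equation \<open>r * d = w\<close> only the component
  of \<open>r\<close> in degree \<open>v \<otimes> inv c\<close> contributes. So left multipliers
  between homogeneous elements may be taken homogeneous, and one family \<open>f\<close> serves all
  equations with the same \<open>r\<close>.\<close>

lemma homogeneous_factor:
  assumes "r \<in> A"
  shows "\<exists>f. (\<forall>h\<in>carrier G. f h \<in> \<Gamma> h) \<and> (\<forall>c\<in>carrier G. \<forall>v\<in>carrier G. \<forall>d\<in>\<Gamma> c. \<forall>w\<in>\<Gamma> v.
    r * d = w \<longrightarrow> f (v \<otimes> inv c) * d = w)"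
proof -
  obtain H f0 where f0: "finite H" "H \<subseteq> carrier G" "\<forall>h\<in>H. f0 h \<in> \<Gamma> h" "r = (\<Sum>h\<in>H. f0 h)"
    using decomp[OF assms] by blast
  \<comment> \<open>Outside the support the component is 0, so that \<open>f\<close> makes sense in
    all degrees.\<close>
  define f where "f h = (if h \<in> H then f0 h else 0)" for h
  have f: "f h \<in> \<Gamma> h" if "h \<in> carrier G" for h
    using f0 that subspace_\<Gamma> by (auto simp: f_def subspace_0)
  moreover have "f (v \<otimes> inv c) * d = w"
    if H: "c \<in> carrier G" "v \<in> carrier G" "d \<in> \<Gamma> c" "w \<in> \<Gamma> v" "r * d = w" for c v d w
  proof -
    define H' where "H' = insert v ((\<lambda>h. h \<otimes> c) ` H)"
    \<comment> \<open>\<open>F k\<close> is the degree \<open>k\<close> part of the difference of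
      the two sides; these parts add up to 0, so directness kills each of them.\<close>
    define F where "F k = f (k \<otimes> inv c) * d - (if k = v then w else 0)" for k
    have fin: "finite H'" and sub: "H' \<subseteq> carrier G" using f0 H by (auto simp: H'_def)
    have Fk: "F k \<in> \<Gamma> k" if "k \<in> H'" for k
    proof -
      have k: "k \<in> carrier G" using that sub by auto
      have "f (k \<otimes> inv c) * d \<in> \<Gamma> (k \<otimes> inv c \<otimes> c)"
        by (intro \<Gamma>_mult f) (use H k in auto)
      then have "f (k \<otimes> inv c) * d \<in> \<Gamma> k" using k H by (simp add: m_assoc)
      moreover have "(if k = v then w else 0) \<in> \<Gamma> k"
        using H subspace_0[OF subspace_\<Gamma>[OF k]] by auto
      ultimately show ?thesis unfolding F_def by (rule subspace_diff[OF subspace_\<Gamma>[OF k]])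
    qed
    have inj: "inj_on (\<lambda>h. h \<otimes> c) H" using f0 H by (auto simp: inj_on_def subset_iff)
    have "(\<Sum>k\<in>H'. f (k \<otimes> inv c) * d) = (\<Sum>k\<in>(\<lambda>h. h \<otimes> c) ` H. f (k \<otimes> inv c) * d)"
    proof (rule sum.mono_neutral_right[OF fin])
      show "\<forall>i\<in>H' - (\<lambda>h. h \<otimes> c) ` H. f (i \<otimes> inv c) * d = 0"
      proof
        fix i assume i: "i \<in> H' - (\<lambda>h. h \<otimes> c) ` H"
        have "i \<otimes> inv c \<notin> H"
        proof
          assume "i \<otimes> inv c \<in> H"
          moreover have "i = (i \<otimes> inv c) \<otimes> c" using i sub H by (simp add: m_assoc subset_iff)
          ultimately show False using i by blast
        qed
        then show "f (i \<otimes> inv c) * d = 0" by (simp add: f_def)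
      qed
    qed (auto simp: H'_def)
    also have "\<dots> = (\<Sum>h\<in>H. f0 h * d)"
      unfolding sum.reindex[OF inj] using f0 H
      by (intro sum.cong) (auto simp: f_def m_assoc subset_iff)
    also have "\<dots> = w" using H(5) f0(4) by (simp add: sum_distrib_right)
    finally have 1: "(\<Sum>k\<in>H'. f (k \<otimes> inv c) * d) = w" .
    have "(\<Sum>k\<in>H'. if k = v then w else 0) = w" using fin by (simp add: H'_def)
    then have "(\<Sum>k\<in>H'. F k) = 0" unfolding F_def sum_subtractf 1 by simp
    then have "F v = 0" using direct[OF fin sub, of F v] Fk by (simp add: H'_def)
    then show ?thesis by (simp add: F_def)
  qed
  ultimately show ?thesis by blast
qed

text \<open>The neutral component of \<open>u\<close> fixes every homogeneous element from the left,
  hence fixes their sum \<open>u\<close>; as \<open>u\<close> is also a right unit, it equals that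
  component.\<close>

lemma u_homogeneous: "u \<in> \<Gamma> \<one>"
proof -
  obtain f where f: "\<And>h. h \<in> carrier G \<Longrightarrow> f h \<in> \<Gamma> h"
    "\<And>c v d w. c \<in> carrier G \<Longrightarrow> v \<in> carrier G \<Longrightarrow> d \<in> \<Gamma> c \<Longrightarrow> w \<in> \<Gamma> v \<Longrightarrow> u * d = w \<Longrightarrow> f (v \<otimes> inv c) * d = w"
    using homogeneous_factor[OF u_in_A] by metis
  have hom: "f \<one> * x = x" if "h \<in> carrier G" "x \<in> \<Gamma> h" for h x
    using f(2)[of h h x x] that u_left \<Gamma>_A by simp
  obtain H f0 where f0: "finite H" "H \<subseteq> carrier G" "\<forall>h\<in>H. f0 h \<in> \<Gamma> h" "u = (\<Sum>h\<in>H. f0 h)"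
    using decomp[OF u_in_A] by blast
  have "f \<one> * u = (\<Sum>h\<in>H. f \<one> * f0 h)" unfolding f0(4) by (rule sum_distrib_left)
  also have "\<dots> = u" unfolding f0(4) using f0 hom by (intro sum.cong) auto
  finally have "f \<one> = u" using u_right \<Gamma>_A f(1) by (metis one_closed)
  then show ?thesis using f(1) by (metis one_closed)
qed

text \<open>
  The idempotent comes from a minimal graded left ideal \<open>A x = A y\<close> with \<open>x y \<noteq> 0\<close>: it is the
  solution \<open>e \<in> A x\<close> of \<open>e y = y\<close>. Minimality makes \<open>e A e\<close> a graded division algebra.
\<close>
lemma ex_graded_division_idempotent:
  obtains e where "e \<in> \<Gamma> \<one>" "e \<noteq> 0" "e * e = e"
    "\<And>h d. h \<in> carrier G \<Longrightarrow> d \<in> \<Gamma> h \<Longrightarrow> d \<noteq> 0 \<Longrightarrow> e * d = d \<Longrightarrow> d * e = d \<Longrightarrow>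
      \<exists>d'\<in>\<Gamma> (inv h). e * d' = d' \<and> d' * e = d' \<and> d' * d = e"
proof -
  define L where "L x = (\<lambda>r. r * x) ` A" for x
  have L_sub: "subspace (L x)" for x unfolding L_def by (rule subspace_image_mult_right[OF subspace_A])
  have L_A: "L x \<subseteq> A" if "x \<in> A" for x using A_mult that by (auto simp: L_def)
  have L_self: "x \<in> L x" if "x \<in> A" for x using u_left[OF that] u_in_A unfolding L_def by (metis image_eqI)
  have L_ideal: "r * y \<in> L x" if "r \<in> A" "y \<in> L x" for r x y
    using that A_mult unfolding L_def by (auto simp flip: mult.assoc)
  define P where "P x \<longleftrightarrow> x \<noteq> 0 \<and> (\<exists>h\<in>carrier G. x \<in> \<Gamma> h)" for x
  have "P u" using u_nz u_homogeneous by (auto simp: P_def)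
  \<comment> \<open>Minimality is taken as least dimension among the left ideals with a nonzero
    homogeneous generator.\<close>
  then obtain x where x: "P x" "\<And>y. P y \<Longrightarrow> dim (L x) \<le> dim (L y)"
    using ex_has_least_nat[of P u "\<lambda>x. dim (L x)"] by blast
  then obtain c where c: "c \<in> carrier G" "x \<in> \<Gamma> c" "x \<noteq> 0" by (auto simp: P_def)
  have xA: "x \<in> A" using \<Gamma>_A c by blast
  have min: "L y = L x" if "P y" "y \<in> L x" for y
  proof (rule subspace_eq_if_dim_le[OF fin_S])
    show "L x \<subseteq> span S" using L_A[OF xA] A_fin by blast
    show "L y \<subseteq> L x" using L_ideal that(2) by (auto simp: L_def[of y])
  qed (use L_sub x(2) that in auto)
  obtain k r where r: "k \<in> carrier G" "r \<in> \<Gamma> k" "x * r * x \<noteq> 0"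
    by (rule homogeneous_prime[OF xA xA c(3,3)])
  define y where "y = r * x"
  \<comment> \<open>\<open>z = x * r * x\<close> generates the same minimal ideal as
    \<open>x\<close>, so \<open>y\<close> is a left multiple of \<open>z\<close>; comparing degrees,
    the multiplier can be taken of degree \<open>inv c\<close>.\<close>
  define z where "z = x * y"
  have y: "y \<in> \<Gamma> (k \<otimes> c)" "y \<noteq> 0" and z: "z \<in> \<Gamma> (c \<otimes> (k \<otimes> c))" "z \<noteq> 0"
    using r c \<Gamma>_mult by (auto simp: y_def z_def mult.assoc)
  have yL: "y \<in> L x" using r \<Gamma>_A by (auto simp: y_def L_def)
  have zL: "z \<in> L x" using yL xA L_ideal by (simp add: z_def)
  have "c \<otimes> (k \<otimes> c) \<in> carrier G" using c r by simp
  then have "P z" unfolding P_def using z by blast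
  then have Lz: "L z = L x" using zL by (rule min)
  then have "y \<in> L z" using yL by simp
  then obtain s where s: "s \<in> A" "y = s * z" unfolding L_def by auto
  obtain f where f: "\<And>h. h \<in> carrier G \<Longrightarrow> f h \<in> \<Gamma> h"
    "\<And>c v d w. c \<in> carrier G \<Longrightarrow> v \<in> carrier G \<Longrightarrow> d \<in> \<Gamma> c \<Longrightarrow> w \<in> \<Gamma> v \<Longrightarrow> s * d = w \<Longrightarrow> f (v \<otimes> inv c) * d = w"
    using homogeneous_factor[OF s(1)] by metis
  define s' where "s' = f (inv c)"
  have "(k \<otimes> c) \<otimes> inv (c \<otimes> (k \<otimes> c)) = inv c"
    using c r by (simp add: inv_mult_group m_assoc)
  moreover have "f ((k \<otimes> c) \<otimes> inv (c \<otimes> (k \<otimes> c))) * z = y"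
    by (rule f(2)[OF _ _ z(1) y(1)]) (use c r s in simp_all)
  ultimately have s': "s' \<in> \<Gamma> (inv c)" "s' * z = y"
    using f(1)[of "inv c"] c(1) by (simp_all add: s'_def)
  define e where "e = s' * x"
  have e1: "e \<in> \<Gamma> \<one>" using \<Gamma>_mult[of "inv c" c s' x] s' c by (simp add: e_def)
  have eL: "e \<in> L x" using s' c \<Gamma>_A[of "inv c"] by (auto simp: e_def L_def)
  have ey: "e * y = y" using s'(2) by (simp add: e_def z_def mult.assoc)
  have enz: "e \<noteq> 0" using ey y by auto
  have eA: "e \<in> A" using e1 \<Gamma>_A by blast
  \<comment> \<open>If \<open>e * e - e\<close> were nonzero, it would generate the minimal ideal
    and \<open>e\<close> would be a left multiple of it; but it annihilates \<open>y\<close>,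
    whereas \<open>e\<close> does not.\<close>
  have ee: "e * e = e"
  proof (rule ccontr)
    assume ne: "e * e \<noteq> e"
    have "e * e - e \<in> L x" using L_ideal[OF eA eL] eL by (rule subspace_diff[OF L_sub])
    moreover have "e * e - e \<in> \<Gamma> \<one>"
      using \<Gamma>_mult[of \<one> \<one> e e] e1 subspace_\<Gamma>[of \<one>] by (auto intro: subspace_diff)
    then have "P (e * e - e)" unfolding P_def using ne by (intro conjI bexI[OF _ one_closed]) auto
    ultimately have "L (e * e - e) = L x" by (intro min)
    then have "e \<in> L (e * e - e)" using eL by simp
    then obtain t where "e = t * (e * e - e)" unfolding L_def by auto
    then have "e * y = t * (e * e - e) * y" by simp
    also have "\<dots> = 0" using ey by (simp add: left_diff_distrib mult.assoc)
    finally show False using ey y by simp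
  qed
  have "P e" unfolding P_def using enz e1 by blast
  then have Le: "L e = L x" using eL by (rule min)
  have div: "\<exists>d'\<in>\<Gamma> (inv h). e * d' = d' \<and> d' * e = d' \<and> d' * d = e"
    if d: "h \<in> carrier G" "d \<in> \<Gamma> h" "d \<noteq> 0" "e * d = d" "d * e = d" for h d
  proof -
    have dA: "d \<in> A" using d \<Gamma>_A by blast
    have "d \<in> L e" using d(5) dA unfolding L_def by (metis image_eqI)
    then have "d \<in> L x" unfolding Le .
    moreover have "P d" unfolding P_def using d by blast
    ultimately have "L d = L x" by (intro min)
    then have "e \<in> L d" using eL by simp
    then obtain r where r: "r \<in> A" "r * d = e" unfolding L_def by auto
    obtain f where f: "\<And>h. h \<in> carrier G \<Longrightarrow> f h \<in> \<Gamma> h"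
      "\<And>c v d w. c \<in> carrier G \<Longrightarrow> v \<in> carrier G \<Longrightarrow> d \<in> \<Gamma> c \<Longrightarrow> w \<in> \<Gamma> v \<Longrightarrow> r * d = w \<Longrightarrow> f (v \<otimes> inv c) * d = w"
      using homogeneous_factor[OF r(1)] by metis
    define q where "q = f (inv h)"
    have q: "q \<in> \<Gamma> (inv h)" "q * d = e"
      using f(1)[of "inv h"] f(2)[OF d(1) one_closed d(2) e1 r(2)] d(1) by (simp_all add: q_def)
    show ?thesis
    proof (intro bexI conjI)
      \<comment> \<open>The left inverse \<open>q\<close> is only homogeneous; cutting it down by
        \<open>e\<close> on both sides places it in the corner without changing its product with
        \<open>d\<close>.\<close>
      show "e * q * e \<in> \<Gamma> (inv h)"
        using \<Gamma>_mult[of \<one> "inv h" e q] \<Gamma>_mult[of "inv h" \<one> "e * q" e] e1 q d by simp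
      show "e * (e * q * e) = e * q * e" using ee by (simp flip: mult.assoc)
      show "e * q * e * e = e * q * e" using ee by (simp add: mult.assoc)
      show "e * q * e * d = e" using q(2) d(4) ee by (simp add: mult.assoc)
    qed
  qed
  show ?thesis by (rule that[OF e1 enz ee div])
qed

text \<open>
  An element of a finite-dimensional corner is annihilated by a polynomial, which splits.
  If \<open>d - a e\<close> is never a zero divisor unless it vanishes, then \<open>d\<close> is a scalar.
\<close>
lemma scalar_if_no_zero_divisors:
  assumes d: "d \<in> A" "e * d = d" "d * e = d" and e: "e \<in> A" "e * e = e" "e \<noteq> 0"
    and nzd: "\<And>a q. q \<in> span (range (\<lambda>n. d ^ n * e)) \<Longrightarrow> (d - a *s e) * q = 0 \<Longrightarrow> q \<noteq> 0 \<Longrightarrow> d = a *s e"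
  shows "\<exists>a. d = a *s e"
proof -
  \<comment> \<open>Horner evaluation at \<open>d\<close> inside the corner: the constant
    coefficient multiplies \<open>e\<close>, not 1.\<close>
  define ev where "ev p = fold_coeffs (\<lambda>c a. c *s e + d * a) p 0" for p
  have ev0: "ev 0 = 0" by (simp add: ev_def)
  have ev_pCons: "ev (pCons c p) = c *s e + d * ev p" for c p
  proof (cases "c = 0 \<and> p = 0")
    case False
    then show ?thesis by (auto simp: ev_def fold_coeffs_pCons_not_0_0_eq fold_coeffs_pCons_coeff_not_0_eq)
  qed (simp add: ev0)
  have ev_add: "ev (p + q) = ev p + ev q" for p q
    by (induction p q rule: poly_induct2) (simp_all add: ev0 ev_pCons algebra_simps scale_left_distrib)
  have ev_smult: "ev (Polynomial.smult c p) = c *s ev p" for c p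
    by (induction p) (simp_all add: ev0 ev_pCons scale_right_distrib)
  have ev_monom: "ev (monom c n) = c *s (d ^ n * e)" for c n
    by (induction n) (simp_all add: ev0 ev_pCons monom_0 monom_Suc mult.assoc)
  have ev_sum: "ev (\<Sum>i\<in>X. p i) = (\<Sum>i\<in>X. ev (p i))" for X :: "nat set" and p
    by (induction X rule: infinite_finite_induct) (simp_all add: ev0 ev_add)
  have ev_span: "ev p \<in> span (range (\<lambda>n. d ^ n * e))" for p
  proof -
    have "ev p = ev (\<Sum>i\<le>degree p. monom (coeff p i) i)" by (simp add: poly_as_sum_of_monoms)
    then show ?thesis unfolding ev_sum ev_monom by (simp only:) (intro span_sum span_scale span_base rangeI)
  qed
  have eev: "e * ev p = ev p" for p
    by (induction p) (simp_all add: ev0 ev_pCons distrib_left e d mult.assoc[of e, symmetric] flip: mult.assoc)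
  note pow_A = pow_mult_in_A[OF d(1) e(1)]
  \<comment> \<open>Among the elements \<open>d ^ n * e\<close> with \<open>n \<le> card S\<close>
    there is either a repetition or a linear relation; both give an annihilating polynomial.\<close>
  have ex: "\<exists>p. p \<noteq> 0 \<and> ev p = 0"
  proof (cases "inj_on (\<lambda>n. d ^ n * e) {..card S}")
    case False
    then obtain i j where ij: "i \<noteq> j" "d ^ i * e = d ^ j * e" by (auto simp: inj_on_def)
    have "ev (monom 1 i + monom (- 1) j) = 0" using ij by (simp add: ev_add ev_monom)
    moreover have "monom 1 i + monom (- 1 :: 'f) j \<noteq> 0"
    proof
      assume "monom 1 i + monom (- 1 :: 'f) j = 0"
      then have "coeff (monom 1 i + monom (- 1 :: 'f) j) i = 0" by simp
      then show False using ij by simp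
    qed
    ultimately show ?thesis by blast
  next
    case True
    let ?V = "(\<lambda>n. d ^ n * e) ` {..card S}"
    have "card ?V = Suc (card S)" using card_image[OF True] by simp
    moreover have "?V \<subseteq> span S" using pow_A A_fin by blast
    ultimately have "dependent ?V"
      using independent_span_bound[OF fin_S, of ?V] by (metis Suc_n_not_le_n)
    then obtain X w where X: "finite X" "X \<subseteq> ?V" "(\<Sum>v\<in>X. w v *s v) = 0" "\<exists>v\<in>X. w v \<noteq> 0"
      unfolding dependent_explicit by (elim exE conjE) (rule that; assumption)
    define N where "N = {n. n \<le> card S \<and> d ^ n * e \<in> X}"
    have im: "X = (\<lambda>n. d ^ n * e) ` N" using X(2) by (auto simp: N_def)
    have injN: "inj_on (\<lambda>n. d ^ n * e) N" by (rule inj_on_subset[OF True]) (auto simp: N_def)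
    have finN: "finite N" by (auto simp: N_def)
    define p where "p = (\<Sum>n\<in>N. monom (w (d ^ n * e)) n)"
    have "ev p = (\<Sum>n\<in>N. w (d ^ n * e) *s (d ^ n * e))" by (simp add: p_def ev_sum ev_monom)
    also have "\<dots> = 0" using X(3) unfolding im by (simp add: sum.reindex[OF injN])
    finally have "ev p = 0" .
    moreover obtain n where n: "n \<in> N" "w (d ^ n * e) \<noteq> 0" using X(4) im by auto
    have "coeff p n = (\<Sum>m\<in>N. if m = n then w (d ^ n * e) else 0)"
      unfolding p_def coeff_sum by (intro sum.cong) auto
    then have "p \<noteq> 0" using n finN by auto
    ultimately show ?thesis by blast
  qed
  \<comment> \<open>Least degree is the point: if \<open>a\<close> is a root of \<open>p\<close>,
    the cofactor \<open>q\<close> has \<open>ev q\<close> nonzero, and \<open>d - a *s e\<close>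
    annihilates it.\<close>
  then obtain p where p: "p \<noteq> 0 \<and> ev p = 0" "\<And>q. q \<noteq> 0 \<and> ev q = 0 \<Longrightarrow> degree p \<le> degree q"
    using ex_has_least_nat[of "\<lambda>p. p \<noteq> 0 \<and> ev p = 0" _ degree] by blast
  have "degree p > 0"
  proof (rule gr0I)
    assume "degree p = 0"
    then obtain a where "p = [:a:]" using degree_eq_zeroE by blast
    then show False using p(1) e(3) by (auto simp: ev_pCons ev0)
  qed
  then obtain a where "poly p a = 0" using alg_closed_imp_poly_has_root by blast
  then have "[:- a, 1:] dvd p" by (simp add: poly_eq_0_iff_dvd)
  then obtain q where q: "p = [:- a, 1:] * q" by (rule dvdE)
  then have qnz: "q \<noteq> 0" and "degree p = Suc (degree q)"
    using p(1) by (auto simp: degree_mult_eq simp del: mult_pCons_left)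
  then have evq: "ev q \<noteq> 0" using p(2)[of q] by auto
  have "p = Polynomial.smult (- a) q + pCons 0 q" by (simp add: q)
  then have "ev p = ev (Polynomial.smult (- a) q) + ev (pCons 0 q)" by (simp only: ev_add)
  then have "ev p = (d - a *s e) * ev q"
    unfolding ev_smult ev_pCons by (simp add: left_diff_distrib eev)
  then have "(d - a *s e) * ev q = 0" using p(1) by simp
  then show ?thesis using nzd[OF ev_span] evq by blast
qed

text \<open>A nonzero central element \<open>x\<close> of a prime algebra is no zero divisor,
  because \<open>x * r * q = r * x * q\<close>. This applies to every
  \<open>z - a *s u\<close>.\<close>

lemma central_scalar:
  assumes z: "z \<in> A" "\<And>x. x \<in> A \<Longrightarrow> z * x = x * z"
  shows "\<exists>a. z = a *s u"
proof (rule scalar_if_no_zero_divisors[OF z(1) _ _ u_in_A _ u_nz])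
  fix a q assume q: "q \<in> span (range (\<lambda>n. z ^ n * u))" "(z - a *s u) * q = 0" "q \<noteq> 0"
  have "span (range (\<lambda>n. z ^ n * u)) \<subseteq> A"
    using subspace_A pow_mult_in_A[OF z(1) u_in_A] by (intro span_minimal) auto
  then have qA: "q \<in> A" using q by blast
  have zA: "z - a *s u \<in> A" using z u_in_A subspace_A by (simp add: subspace_diff subspace_scale)
  show "z = a *s u"
  proof (rule ccontr)
    assume "z \<noteq> a *s u"
    then obtain r where r: "r \<in> A" "(z - a *s u) * r * q \<noteq> 0" using prime[OF zA qA] q by auto
    have "(z - a *s u) * r = r * (z - a *s u)"
      using z(2)[OF r(1)] u_left[OF r(1)] u_right[OF r(1)] by (simp add: left_diff_distrib right_diff_distrib)
    then show False using r q by (simp add: mult.assoc)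
  qed
qed (use z u_left u_right u_in_A in auto)

end

context graded_prime_algebra
begin

text \<open>The corner of \<open>e\<close> supplies \<open>T\<close>, \<open>\<beta>\<close> and
  \<open>\<sigma>\<close>; a maximal system of homogeneous copies of \<open>e\<close> supplies
  \<open>k\<close> and \<open>g\<close>. Nondegeneracy is left to the end because its proof uses a
  central element built from the whole diagonal of the finished basis.\<close>

theorem ex_graded_matrix_basis:
  "\<exists>T (\<beta> :: 'g \<Rightarrow> 'g \<Rightarrow> 'f) k g B \<sigma>. graded_matrix_basis scale G T \<beta> k g A \<Gamma> B \<sigma>"
proof -

  \<comment> \<open>The graded division algebra in the corner of the idempotent\<close>
  obtain e where e: "e \<in> \<Gamma> \<one>" "e \<noteq> 0" "e * e = e"
    and div: "\<And>h d. h \<in> carrier G \<Longrightarrow> d \<in> \<Gamma> h \<Longrightarrow> d \<noteq> 0 \<Longrightarrow> e * d = d \<Longrightarrow> d * e = d \<Longrightarrow>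
      \<exists>d'\<in>\<Gamma> (inv h). e * d' = d' \<and> d' * e = d' \<and> d' * d = e"
    by (rule ex_graded_division_idempotent) blast
  have eA: "e \<in> A" using e \<Gamma>_A by blast
  define D where "D h = {d \<in> \<Gamma> h. e * d = d \<and> d * e = d}" for h
  have D_mult: "x * y \<in> D (h \<otimes> h')" if "h \<in> carrier G" "h' \<in> carrier G" "x \<in> D h" "y \<in> D h'" for h h' x y
    using that \<Gamma>_mult[of h h' x y] by (auto simp: D_def mult.assoc) (metis mult.assoc)
  have D_A: "d \<in> A" if "d \<in> D h" "h \<in> carrier G" for d h using that \<Gamma>_A by (auto simp: D_def)
  have D_\<Gamma>: "d \<in> \<Gamma> h" if "d \<in> D h" for d h using that by (auto simp: D_def)
  have D_e: "e * d = d" "d * e = d" if "d \<in> D h" for d h using that by (auto simp: D_def)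
  have D_compress: "e * x * e \<in> D h" if "h \<in> carrier G" "x \<in> \<Gamma> h" for h x
  proof -
    have "e * x * e \<in> \<Gamma> h"
      using \<Gamma>_mult[of \<one> h e x] \<Gamma>_mult[of h \<one> "e * x" e] that e by simp
    moreover have "e * (e * x * e) = e * x * e" using e(3) by (simp flip: mult.assoc)
    moreover have "e * x * e * e = e * x * e" using e(3) by (simp add: mult.assoc)
    ultimately show ?thesis by (simp add: D_def)
  qed
  have D_scale: "a *s d \<in> D h" if "d \<in> D h" "h \<in> carrier G" for a d h
    using that subspace_\<Gamma>[of h] by (auto simp: D_def subspace_scale)
  \<comment> \<open>Left inverses suffice: the left inverse \<open>d2\<close> of the left inverse
    \<open>d1\<close> turns out to be \<open>d\<close> itself.\<close>
  have D_inv: "\<exists>d'\<in>D (inv h). d' * d = e \<and> d * d' = e" if h: "h \<in> carrier G" and d: "d \<in> D h" "d \<noteq> 0" for h d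
  proof -
    obtain d1 where d1: "d1 \<in> D (inv h)" "d1 * d = e" using div[OF h, of d] d by (auto simp: D_def)
    then have "d1 \<noteq> 0" using e by auto
    then obtain d2 where d2: "d2 \<in> D (inv (inv h))" "d2 * d1 = e"
      using div[of "inv h" d1] d1 h by (auto simp: D_def)
    have "d = e * d" using D_e(1)[OF d(1)] by simp
    also have "\<dots> = d2 * (d1 * d)" by (simp flip: d2(2) add: mult.assoc)
    also have "\<dots> = d2" using d1 D_e(2)[OF d2(1)] by simp
    finally show ?thesis using d1 d2 by blast
  qed
  \<comment> \<open>Nonzero elements of the neutral component are invertible in the corner, so they
    are not zero divisors there, and over an algebraically closed field only the scalars
    remain.\<close>
  have D_one: "\<exists>a. d = a *s e" if d: "d \<in> D \<one>" for d
  proof (rule scalar_if_no_zero_divisors[OF _ _ _ eA e(3,2)])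
    fix a q assume q: "q \<in> span (range (\<lambda>n. d ^ n * e))" "(d - a *s e) * q = 0" "q \<noteq> 0"
    have "e * q = q" using q(1)
    proof (induction rule: span_induct_alt)
      case (step c x y)
      have "e * (d ^ n * e) = d ^ n * e" for n
        by (cases n) (simp_all add: e D_e(1)[OF d] flip: mult.assoc)
      then show ?case using step by (auto simp: distrib_left)
    qed simp
    have de: "d - a *s e \<in> D \<one>"
      using d e subspace_\<Gamma>[of \<one>]
      by (auto simp: D_def left_diff_distrib right_diff_distrib subspace_diff subspace_scale)
    show "d = a *s e"
    proof (rule ccontr)
      assume "d \<noteq> a *s e"
      then obtain d' where "d' * (d - a *s e) = e" using D_inv[OF one_closed de] by auto
      then have "e * q = d' * ((d - a *s e) * q)" by (simp flip: mult.assoc)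
      then show False using q \<open>e * q = q\<close> by simp
    qed
  qed (use D_A D_e d in auto)
  define T where "T = {h \<in> carrier G. \<exists>d\<in>D h. d \<noteq> 0}"
  define X where "X t = (SOME d. d \<in> D t \<and> d \<noteq> 0)" for t
  have X: "X t \<in> D t" "X t \<noteq> 0" if "t \<in> T" for t
    using that someI_ex[of "\<lambda>d. d \<in> D t \<and> d \<noteq> 0"] by (auto simp: T_def X_def)
  have Tc: "t \<in> carrier G" if "t \<in> T" for t using that by (simp add: T_def)
  \<comment> \<open>Multiplication by an inverse of \<open>X t\<close> carries \<open>D t\<close>
    into the neutral component, hence \<open>D t\<close> is a line.\<close>
  have D_span: "\<exists>a. d = a *s X t" if t: "t \<in> T" and d: "d \<in> D t" for t d
  proof -
    obtain x' where x': "x' \<in> D (inv t)" "x' * X t = e" "X t * x' = e"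
      using D_inv[OF Tc[OF t] X[OF t]] by blast
    have "x' * d \<in> D \<one>" using D_mult[OF _ Tc[OF t] x'(1) d] Tc[OF t] by simp
    then obtain a where a: "x' * d = a *s e" using D_one by blast
    have "d = X t * (x' * d)" using x'(3) D_e(1)[OF d] by (simp flip: mult.assoc)
    also have "\<dots> = a *s X t" unfolding a using D_e(2)[OF X(1)[OF t]] by simp
    finally show ?thesis by blast
  qed
  have X_mult_nz: "X s * X t \<noteq> 0" if st: "s \<in> T" "t \<in> T" for s t
  proof
    assume "X s * X t = 0"
    moreover obtain x' where "x' * X s = e" using D_inv[OF Tc[OF st(1)] X[OF st(1)]] by blast
    ultimately have "e * X t = 0" by (metis mult.assoc mult_zero_right)
    then show False using D_e(1)[OF X(1)] X(2) st by simp
  qed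
  have T_mult: "s \<otimes> t \<in> T" if st: "s \<in> T" "t \<in> T" for s t
  proof -
    have "X s * X t \<in> D (s \<otimes> t)" by (rule D_mult[OF Tc[OF st(1)] Tc[OF st(2)] X(1)[OF st(1)] X(1)[OF st(2)]])
    then have "\<exists>d\<in>D (s \<otimes> t). d \<noteq> 0" using X_mult_nz[OF st] by blast
    moreover have "s \<otimes> t \<in> carrier G" using Tc[OF st(1)] Tc[OF st(2)] by simp
    ultimately show ?thesis unfolding T_def by blast
  qed
  have "e \<in> D \<one>" using e by (simp add: D_def)
  then have T_one: "\<one> \<in> T" using e(2) unfolding T_def by blast
  have subT: "subgroup T G"
  proof (rule subgroupI)
    fix a assume a: "a \<in> T"
    obtain x' where x': "x' \<in> D (inv a)" "x' * X a = e" using D_inv[OF Tc[OF a] X[OF a]] by blast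
    then have "x' \<noteq> 0" using e by auto
    then have "\<exists>d\<in>D (inv a). d \<noteq> 0" using x' by blast
    moreover have "inv a \<in> carrier G" using Tc[OF a] by simp
    ultimately show "inv a \<in> T" unfolding T_def by blast
  next
    show "T \<subseteq> carrier G" using Tc by blast
    show "T \<noteq> {}" using T_one by blast
    show "s \<otimes> t \<in> T" if "s \<in> T" "t \<in> T" for s t using that by (rule T_mult)
  qed
  \<comment> \<open>Nonzero elements of different degrees are independent by directness, so the
    support cannot have more elements than the spanning set \<open>S\<close>.\<close>
  have finT: "finite T"
  proof -
    have card_le: "finite H \<and> card H \<le> card S" if H: "H \<subseteq> T" "finite H" for H
    proof -
      have zero: "a h = 0" if "(\<Sum>h\<in>H. a h *s X h) = 0" "h \<in> H" for a h
      proof -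
        have "a h *s X h = 0"
          by (rule direct[of H "\<lambda>h. a h *s X h"]) (use that H D_scale D_\<Gamma> X Tc in \<open>auto simp: subset_iff\<close>)
        then show ?thesis using X that H by auto
      qed
      have injX: "inj_on X H"
      proof (rule inj_onI, rule ccontr)
        fix s t assume st: "s \<in> H" "t \<in> H" "X s = X t" "s \<noteq> t"
        let ?a = "\<lambda>h. if h = s then 1 else if h = t then - 1 else 0 :: 'f"
        have "(\<Sum>h\<in>H. ?a h *s X h) = (\<Sum>h\<in>{s, t}. ?a h *s X h)"
          using st H by (intro sum.mono_neutral_right) auto
        also have "\<dots> = 0" using st by simp
        finally show False using zero[of ?a s] st(1) by simp
      qed
      have "independent (X ` H)"
      proof (rule independent_if_scalars_zero)
        fix f x assume H': "(\<Sum>x\<in>X ` H. f x *s x) = 0" "x \<in> X ` H"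
        then have "(\<Sum>h\<in>H. f (X h) *s X h) = 0" by (simp add: sum.reindex[OF injX])
        then show "f x = 0" using zero[of "\<lambda>h. f (X h)"] H'(2) by blast
      qed (use H in simp)
      moreover have "X ` H \<subseteq> span S" using H X D_A Tc A_fin by blast
      ultimately have "card (X ` H) \<le> card S" using independent_span_bound[OF fin_S] by blast
      then show ?thesis using H card_image[OF injX] by simp
    qed
    then show ?thesis by (meson finite_if_finite_subsets_card_bdd)
  qed

  \<comment> \<open>The cocycle and its commutator\<close>
  define \<sigma> where "\<sigma> s t = (SOME a. X s * X t = a *s X (s \<otimes> t))" for s t
  have \<sigma>: "X s * X t = \<sigma> s t *s X (s \<otimes> t)" if st: "s \<in> T" "t \<in> T" for s t
  proof -
    have "X s * X t \<in> D (s \<otimes> t)" using D_mult X Tc st by blast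
    then show ?thesis unfolding \<sigma>_def by (rule someI_ex[OF D_span[OF T_mult[OF st]]])
  qed
  have \<sigma>_nz: "\<sigma> s t \<noteq> 0" if st: "s \<in> T" "t \<in> T" for s t
    using \<sigma>[OF st] X_mult_nz[OF st] by auto
  \<comment> \<open>By commutativity of \<open>G\<close> both products of \<open>X s\<close> and
    \<open>X t\<close> are multiples of the same \<open>X (s \<otimes> t)\<close>;
    \<open>\<beta>\<close> is the ratio of the two coefficients.\<close>
  define \<beta> where "\<beta> s t = \<sigma> s t / \<sigma> t s" for s t
  have \<sigma>_comm: "\<sigma> s t = \<beta> s t * \<sigma> t s" if "s \<in> T" "t \<in> T" for s t
    using \<sigma>_nz[OF that(2,1)] by (simp add: \<beta>_def)
  have X_comm: "X s * X t = \<beta> s t *s (X t * X s)" if "s \<in> T" "t \<in> T" for s t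
    using \<sigma>[OF that] \<sigma>[OF that(2,1)] \<sigma>_comm[OF that] m_comm[of s t] Tc that by simp
  have \<beta>_eq: "a = \<beta> s t" if st: "s \<in> T" "t \<in> T" and "X s * X t = a *s (X t * X s)" for s t a
    using that X_comm[OF st] X_mult_nz[OF st(2,1)] by simp
  have \<beta>_mult: "\<beta> (s \<otimes> t) v = \<beta> s v * \<beta> t v" "\<beta> v (s \<otimes> t) = \<beta> v s * \<beta> v t"
    if st: "s \<in> T" "t \<in> T" "v \<in> T" for s t v
  proof -
    have "\<sigma> s t *s (X (s \<otimes> t) * X v) = X s * (X t * X v)" using \<sigma>[OF st(1,2)] by (simp flip: mult.assoc mult_scale_left)
    also have "\<dots> = \<beta> t v *s (X s * X v * X t)" unfolding X_comm[OF st(2,3)] by (simp add: mult.assoc)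
    also have "\<dots> = (\<beta> s v * \<beta> t v) *s (X v * (X s * X t))"
      unfolding X_comm[OF st(1,3)] by (simp add: mult.assoc mult.commute)
    also have "\<dots> = \<sigma> s t *s ((\<beta> s v * \<beta> t v) *s (X v * X (s \<otimes> t)))"
      unfolding \<sigma>[OF st(1,2)] by (simp add: mult.commute)
    finally have 1: "X (s \<otimes> t) * X v = (\<beta> s v * \<beta> t v) *s (X v * X (s \<otimes> t))"
      using \<sigma>_nz[OF st(1,2)] by (metis scale_left_imp_eq)
    then show "\<beta> (s \<otimes> t) v = \<beta> s v * \<beta> t v" using \<beta>_eq[OF T_mult[OF st(1,2)] st(3)] by metis
    have inv\<beta>: "\<beta> v x = inverse (\<beta> x v)" for x by (simp add: \<beta>_def)
    show "\<beta> v (s \<otimes> t) = \<beta> v s * \<beta> v t"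
      using \<open>\<beta> (s \<otimes> t) v = \<beta> s v * \<beta> t v\<close> by (simp add: inv\<beta>)
  qed
  have bichar: "alternating_bicharacter G T \<beta>"
    unfolding alternating_bicharacter_def using \<beta>_mult \<sigma>_nz by (auto simp: \<beta>_def)

  \<comment> \<open>A maximal system of orthogonal copies of the idempotent\<close>
  define Q where "Q k v w g \<longleftrightarrow> (\<forall>i<k. g i \<in> carrier G \<and> v i \<in> \<Gamma> (inv (g i)) \<and> w i \<in> \<Gamma> (g i) \<and>
      v i * e = v i \<and> e * w i = w i) \<and> (\<forall>i<k. \<forall>j<k. w i * v j = (if i = j then e else 0))"
    for k :: nat and v w :: "nat \<Rightarrow> 'a" and g :: "nat \<Rightarrow> 'g"
  \<comment> \<open>Multiplication by \<open>w i\<close> isolates the coefficient of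
    \<open>v i\<close>, so the \<open>v i\<close> are independent.\<close>
  have Q_bound: "k \<le> card S" if Q: "Q k v w g" for k v w g
  proof -
    have zero: "a i = 0" if "(\<Sum>j<k. a j *s v j) = 0" "i < k" for a i
    proof -
      have "0 = w i * (\<Sum>j<k. a j *s v j)" using that by simp
      also have "\<dots> = (\<Sum>j<k. if j = i then a i *s e else 0)"
        unfolding sum_distrib_left using Q that by (intro sum.cong) (auto simp: Q_def)
      also have "\<dots> = a i *s e" using that by simp
      finally show ?thesis using e by simp
    qed
    have injv: "inj_on v {..<k}"
    proof (rule inj_onI)
      fix i j assume "i \<in> {..<k}" "j \<in> {..<k}" "v i = v j"
      then have "w i * v i = w i * v j" "i < k" "j < k" by auto
      then show "i = j" using Q e by (auto simp: Q_def split: if_splits)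
    qed
    have "independent (v ` {..<k})"
    proof (rule independent_if_scalars_zero)
      fix f x assume H': "(\<Sum>x\<in>v ` {..<k}. f x *s x) = 0" "x \<in> v ` {..<k}"
      then have "(\<Sum>i<k. f (v i) *s v i) = 0" by (simp add: sum.reindex[OF injv])
      then show "f x = 0" using zero[of "\<lambda>i. f (v i)"] H'(2) by blast
    qed simp
    moreover have "v ` {..<k} \<subseteq> span S"
    proof
      fix x assume "x \<in> v ` {..<k}"
      then obtain i where "i < k" "x = v i" by blast
      then have "x \<in> A" using Q \<Gamma>_A[of "inv (g i)" x] by (auto simp: Q_def)
      then show "x \<in> span S" using A_fin by blast
    qed
    ultimately have "card (v ` {..<k}) \<le> card S" using independent_span_bound[OF fin_S] by blast
    then show ?thesis using card_image[OF injv] by simp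
  qed
  have "\<exists>v w g. Q 0 v w g" by (simp add: Q_def)
  then obtain k where k: "\<exists>v w g. Q k v w g" "\<And>k'. \<exists>v w g. Q k' v w g \<Longrightarrow> k' \<le> k"
    using ex_has_greatest_nat[of "\<lambda>k. \<exists>v w g. Q k v w g" 0 "\<lambda>k. k" "Suc (card S)"] Q_bound
    by (metis le_imp_less_Suc)
  \<comment> \<open>The elements \<open>v i * w i\<close> are orthogonal idempotents of neutral
    degree, because \<open>v i\<close> and \<open>w i\<close> have opposite degrees and
    \<open>w i * v i = e\<close>.\<close>
  then obtain v w g where Q: "Q k v w g" by blast
  have g: "g i \<in> carrier G" and v: "v i \<in> \<Gamma> (inv (g i))" "v i * e = v i"
    and w: "w i \<in> \<Gamma> (g i)" "e * w i = w i" if "i < k" for i using Q that by (auto simp: Q_def)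
  have wv: "w i * v j = (if i = j then e else 0)" if "i < k" "j < k" for i j using Q that by (auto simp: Q_def)
  \<comment> \<open>If the idempotents \<open>v i * w i\<close> did not exhaust the unit, the
    complement \<open>f\<close> would be a nonzero idempotent. Primeness would connect it with
    \<open>e\<close> in both directions and yield one more pair \<open>v'\<close>,
    \<open>w'\<close>, against maximality of \<open>k\<close>.\<close>
  have unit: "(\<Sum>i<k. v i * w i) = u"
  proof (rule ccontr)
    assume ne: "(\<Sum>i<k. v i * w i) \<noteq> u"
    define f where "f = u - (\<Sum>i<k. v i * w i)"
    have vw1: "v i * w i \<in> \<Gamma> \<one>" if "i < k" for i
      using \<Gamma>_mult[of "inv (g i)" "g i" "v i" "w i"] g[OF that] v[OF that] w[OF that] by simp
    have f1: "f \<in> \<Gamma> \<one>"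
      unfolding f_def using u_homogeneous vw1 subspace_\<Gamma>[of \<one>]
      by (intro subspace_diff subspace_sum) auto
    have fnz: "f \<noteq> 0" using ne by (simp add: f_def)
    have vA: "v i \<in> A" and wA: "w i \<in> A" if "i < k" for i
      using that g v w \<Gamma>_A[of "inv (g i)"] \<Gamma>_A[of "g i"] by auto
    have fv: "f * v j = 0" if "j < k" for j
    proof -
      have "(\<Sum>i<k. v i * w i) * v j = (\<Sum>i<k. if i = j then v j else 0)"
        unfolding sum_distrib_right using that wv v by (intro sum.cong) (auto simp: mult.assoc)
      then show ?thesis using that u_left[OF vA[OF that]] by (simp add: f_def left_diff_distrib)
    qed
    have wf: "w j * f = 0" if "j < k" for j
    proof -
      have "w j * (\<Sum>i<k. v i * w i) = (\<Sum>i<k. if i = j then w j else 0)"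
        unfolding sum_distrib_left using that wv w by (intro sum.cong) (auto simp flip: mult.assoc)
      then show ?thesis using that u_right[OF wA[OF that]] by (simp add: f_def right_diff_distrib)
    qed
    have fA: "f \<in> A" using f1 \<Gamma>_A by blast
    have "f * (\<Sum>i<k. v i * w i) = 0"
      unfolding sum_distrib_left by (intro sum.neutral) (auto simp: fv simp flip: mult.assoc)
    then have ff: "f * f = f" using u_right[OF fA] by (simp add: f_def right_diff_distrib)
    obtain h r where r: "h \<in> carrier G" "r \<in> \<Gamma> h" "f * r * e \<noteq> 0"
      by (rule homogeneous_prime[OF fA eA fnz e(2)])
    define v' where "v' = f * r * e"
    have v'1: "v' \<in> \<Gamma> h"
      using \<Gamma>_mult[of \<one> h f r] \<Gamma>_mult[of h \<one> "f * r" e] f1 r e by (simp add: v'_def)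
    have v': "v' * e = v'" "f * v' = v'" "v' \<in> A" "v' \<noteq> 0"
      using e ff v'1 r \<Gamma>_A by (auto simp: v'_def mult.assoc) (metis mult.assoc)
    obtain h' r' where r': "h' \<in> carrier G" "r' \<in> \<Gamma> h'" "e * r' * v' \<noteq> 0"
      by (rule homogeneous_prime[OF eA v'(3) e(2) v'(4)])
    have "e * (r' * v') * e = e * r' * v'" using v'(1) by (simp add: mult.assoc)
    then have "e * r' * v' \<in> D (h' \<otimes> h)"
      using D_compress[of "h' \<otimes> h" "r' * v'"] \<Gamma>_mult[of h' h r' v'] r r' v'1 by simp
    \<comment> \<open>\<open>e * r' * v'\<close> is a nonzero homogeneous element of the division
      algebra; its inverse \<open>d'\<close> adjusts the way back so that
      \<open>w' * v' = e\<close>.\<close>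
    then obtain d' where d': "d' \<in> D (inv (h' \<otimes> h))" "d' * (e * r' * v') = e"
      using D_inv[of "h' \<otimes> h" "e * r' * v'"] r r' by blast
    define w' where "w' = d' * r' * f"
    have w'1: "w' \<in> \<Gamma> (inv h)"
    proof -
      have "d' * r' \<in> \<Gamma> (inv (h' \<otimes> h) \<otimes> h')" using \<Gamma>_mult D_\<Gamma>[OF d'(1)] r' r by simp
      also have "inv (h' \<otimes> h) \<otimes> h' = inv h" using r r' by (simp add: inv_mult m_assoc m_comm[of "inv h'"])
      finally show ?thesis using \<Gamma>_mult[of "inv h" \<one> "d' * r'" f] f1 r by (simp add: w'_def)
    qed
    have w': "e * w' = w'" using D_e(1)[OF d'(1)] by (simp add: w'_def flip: mult.assoc)
    have w'v': "w' * v' = e"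
      using d'(2) v'(2) D_e(2)[OF d'(1)] by (simp add: w'_def mult.assoc) (metis mult.assoc)
    have w'v: "w' * v j = 0" if "j < k" for j using fv[OF that] by (simp add: w'_def mult.assoc)
    have wv': "w j * v' = 0" if "j < k" for j
      using wf[OF that] by (simp add: v'_def flip: mult.assoc)
    have "Q (Suc k) (v(k := v')) (w(k := w')) (g(k := inv h))"
      unfolding Q_def
    proof (intro conjI allI impI)
      fix i j assume "i < Suc k" "j < Suc k"
      then show "(w(k := w')) i * (v(k := v')) j = (if i = j then e else 0)"
        using wv w'v' w'v wv' by (auto simp: less_Suc_eq)
    qed (use v'1 v' w'1 w' r g v w in \<open>auto simp: less_Suc_eq\<close>)
    then show False using k(2)[of "Suc k"] by fastforce
  qed
  have kpos: "0 < k" using unit u_nz by (intro gr0I) auto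
  have vA: "v i \<in> A" and wA: "w i \<in> A" if "i < k" for i
    using that g v w \<Gamma>_A[of "inv (g i)"] \<Gamma>_A[of "g i"] by auto

  \<comment> \<open>The matrix basis and its degrees\<close>
  define B where "B p q t = v p * X t * w q" for p q t
  \<comment> \<open>Writing the unit on both sides as the sum of the \<open>v p * w p\<close> puts
    the middle factors \<open>w p * x * v q\<close> into the corner of \<open>e\<close>.\<close>
  have expand: "x = (\<Sum>p<k. \<Sum>q<k. v p * (w p * x * v q) * w q)" if "x \<in> A" for x
  proof -
    have "x = (\<Sum>p<k. v p * w p) * x * (\<Sum>q<k. v q * w q)" using that u_left u_right unit by simp
    also have "\<dots> = (\<Sum>p<k. \<Sum>q<k. v p * w p * x * (v q * w q))"
      by (simp only: sum_distrib_right) (simp only: sum_distrib_left)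
    finally show ?thesis by (simp add: mult.assoc)
  qed
  have B_deg: "B p q t \<in> \<Gamma> (inv (g p) \<otimes> t \<otimes> g q)" if "p < k" "q < k" "t \<in> T" for p q t
  proof -
    have "v p * X t \<in> \<Gamma> (inv (g p) \<otimes> t)"
      by (intro \<Gamma>_mult) (use that g v Tc D_\<Gamma>[OF X(1)] in auto)
    then show ?thesis unfolding B_def
      by (rule \<Gamma>_mult[rotated 2, OF _ w(1)[OF that(2)]]) (use that g Tc in auto)
  qed
  have B_mult: "B p q s * B p' q' t = (if q = p' then \<sigma> s t *s B p q' (s \<otimes> t) else 0)"
    if "p < k" "q < k" "p' < k" "q' < k" "s \<in> T" "t \<in> T" for p q p' q' s t
  proof -
    have "B p q s * B p' q' t = v p * X s * (w q * v p') * X t * w q'" by (simp add: B_def mult.assoc)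
    also have "\<dots> = (if q = p' then v p * (X s * e) * X t * w q' else 0)"
      using wv that by (simp add: mult.assoc)
    also have "\<dots> = (if q = p' then v p * (X s * X t) * w q' else 0)"
      using D_e(2)[OF X(1)[OF that(5)]] by (simp add: mult.assoc)
    finally show ?thesis using \<sigma>[OF that(5,6)] by (simp add: B_def)
  qed
  have B_nz: "B p q t \<noteq> 0" if "p < k" "q < k" "t \<in> T" for p q t
  proof
    assume "B p q t = 0"
    then have "w p * B p q t * v q = 0" by simp
    moreover have "w p * B p q t * v q = (w p * v p) * X t * (w q * v q)" by (simp add: B_def mult.assoc)
    moreover have "\<dots> = X t" using wv that D_e[OF X(1)[OF that(3)]] by simp
    ultimately show False using X(2)[OF that(3)] by simp
  qed
  have in_span: "x \<in> span {B p q t | p q t. p < k \<and> q < k \<and> t \<in> T \<and> inv (g p) \<otimes> t \<otimes> g q = h}"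
    if h: "h \<in> carrier G" and x: "x \<in> \<Gamma> h" for h x
  proof (subst expand[OF \<Gamma>_A[OF h x]], intro span_sum)
    fix p q assume "p \<in> {..<k}" "q \<in> {..<k}"
    then have pq: "p < k" "q < k" by auto
    define t where "t = g p \<otimes> h \<otimes> inv (g q)"
    have t: "t \<in> carrier G" "inv (g p) \<otimes> t \<otimes> g q = h"
      using inv_mult_mult_eq_iff[of "g p" "g q" t h] g pq h by (auto simp: t_def)
    have "w p * x \<in> \<Gamma> (g p \<otimes> h)" by (intro \<Gamma>_mult) (use pq g w h x in auto)
    then have "w p * x * v q \<in> \<Gamma> t" unfolding t_def
      by (rule \<Gamma>_mult[rotated 2, OF _ v(1)[OF pq(2)]]) (use pq g h in auto)
    moreover have "e * (w p * x * v q) = w p * x * v q" using w pq by (simp flip: mult.assoc)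
    moreover have "w p * x * v q * e = w p * x * v q" using v pq by (simp add: mult.assoc)
    ultimately have D: "w p * x * v q \<in> D t" by (simp add: D_def)
    show "v p * (w p * x * v q) * w q \<in> span {B p q t | p q t. p < k \<and> q < k \<and> t \<in> T \<and> inv (g p) \<otimes> t \<otimes> g q = h}"
    proof (cases "w p * x * v q = 0")
      case False
      then have tT: "t \<in> T" using D t by (auto simp: T_def)
      then obtain a where "w p * x * v q = a *s X t" using D_span D by blast
      then have "v p * (w p * x * v q) * w q = a *s B p q t" by (simp add: B_def)
      moreover have "B p q t \<in> {B p q t | p q t. p < k \<and> q < k \<and> t \<in> T \<and> inv (g p) \<otimes> t \<otimes> g q = h}"
        using pq tT t by blast
      ultimately show ?thesis by (simp add: span_scale span_base)
    qed (simp add: span_zero)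
  qed
  have \<Gamma>_span: "\<Gamma> h = span {B p q t | p q t. p < k \<and> q < k \<and> t \<in> T \<and> inv (g p) \<otimes> t \<otimes> g q = h}"
    (is "_ = span (?B h)") if h: "h \<in> carrier G" for h
  proof
    show "\<Gamma> h \<subseteq> span (?B h)" using in_span[OF h] by blast
    show "span (?B h) \<subseteq> \<Gamma> h" using B_deg by (intro span_minimal subspace_\<Gamma>[OF h]) auto
  qed
  have A_span: "A = span {B p q t | p q t. p < k \<and> q < k \<and> t \<in> T}" (is "_ = span ?BA")
  proof
    show "span ?BA \<subseteq> A"
      using A_mult vA wA D_A[OF X(1)] Tc by (intro span_minimal subspace_A) (auto simp: B_def)
    show "A \<subseteq> span ?BA"
    proof
      fix x assume "x \<in> A"
      then obtain H f where f: "finite H" "H \<subseteq> carrier G" "\<forall>h\<in>H. f h \<in> \<Gamma> h" "x = (\<Sum>h\<in>H. f h)"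
        using decomp by blast
      show "x \<in> span ?BA" unfolding f(4)
      proof (rule span_sum)
        fix h assume "h \<in> H"
        then have "f h \<in> span {B p q t | p q t. p < k \<and> q < k \<and> t \<in> T \<and> inv (g p) \<otimes> t \<otimes> g q = h}"
          using in_span f by blast
        also have "\<dots> \<subseteq> span ?BA" by (rule span_mono) auto
        finally show "f h \<in> span ?BA" .
      qed
    qed
  qed

  \<comment> \<open>Nondegeneracy of the commutator\<close>
  have nondeg: "nondegenerate G T \<beta>"
    unfolding nondegenerate_def
  proof (intro ballI impI)
    fix t assume t: "t \<in> T" and triv: "\<forall>s\<in>T. \<beta> s t = 1"
    \<comment> \<open>If \<open>t\<close> is in the radical of \<open>\<beta>\<close>, the diagonal
      matrix with all entries \<open>X t\<close> is central, hence a multiple of \<open>u\<close>;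
      but it is nonzero of degree \<open>t\<close>, while \<open>u\<close> is neutral.\<close>
    define z where "z = (\<Sum>p<k. B p p t)"
    have B_A: "B p q t \<in> A" if "p < k" "q < k" "t \<in> T" for p q t
      using that A_mult vA wA D_A[OF X(1)] Tc by (auto simp: B_def)
    have zA: "z \<in> A" unfolding z_def using B_A t subspace_A by (intro subspace_sum) auto
    have comm: "z * x = x * z" if "x \<in> A" for x
      using that unfolding A_span
    proof (induction rule: span_induct_alt)
      case (step c x y)
      then obtain p q s where x: "x = B p q s" "p < k" "q < k" "s \<in> T" by blast
      have "z * x = (\<Sum>r<k. if r = p then \<sigma> t s *s B p q (t \<otimes> s) else 0)"
        unfolding z_def sum_distrib_right using x t B_mult by (intro sum.cong) auto
      also have "\<dots> = \<sigma> t s *s B p q (t \<otimes> s)" using x by simp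
      finally have 1: "z * x = \<sigma> t s *s B p q (t \<otimes> s)" .
      have "x * z = (\<Sum>r<k. if r = q then \<sigma> s t *s B p q (s \<otimes> t) else 0)"
        unfolding z_def sum_distrib_left using x t B_mult by (intro sum.cong) auto
      also have "\<dots> = \<sigma> s t *s B p q (s \<otimes> t)" using x by simp
      also have "\<dots> = z * x" using 1 \<sigma>_comm[OF x(4) t] triv x(4) m_comm[of s t] Tc t by simp
      finally show ?case using step by (simp add: distrib_left distrib_right)
    qed simp
    obtain a where a: "z = a *s u" using central_scalar[OF zA comm] by blast
    have "z \<in> \<Gamma> t"
      unfolding z_def
    proof (rule subspace_sum[OF subspace_\<Gamma>[OF Tc[OF t]]])
      fix p assume "p \<in> {..<k}"
      then show "B p p t \<in> \<Gamma> t" using B_deg[of p p t] t conj_eq(2)[of "g p" t] g Tc by simp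
    qed
    have znz: "z \<noteq> 0"
    proof
      assume "z = 0"
      then have "0 = z * v 0" by simp
      also have "\<dots> = (\<Sum>p<k. if p = 0 then v 0 * X t else 0)"
        unfolding z_def sum_distrib_right
      proof (rule sum.cong[OF refl])
        fix p assume "p \<in> {..<k}"
        then have "B p p t * v 0 = v p * X t * (w p * v 0)" "p < k" by (auto simp: B_def mult.assoc)
        then show "B p p t * v 0 = (if p = 0 then v 0 * X t else 0)"
          using wv[of p 0] kpos D_e(2)[OF X(1)[OF t]] by (auto simp: mult.assoc)
      qed
      also have "\<dots> = v 0 * X t" using kpos by simp
      finally have "w 0 * (v 0 * X t) = 0" by simp
      then have "e * X t = 0" using wv[of 0 0] kpos by (simp flip: mult.assoc)
      then show False using D_e(1)[OF X(1)[OF t]] X(2)[OF t] by simp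
    qed
    show "t = \<one>"
    proof (rule ccontr)
      assume ne: "t \<noteq> \<one>"
      \<comment> \<open>The equation \<open>z = a *s u\<close> is read as a vanishing sum of
        homogeneous elements of the two degrees \<open>t\<close> and \<open>\<one>\<close>.\<close>
      define f where "f h = (if h = t then z else - a *s u)" for h
      have "f t = 0"
      proof (rule direct[of "{t, \<one>}"])
        show "(\<Sum>h\<in>{t, \<one>}. f h) = 0" using ne a by (simp add: f_def)
        show "\<forall>h\<in>{t, \<one>}. f h \<in> \<Gamma> h"
          using \<open>z \<in> \<Gamma> t\<close> u_homogeneous subspace_\<Gamma>[of \<one>] ne by (auto simp: f_def subspace_scale subspace_neg)
      qed (use Tc t in auto)
      then show False using znz by (simp add: f_def)
    qed
  qed
  have "graded_matrix_basis scale G T \<beta> k g A \<Gamma> B \<sigma>"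
    by (intro graded_matrix_basis.intro graded_matrix_basis_axioms.intro)
      (fact assoc_algebra_axioms comm_group_axioms subT finT bichar nondeg kpos g B_mult \<sigma>_nz \<sigma>_comm B_nz A_span \<Gamma>_span)+
  then show ?thesis by blast
qed

end

section \<open>From equal coset multiplicities to an isomorphism\<close>

lemma ex_bij_betw_if_card_fibers_eq:
  assumes "finite P" "finite P'" and "\<And>C. card {p\<in>P. c p = C} = card {q\<in>P'. c' q = C}"
  obtains \<pi> where "bij_betw \<pi> P P'" "\<And>p. p \<in> P \<Longrightarrow> c' (\<pi> p) = c p"
proof -
  have "\<exists>h. bij_betw h {p\<in>P. c p = C} {q\<in>P'. c' q = C}" for C
    using assms by (intro finite_same_card_bij) auto
  then obtain h where h: "\<And>C. bij_betw (h C) {p\<in>P. c p = C} {q\<in>P'. c' q = C}" by metis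
  define \<pi> where "\<pi> p = h (c p) p" for p
  have \<pi>: "\<pi> p \<in> P'" "c' (\<pi> p) = c p" if "p \<in> P" for p
    using bij_betwE[OF h[of "c p"]] that by (auto simp: \<pi>_def)
  have "inj_on \<pi> P"
  proof (rule inj_onI)
    fix p q assume pq: "p \<in> P" "q \<in> P" "\<pi> p = \<pi> q"
    then have "c p = c q" using \<pi> by metis
    then show "p = q" using pq bij_betw_imp_inj_on[OF h[of "c p"]] by (auto simp: \<pi>_def inj_on_def)
  qed
  moreover have "\<pi> ` P = P'"
  proof
    show "P' \<subseteq> \<pi> ` P"
    proof
      fix q assume "q \<in> P'"
      then have "q \<in> h (c' q) ` {p\<in>P. c p = c' q}" using bij_betw_imp_surj_on[OF h[of "c' q"]] by auto
      then obtain p where "p \<in> P" "c p = c' q" "q = h (c' q) p" by blast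
      then have "q = \<pi> p" "p \<in> P" by (simp_all add: \<pi>_def)
      then show "q \<in> \<pi> ` P" by blast
    qed
  qed (use \<pi> in auto)
  ultimately show ?thesis using that[of \<pi>] \<pi> by (simp add: bij_betw_def)
qed

lemma (in group) rcos_eq_iff:
  assumes "subgroup T G" "x \<in> carrier G" "y \<in> carrier G"
  shows "T #> x = T #> y \<longleftrightarrow> x \<otimes> inv y \<in> T"
proof
  assume "T #> x = T #> y"
  then have "x \<in> T #> y" using rcos_self[OF assms(2,1)] by simp
  then obtain t where "t \<in> T" "x = t \<otimes> y" by (auto simp: r_coset_def)
  then show "x \<otimes> inv y \<in> T" using assms by (simp add: m_assoc subgroup.mem_carrier)
next
  assume t: "x \<otimes> inv y \<in> T"
  have "x = (x \<otimes> inv y) \<otimes> y" using assms by (simp add: m_assoc)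
  then have "x \<in> T #> y" using t by (auto simp: r_coset_def)
  then show "T #> x = T #> y" using repr_independence[of x T y] assms by auto
qed

context graded_matrix_basis
begin

text \<open>Since the factor \<open>d t\<close> does not depend on the matrix position, the pattern
  of products is kept and the cocycle changes by the coboundary of \<open>d\<close>.\<close>

lemma rescale:
  assumes d: "\<And>t. t \<in> T \<Longrightarrow> d t \<noteq> 0"
  shows "graded_matrix_basis scale G T \<beta> k g A \<Gamma> (\<lambda>p q t. d t *s B p q t)
    (\<lambda>s t. d s * d t * \<sigma> s t / d (s \<otimes> t))"
proof (intro graded_matrix_basis.intro graded_matrix_basis_axioms.intro)
  have B': "B p q t = inverse (d t) *s (d t *s B p q t)" if "t \<in> T" for p q t using d[OF that] by simp
  have span_eq: "span {B p q t | p q t. p < k \<and> q < k \<and> t \<in> T \<and> P p q t}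
      = span {d t *s B p q t | p q t. p < k \<and> q < k \<and> t \<in> T \<and> P p q t}" (is "span ?S = span ?S'") for P
    unfolding span_eq
  proof (intro conjI subsetI)
    fix x assume "x \<in> ?S"
    then obtain p q t where x: "x = B p q t" "p < k" "q < k" "t \<in> T" "P p q t" by blast
    then have "d t *s B p q t \<in> span ?S'" by (intro span_base) blast
    then have "inverse (d t) *s (d t *s B p q t) \<in> span ?S'" by (rule span_scale)
    then show "x \<in> span ?S'" using x d by simp
  next
    fix x assume "x \<in> ?S'"
    then obtain p q t where x: "x = d t *s B p q t" "p < k" "q < k" "t \<in> T" "P p q t" by blast
    then have "B p q t \<in> span ?S" by (intro span_base) blast
    then show "x \<in> span ?S" unfolding x by (rule span_scale)
  qed
  show "A = span {d t *s B p q t |p q t. p < k \<and> q < k \<and> t \<in> T}"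
    using span_eq[of "\<lambda>_ _ _. True"] A_span by simp
  show "\<Gamma> h = span {d t *s B p q t |p q t. p < k \<and> q < k \<and> t \<in> T \<and> inv (g p) \<otimes> t \<otimes> g q = h}"
    if "h \<in> carrier G" for h
    using span_eq[of "\<lambda>p q t. inv (g p) \<otimes> t \<otimes> g q = h"] \<Gamma>_span[OF that] by simp
  show "d s * d t * \<sigma> s t / d (s \<otimes> t) = \<beta> s t * (d t * d s * \<sigma> t s / d (t \<otimes> s))"
    if "s \<in> T" "t \<in> T" for s t
    using \<sigma>_comm[OF that] m_comm[of s t] that by simp
  show "(d s *s B p q s) * (d t *s B p' q' t)
      = (if q = p' then (d s * d t * \<sigma> s t / d (s \<otimes> t)) *s (d (s \<otimes> t) *s B p q' (s \<otimes> t)) else 0)"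
    if "p < k" "q < k" "p' < k" "q' < k" "s \<in> T" "t \<in> T" for p q p' q' s t
    using that d[of "s \<otimes> t"] by (simp add: B_mult mult.assoc)
  show "d s * d t * \<sigma> s t / d (s \<otimes> t) \<noteq> 0" if "s \<in> T" "t \<in> T" for s t
    using that d[of s] d[of t] d[of "s \<otimes> t"] \<sigma>_nz by simp
  show "d t *s B p q t \<noteq> 0" if "p < k" "q < k" "t \<in> T" for p q t
    using that d[of t] B_nz by simp
qed (fact assoc_algebra_axioms comm_group_axioms subgroup_T finite_T bichar nondeg k_pos g_closed)+

text \<open>The degree family may be permuted, shifted by a common \<open>v\<close> and altered by
  factors in \<open>T\<close>. The factor \<open>s p\<close> is absorbed by multiplying with an
  invertible homogeneous element of degree \<open>s p\<close> of the corner at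
  \<open>\<pi> p\<close> and with its inverse on the other side, which leaves
  \<open>\<sigma>\<close> as it is.\<close>

lemma reindex:
  assumes \<pi>: "bij_betw \<pi> {..<k2} {..<k}" and v: "v \<in> carrier G"
    and s: "\<And>p. p < k2 \<Longrightarrow> s p \<in> T" and g2: "\<And>p. p < k2 \<Longrightarrow> g2 p \<in> carrier G"
    and g\<pi>: "\<And>p. p < k2 \<Longrightarrow> g (\<pi> p) = s p \<otimes> (g2 p \<otimes> v)"
  shows "\<exists>B2. graded_matrix_basis scale G T \<beta> k2 g2 A \<Gamma> B2 \<sigma>"
proof -
  have \<pi>k: "\<pi> p < k" if "p < k2" for p using bij_betwE[OF \<pi>] that by auto
  have \<pi>_inj: "\<pi> p = \<pi> q \<longleftrightarrow> p = q" if "p < k2" "q < k2" for p q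
    using bij_betw_imp_inj_on[OF \<pi>] that by (auto simp: inj_on_def)
  have \<pi>_surj: "\<exists>p<k2. q = \<pi> p" if "q < k" for q
    using bij_betw_imp_surj_on[OF \<pi>] that by (metis imageE lessThan_iff)
  \<comment> \<open>This scalar makes \<open>V q\<close> inverse to \<open>U q\<close>: the product
    of \<open>B\<close> at \<open>inv (s q)\<close> with \<open>B\<close> at \<open>s q\<close> is
    \<open>\<sigma> (inv (s q)) (s q)\<close> times \<open>B\<close> at \<open>\<one>\<close>, which
    in turn is \<open>\<sigma>\<^sub>1\<close> times the idempotent.\<close>
  define nu where "nu q = inverse (\<sigma>\<^sub>1 * \<sigma> (inv (s q)) (s q))" for q
  have nu_nz: "nu q \<noteq> 0" if "q < k2" for q using that s \<sigma>_nz \<sigma>\<^sub>1_nz by (simp add: nu_def)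
  define U where "U p = B (\<pi> p) (\<pi> p) (s p)" for p
  define V where "V q = nu q *s B (\<pi> q) (\<pi> q) (inv (s q))" for q
  define B2 where "B2 p q t = U p * B (\<pi> p) (\<pi> q) t * V q" for p q t
  define \<tau> where "\<tau> p q t = s p \<otimes> t \<otimes> inv (s q)" for p q t
  define a where "a p q t = nu q * \<sigma> (s p) t * \<sigma> (s p \<otimes> t) (inv (s q))" for p q t
  have a_nz: "a p q t \<noteq> 0" if "p < k2" "q < k2" "t \<in> T" for p q t
    using that nu_nz s \<sigma>_nz by (simp add: a_def)
  have B2: "B2 p q t = a p q t *s B (\<pi> p) (\<pi> q) (\<tau> p q t)" if "p < k2" "q < k2" "t \<in> T" for p q t
    using that s \<pi>k by (simp add: B2_def U_def V_def a_def \<tau>_def B_mult mult_ac)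
  have VU: "V q * U p = (if p = q then e (\<pi> q) else 0)" if "p < k2" "q < k2" for p q
    using that s \<pi>k \<pi>_inj[of q p] \<sigma>_nz[of "inv (s q)" "s q"] 
    by (auto simp: V_def U_def B_mult e_def nu_def)
  have \<tau>T: "\<tau> p q t \<in> T" if "p < k2" "q < k2" "t \<in> T" for p q t using that s by (simp add: \<tau>_def)
  \<comment> \<open>The factors \<open>s p\<close> and \<open>s q\<close> cancel, and the common
    shift \<open>v\<close> only conjugates, which has no effect in a commutative group.\<close>
  have deg: "inv (g (\<pi> p)) \<otimes> \<tau> p q t \<otimes> g (\<pi> q) = inv (g2 p) \<otimes> t \<otimes> g2 q"
    if "p < k2" "q < k2" "t \<in> T" for p q t
  proof -
    have c: "s p \<in> carrier G" "s q \<in> carrier G" "g2 p \<in> carrier G" "g2 q \<in> carrier G" "t \<in> carrier G"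
      using that s g2 by auto
    have "inv (g (\<pi> p)) \<otimes> \<tau> p q t \<otimes> g (\<pi> q) = inv v \<otimes> (inv (g2 p) \<otimes> t \<otimes> g2 q) \<otimes> v"
      unfolding g\<pi>[OF that(1)] g\<pi>[OF that(2)] \<tau>_def using c v by (simp add: inv_mult_group m_assoc)
    also have "\<dots> = inv (g2 p) \<otimes> t \<otimes> g2 q" using c v by (intro conj_eq) auto
    finally show ?thesis .
  qed
  have span_eq: "span {B p q t | p q t. p < k \<and> q < k \<and> t \<in> T \<and> P (inv (g p) \<otimes> t \<otimes> g q)}
      = span {B2 p q t | p q t. p < k2 \<and> q < k2 \<and> t \<in> T \<and> P (inv (g2 p) \<otimes> t \<otimes> g2 q)}"
    (is "span ?S = span ?S'") for P
    unfolding span_eq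
  proof (intro conjI subsetI)
    fix x assume "x \<in> ?S"
    then obtain p' q' t' where x: "x = B p' q' t'" "p' < k" "q' < k" "t' \<in> T" "P (inv (g p') \<otimes> t' \<otimes> g q')"
      by blast
    obtain p q where pq: "p < k2" "q < k2" "p' = \<pi> p" "q' = \<pi> q" using \<pi>_surj x by metis
    define t where "t = inv (s p) \<otimes> t' \<otimes> s q"
    have t: "t \<in> T" "\<tau> p q t = t'" using pq s x by (simp_all add: t_def \<tau>_def m_assoc)
    have "B2 p q t \<in> ?S'" using x(5) deg[OF pq(1,2) t(1)] pq t by auto
    then have "inverse (a p q t) *s B2 p q t \<in> span ?S'" by (intro span_scale span_base)
    then show "x \<in> span ?S'" using a_nz[OF pq(1,2) t(1)] t pq x by (simp add: B2)
  next
    fix x assume "x \<in> ?S'"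
    then obtain p q t where x: "x = B2 p q t" "p < k2" "q < k2" "t \<in> T" "P (inv (g2 p) \<otimes> t \<otimes> g2 q)" by blast
    have "B (\<pi> p) (\<pi> q) (\<tau> p q t) \<in> ?S"
      using x deg[OF x(2-4)] \<pi>k \<tau>T
      by (intro CollectI exI[of _ "\<pi> p"] exI[of _ "\<pi> q"] exI[of _ "\<tau> p q t"]) simp
    then show "x \<in> span ?S" unfolding x(1) B2[OF x(2-4)] by (intro span_scale span_base)
  qed
  have "graded_matrix_basis scale G T \<beta> k2 g2 A \<Gamma> B2 \<sigma>"
  proof (intro graded_matrix_basis.intro graded_matrix_basis_axioms.intro)
    show "0 < k2" using \<pi>_surj[OF k_pos] by auto
    show "A = span {B2 p q t |p q t. p < k2 \<and> q < k2 \<and> t \<in> T}"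
      using span_eq[of "\<lambda>_. True"] A_span by simp
    show "\<Gamma> h = span {B2 p q t |p q t. p < k2 \<and> q < k2 \<and> t \<in> T \<and> inv (g2 p) \<otimes> t \<otimes> g2 q = h}"
      if "h \<in> carrier G" for h
      using span_eq[of "\<lambda>x. x = h"] \<Gamma>_span[OF that] by simp
    show "B2 p q t \<noteq> 0" if "p < k2" "q < k2" "t \<in> T" for p q t
      using that B2 a_nz B_nz \<pi>k \<tau>T by simp
    show "B2 p q s' * B2 p' q' t = (if q = p' then \<sigma> s' t *s B2 p q' (s' \<otimes> t) else 0)"
      if pq: "p < k2" "q < k2" "p' < k2" "q' < k2" "s' \<in> T" "t \<in> T" for p q p' q' s' t
    proof -
      have "B2 p q s' * B2 p' q' t = U p * (B (\<pi> p) (\<pi> q) s' * (V q * U p')) * B (\<pi> p') (\<pi> q') t * V q'"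
        by (simp add: B2_def mult.assoc)
      also have "\<dots> = (if q = p' then U p * (B (\<pi> p) (\<pi> q) s' * e (\<pi> q)) * B (\<pi> q) (\<pi> q') t * V q' else 0)"
        using VU[of p' q] pq by simp
      also have "B (\<pi> p) (\<pi> q) s' * e (\<pi> q) = B (\<pi> p) (\<pi> q) s'"
        using B_e[of "\<pi> q" "\<pi> p" "\<pi> q" s'] pq \<pi>k by simp
      finally have "B2 p q s' * B2 p' q' t
          = (if q = p' then U p * (B (\<pi> p) (\<pi> q) s' * B (\<pi> q) (\<pi> q') t) * V q' else 0)"
        by (simp only: mult.assoc)
      then show ?thesis using pq \<pi>k by (simp add: B_mult B2_def)
    qed
  qed (fact assoc_algebra_axioms comm_group_axioms subgroup_T finite_T bichar nondeg g2 \<sigma>_nz \<sigma>_comm)+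
  then show ?thesis by blast
qed

end

context assoc_algebra
begin

text \<open>Equal structure constants make the linear map from \<open>B p q t\<close> to
  \<open>B' p q t\<close> multiplicative. It is constructed on the whole ambient space and then
  restricted to \<open>A\<close>, where independence of the image basis makes it injective.\<close>

lemma alg_iso_if_same_table:
  assumes "graded_matrix_basis scale G T \<beta> k g A \<Gamma> B \<sigma>" "graded_matrix_basis scale G T \<beta> k g A' \<Gamma>' B' \<sigma>"
  shows "\<exists>\<phi>. alg_iso \<phi> A A' \<and> (\<forall>h\<in>carrier G. \<phi> ` \<Gamma> h = \<Gamma>' h)"
proof -
  interpret M: graded_matrix_basis scale G T \<beta> k g A \<Gamma> B \<sigma> by fact
  interpret M': graded_matrix_basis scale G T \<beta> k g A' \<Gamma>' B' \<sigma> by fact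
  interpret vp: vector_space_pair scale scale ..
  define \<phi> where "\<phi> = vp.construct (M.Bt ` M.I) (\<lambda>x. M'.Bt (inv_into M.I M.Bt x))"
  have lin: "Vector_Spaces.linear scale scale \<phi>"
    unfolding \<phi>_def by (rule vp.linear_construct[OF M.independent_Bt])
  interpret \<phi>: Vector_Spaces.linear scale scale \<phi> by (rule lin)
  have \<phi>B: "\<phi> (B p q t) = B' p q t" if "p < k" "q < k" "t \<in> T" for p q t
  proof -
    have i: "(p, q, t) \<in> M.I" using that by (simp add: M.I_def)
    have "\<phi> (M.Bt (p, q, t)) = M'.Bt (p, q, t)"
      unfolding \<phi>_def using i by (simp add: vp.construct_basis[OF M.independent_Bt] inv_into_f_f[OF M.inj_Bt])
    then show ?thesis by (simp add: M.Bt_def M'.Bt_def)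
  qed
  have \<phi>Bt: "\<phi> (M.Bt i) = M'.Bt i" if "i \<in> M.I" for i
    using that \<phi>B by (auto simp: M.I_def M.Bt_def M'.Bt_def)
  have span_im: "\<phi> ` span {B p q t | p q t. p < k \<and> q < k \<and> t \<in> T \<and> P p q t}
      = span {B' p q t | p q t. p < k \<and> q < k \<and> t \<in> T \<and> P p q t}" for P
  proof -
    have "\<phi> ` {B p q t | p q t. p < k \<and> q < k \<and> t \<in> T \<and> P p q t}
        = {B' p q t | p q t. p < k \<and> q < k \<and> t \<in> T \<and> P p q t}" (is "?L = ?R")
    proof
      show "?L \<subseteq> ?R" using \<phi>B by blast
      show "?R \<subseteq> ?L"
      proof
        fix x assume "x \<in> ?R"
        then obtain p q t where x: "x = B' p q t" "p < k" "q < k" "t \<in> T" "P p q t" by blast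
        then have "x = \<phi> (B p q t)" using \<phi>B by simp
        then show "x \<in> ?L" using x by blast
      qed
    qed
    then show ?thesis by (simp only: vp.linear_span_image[OF lin, symmetric])
  qed
  have "\<phi> ` A = A'" using span_im[of "\<lambda>_ _ _. True"] M.A_span M'.A_span by simp
  moreover have "inj_on \<phi> A"
  proof (rule inj_onI)
    fix x y assume xy: "x \<in> A" "y \<in> A" "\<phi> x = \<phi> y"
    have "\<phi> ` M.Bt ` M.I = (\<lambda>i. \<phi> (M.Bt i)) ` M.I" by (rule image_image)
    also have "\<dots> = M'.Bt ` M.I"
    proof (rule image_cong[OF refl])
      show "\<phi> (M.Bt i) = M'.Bt i" if "i \<in> M.I" for i using that by (rule \<phi>Bt)
    qed
    finally have im: "\<phi> ` M.Bt ` M.I = M'.Bt ` M'.I" .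
    have "x - y = 0"
    proof (rule vp.linear_indep_image_lemma[OF lin, of "M.Bt ` M.I"])
      show "finite (M.Bt ` M.I)" using M.finite_I by simp
      show "independent (\<phi> ` M.Bt ` M.I)" unfolding im by (rule M'.independent_Bt)
      show "inj_on \<phi> (M.Bt ` M.I)"
      proof (rule inj_onI)
        fix x y assume "x \<in> M.Bt ` M.I" "y \<in> M.Bt ` M.I" and eq: "\<phi> x = \<phi> y"
        then obtain i j where ij: "i \<in> M.I" "j \<in> M.I" "x = M.Bt i" "y = M.Bt j" by blast
        then have "M'.Bt i = M'.Bt j" using eq \<phi>Bt[OF ij(1)] \<phi>Bt[OF ij(2)] by simp
        then have "i = j" using inj_onD[OF M'.inj_Bt] ij(1,2) by blast
        then show "x = y" using ij by simp
      qed
      show "x - y \<in> span (M.Bt ` M.I)" unfolding M.A_span_Bt[symmetric]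
        using xy M.subspace_A by (simp add: subspace_diff)
      show "\<phi> (x - y) = 0" using xy by (simp add: \<phi>.diff)
    qed
    then show "x = y" by simp
  qed
  moreover have "\<phi> (x * y) = \<phi> x * \<phi> y" if x: "x \<in> A" and y: "y \<in> A" for x y
    using x unfolding M.A_span
  proof (induction rule: span_induct_alt)
    case (step c b x)
    have "\<phi> (b * y) = \<phi> b * \<phi> y" using y unfolding M.A_span
    proof (induction rule: span_induct_alt)
      case (step c b' y)
      from \<open>b \<in> _\<close> obtain p q s where b: "b = B p q s" "p < k" "q < k" "s \<in> T" by blast
      from \<open>b' \<in> _\<close> obtain p' q' t where b': "b' = B p' q' t" "p' < k" "q' < k" "t \<in> T" by blast
      have "\<phi> (b * b') = \<phi> b * \<phi> b'"
        using b b' by (simp add: M.B_mult M'.B_mult \<phi>B \<phi>.scale \<phi>.zero)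
      then show ?case using step by (simp add: distrib_left \<phi>.add \<phi>.scale)
    qed (simp add: \<phi>.zero)
    then show ?case using step by (simp add: distrib_right \<phi>.add \<phi>.scale)
  qed (simp add: \<phi>.zero)
  moreover have "\<phi> ` \<Gamma> h = \<Gamma>' h" if "h \<in> carrier G" for h
    using span_im[of "\<lambda>p q t. inv\<^bsub>G\<^esub> (g p) \<otimes>\<^bsub>G\<^esub> t \<otimes>\<^bsub>G\<^esub> g q = h"] M.\<Gamma>_span[OF that] M'.\<Gamma>_span[OF that] by simp
  ultimately have "alg_iso \<phi> A A' \<and> (\<forall>h\<in>carrier G. \<phi> ` \<Gamma> h = \<Gamma>' h)"
    by (auto simp: alg_iso_def bij_betw_def \<phi>.add \<phi>.scale)
  then show ?thesis by blast
qed

end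

text \<open>Reindexing the second basis gives it the same \<open>k\<close> and \<open>g\<close> as
  the first. What then distinguishes the two multiplication tables is the ratio
  \<open>\<rho>\<close> of the cocycles, which a rescaling removes.\<close>

theorem alg_iso_if_same_data:
  fixes scale :: "'f::alg_closed_field \<Rightarrow> 'a::ring_1 \<Rightarrow> 'a" and G :: "('g, 'm) monoid_scheme" (structure)
  assumes M: "graded_matrix_basis scale G T \<beta> k g A \<Gamma> B \<sigma>"
    and M': "graded_matrix_basis scale G T \<beta> k' g' A' \<Gamma>' B' \<sigma>'"
    and v: "v \<in> carrier G"
    and mult: "\<And>u. u \<in> carrier G \<Longrightarrow> comm_group.coset_mult G T k g u = comm_group.coset_mult G T k' g' (u \<otimes> v)"
  shows "\<exists>\<phi>. assoc_algebra.alg_iso scale \<phi> A A' \<and> (\<forall>h\<in>carrier G. \<phi> ` \<Gamma> h = \<Gamma>' h)"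
proof -
  interpret M: graded_matrix_basis scale G T \<beta> k g A \<Gamma> B \<sigma> by fact
  interpret M': graded_matrix_basis scale G T \<beta> k' g' A' \<Gamma>' B' \<sigma>' by fact
  define c where "c p = T #> (g p \<otimes> v)" for p
  define c' where "c' q = T #> g' q" for q
  \<comment> \<open>The hypothesis compares multiplicities of cosets of \<open>T\<close>; a set
    \<open>C\<close> that is no coset has empty fibres on both sides.\<close>
  have fib: "card {p\<in>{..<k}. c p = C} = card {q\<in>{..<k'}. c' q = C}" for C
  proof (cases "\<exists>w\<in>carrier G. C = T #> w")
    case True
    then obtain w where w: "w \<in> carrier G" "C = T #> w" by blast
    have "c p = C \<longleftrightarrow> w \<otimes> inv v \<otimes> inv (g p) \<in> T" if "p < k" for p
      using that w v M.rcos_eq_iff[OF M.subgroup_T w(1), of "g p \<otimes> v"] 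
      by (auto simp: c_def M.inv_mult M.m_assoc M.m_comm[of "inv v"])
    then have "{p\<in>{..<k}. c p = C} = {p. p < k \<and> w \<otimes> inv v \<otimes> inv (g p) \<in> T}" by auto
    then have 1: "card {p\<in>{..<k}. c p = C} = M.coset_mult T k g (w \<otimes> inv v)" by (simp add: M.coset_mult_def)
    have "c' p = C \<longleftrightarrow> w \<otimes> inv (g' p) \<in> T" if "p < k'" for p
      using that w M.rcos_eq_iff[OF M.subgroup_T w(1), of "g' p"] by (auto simp: c'_def)
    then have "{q\<in>{..<k'}. c' q = C} = {q. q < k' \<and> w \<otimes> inv (g' q) \<in> T}" by auto
    then have 2: "card {q\<in>{..<k'}. c' q = C} = M.coset_mult T k' g' w" by (simp add: M.coset_mult_def)
    show ?thesis unfolding 1 2 using mult[of "w \<otimes> inv v"] w v by (simp add: M.m_assoc)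
  next
    case False
    then have 0: "{p\<in>{..<k}. c p = C} = {}" "{q\<in>{..<k'}. c' q = C} = {}" using v by (auto simp: c_def c'_def)
    show ?thesis unfolding 0 by simp
  qed
  obtain \<pi> where \<pi>: "bij_betw \<pi> {..<k} {..<k'}" "\<And>p. p \<in> {..<k} \<Longrightarrow> c' (\<pi> p) = c p"
    using ex_bij_betw_if_card_fibers_eq[OF _ _ fib] by blast
  have \<pi>k: "\<pi> p < k'" if "p < k" for p using bij_betwE[OF \<pi>(1)] that by auto
  define s where "s p = g' (\<pi> p) \<otimes> inv (g p \<otimes> v)" for p
  have s: "s p \<in> T" if "p < k" for p
    using that \<pi>(2)[of p] \<pi>k v M.rcos_eq_iff[OF M.subgroup_T, of "g' (\<pi> p)" "g p \<otimes> v"]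
    by (simp add: s_def c_def c'_def)
  have gs: "g' (\<pi> p) = s p \<otimes> (g p \<otimes> v)" if "p < k" for p
    using that \<pi>k v by (simp add: s_def M.m_assoc)
  have "\<exists>B2. graded_matrix_basis scale G T \<beta> k g A' \<Gamma>' B2 \<sigma>'"
    by (rule M'.reindex[OF \<pi>(1) v, where s = s and ?g2.0 = g]) (fact s M.g_closed gs)+
  then obtain B2 where "graded_matrix_basis scale G T \<beta> k g A' \<Gamma>' B2 \<sigma>'" ..
  then interpret M2: graded_matrix_basis scale G T \<beta> k g A' \<Gamma>' B2 \<sigma>' .
  define \<rho> where "\<rho> s t = \<sigma>' s t / \<sigma> s t" for s t
  have "\<exists>d. (\<forall>t\<in>T. d t \<noteq> 0) \<and> (\<forall>s\<in>T. \<forall>t\<in>T. d s * d t * \<rho> s t = d (s \<otimes> t))"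
  proof (rule M.symmetric_cocycle_trivial[OF M.subgroup_T M.finite_T])
    show "\<rho> s t \<noteq> 0" if "s \<in> T" "t \<in> T" for s t using that by (simp add: \<rho>_def M.\<sigma>_nz M2.\<sigma>_nz)
    show "\<rho> s t = \<rho> t s" if "s \<in> T" "t \<in> T" for s t
      using M.\<sigma>_comm[OF that] M2.\<sigma>_comm[OF that] bichar_nz[OF M.comm_group_axioms M.subgroup_T M.bichar that]
      by (simp add: \<rho>_def)
    show "\<rho> s t * \<rho> (s \<otimes> t) u = \<rho> t u * \<rho> s (t \<otimes> u)" if "s \<in> T" "t \<in> T" "u \<in> T" for s t u
      using M.\<sigma>_cocycle[OF that] M2.\<sigma>_cocycle[OF that] by (simp add: \<rho>_def)
  qed
  then obtain d where d: "\<And>t. t \<in> T \<Longrightarrow> d t \<noteq> 0" "\<And>s t. s \<in> T \<Longrightarrow> t \<in> T \<Longrightarrow> d s * d t * \<rho> s t = d (s \<otimes> t)"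
    by blast
  have \<sigma>eq: "d s * d t * \<sigma>' s t / d (s \<otimes> t) = \<sigma> s t" if "s \<in> T" "t \<in> T" for s t
    using d(2)[OF that] d(1)[of "s \<otimes> t"] M.\<sigma>_nz[OF that] that by (simp add: \<rho>_def field_simps)
  interpret M3: graded_matrix_basis scale G T \<beta> k g A' \<Gamma>' "\<lambda>p q t. scale (d t) (B2 p q t)"
      "\<lambda>s t. d s * d t * \<sigma>' s t / d (s \<otimes> t)"
    by (rule M2.rescale[OF d(1)])
  have "graded_matrix_basis scale G T \<beta> k g A' \<Gamma>' (\<lambda>p q t. scale (d t) (B2 p q t)) \<sigma>"
  proof (intro graded_matrix_basis.intro graded_matrix_basis_axioms.intro)
    show "scale (d s) (B2 p q s) * scale (d t) (B2 p' q' t)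
        = (if q = p' then scale (\<sigma> s t) (scale (d (s \<otimes> t)) (B2 p q' (s \<otimes> t))) else 0)"
      if "p < k" "q < k" "p' < k" "q' < k" "s \<in> T" "t \<in> T" for p q p' q' s t
      using M3.B_mult[OF that] \<sigma>eq[OF that(5,6)] by simp
  qed (fact M.assoc_algebra_axioms M.comm_group_axioms M3.subgroup_T M3.finite_T M3.bichar M3.nondeg M3.k_pos M3.g_closed M.\<sigma>_nz M.\<sigma>_comm
      M3.B_nz M3.A_span M3.\<Gamma>_span)+
  then show ?thesis by (rule M.alg_iso_if_same_table[OF M])
qed

section \<open>Symplectic decompositions\<close>

text \<open>Raising to a multiple of \<open>ord y\<close> removes \<open>y\<close> and leaves a
  power of \<open>x\<close>, and conversely; coprimality then separates the divisibilities.\<close>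

lemma (in comm_group) ord_mult_coprime:
  assumes x: "x \<in> carrier G" and y: "y \<in> carrier G" and cop: "coprime (ord x) (ord y)"
  shows "ord (x \<otimes> y) = ord x * ord y"
proof (rule dvd_antisym)
  let ?n = "ord (x \<otimes> y)"
  have pow: "(x \<otimes> y) [^] m = x [^] m \<otimes> y [^] m" for m :: nat
    using x y by (simp add: pow_mult_distrib m_comm)
  have one: "x [^] ?n \<otimes> y [^] ?n = \<one>" using pow[of ?n] x y by (metis m_closed pow_ord_eq_1)
  have "x [^] (?n * ord y) = x [^] (?n * ord y) \<otimes> y [^] (?n * ord y)"
    using y x pow_eq_id[of y "?n * ord y"] by simp
  also have "\<dots> = (x [^] ?n \<otimes> y [^] ?n) [^] ord y"
    using x y by (simp add: pow_mult_distrib m_comm nat_pow_pow)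
  finally have "ord x dvd ?n * ord y" using one x pow_eq_id by simp
  moreover have "y [^] (?n * ord x) = x [^] (?n * ord x) \<otimes> y [^] (?n * ord x)"
    using y x pow_eq_id[of x "?n * ord x"] by simp
  moreover have "\<dots> = (x [^] ?n \<otimes> y [^] ?n) [^] ord x"
    using x y by (simp add: pow_mult_distrib m_comm nat_pow_pow)
  ultimately have "ord x dvd ?n * ord y" "ord y dvd ?n * ord x" using one y pow_eq_id by simp_all
  then have "ord x dvd ?n" "ord y dvd ?n"
    using cop by (simp_all add: coprime_dvd_mult_left_iff coprime_commute)
  then show "ord x * ord y dvd ?n" using cop by (simp add: divides_mult)
  have "(x \<otimes> y) [^] (ord x * ord y) = \<one>"
    using x y pow[of "ord x * ord y"] pow_eq_id[of x "ord x * ord y"] pow_eq_id[of y "ord x * ord y"] by simp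
  then show "?n dvd ord x * ord y" using x y pow_eq_id by simp
qed

text \<open>If a prime \<open>p\<close> divided \<open>ord y\<close> to a higher power than
  \<open>ord x\<close>, the \<open>p\<close>-part of \<open>x\<close> could be exchanged for that of
  \<open>y\<close>: the product of \<open>x [^] p ^ b\<close> and \<open>y [^] k\<close> would have
  larger order than \<open>x\<close>.\<close>

lemma (in comm_group) ord_dvd_maximal_ord:
  assumes S: "S \<subseteq> carrier G" "\<And>x y. x \<in> S \<Longrightarrow> y \<in> S \<Longrightarrow> x \<otimes> y \<in> S" "\<one> \<in> S"
    and pos: "\<And>x. x \<in> S \<Longrightarrow> 0 < ord x"
    and x: "x \<in> S" "\<And>y. y \<in> S \<Longrightarrow> ord y \<le> ord x" and y: "y \<in> S"
  shows "ord y dvd ord x"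
proof (rule ccontr)
  assume "\<not> ord y dvd ord x"
  moreover have nz: "ord x \<noteq> 0" "ord y \<noteq> 0" using pos x y by auto
  ultimately obtain p where p: "prime p" "multiplicity p (ord x) < multiplicity p (ord y)"
    using multiplicity_le_imp_dvd[of "ord y" "ord x"] by (metis linorder_not_less)
  define a where "a = multiplicity p (ord y)"
  define b where "b = multiplicity p (ord x)"
  have powS: "z [^] n \<in> S" if "z \<in> S" for z and n :: nat using that S by (induction n) auto
  have dvd: "p ^ b dvd ord x" "p ^ a dvd ord y" unfolding a_def b_def by (rule multiplicity_dvd)+
  \<comment> \<open>Chosen so that \<open>y [^] k\<close> has order exactly
    \<open>p ^ a\<close>.\<close>
  define k where "k = ord y div p ^ a"
  have k: "k dvd ord y" "k \<noteq> 0" "ord y div k = p ^ a"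
    using dvd nz by (auto simp: k_def elim!: dvdE)
  have ox: "ord (x [^] p ^ b) = ord x div p ^ b"
    using ord_pow[of x "p ^ b"] dvd p x S by (auto simp: prime_gt_0_nat)
  have oy: "ord (y [^] k) = p ^ a" using ord_pow[of y k] k y S by auto
  have "\<not> p dvd ord x div p ^ b"
    using multiplicity_decompose[of "ord x" p] prime_gt_1_nat[OF p(1)] nz by (auto simp: b_def)
  then have "coprime (ord x div p ^ b) (p ^ a)"
    using p(1) by (simp add: prime_imp_coprime_nat coprime_commute)
  then have 1: "ord (x [^] p ^ b \<otimes> y [^] k) = (ord x div p ^ b) * p ^ a"
    using ord_mult_coprime[of "x [^] p ^ b" "y [^] k"] ox oy x y S by auto
  have "ord x div p ^ b \<noteq> 0" using dvd(1) nz by (auto elim: dvdE)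
  moreover have "p ^ b < p ^ a"
    unfolding a_def b_def by (rule power_strict_increasing[OF p(2) prime_gt_1_nat[OF p(1)]])
  ultimately have "(ord x div p ^ b) * p ^ b < (ord x div p ^ b) * p ^ a" by simp
  then have "ord x < ord (x [^] p ^ b \<otimes> y [^] k)" unfolding 1 using dvd(1) by simp
  then show False using x(2)[of "x [^] p ^ b \<otimes> y [^] k"] powS x y S by (meson linorder_not_less)
qed

text \<open>The multiplicative group of the field as a record, so that \<open>ord\<close> and the
  lemma on maximal orders apply to values of \<open>\<beta>\<close>.\<close>

definition unit_group :: "'f::field itself \<Rightarrow> 'f monoid"
  where "unit_group _ = \<lparr>carrier = UNIV - {0}, mult = (*), one = 1\<rparr>"

lemma comm_group_unit_group: "comm_group (unit_group TYPE('f::field))"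
proof (rule comm_groupI)
  fix x assume x: "x \<in> carrier (unit_group TYPE('f))"
  show "\<exists>y\<in>carrier (unit_group TYPE('f)). y \<otimes>\<^bsub>unit_group TYPE('f)\<^esub> x = \<one>\<^bsub>unit_group TYPE('f)\<^esub>"
    by (rule bexI[of _ "inverse x"]) (use x in \<open>auto simp: unit_group_def\<close>)
qed (auto simp: unit_group_def)

lemma unit_group_pow: "x [^]\<^bsub>unit_group TYPE('f::field)\<^esub> (n::nat) = x ^ n"
  by (induction n) (auto simp: unit_group_def nat_pow_def mult.commute)

lemma primitive_root_of_unity_ord:
  fixes x :: "'f::field"
  assumes "x \<noteq> 0" "0 < group.ord (unit_group TYPE('f)) x"
  shows "primitive_root_of_unity (group.ord (unit_group TYPE('f)) x) x"
proof -
  interpret U: comm_group "unit_group TYPE('f)" by (rule comm_group_unit_group)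
  have "x ^ k = 1 \<longleftrightarrow> U.ord x dvd k" for k
    using U.pow_eq_id[of x k] assms by (simp add: unit_group_pow) (simp add: unit_group_def)
  then show ?thesis using assms by (auto simp: primitive_root_of_unity_def dest: dvd_imp_le)
qed

lemma primitive_root_power_inj:
  assumes "primitive_root_of_unity l \<epsilon>" "\<epsilon> ^ i = \<epsilon> ^ j" "i < l" "j < l"
  shows "i = j"
proof -
  have nz: "\<epsilon> \<noteq> 0" using assms(1) by (auto simp: primitive_root_of_unity_def power_0_left split: if_splits)
  have "\<not> i < j" if "\<epsilon> ^ i = \<epsilon> ^ j" "j < l" for i j
  proof
    assume "i < j"
    then have "\<epsilon> ^ i * \<epsilon> ^ (j - i) = \<epsilon> ^ i * 1"
      using that by (metis le_add_diff_inverse less_imp_le mult.right_neutral power_add)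
    then have "\<epsilon> ^ (j - i) = 1" using nz by simp
    then show False using assms(1) that \<open>i < j\<close> by (auto simp: primitive_root_of_unity_def)
  qed
  then show ?thesis using assms by (metis linorder_neqE_nat)
qed

text \<open>The polynomial \<open>monom 1 l - 1\<close> has at most \<open>l\<close> roots, and the
  powers of \<open>\<epsilon>\<close> already provide \<open>l\<close> of them.\<close>

lemma root_of_unity_is_power:
  fixes x :: "'f::field"
  assumes prim: "primitive_root_of_unity l \<epsilon>" and x: "x ^ l = 1"
  obtains v where "v < l" "x = \<epsilon> ^ v"
proof -
  have l: "0 < l" "\<epsilon> ^ l = 1" using prim by (auto simp: primitive_root_of_unity_def)
  define p :: "'f poly" where "p = monom 1 l - 1"
  have "coeff p l = 1" using l by (simp add: p_def)
  then have p0: "p \<noteq> 0" by auto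
  have roots: "poly p y = 0 \<longleftrightarrow> y ^ l = 1" for y by (simp add: p_def poly_monom)
  have "degree p \<le> l" unfolding p_def by (rule degree_diff_le) (auto simp: degree_monom_le)
  then have card_le: "card {y. poly p y = 0} \<le> l" using card_poly_roots_bound[OF p0] by linarith
  have sub: "(\<lambda>v. \<epsilon> ^ v) ` {..<l} \<subseteq> {y. poly p y = 0}"
  proof clarify
    fix v
    have "(\<epsilon> ^ v) ^ l = (\<epsilon> ^ l) ^ v" by (simp add: mult.commute flip: power_mult)
    then show "poly p (\<epsilon> ^ v) = 0" using l by (simp add: roots)
  qed
  have inj: "inj_on (\<lambda>v. \<epsilon> ^ v) {..<l}" using primitive_root_power_inj[OF prim] by (auto simp: inj_on_def)
  have "(\<lambda>v. \<epsilon> ^ v) ` {..<l} = {y. poly p y = 0}"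
    using card_subset_eq[OF poly_roots_finite[OF p0] sub] card_mono[OF poly_roots_finite[OF p0] sub]
      card_le card_image[OF inj] by simp
  then have "x \<in> (\<lambda>v. \<epsilon> ^ v) ` {..<l}" using x roots by blast
  then show ?thesis using that by auto
qed

text \<open>A hyperbolic pair splits off with its orthogonal complement.\<close>
locale hyperbolic_pair = comm_group G for G :: "('g, 'm) monoid_scheme" (structure) +
  fixes T :: "'g set" and \<beta> :: "'g \<Rightarrow> 'g \<Rightarrow> 'f::field" and a b :: 'g
  assumes T: "subgroup T G" and bichar: "alternating_bicharacter G T \<beta>"
    and a: "a \<in> T" and b: "b \<in> T" and ord_eq: "ord a = ord b"
    and prim: "primitive_root_of_unity (ord a) (\<beta> a b)"
begin

sublocale T: subgroup T G by (rule T)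

lemmas bc = comm_group_axioms T bichar

definition perp :: "'g set" where "perp = {t \<in> T. \<beta> a t = 1 \<and> \<beta> b t = 1}"

lemma perp_T: "perp \<subseteq> T" by (auto simp: perp_def)

lemma perp_subgroup: "subgroup perp G"
proof (rule subgroupI)
  have "\<one> \<in> perp" using bichar_one(2)[OF bc] a b by (simp add: perp_def)
  then show "perp \<noteq> {}" by blast
qed (use bichar_mult(2)[OF bc] bichar_inv(2)[OF bc] a b in \<open>auto simp: perp_def\<close>)

lemma bichar_perp: "alternating_bicharacter G perp \<beta>"
  using bichar perp_T unfolding alternating_bicharacter_def by blast

lemma ord_pos: "0 < ord a"
  using prim by (simp add: primitive_root_of_unity_def)

lemma pow_T: "x \<in> T \<Longrightarrow> x [^] (n::nat) \<in> T"
  by (induction n) auto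

lemma generate_eq: "generate G {a} = (\<lambda>n. a [^] n) ` {..<ord a}" "generate G {b} = (\<lambda>n. b [^] n) ` {..<ord a}"
proof -
  have "generate G {x} = (\<lambda>n. x [^] n) ` {..<ord x}" if "x \<in> T" "0 < ord x" for x
  proof -
    have xc: "x \<in> carrier G" using that by simp
    have "generate G {x} = {x [^] n | n. n \<in> (UNIV :: nat set)}"
      using generate_pow_nat[OF xc] that by simp
    also have "\<dots> = (\<lambda>n. x [^] n) ` {..<ord x}"
    proof (intro equalityI subsetI)
      fix z assume "z \<in> {x [^] n | n. n \<in> (UNIV :: nat set)}"
      then obtain n :: nat where "z = x [^] n" by auto
      also have "x [^] n = x [^] (ord x * (n div ord x)) \<otimes> x [^] (n mod ord x)"
        using xc by (simp add: nat_pow_mult)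
      also have "\<dots> = x [^] (n mod ord x)" using xc pow_eq_id[of x "ord x * (n div ord x)"] by simp
      finally show "z \<in> (\<lambda>n. x [^] n) ` {..<ord x}" by (rule image_eqI) (use that in simp)
    next
      fix z assume "z \<in> (\<lambda>n. x [^] n) ` {..<ord x}"
      then show "z \<in> {x [^] n | n. n \<in> (UNIV :: nat set)}" by blast
    qed
    finally show ?thesis .
  qed
  then show "generate G {a} = (\<lambda>n. a [^] n) ` {..<ord a}" "generate G {b} = (\<lambda>n. b [^] n) ` {..<ord a}"
    using a b ord_pos ord_eq by auto
qed

text \<open>Pairing with \<open>a\<close> reads off the exponent of \<open>b\<close>, and pairing
  with \<open>b\<close> that of \<open>a\<close>; these are the coordinates behind the splitting of
  \<open>T\<close>. The inverse in the second case comes from skew symmetry.\<close>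

lemma beta_ab:
  assumes "z \<in> perp"
  shows "\<beta> a (a [^] (i::nat) \<otimes> b [^] (j::nat) \<otimes> z) = \<beta> a b ^ j"
    and "\<beta> b (a [^] i \<otimes> b [^] j \<otimes> z) = inverse (\<beta> a b) ^ i"
proof -
  have zT: "z \<in> T" using assms perp_T by auto
  have "\<beta> b a = inverse (\<beta> a b)"
    using bichar_skew[OF bc a b] by (metis inverse_unique)
  then show "\<beta> a (a [^] i \<otimes> b [^] j \<otimes> z) = \<beta> a b ^ j" "\<beta> b (a [^] i \<otimes> b [^] j \<otimes> z) = inverse (\<beta> a b) ^ i"
    using assms zT a b pow_T by (simp_all add: bichar_mult[OF bc] bichar_pow[OF bc] bichar_diag[OF bc] perp_def)
qed

lemma prim_inverse: "primitive_root_of_unity (ord a) (inverse (\<beta> a b))"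
  using prim by (simp add: primitive_root_of_unity_def power_inverse)

lemma split_unique:
  assumes "z \<in> perp" "z' \<in> perp" "i < ord a" "i' < ord a" "j < ord a" "j' < ord a"
    and eq: "a [^] (i::nat) \<otimes> b [^] (j::nat) \<otimes> z = a [^] i' \<otimes> b [^] j' \<otimes> z'"
  shows "i = i' \<and> j = j' \<and> z = z'"
proof -
  have j: "j = j'"
    using primitive_root_power_inj[OF prim _ assms(5,6)] beta_ab(1)[OF assms(1), of i j]
      beta_ab(1)[OF assms(2), of i' j'] eq by simp
  have i: "i = i'"
    using primitive_root_power_inj[OF prim_inverse _ assms(3,4)] beta_ab(2)[OF assms(1), of i j]
      beta_ab(2)[OF assms(2), of i' j'] eq by simp
  have "z = z'"
    using eq perp_T assms(1,2) a b T.mem_carrier unfolding i j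
    by (metis Units_eq Units_l_cancel m_closed nat_pow_closed subsetD)
  then show ?thesis using i j by simp
qed

text \<open>\<open>\<beta> a t\<close> and \<open>\<beta> b t\<close> are roots of unity of exponent
  \<open>ord a\<close>, so they prescribe the exponents \<open>j\<close> and \<open>i\<close>;
  dividing \<open>t\<close> by the corresponding product leaves an element orthogonal to the
  pair.\<close>

lemma split_exists:
  assumes "t \<in> T"
  obtains i j z where "i < ord a" "j < ord a" "z \<in> perp" "t = a [^] (i::nat) \<otimes> b [^] (j::nat) \<otimes> z"
proof -
  have "\<beta> a t ^ ord a = 1"
    using bichar_pow(1)[OF bc a assms, of "ord a"] bichar_one(1)[OF bc assms] a by simp
  then obtain j where j: "j < ord a" "\<beta> a t = \<beta> a b ^ j" by (rule root_of_unity_is_power[OF prim])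
  have "\<beta> b t ^ ord a = 1"
    using bichar_pow(1)[OF bc b assms, of "ord b"] bichar_one(1)[OF bc assms] b by (simp add: ord_eq)
  then obtain i where i: "i < ord a" "\<beta> b t = inverse (\<beta> a b) ^ i" by (rule root_of_unity_is_power[OF prim_inverse])
  define y where "y = a [^] i \<otimes> b [^] j"
  have yT: "y \<in> T" using a b pow_T by (simp add: y_def)
  have one: "\<one> \<in> perp" using perp_subgroup by (rule subgroup.one_closed)
  have \<beta>y: "\<beta> a y = \<beta> a t" "\<beta> b y = \<beta> b t"
    using beta_ab[OF one, of i j] i j yT by (simp_all add: y_def)
  have "inv y \<otimes> t \<in> perp"
    using yT assms \<beta>y a b bichar_nz[OF bc] by (simp add: perp_def bichar_mult[OF bc] bichar_inv[OF bc])
  moreover have "t = y \<otimes> (inv y \<otimes> t)" using yT assms by simp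
  ultimately show ?thesis using that i j unfolding y_def by blast
qed

lemma hyperbolic_split:
  "bij_betw (\<lambda>((x, y), z). (x \<otimes> y) \<otimes> z) ((generate G {a} \<times> generate G {b}) \<times> perp) T"
  (is "bij_betw ?f _ _")
proof (rule bij_betwI')
  fix u v assume u: "u \<in> (generate G {a} \<times> generate G {b}) \<times> perp" and v: "v \<in> (generate G {a} \<times> generate G {b}) \<times> perp"
  obtain i j z where u': "u = ((a [^] i, b [^] j), z)" "i < ord a" "j < ord a" "z \<in> perp"
    using u unfolding generate_eq by auto
  obtain i' j' z' where v': "v = ((a [^] i', b [^] j'), z')" "i' < ord a" "j' < ord a" "z' \<in> perp"
    using v unfolding generate_eq by auto
  show "(?f u = ?f v) = (u = v)"
    using split_unique[OF u'(4) v'(4) u'(2) v'(2) u'(3) v'(3)] u'(1) v'(1) by auto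
next
  fix u assume "u \<in> (generate G {a} \<times> generate G {b}) \<times> perp"
  then show "?f u \<in> T"
    unfolding generate_eq using perp_T a b pow_T by auto
next
  fix t assume "t \<in> T"
  then obtain i j z where "i < ord a" "j < ord a" "z \<in> perp" "t = a [^] (i::nat) \<otimes> b [^] (j::nat) \<otimes> z"
    by (rule split_exists)
  then show "\<exists>u\<in>(generate G {a} \<times> generate G {b}) \<times> perp. t = ?f u"
    unfolding generate_eq by (intro bexI[of _ "((a [^] i, b [^] j), z)"]) auto
qed

lemma card_T: "card T = ord a * ord a * card perp"
proof -
  have ac: "a \<in> carrier G" "b \<in> carrier G" using a b by auto
  show ?thesis
    using bij_betw_same_card[OF hyperbolic_split] generate_pow_card[OF ac(1)] generate_pow_card[OF ac(2)] ord_eq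
    by (simp add: card_cartesian_product)
qed

text \<open>An element of \<open>perp\<close> pairs trivially with \<open>a\<close> and
  \<open>b\<close>, so being orthogonal to \<open>perp\<close> makes it orthogonal to all of
  \<open>T\<close>.\<close>

lemma nondeg_perp:
  assumes "nondegenerate G T \<beta>"
  shows "nondegenerate G perp \<beta>"
  unfolding nondegenerate_def
proof (intro ballI impI)
  fix t assume t: "t \<in> perp" "\<forall>u\<in>perp. \<beta> u t = 1"
  have tT: "t \<in> T" using t perp_T by auto
  have "\<beta> u t = 1" if u: "u \<in> T" for u
  proof -
    obtain i j z where "i < ord a" "j < ord a" "z \<in> perp" "u = a [^] (i::nat) \<otimes> b [^] (j::nat) \<otimes> z"
      using split_exists[OF u] .
    moreover have "\<beta> (a [^] i \<otimes> b [^] j \<otimes> z) t = \<beta> a t ^ i * \<beta> b t ^ j * \<beta> z t"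
      using \<open>z \<in> perp\<close> perp_T tT a b pow_T
      by (simp add: bichar_mult(1)[OF bc] bichar_pow(1)[OF bc] subset_iff)
    ultimately show ?thesis using t by (simp add: perp_def)
  qed
  then show "t = \<one>" using assms tT by (auto simp: nondegenerate_def)
qed

end

text \<open>Splits off coordinate 0; the restrictions keep functions \<open>undefined\<close>
  outside their index sets, as the extensional product demands.\<close>

lemma PiE_Suc_bij:
  "bij_betw (\<lambda>x. (x 0, \<lambda>i\<in>{..<n}. x (Suc i))) (\<Pi>\<^sub>E i\<in>{..<Suc n}. S i) (S 0 \<times> (\<Pi>\<^sub>E i\<in>{..<n}. S (Suc i)))"
proof (rule bij_betw_byWitness[where f' = "\<lambda>(y, z). \<lambda>i\<in>{..<Suc n}. case i of 0 \<Rightarrow> y | Suc j \<Rightarrow> z j"])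
  show "\<forall>x\<in>\<Pi>\<^sub>E i\<in>{..<Suc n}. S i. (case (x 0, \<lambda>i\<in>{..<n}. x (Suc i)) of
      (y, z) \<Rightarrow> \<lambda>i\<in>{..<Suc n}. case i of 0 \<Rightarrow> y | Suc j \<Rightarrow> z j) = x"
    by (auto simp: fun_eq_iff PiE_def extensional_def split: nat.splits)
  show "\<forall>p\<in>S 0 \<times> (\<Pi>\<^sub>E i\<in>{..<n}. S (Suc i)). ((case p of (y, z) \<Rightarrow> \<lambda>i\<in>{..<Suc n}. case i of 0 \<Rightarrow> y | Suc j \<Rightarrow> z j) 0,
      \<lambda>i\<in>{..<n}. (case p of (y, z) \<Rightarrow> \<lambda>i\<in>{..<Suc n}. case i of 0 \<Rightarrow> y | Suc j \<Rightarrow> z j) (Suc i)) = p"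
    by (auto simp: fun_eq_iff PiE_def extensional_def)
qed (auto simp: PiE_def Pi_def extensional_def split: nat.splits)

section \<open>Prepending a hyperbolic pair to a symplectic decomposition\<close>

context hyperbolic_pair
begin

context
  fixes ab :: "('g \<times> 'g) list"
  assumes ab: "\<And>i. i < length ab \<Longrightarrow> fst (ab ! i) \<in> T \<and> snd (ab ! i) \<in> T"
    and orth: "\<And>i x. i < length ab \<Longrightarrow> x \<in> {fst (ab ! i), snd (ab ! i)} \<Longrightarrow> \<beta> a x = 1 \<and> \<beta> b x = 1"
begin

definition dom :: "(nat \<Rightarrow> 'g \<times> 'g) set"
  where "dom = (\<Pi>\<^sub>E i\<in>{..<length ab}. generate G {fst (ab ! i)} \<times> generate G {snd (ab ! i)})"

definition dom' :: "(nat \<Rightarrow> 'g \<times> 'g) set"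
  where "dom' = (\<Pi>\<^sub>E i\<in>{..<Suc (length ab)}.
    generate G {fst (((a, b) # ab) ! i)} \<times> generate G {snd (((a, b) # ab) ! i)})"

definition prod_of :: "nat \<Rightarrow> (nat \<Rightarrow> 'g \<times> 'g) \<Rightarrow> 'g"
  where "prod_of n x = (\<Otimes>i\<in>{..<n}. fst (x i) \<otimes> snd (x i))"

lemma generate_perp: "i < length ab \<Longrightarrow> generate G {fst (ab ! i)} \<times> generate G {snd (ab ! i)} \<subseteq> perp \<times> perp"
  using ab orth generate_subgroup_incl[OF _ perp_subgroup, of "{fst (ab ! i)}"]
    generate_subgroup_incl[OF _ perp_subgroup, of "{snd (ab ! i)}"]
  by (auto simp: perp_def)

lemma prod_of_perp: "x \<in> dom \<Longrightarrow> prod_of (length ab) x \<in> perp"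
proof -
  interpret perp: subgroup perp G by (rule perp_subgroup)
  assume "x \<in> dom"
  then have x: "fst (x i) \<in> perp \<and> snd (x i) \<in> perp" if "i < length ab" for i
    using generate_perp[OF that] that by (fastforce simp: dom_def PiE_def Pi_def)
  have "n \<le> length ab \<Longrightarrow> (\<Otimes>i\<in>{..<n}. fst (x i) \<otimes> snd (x i)) \<in> perp" for n
  proof (induction n)
    case (Suc n)
    have "(\<Otimes>i\<in>insert n {..<n}. fst (x i) \<otimes> snd (x i)) = (fst (x n) \<otimes> snd (x n)) \<otimes> (\<Otimes>i\<in>{..<n}. fst (x i) \<otimes> snd (x i))"
      using x Suc by (intro finprod_insert) auto
    then show ?case using Suc x[of n] by (simp add: lessThan_Suc)
  qed simp
  then show ?thesis by (simp add: prod_of_def)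
qed

lemma prod_of_Suc:
  assumes "x \<in> dom'"
  shows "prod_of (Suc (length ab)) x
    = (case ((x 0), \<lambda>i\<in>{..<length ab}. x (Suc i)) of ((y, z), w) \<Rightarrow> (y \<otimes> z) \<otimes> prod_of (length ab) w)"
proof -
  have gen: "generate G {y} \<subseteq> carrier G" if "y \<in> T" for y using that generate_incl[of "{y}"] by simp
  have x0: "x 0 \<in> generate G {a} \<times> generate G {b}"
    using assms by (auto simp: dom'_def PiE_def Pi_def)
  have xS: "x (Suc i) \<in> generate G {fst (ab ! i)} \<times> generate G {snd (ab ! i)}" if "i < length ab" for i
    using assms that by (auto simp: dom'_def PiE_def Pi_def)
  have c0: "fst (x 0) \<otimes> snd (x 0) \<in> carrier G" using x0 gen[OF a] gen[OF b] by (intro m_closed) auto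
  have cS: "fst (x (Suc i)) \<otimes> snd (x (Suc i)) \<in> carrier G" if "i < length ab" for i
    using xS[OF that] ab[OF that] gen[of "fst (ab ! i)"] gen[of "snd (ab ! i)"] by (intro m_closed) auto
  have "prod_of (Suc (length ab)) x = (\<Otimes>i\<in>insert 0 (Suc ` {..<length ab}). fst (x i) \<otimes> snd (x i))"
    by (simp only: prod_of_def lessThan_Suc_eq_insert_0)
  also have "\<dots> = (fst (x 0) \<otimes> snd (x 0)) \<otimes> (\<Otimes>i\<in>Suc ` {..<length ab}. fst (x i) \<otimes> snd (x i))"
    using c0 cS by (intro finprod_insert) auto
  also have "(\<Otimes>i\<in>Suc ` {..<length ab}. fst (x i) \<otimes> snd (x i)) = (\<Otimes>i\<in>{..<length ab}. fst (x (Suc i)) \<otimes> snd (x (Suc i)))"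
    using cS by (intro finprod_reindex) auto
  also have "\<dots> = prod_of (length ab) (\<lambda>i\<in>{..<length ab}. x (Suc i))"
    unfolding prod_of_def using cS by (intro finprod_cong') auto
  finally show ?thesis by (simp add: case_prod_unfold)
qed

text \<open>Once coordinate 0 is separated, the product map of the longer list is the product map of
  \<open>ab\<close> in the second coordinate followed by the splitting of \<open>T\<close>. The
  outer maps are bijections, so only the inner one decides.\<close>

lemma bij_iff: "bij_betw (prod_of (Suc (length ab))) dom' T \<longleftrightarrow> bij_betw (prod_of (length ab)) dom perp"
proof -
  define P where "P = generate G {a} \<times> generate G {b}"
  define u where "u = (\<lambda>x :: nat \<Rightarrow> 'g \<times> 'g. (x 0, \<lambda>i\<in>{..<length ab}. x (Suc i)))"
  define h where "h = (\<lambda>((x, y), z). (x \<otimes> y) \<otimes> z)"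
  define q where "q = (\<lambda>(y :: 'g \<times> 'g, w). (y, prod_of (length ab) w))"
  have u: "bij_betw u dom' (P \<times> dom)"
    using PiE_Suc_bij[of "length ab" "\<lambda>i. generate G {fst (((a, b) # ab) ! i)} \<times> generate G {snd (((a, b) # ab) ! i)}"]
    by (simp add: u_def dom'_def dom_def P_def)
  have h: "bij_betw h (P \<times> perp) T" unfolding h_def P_def by (rule hyperbolic_split)
  have q_into: "q ` (P \<times> dom) \<subseteq> P \<times> perp" using prod_of_perp by (auto simp: q_def)
  have "prod_of (Suc (length ab)) x = h (q (u x))" if "x \<in> dom'" for x
    using prod_of_Suc[OF that] by (simp add: h_def q_def u_def case_prod_unfold)
  then have "bij_betw (prod_of (Suc (length ab))) dom' T \<longleftrightarrow> bij_betw (h \<circ> q \<circ> u) dom' T"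
    by (intro bij_betw_cong) auto
  also have "\<dots> \<longleftrightarrow> bij_betw (h \<circ> q) (P \<times> dom) T"
    using bij_betw_comp_iff[OF u, of "h \<circ> q" T] by simp
  also have "\<dots> \<longleftrightarrow> bij_betw q (P \<times> dom) (P \<times> perp)"
    using bij_betw_comp_iff2[OF h q_into] by simp
  also have "\<dots> \<longleftrightarrow> bij_betw (prod_of (length ab)) dom perp"
  proof
    assume bij: "bij_betw q (P \<times> dom) (P \<times> perp)"
    \<comment> \<open>Fixing any first coordinate \<open>y\<close> restricts \<open>q\<close> to a
      copy of the product map of \<open>ab\<close>.\<close>
    obtain y where y: "y \<in> P" unfolding P_def by (metis SigmaI generate.one)
    show "bij_betw (prod_of (length ab)) dom perp"
      unfolding bij_betw_def
    proof
      show "inj_on (prod_of (length ab)) dom"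
      proof (rule inj_onI)
        fix w w' assume "w \<in> dom" "w' \<in> dom" "prod_of (length ab) w = prod_of (length ab) w'"
        then have "q (y, w) = q (y, w')" "(y, w) \<in> P \<times> dom" "(y, w') \<in> P \<times> dom" using y by (auto simp: q_def)
        then show "w = w'" using bij_betw_imp_inj_on[OF bij] by (metis inj_onD prod.inject)
      qed
      show "prod_of (length ab) ` dom = perp"
      proof
        show "perp \<subseteq> prod_of (length ab) ` dom"
        proof
          fix t assume "t \<in> perp"
          then have "(y, t) \<in> q ` (P \<times> dom)" using y bij_betw_imp_surj_on[OF bij] by auto
          then show "t \<in> prod_of (length ab) ` dom" by (auto simp: q_def)
        qed
      qed (use prod_of_perp in auto)
    qed
  next
    assume bij: "bij_betw (prod_of (length ab)) dom perp"
    have "q = map_prod (\<lambda>y. y) (prod_of (length ab))" by (auto simp: q_def fun_eq_iff)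
    moreover have "bij_betw (\<lambda>y. y) P P" by (simp add: bij_betw_def)
    ultimately show "bij_betw q (P \<times> dom) (P \<times> perp)" using bij by (simp add: bij_betw_map_prod)
  qed
  finally show ?thesis .
qed

text \<open>Needed in both directions: from right to left it assembles a decomposition by induction,
  from left to right it peels off the first pair for the recursion of the standard
  realization.\<close>

lemma symplectic_Cons_iff:
  "symplectic_decomposition G T \<beta> ((a, b) # ab) \<longleftrightarrow> symplectic_decomposition G perp \<beta> ab"
proof -
  have sym: "\<beta> x y = 1 \<longleftrightarrow> \<beta> y x = 1" if "x \<in> T" "y \<in> T" for x y
    using bichar_skew[OF bc that] by auto
  have mem: "fst (ab ! i) \<in> perp \<and> snd (ab ! i) \<in> perp" if "i < length ab" for i
    using ab[OF that] orth[OF that] by (auto simp: perp_def)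
  have 1: "(\<forall>(a', b')\<in>set ((a, b) # ab). a' \<in> T \<and> b' \<in> T \<and> ord a' = ord b' \<and> primitive_root_of_unity (ord a') (\<beta> a' b'))
      \<longleftrightarrow> (\<forall>(a', b')\<in>set ab. a' \<in> perp \<and> b' \<in> perp \<and> ord a' = ord b' \<and> primitive_root_of_unity (ord a') (\<beta> a' b'))"
  proof -
    have "a' \<in> perp \<and> b' \<in> perp" if "(a', b') \<in> set ab" for a' b'
      using that mem by (metis fst_conv in_set_conv_nth snd_conv)
    then show ?thesis using a b ord_eq prim perp_T by fastforce
  qed
  let ?o = "\<lambda>c d. \<forall>x\<in>{fst c, snd c}. \<forall>y\<in>{fst d, snd d}. \<beta> x y = 1"
  have 2: "(\<forall>i<length ((a, b) # ab). \<forall>j<length ((a, b) # ab). i \<noteq> j \<longrightarrow> ?o (((a, b) # ab) ! i) (((a, b) # ab) ! j))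
      \<longleftrightarrow> (\<forall>i<length ab. \<forall>j<length ab. i \<noteq> j \<longrightarrow> ?o (ab ! i) (ab ! j))" (is "?L \<longleftrightarrow> ?R")
  proof
    assume L: ?L
    show ?R
    proof (intro allI impI)
      fix i j assume "i < length ab" "j < length ab" "i \<noteq> j"
      then show "?o (ab ! i) (ab ! j)" using L[rule_format, of "Suc i" "Suc j"] by simp
    qed
  next
    assume R: ?R
    show ?L
    proof (intro allI impI)
      fix i j assume ij: "i < length ((a, b) # ab)" "j < length ((a, b) # ab)" "i \<noteq> j"
      show "?o (((a, b) # ab) ! i) (((a, b) # ab) ! j)"
      proof (cases i)
        case 0
        then obtain j' where "j = Suc j'" "j' < length ab" using ij by (cases j) auto
        then show ?thesis using 0 orth by auto
      next
        case (Suc i')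
        then have i': "i' < length ab" using ij by simp
        show ?thesis
        proof (cases j)
          case 0
          then show ?thesis using Suc orth[OF i'] ab[OF i'] a b sym by auto
        next
          case (Suc j')
          then show ?thesis using \<open>i = Suc i'\<close> R ij by auto
        qed
      qed
    qed
  qed
  show ?thesis
    unfolding symplectic_decomposition_def 1 2 using bij_iff
    unfolding prod_of_def dom_def dom'_def by simp
qed

end
end

context
  fixes G :: "('g, 'm) monoid_scheme" (structure) and \<beta> :: "'g \<Rightarrow> 'g \<Rightarrow> 'f::field"
  assumes G: "comm_group G"
begin

interpretation comm_group G by (rule G)

lemma symplectic_ConsD:
  assumes T: "subgroup T G" and bichar: "alternating_bicharacter G T \<beta>"
    and sd: "symplectic_decomposition G T \<beta> ((a, b) # ab)"
  shows "hyperbolic_pair G T \<beta> a b"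
    and "symplectic_decomposition G (hyperbolic_pair.perp T \<beta> a b) \<beta> ab"
proof -
  have "(a, b) \<in> set ((a, b) # ab)" by simp
  then show hp: "hyperbolic_pair G T \<beta> a b"
    using sd T bichar G unfolding symplectic_decomposition_def
    by (auto simp: hyperbolic_pair_def hyperbolic_pair_axioms_def)
  interpret hyperbolic_pair G T \<beta> a b by (rule hp)
  have mem: "fst (ab ! i) \<in> T \<and> snd (ab ! i) \<in> T" if "i < length ab" for i
  proof -
    have "ab ! i \<in> set ((a, b) # ab)" using that by simp
    then show ?thesis using sd unfolding symplectic_decomposition_def by (auto simp: case_prod_unfold)
  qed
  have orth: "\<beta> a x = 1 \<and> \<beta> b x = 1" if "i < length ab" "x \<in> {fst (ab ! i), snd (ab ! i)}" for i x
  proof -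
    have "\<forall>i<length ((a, b) # ab). \<forall>j<length ((a, b) # ab). i \<noteq> j \<longrightarrow>
        (\<forall>x\<in>{fst (((a, b) # ab) ! i), snd (((a, b) # ab) ! i)}.
         \<forall>y\<in>{fst (((a, b) # ab) ! j), snd (((a, b) # ab) ! j)}. \<beta> x y = 1)"
      using sd unfolding symplectic_decomposition_def by (elim conjE)
    from this[rule_format, of 0 "Suc i" a x] this[rule_format, of 0 "Suc i" b x]
    show ?thesis using that by auto
  qed
  show "symplectic_decomposition G perp \<beta> ab"
    by (rule iffD1[OF symplectic_Cons_iff sd]) (fact mem orth)+
qed

text \<open>Take \<open>a\<close> of maximal order. The values \<open>\<beta> a t\<close> form a
  finite group of roots of unity whose exponent is the order of one value
  \<open>\<beta> a b\<close>; nondegeneracy makes that exponent equal to \<open>ord a\<close>, and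
  maximality of \<open>ord a\<close> then gives \<open>ord b = ord a\<close>. The bound
  \<open>1 < ord a\<close> excludes the pair of neutral elements, which would split off
  nothing.\<close>

lemma ex_hyperbolic_pair:
  assumes T: "subgroup T G" "finite T" and bichar: "alternating_bicharacter G T \<beta>"
    and nondeg: "nondegenerate G T \<beta>" and nontriv: "T \<noteq> {\<one>}"
  obtains a b where "hyperbolic_pair G T \<beta> a b" "1 < ord a"
proof -
  interpret T: subgroup T G by (rule T(1))
  let ?U = "unit_group TYPE('f)"
  interpret U: comm_group ?U by (rule comm_group_unit_group)
  note bc = G T(1) bichar
  have pos: "0 < ord x" if "x \<in> T" for x using ord_pos_if_finite_subgroup[OF T that] .
  obtain a where a: "a \<in> T" "\<And>x. x \<in> T \<Longrightarrow> ord x \<le> ord a"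
    using T(2) T.one_closed ex_has_greatest_nat[of "\<lambda>x. x \<in> T" \<one> ord "Suc (Max (ord ` T))"]
    by (metis Max_ge finite_imageI image_eqI le_imp_less_Suc)
  have powT: "x [^] (n::nat) \<in> T" if "x \<in> T" for x n using that by (induction n) auto
  obtain t where "t \<in> T" "t \<noteq> \<one>" using nontriv T.one_closed by blast
  then have "ord t \<noteq> 1" using ord_eq_1[of t] by auto
  then have a1: "1 < ord a" using a(2)[OF \<open>t \<in> T\<close>] pos[OF \<open>t \<in> T\<close>] by linarith
  define V where "V = \<beta> a ` T"
  have V: "V \<subseteq> carrier ?U" using bichar_nz[OF bc] a by (auto simp: V_def unit_group_def)
  have V_mult: "x \<otimes>\<^bsub>?U\<^esub> y \<in> V" if xy: "x \<in> V" "y \<in> V" for x y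
  proof -
    obtain s t where "s \<in> T" "t \<in> T" "x = \<beta> a s" "y = \<beta> a t" using xy by (auto simp: V_def)
    then have "x \<otimes>\<^bsub>?U\<^esub> y = \<beta> a (s \<otimes> t)" "s \<otimes> t \<in> T"
      using bichar_mult(2)[OF bc _ _ a(1)] by (simp_all add: unit_group_def)
    then show ?thesis unfolding V_def by (rule image_eqI)
  qed
  have "\<one>\<^bsub>?U\<^esub> = \<beta> a \<one>" using bichar_one(2)[OF bc a(1)] by (simp add: unit_group_def)
  then have V_one: "\<one>\<^bsub>?U\<^esub> \<in> V" unfolding V_def using T.one_closed by (rule image_eqI)
  have V_pow: "U.ord (\<beta> a t) dvd n \<longleftrightarrow> \<beta> a t ^ n = 1" if "t \<in> T" for t n
  proof -
    have "\<beta> a t \<in> carrier ?U" using V that unfolding V_def by blast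
    then have "\<beta> a t [^]\<^bsub>?U\<^esub> n = \<one>\<^bsub>?U\<^esub> \<longleftrightarrow> U.ord (\<beta> a t) dvd n" by (rule U.pow_eq_id)
    moreover have "\<one>\<^bsub>?U\<^esub> = 1" by (simp add: unit_group_def)
    ultimately show ?thesis by (simp add: unit_group_pow)
  qed
  have V_pos: "0 < U.ord x" if xV: "x \<in> V" for x
  proof -
    obtain t where t: "t \<in> T" "x = \<beta> a t" using xV by (auto simp: V_def)
    have "\<beta> a t ^ ord t = 1"
      using bichar_pow(2)[OF bc t(1) a(1), of "ord t"] bichar_one(2)[OF bc a(1)] t by simp
    then have "U.ord x dvd ord t" using V_pow t by simp
    then show ?thesis using pos[OF t(1)] by (metis dvd_pos_nat)
  qed
  have finV: "finite V" using T(2) by (simp add: V_def)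
  obtain x where x: "x \<in> V" "\<And>y. y \<in> V \<Longrightarrow> U.ord y \<le> U.ord x"
    using V_one finV ex_has_greatest_nat[of "\<lambda>x. x \<in> V" "\<one>\<^bsub>?U\<^esub>" U.ord "Suc (Max (U.ord ` V))"]
    by (metis Max_ge finite_imageI image_eqI le_imp_less_Suc)
  obtain b where b: "b \<in> T" "x = \<beta> a b" using x(1) by (auto simp: V_def)
  have dvd: "U.ord y dvd U.ord x" if "y \<in> V" for y
    by (rule U.ord_dvd_maximal_ord[OF V V_mult V_one V_pos x that])
  \<comment> \<open>The order of \<open>x\<close> is an exponent for all values
    \<open>\<beta> a t\<close>, so this power of \<open>a\<close> lies in the radical, which is
    trivial.\<close>
  have "a [^] U.ord x = \<one>"
  proof -
    have "\<beta> t (a [^] U.ord x) = 1" if t: "t \<in> T" for t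
    proof -
      have "\<beta> a t ^ U.ord x = 1" using V_pow[OF t] dvd[of "\<beta> a t"] t by (auto simp: V_def)
      then have "\<beta> (a [^] U.ord x) t = 1" using bichar_pow(1)[OF bc a(1) t] by simp
      then show ?thesis using bichar_skew[OF bc powT[OF a(1), of "U.ord x"] t] by simp
    qed
    then show ?thesis using nondeg powT[OF a(1)] by (auto simp: nondegenerate_def)
  qed
  then have 1: "ord a dvd U.ord x" using pow_eq_id a(1) by auto
  have "\<beta> a b ^ ord a = 1"
    using bichar_pow(1)[OF bc a(1) b(1), of "ord a"] bichar_one(1)[OF bc b(1)] a by simp
  then have "U.ord x dvd ord a" using V_pow[OF b(1)] b by simp
  then have ox: "U.ord x = ord a" using 1 by (rule dvd_antisym)
  have "x \<noteq> 0" using V x(1) by (auto simp: unit_group_def)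
  then have prim: "primitive_root_of_unity (ord a) (\<beta> a b)"
    using primitive_root_of_unity_ord[of x] V_pos[OF x(1)] ox b by simp
  have "\<beta> a b ^ ord b = 1"
    using bichar_pow(2)[OF bc b(1) a(1), of "ord b"] bichar_one(2)[OF bc a(1)] b by simp
  then have "ord a dvd ord b" using V_pow[OF b(1)] ox b by simp
  then have "ord a \<le> ord b" using pos[OF b(1)] dvd_imp_le by blast
  then have "ord a = ord b" using a(2)[OF b(1)] by simp
  then have "hyperbolic_pair G T \<beta> a b"
    using G T bichar a b prim by (simp add: hyperbolic_pair_def hyperbolic_pair_axioms_def)
  then show ?thesis using that a1 by blast
qed

theorem ex_symplectic_decomposition:
  assumes "subgroup T G" "finite T" "alternating_bicharacter G T \<beta>" "nondegenerate G T \<beta>"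
  shows "\<exists>ab. symplectic_decomposition G T \<beta> ab"
  using assms
proof (induction "card T" arbitrary: T rule: less_induct)
  case less
  show ?case
  proof (cases "T = {\<one>}")
    case True
    then have "symplectic_decomposition G T \<beta> []" by (simp add: symplectic_decomposition_def bij_betw_def)
    then show ?thesis by blast
  next
    case False
    obtain a b where hp: "hyperbolic_pair G T \<beta> a b" and a1: "1 < ord a"
      using ex_hyperbolic_pair[OF less.prems False] by blast
    interpret hyperbolic_pair G T \<beta> a b by (rule hp)
    have "card perp < card T"
      using card_T less.prems(2) perp_T a1 perp_subgroup
    proof -
      \<comment> \<open>The induction advances because \<open>a\<close> itself is not orthogonal to
        \<open>b\<close>.\<close>
      have "\<beta> b a \<noteq> 1"
        using prim a1 bichar_skew[OF bc a b] by (auto simp: primitive_root_of_unity_def dest: spec[of _ 1])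
      then have "a \<notin> perp" by (simp add: perp_def)
      then show ?thesis using perp_T a less.prems(2) by (metis psubsetI psubset_card_mono)
    qed
    then obtain ab where ab: "symplectic_decomposition G perp \<beta> ab"
      using less.hyps[OF _ perp_subgroup _ bichar_perp nondeg_perp[OF less.prems(4)]] less.prems(2) perp_T
      by (metis finite_subset)
    have mem: "fst (ab ! i) \<in> perp \<and> snd (ab ! i) \<in> perp" if "i < length ab" for i
    proof -
      have "ab ! i \<in> set ab" using that by simp
      then show ?thesis using ab unfolding symplectic_decomposition_def by (auto simp: case_prod_unfold)
    qed
    then have "symplectic_decomposition G T \<beta> ((a, b) # ab)"
      using ab by (subst symplectic_Cons_iff) (auto simp: perp_def)
    then show ?thesis by blast
  qed
qed

end

section \<open>Matrix algebras as corners\<close>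

lemma app_sum: "app (\<Sum>x\<in>S. f x) v i = (\<Sum>x\<in>S. app (f x) v i)"
  by (induction S rule: infinite_finite_induct) (simp_all add: op_rep_eq)

lemma emb_finsum:
  assumes "finite S" "f \<in> S \<rightarrow> carrier_mat n n"
  shows "emb n (finsum (module_mat TYPE('f::field) n n) f S) = (\<Sum>x\<in>S. emb n (f x))"
  using assms
proof (induction S)
  case empty
  interpret abelian_group "module_mat TYPE('f) n n" by (rule abelian_group_mat)
  show ?case by (simp add: module_mat_simps emb_zero)
next
  case (insert x S)
  interpret abelian_group "module_mat TYPE('f) n n" by (rule abelian_group_mat)
  have f: "f x \<in> carrier_mat n n" "f \<in> S \<rightarrow> carrier_mat n n" using insert by auto
  then have "finsum (module_mat TYPE('f) n n) f S \<in> carrier_mat n n"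
    using finsum_closed[of f S] by (simp add: module_mat_simps)
  then show ?case
    using insert f finsum_insert[OF insert.hyps(1,2), of f] by (simp add: module_mat_simps emb_add)
qed

lemma mat_span_carrier:
  assumes "S \<subseteq> carrier_mat n n"
  shows "mat_span n S \<subseteq> (carrier_mat n n :: 'f::field mat set)"
proof -
  interpret V: vectorspace class_ring "module_mat TYPE('f) n n" by (rule matrix_vs)
  show ?thesis using V.span_is_subset2[of S] assms by (simp add: module_mat_simps)
qed

lemma emb_lincomb:
  fixes S :: "'f::field mat set"
  assumes "finite S" "S \<subseteq> carrier_mat n n"
  shows "emb n (LinearCombinations.module.lincomb (module_mat TYPE('f) n n) a S) = (\<Sum>v\<in>S. scale_op (a v) (emb n v))"
proof -
  interpret V: vectorspace class_ring "module_mat TYPE('f) n n" by (rule matrix_vs)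
  have "emb n (V.lincomb a S) = (\<Sum>v\<in>S. emb n (a v \<cdot>\<^sub>m v))"
    unfolding V.lincomb_def module_mat_simps by (rule emb_finsum) (use assms in auto)
  also have "\<dots> = (\<Sum>v\<in>S. scale_op (a v) (emb n v))"
    using assms by (intro sum.cong) (auto simp: emb_smult)
  finally show ?thesis .
qed

text \<open>The module record and the operator type each have their own notion of span; this lets
  statements about homogeneous components pass between them.\<close>

lemma emb_mat_span:
  fixes S :: "'f::field mat set"
  assumes S: "S \<subseteq> carrier_mat n n"
  shows "emb n ` mat_span n S = op.span (emb n ` S)"
proof -
  interpret V: vectorspace class_ring "module_mat TYPE('f) n n" by (rule matrix_vs)
  have span: "mat_span n S = {V.lincomb a A | a A. finite A \<and> A \<subseteq> S}"
    unfolding V.span_def by (simp add: class_ring_simps)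
  show ?thesis
  proof
    show "emb n ` mat_span n S \<subseteq> op.span (emb n ` S)"
    proof clarify
      fix x assume "x \<in> mat_span n S"
      then obtain a A where A: "x = V.lincomb a A" "finite A" "A \<subseteq> S" unfolding span by blast
      have "emb n x = (\<Sum>v\<in>A. scale_op (a v) (emb n v))"
        unfolding A(1) using A(2,3) S by (intro emb_lincomb) auto
      then show "emb n x \<in> op.span (emb n ` S)"
        using A(3) by (simp only:) (intro op.span_sum op.span_scale op.span_base imageI, blast)
    qed
    show "op.span (emb n ` S) \<subseteq> emb n ` mat_span n S"
    proof
      fix x assume "x \<in> op.span (emb n ` S)"
      then obtain t r where t: "finite t" "t \<subseteq> emb n ` S" "x = (\<Sum>y\<in>t. scale_op (r y) y)"
        unfolding op.span_explicit by blast
      define A where "A = {v \<in> S. emb n v \<in> t}"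
      have im: "t = emb n ` A" using t(2) by (auto simp: A_def)
      have inj: "inj_on (emb n) A" by (rule inj_on_subset[OF emb_inj]) (use S in \<open>auto simp: A_def\<close>)
      have fin: "finite A" using t(1) im inj finite_imageD by blast
      have "x = (\<Sum>v\<in>A. scale_op (r (emb n v)) (emb n v))" unfolding t(3) im by (simp add: sum.reindex[OF inj])
      also have "\<dots> = emb n (V.lincomb (\<lambda>v. r (emb n v)) A)"
        using S fin by (subst emb_lincomb) (auto simp: A_def)
      finally show "x \<in> emb n ` mat_span n S"
        unfolding span using fin by (intro image_eqI[where x = "V.lincomb (\<lambda>v. r (emb n v)) A"]) (auto simp: A_def)
    qed
  qed
qed

lemma mem_mat_span_iff:
  assumes "S \<subseteq> carrier_mat n n" "A \<in> carrier_mat n n"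
  shows "A \<in> mat_span n S \<longleftrightarrow> emb n A \<in> op.span (emb n ` S)"
  using emb_mat_span[OF assms(1)] inj_on_image_mem_iff[OF emb_inj assms(2) mat_span_carrier[OF assms(1)]] by auto

lemma mat_span_subset:
  assumes "S \<subseteq> mat_span n S'" "S' \<subseteq> carrier_mat n n"
  shows "mat_span n S \<subseteq> mat_span n (S' :: 'f::field mat set)"
proof
  have S: "S \<subseteq> carrier_mat n n" using assms mat_span_carrier by blast
  fix x :: "'f mat" assume x: "x \<in> mat_span n S"
  have "emb n ` S \<subseteq> op.span (emb n ` S')" using assms(1) emb_mat_span[OF assms(2)] by blast
  then have "op.span (emb n ` S) \<subseteq> op.span (emb n ` S')" by (intro op.span_minimal) auto
  moreover have "x \<in> carrier_mat n n" using x mat_span_carrier[OF S] by blast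
  ultimately show "x \<in> mat_span n S'" using x mem_mat_span_iff S assms(2) by blast
qed

lemma mat_span_base:
  assumes "S \<subseteq> carrier_mat n n" "x \<in> S"
  shows "x \<in> mat_span n S"
proof -
  have xc: "x \<in> carrier_mat n n" using assms by blast
  show ?thesis unfolding mem_mat_span_iff[OF assms(1) xc] using assms(2) by (intro op.span_base imageI)
qed

lemma mat_span_empty: "mat_span n {} = {0\<^sub>m n n :: 'f::field mat}"
proof -
  have "emb n ` mat_span n {} = emb n ` {0\<^sub>m n n :: 'f mat}"
    by (subst emb_mat_span) (auto simp: emb_zero)
  then show ?thesis
    by (subst (asm) inj_on_image_eq_iff[OF emb_inj]) (use mat_span_carrier[of "{}"] in auto)
qed

lemma mem_mat_span_singleton:
  assumes "y \<in> carrier_mat n n"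
  shows "x \<in> mat_span n {y} \<longleftrightarrow> (\<exists>c. x = c \<cdot>\<^sub>m y)"
proof
  assume x: "x \<in> mat_span n {y}"
  then have xc: "x \<in> carrier_mat n n" using mat_span_carrier[of "{y}" n] assms by auto
  then obtain c where "emb n x = scale_op c (emb n y)"
    using x assms by (auto simp: mem_mat_span_iff op.span_breakdown_eq)
  then have "emb n x = emb n (c \<cdot>\<^sub>m y)" using assms by (simp add: emb_smult)
  then show "\<exists>c. x = c \<cdot>\<^sub>m y" using emb_inj xc assms by (metis inj_onD smult_carrier_mat)
next
  assume "\<exists>c. x = c \<cdot>\<^sub>m y"
  then obtain c where x: "x = c \<cdot>\<^sub>m y" by blast
  have "scale_op c (emb n y) \<in> op.span (emb n ` {y})" by (intro op.span_scale op.span_base) simp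
  then show "x \<in> mat_span n {y}" unfolding x using assms by (simp add: mem_mat_span_iff emb_smult)
qed

lemma corner_eq_span: "corner n = op.span {emb n (unit_mat n p q :: 'f::field mat) | p q. p < n \<and> q < n}"
  (is "_ = op.span ?E")
proof
  show "corner n \<subseteq> op.span ?E"
  proof
    fix x :: "'f op" assume "x \<in> corner n"
    then obtain A where A: "A \<in> carrier_mat n n" "x = emb n A" by (auto simp: corner_def)
    have "x = (\<Sum>p<n. \<Sum>q<n. scale_op (A $$ (p, q)) (emb n (unit_mat n p q)))"
      unfolding A(2)
    proof (rule op_eqI)
      fix v i
      have "app (\<Sum>p<n. \<Sum>q<n. scale_op (A $$ (p, q)) (emb n (unit_mat n p q))) v i
          = (\<Sum>p<n. \<Sum>q<n. A $$ (p, q) * (if i < n then \<Sum>j<n. unit_mat n p q $$ (i, j) * v j else 0))"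
        by (simp add: app_sum scale_op.rep_eq emb.rep_eq)
      also have "\<dots> = (\<Sum>p<n. \<Sum>q<n. if p = i then A $$ (i, q) * v q else 0)"
      proof (intro sum.cong refl)
        fix p q assume pq: "p \<in> {..<n}" "q \<in> {..<n}"
        have "(\<Sum>j<n. unit_mat n p q $$ (i, j) * v j) = (\<Sum>j<n. if j = q then (if p = i then v q else 0) else 0)"
          if "i < n" using that pq by (intro sum.cong) (auto simp: unit_mat_def)
        then show "A $$ (p, q) * (if i < n then \<Sum>j<n. unit_mat n p q $$ (i, j) * v j else 0)
            = (if p = i then A $$ (i, q) * v q else 0)" using pq by auto
      qed
      also have "\<dots> = (\<Sum>p<n. if p = i then \<Sum>q<n. A $$ (i, q) * v q else 0)" by (intro sum.cong) auto
      also have "\<dots> = app (emb n A) v i" by (simp add: emb.rep_eq)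
      finally show "app (emb n A) v i = app (\<Sum>p<n. \<Sum>q<n. scale_op (A $$ (p, q)) (emb n (unit_mat n p q))) v i" ..
    qed
    also have "\<dots> \<in> op.span ?E"
      by (intro op.span_sum op.span_scale op.span_base) auto
    finally show "x \<in> op.span ?E" .
  qed
  have "op.subspace (corner n :: 'f op set)"
    unfolding op.subspace_def corner_def
  proof (intro conjI ballI allI)
    show "(0 :: 'f op) \<in> emb n ` (carrier_mat n n :: 'f mat set)" by (rule image_eqI[of _ _ "0\<^sub>m n n"]) (simp_all add: emb_zero)
    fix x :: "'f op" assume "x \<in> emb n ` (carrier_mat n n :: 'f mat set)"
    then obtain A where A: "A \<in> carrier_mat n n" "x = emb n A" by blast
    show "scale_op c x \<in> emb n ` (carrier_mat n n :: 'f mat set)" for c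
      by (rule image_eqI[of _ _ "c \<cdot>\<^sub>m A"]) (use A in \<open>simp_all add: emb_smult\<close>)
    fix y :: "'f op" assume "y \<in> emb n ` (carrier_mat n n :: 'f mat set)"
    then obtain B where B: "B \<in> carrier_mat n n" "y = emb n B" by blast
    show "x + y \<in> emb n ` (carrier_mat n n :: 'f mat set)"
      by (rule image_eqI[of _ _ "A + B"]) (use A B in \<open>simp_all add: emb_add\<close>)
  qed
  then show "op.span ?E \<subseteq> corner n"
    by (intro op.span_minimal) (auto simp: corner_def)
qed

lemma unit_mat_mult:
  assumes "q < n" "p' < n"
  shows "unit_mat n p q * unit_mat n p' q' = (if q = p' then unit_mat n p q' else 0\<^sub>m n n :: 'f::field mat)"
proof (rule eq_matI)
  fix i j assume "i < dim_row (if q = p' then unit_mat n p q' else 0\<^sub>m n n :: 'f mat)"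
    "j < dim_col (if q = p' then unit_mat n p q' else 0\<^sub>m n n :: 'f mat)"
  then have ij: "i < n" "j < n" by (auto simp: unit_mat_def split: if_splits)
  then have "(unit_mat n p q * unit_mat n p' q') $$ (i, j)
      = (\<Sum>k = 0..<n. unit_mat n p q $$ (i, k) * (unit_mat n p' q' $$ (k, j) :: 'f))"
    by (simp add: scalar_prod_def unit_mat_def)
  also have "\<dots> = (\<Sum>k = 0..<n. if k = q then (if i = p \<and> q = p' \<and> j = q' then 1 else 0) else 0)"
    using ij assms by (intro sum.cong) (auto simp: unit_mat_def)
  also have "\<dots> = (if i = p \<and> q = p' \<and> j = q' then 1 else 0)" using assms by simp
  finally have eq: "(unit_mat n p q * unit_mat n p' q') $$ (i, j) = (if i = p \<and> q = p' \<and> j = q' then 1 else 0 :: 'f)" .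
  show "(unit_mat n p q * unit_mat n p' q') $$ (i, j) = (if q = p' then unit_mat n p q' else 0\<^sub>m n n :: 'f mat) $$ (i, j)"
    unfolding eq using ij by (auto simp: unit_mat_def)
qed (auto simp: unit_mat_def)

lemma unit_mat_nz: "p < n \<Longrightarrow> q < n \<Longrightarrow> unit_mat n p q \<noteq> (0\<^sub>m n n :: 'f::field mat)"
proof
  assume "p < n" "q < n" "unit_mat n p q = (0\<^sub>m n n :: 'f mat)"
  then have "unit_mat n p q $$ (p, q) = (0 :: 'f)" by simp
  then show False using \<open>p < n\<close> \<open>q < n\<close> by (simp add: unit_mat_def)
qed

lemma emb_eq_0_iff: "A \<in> carrier_mat n n \<Longrightarrow> emb n A = 0 \<longleftrightarrow> A = 0\<^sub>m n n"
  using emb_inj[of n] by (metis emb_zero inj_onD zero_carrier_mat)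

section \<open>Kronecker products\<close>

lemma kronecker_carrier [simp]:
  "A \<in> carrier_mat m m \<Longrightarrow> B \<in> carrier_mat n n \<Longrightarrow> kronecker A B \<in> carrier_mat (m * n) (m * n)"
  by (auto simp: kronecker_def)

lemma kronecker_index:
  "A \<in> carrier_mat m m \<Longrightarrow> B \<in> carrier_mat n n \<Longrightarrow> i < m * n \<Longrightarrow> j < m * n \<Longrightarrow>
    kronecker A B $$ (i, j) = A $$ (i div n, j div n) * B $$ (i mod n, j mod n)"
  by (auto simp: kronecker_def)

text \<open>The index \<open>r\<close> stands for the pair with \<open>r = i * n + j\<close>, the
  convention of the Kronecker product.\<close>

lemma sum_div_mod:
  fixes f :: "nat \<Rightarrow> nat \<Rightarrow> 'a::comm_monoid_add"
  shows "(\<Sum>r<m * n. f (r div n) (r mod n)) = (\<Sum>i<m. \<Sum>j<n. f i j)"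
proof -
  have "(\<Sum>i<m. \<Sum>j<n. f i j) = (\<Sum>(i, j)\<in>{..<m} \<times> {..<n}. f i j)" by (rule sum.cartesian_product)
  also have "\<dots> = (\<Sum>r<m * n. f (r div n) (r mod n))"
  proof (rule sum.reindex_bij_witness[where i = "\<lambda>r. (r div n, r mod n)" and j = "\<lambda>(i, j). i * n + j"])
    fix r assume "r \<in> {..<m * n}"
    then have "0 < n" "r < m * n" by (auto intro: gr0I)
    then show "(r div n, r mod n) \<in> {..<m} \<times> {..<n}" by (auto simp: less_mult_imp_div_less)
  next
    fix p assume "p \<in> {..<m} \<times> {..<n}"
    then obtain i j where p: "p = (i, j)" "i < m" "j < n" by auto
    have "i * n + j < Suc i * n" using p by simp
    also have "\<dots> \<le> m * n" using p by (intro mult_le_mono1) simp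
    finally show "(case p of (i, j) \<Rightarrow> i * n + j) \<in> {..<m * n}" using p by simp
  qed auto
  finally show ?thesis ..
qed

lemma div_mod_less:
  fixes i m n :: nat
  assumes "i < m * n"
  shows "i div n < m" "i mod n < n"
proof -
  have "0 < n" using assms by (auto intro: gr0I)
  then show "i div n < m" "i mod n < n" using assms by (auto simp: less_mult_imp_div_less)
qed

lemma kronecker_mult:
  fixes A B A' B' :: "'f::field mat"
  assumes "A \<in> carrier_mat m m" "A' \<in> carrier_mat m m" "B \<in> carrier_mat n n" "B' \<in> carrier_mat n n"
  shows "kronecker A B * kronecker A' B' = kronecker (A * A') (B * B')"
proof (rule eq_matI)
  fix i j assume "i < dim_row (kronecker (A * A') (B * B'))" "j < dim_col (kronecker (A * A') (B * B'))"
  then have ij: "i < m * n" "j < m * n" using assms by (auto simp: kronecker_def)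
  have "(kronecker A B * kronecker A' B') $$ (i, j) = (\<Sum>r<m * n. kronecker A B $$ (i, r) * kronecker A' B' $$ (r, j))"
    using ij kronecker_carrier[OF assms(1,3)] kronecker_carrier[OF assms(2,4)]
    by (auto simp: scalar_prod_def atLeast0LessThan)
  also have "\<dots> = (\<Sum>r<m * n. (A $$ (i div n, r div n) * A' $$ (r div n, j div n)) * (B $$ (i mod n, r mod n) * B' $$ (r mod n, j mod n)))"
    using ij assms by (intro sum.cong) (auto simp: kronecker_index[OF assms(1,3)] kronecker_index[OF assms(2,4)] mult_ac)
  also have "\<dots> = (\<Sum>k<m. \<Sum>l<n. (A $$ (i div n, k) * A' $$ (k, j div n)) * (B $$ (i mod n, l) * B' $$ (l, j mod n)))"
    by (rule sum_div_mod)
  also have "\<dots> = (\<Sum>k<m. A $$ (i div n, k) * A' $$ (k, j div n)) * (\<Sum>l<n. B $$ (i mod n, l) * B' $$ (l, j mod n))"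
    by (simp only: sum_product)
  also have "\<dots> = (A * A') $$ (i div n, j div n) * (B * B') $$ (i mod n, j mod n)"
    using assms div_mod_less[OF ij(1)] div_mod_less[OF ij(2)] by (auto simp: scalar_prod_def atLeast0LessThan)
  also have "\<dots> = kronecker (A * A') (B * B') $$ (i, j)"
    using assms ij by (subst kronecker_index[of _ m _ n]) auto
  finally show "(kronecker A B * kronecker A' B') $$ (i, j) = kronecker (A * A') (B * B') $$ (i, j)" .
qed (use assms in \<open>auto simp: kronecker_def\<close>)

lemma kronecker_smult:
  assumes "A \<in> carrier_mat m m" "B \<in> carrier_mat n n"
  shows "kronecker (c \<cdot>\<^sub>m A) (d \<cdot>\<^sub>m B) = (c * d) \<cdot>\<^sub>m kronecker A B"
proof (rule eq_matI)
  fix i j assume "i < dim_row ((c * d) \<cdot>\<^sub>m kronecker A B)" "j < dim_col ((c * d) \<cdot>\<^sub>m kronecker A B)"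
  then have ij: "i < m * n" "j < m * n" using assms by (auto simp: kronecker_def)
  show "kronecker (c \<cdot>\<^sub>m A) (d \<cdot>\<^sub>m B) $$ (i, j) = ((c * d) \<cdot>\<^sub>m kronecker A B) $$ (i, j)"
    using ij assms div_mod_less[OF ij(1)] div_mod_less[OF ij(2)] kronecker_carrier[OF assms]
    by (subst kronecker_index[of _ m _ n])
      (auto simp: kronecker_index[OF assms] carrier_matD[OF kronecker_carrier[OF assms]] mult_ac)
qed (use assms in \<open>auto simp: kronecker_def\<close>)

lemma kronecker_zero:
  assumes "A \<in> carrier_mat m m" "B \<in> carrier_mat n n"
  shows "kronecker (0\<^sub>m m m) B = 0\<^sub>m (m * n) (m * n)" "kronecker A (0\<^sub>m n n) = 0\<^sub>m (m * n) (m * n)"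
  using assms div_mod_less by (auto simp: kronecker_def intro!: eq_matI)

lemma kronecker_nz:
  assumes "A \<in> carrier_mat m m" "B \<in> carrier_mat n n" "A \<noteq> 0\<^sub>m m m" "B \<noteq> 0\<^sub>m n n"
  shows "kronecker A B \<noteq> 0\<^sub>m (m * n) (m * n)"
proof -
  obtain i j where ij: "i < m" "j < m" "A $$ (i, j) \<noteq> 0"
    using assms(1,3) by (metis carrier_matD eq_matI index_zero_mat)
  obtain k l where kl: "k < n" "l < n" "B $$ (k, l) \<noteq> 0"
    using assms(2,4) by (metis carrier_matD eq_matI index_zero_mat)
  have lt: "a * n + b < m * n" if "a < m" "b < n" for a b
  proof -
    have "a * n + b < Suc a * n" using that by simp
    also have "\<dots> \<le> m * n" using that by (intro mult_le_mono1) simp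
    finally show ?thesis .
  qed
  have "kronecker A B $$ (i * n + k, j * n + l) = A $$ (i, j) * B $$ (k, l)"
    using kl lt[OF ij(1) kl(1)] lt[OF ij(2) kl(2)] by (subst kronecker_index[OF assms(1,2)]) auto
  then show ?thesis using ij kl lt by auto
qed

text \<open>Only the first factor is expanded in matrix units. The second stays whole because in the
  application it is already a homogeneous generator of the division algebra.\<close>

lemma emb_kronecker_expand:
  assumes U: "U \<in> carrier_mat m m" and X: "X \<in> carrier_mat n n"
  shows "emb (m * n) (kronecker U X) = (\<Sum>p<m. \<Sum>q<m. scale_op (U $$ (p, q)) (emb (m * n) (kronecker (unit_mat m p q) X)))"
proof (rule op_eqI)
  fix v i
  show "app (emb (m * n) (kronecker U X)) v i
      = app (\<Sum>p<m. \<Sum>q<m. scale_op (U $$ (p, q)) (emb (m * n) (kronecker (unit_mat m p q) X))) v i"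
  proof (cases "i < m * n")
    case True
    have un: "kronecker (unit_mat m p q) X $$ (i, j) = unit_mat m p q $$ (i div n, j div n) * X $$ (i mod n, j mod n)"
      if "j < m * n" for p q j using kronecker_index[OF unit_mat_carrier X True that] .
    have delta: "(\<Sum>p<m. \<Sum>q<m. U $$ (p, q) * unit_mat m p q $$ (a, b)) = U $$ (a, b)" if "a < m" "b < m" for a b
    proof -
      have "(\<Sum>p<m. \<Sum>q<m. U $$ (p, q) * unit_mat m p q $$ (a, b)) = (\<Sum>p<m. \<Sum>q<m. if q = b then (if p = a then U $$ (a, b) else 0) else 0)"
        using that by (intro sum.cong) (auto simp: unit_mat_def)
      then show ?thesis using that by simp
    qed
    have "app (\<Sum>p<m. \<Sum>q<m. scale_op (U $$ (p, q)) (emb (m * n) (kronecker (unit_mat m p q) X))) v i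
        = (\<Sum>p<m. \<Sum>q<m. \<Sum>j<m * n. U $$ (p, q) * unit_mat m p q $$ (i div n, j div n) * (X $$ (i mod n, j mod n) * v j))"
      using True by (simp add: app_sum scale_op.rep_eq emb.rep_eq sum_distrib_left un mult.assoc)
    also have "\<dots> = (\<Sum>p<m. \<Sum>j<m * n. \<Sum>q<m. U $$ (p, q) * unit_mat m p q $$ (i div n, j div n) * (X $$ (i mod n, j mod n) * v j))"
      by (intro sum.cong refl sum.swap)
    also have "\<dots> = (\<Sum>j<m * n. \<Sum>p<m. \<Sum>q<m. U $$ (p, q) * unit_mat m p q $$ (i div n, j div n) * (X $$ (i mod n, j mod n) * v j))"
      by (rule sum.swap)
    also have "\<dots> = (\<Sum>j<m * n. (\<Sum>p<m. \<Sum>q<m. U $$ (p, q) * unit_mat m p q $$ (i div n, j div n)) * (X $$ (i mod n, j mod n) * v j))"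
      by (simp only: sum_distrib_right)
    also have "\<dots> = (\<Sum>j<m * n. kronecker U X $$ (i, j) * v j)"
      using div_mod_less[OF True] div_mod_less by (intro sum.cong) (auto simp: delta kronecker_index[OF U X True])
    also have "\<dots> = app (emb (m * n) (kronecker U X)) v i" using True by (simp add: emb.rep_eq)
    finally show ?thesis ..
  qed (simp add: app_sum scale_op.rep_eq emb.rep_eq)
qed

section \<open>The standard realization\<close>

text \<open>What the induction along the list of hyperbolic pairs has to deliver about a standard realization.\<close>
definition realizes ::
  "('g, 'm) monoid_scheme \<Rightarrow> 'g set \<Rightarrow> ('g \<Rightarrow> 'g \<Rightarrow> 'f::field) \<Rightarrow> nat \<Rightarrow> ('g \<Rightarrow> 'f mat set)
    \<Rightarrow> ('g \<Rightarrow> 'f mat) \<Rightarrow> ('g \<Rightarrow> 'g \<Rightarrow> 'f) \<Rightarrow> bool"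
  where "realizes G T \<beta> d \<Delta> X \<sigma> \<longleftrightarrow> card T = d * d \<and> 0 < d \<and>
    (\<forall>t\<in>T. X t \<in> carrier_mat d d \<and> X t \<noteq> 0\<^sub>m d d) \<and>
    (\<forall>s\<in>T. \<forall>t\<in>T. X s * X t = \<sigma> s t \<cdot>\<^sub>m X (s \<otimes>\<^bsub>G\<^esub> t) \<and> \<sigma> s t \<noteq> 0 \<and> \<sigma> s t = \<beta> s t * \<sigma> t s) \<and>
    (\<forall>g\<in>carrier G. \<Delta> g = mat_span d (if g \<in> T then {X g} else {}))"

context
  fixes l :: nat and \<epsilon> :: "'f::field"
  assumes prim: "primitive_root_of_unity l \<epsilon>"
begin

private abbreviation "X \<equiv> X_mat l \<epsilon>"
private abbreviation "Y \<equiv> Y_mat l :: 'f mat"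

definition W :: "nat \<Rightarrow> nat \<Rightarrow> 'f mat" where "W i j = X ^\<^sub>m i * Y ^\<^sub>m j"

lemma l_pos: "0 < l" using prim by (simp add: primitive_root_of_unity_def)

lemma \<epsilon>_pow: "\<epsilon> ^ l = 1" using prim by (simp add: primitive_root_of_unity_def)

lemma \<epsilon>_nz: "\<epsilon> \<noteq> 0" using \<epsilon>_pow l_pos by (auto simp: power_0_left)

lemma X_carrier: "X \<in> carrier_mat l l" by (simp add: X_mat_def mat_diag_def)

lemma Y_carrier: "Y \<in> carrier_mat l l" by (simp add: Y_mat_def)

lemma W_carrier: "W i j \<in> carrier_mat l l"
  unfolding W_def by (rule mult_carrier_mat[OF pow_carrier_mat[OF X_carrier] pow_carrier_mat[OF Y_carrier]])

lemma X_pow: "X ^\<^sub>m u = mat_diag l (\<lambda>i. \<epsilon> ^ (u * (l - 1 - i)))"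
proof (induction u)
  case 0
  then show ?case by (simp add: X_mat_def mat_diag_def one_mat_def cong: if_cong)
next
  case (Suc u)
  have "X ^\<^sub>m Suc u = mat_diag l (\<lambda>i. \<epsilon> ^ (u * (l - 1 - i))) * mat_diag l (\<lambda>i. \<epsilon> ^ (l - 1 - i))"
    using Suc by (simp add: X_mat_def)
  also have "\<dots> = mat_diag l (\<lambda>i. \<epsilon> ^ (Suc u * (l - 1 - i)))"
    by (simp add: mat_diag_mult_left power_add mult.commute)
  finally show ?case .
qed

text \<open>\<open>Y\<close> is the permutation matrix of the cyclic shift from \<open>i\<close> to
  \<open>i + 1\<close> modulo \<open>l\<close>, also for \<open>l = 1\<close>, where it is the
  identity.\<close>

lemma Y_pow: "Y ^\<^sub>m v = mat l l (\<lambda>(i, j). if j = (i + v) mod l then 1 else 0)"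
proof (induction v)
  case 0
  then show ?case by (intro eq_matI) (auto simp: Y_mat_def)
next
  case (Suc v)
  show ?case
  proof (rule eq_matI)
    fix i j assume "i < dim_row (mat l l (\<lambda>(i, j). if j = (i + Suc v) mod l then 1 else 0 :: 'f))"
      "j < dim_col (mat l l (\<lambda>(i, j). if j = (i + Suc v) mod l then 1 else 0 :: 'f))"
    then have ij: "i < l" "j < l" by auto
    define a where "a = (i + v) mod l"
    have a: "a < l" using l_pos by (simp add: a_def)
    have "(Y ^\<^sub>m Suc v) $$ (i, j) = (\<Sum>k = 0..<l. (if k = a then 1 else 0) * Y $$ (k, j))"
      using ij Suc by (simp add: scalar_prod_def Y_mat_def a_def)
    also have "\<dots> = (\<Sum>k = 0..<l. if k = a then Y $$ (a, j) else 0)" by (intro sum.cong) auto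
    also have "\<dots> = Y $$ (a, j)" using a by simp
    also have "\<dots> = (if j = Suc a mod l then 1 else 0)"
      using a ij by (auto simp: Y_mat_def mod_Suc)
    also have "Suc a mod l = (i + Suc v) mod l" by (simp add: a_def mod_Suc_eq)
    finally show "(Y ^\<^sub>m Suc v) $$ (i, j) = mat l l (\<lambda>(i, j). if j = (i + Suc v) mod l then 1 else 0) $$ (i, j)"
      using ij by simp
  qed (simp_all only: carrier_matD[OF pow_carrier_mat[OF Y_carrier]] dim_row_mat dim_col_mat)
qed

lemma W_index: "i < l \<Longrightarrow> j < l \<Longrightarrow> W u v $$ (i, j) = (if j = (i + v) mod l then \<epsilon> ^ (u * (l - 1 - i)) else 0)"
proof -
  assume ij: "i < l" "j < l"
  have "W u v $$ (i, j) = (\<Sum>k = 0..<l. (X ^\<^sub>m u) $$ (i, k) * (Y ^\<^sub>m v) $$ (k, j))"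
    using ij by (simp add: W_def scalar_prod_def X_pow Y_pow mat_diag_def)
  also have "\<dots> = (\<Sum>k = 0..<l. if k = i then (if j = (i + v) mod l then \<epsilon> ^ (u * (l - 1 - i)) else 0) else 0)"
    using ij by (intro sum.cong) (auto simp: X_pow Y_pow mat_diag_def)
  finally show ?thesis using ij by simp
qed

lemma W_nz: "W u v \<noteq> 0\<^sub>m l l"
proof
  assume "W u v = 0\<^sub>m l l"
  then have "W u v $$ (0, v mod l) = 0" using l_pos by simp
  then show False using l_pos \<epsilon>_nz by (simp add: W_index)
qed

lemma \<epsilon>_pow_mod: "\<epsilon> ^ u = \<epsilon> ^ (u mod l)"
proof -
  have "\<epsilon> ^ u = \<epsilon> ^ (l * (u div l) + u mod l)" by simp
  also have "\<dots> = \<epsilon> ^ (u mod l)" unfolding power_add power_mult \<epsilon>_pow by simp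
  finally show ?thesis .
qed

text \<open>The \<open>l\<close>-th powers of \<open>X\<close> and of \<open>Y\<close> are the
  identity.\<close>

lemma W_mod: "W u v = W (u mod l) (v mod l)"
proof (rule eq_matI)
  fix i j assume "i < dim_row (W (u mod l) (v mod l))" "j < dim_col (W (u mod l) (v mod l))"
  then have ij: "i < l" "j < l" by (simp_all add: carrier_matD[OF W_carrier])
  have "\<epsilon> ^ (u * (l - 1 - i)) = \<epsilon> ^ (u mod l * (l - 1 - i))"
    unfolding power_mult by (subst \<epsilon>_pow_mod) (rule refl)
  then show "W u v $$ (i, j) = W (u mod l) (v mod l) $$ (i, j)"
    by (simp only: W_index[OF ij] mod_add_right_eq)
qed (simp_all only: carrier_matD[OF W_carrier])

text \<open>Moving \<open>X\<^sup>u\<close> to the left of \<open>Y\<^sup>v\<close> costs \<open>\<epsilon>\<^sup>-\<^sup>u\<^sup>v\<close>.\<close>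
lemma W_mult: "W u v * W u' v' = inverse \<epsilon> ^ (u' * v) \<cdot>\<^sub>m W (u + u') (v + v')"
proof (rule eq_matI)
  fix i j assume "i < dim_row (inverse \<epsilon> ^ (u' * v) \<cdot>\<^sub>m W (u + u') (v + v'))"
    "j < dim_col (inverse \<epsilon> ^ (u' * v) \<cdot>\<^sub>m W (u + u') (v + v'))"
  then have ij: "i < l" "j < l" by (simp_all add: carrier_matD[OF W_carrier])
  define a where "a = (i + v) mod l"
  have a: "a < l" using l_pos by (simp add: a_def)
  have "(W u v * W u' v') $$ (i, j) = (\<Sum>k = 0..<l. W u v $$ (i, k) * W u' v' $$ (k, j))"
    using ij carrier_matD[OF W_carrier] by (simp add: scalar_prod_def)
  also have "\<dots> = (\<Sum>k = 0..<l. if k = a then W u v $$ (i, a) * W u' v' $$ (a, j) else 0)"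
    using ij by (intro sum.cong) (auto simp: W_index a_def)
  also have "\<dots> = W u v $$ (i, a) * W u' v' $$ (a, j)" using a by simp
  also have "\<dots> = (if j = (a + v') mod l then \<epsilon> ^ (u * (l - 1 - i)) * \<epsilon> ^ (u' * (l - 1 - a)) else 0)"
    using ij a by (simp add: W_index) (simp add: a_def)
  also have "(a + v') mod l = (i + (v + v')) mod l" by (simp add: a_def mod_simps add.assoc)
  \<comment> \<open>The shifted row \<open>a = (i + v) mod l\<close> may have wrapped around;
    \<open>\<epsilon> ^ l = 1\<close> absorbs this. Multiplying by
    \<open>\<epsilon> ^ (i + a)\<close> first avoids truncated subtraction in the exponents.\<close>
  also have "\<epsilon> ^ (u' * (l - 1 - a)) = inverse \<epsilon> ^ (u' * v) * \<epsilon> ^ (u' * (l - 1 - i))"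
  proof -
    have "\<epsilon> ^ (l - 1 - a) * \<epsilon> ^ v = \<epsilon> ^ (l - 1 - i)"
    proof -
      have "\<epsilon> ^ (l - 1 - a) * \<epsilon> ^ v * \<epsilon> ^ (i + a) = \<epsilon> ^ ((l - 1 - a) + v + (i + a))" by (simp only: power_add)
      also have "(l - 1 - a) + v + (i + a) = l - 1 + (i + v)" using a by simp
      also have "\<epsilon> ^ (l - 1 + (i + v)) = \<epsilon> ^ (l - 1) * \<epsilon> ^ a"
        unfolding a_def power_add[of \<epsilon> "l - 1"] by (subst \<epsilon>_pow_mod[of "i + v"]) (rule refl)
      also have "\<dots> = \<epsilon> ^ ((l - 1 - i) + (i + a))" using ij by (simp flip: power_add)
      also have "\<dots> = \<epsilon> ^ (l - 1 - i) * \<epsilon> ^ (i + a)" by (simp only: power_add)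
      finally show ?thesis using \<epsilon>_nz by simp
    qed
    then have "\<epsilon> ^ (l - 1 - a) = inverse \<epsilon> ^ v * \<epsilon> ^ (l - 1 - i)"
      using \<epsilon>_nz by (simp add: field_simps)
    then have "(\<epsilon> ^ (l - 1 - a)) ^ u' = (inverse \<epsilon> ^ v) ^ u' * (\<epsilon> ^ (l - 1 - i)) ^ u'"
      by (simp add: power_mult_distrib)
    then show ?thesis by (simp add: mult.commute flip: power_mult)
  qed
  finally show "(W u v * W u' v') $$ (i, j) = (inverse \<epsilon> ^ (u' * v) \<cdot>\<^sub>m W (u + u') (v + v')) $$ (i, j)"
    using ij carrier_matD[OF W_carrier] by (simp add: W_index distrib_right power_add)
qed (simp_all only: carrier_matD[OF W_carrier] index_smult_mat index_mult_mat)

end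

text \<open>The degree of a monomial determines its exponents modulo \<open>ord a\<close> by
  \<open>split_unique\<close>, and by \<open>W_mod\<close> the matrix depends only on these
  residues. So each component is spanned by one monomial or is 0.\<close>

lemma (in hyperbolic_pair) XY_grading_eq:
  shows "i < ord a \<Longrightarrow> j < ord a \<Longrightarrow>
      XY_grading G (ord a) (\<beta> a b) a b (a [^] i \<otimes> b [^] j) = mat_span (ord a) {W (ord a) (\<beta> a b) i j}"
    and "(\<And>i j. i < ord a \<Longrightarrow> j < ord a \<Longrightarrow> h \<noteq> a [^] i \<otimes> b [^] j) \<Longrightarrow>
      XY_grading G (ord a) (\<beta> a b) a b h = mat_span (ord a) {}"
proof -
  have ac: "a \<in> carrier G" "b \<in> carrier G" using a b by auto
  have pm: "x [^] u = x [^] (u mod ord x)" if "x \<in> carrier G" for x and u :: nat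
  proof -
    have "x [^] u = x [^] (ord x * (u div ord x)) \<otimes> x [^] (u mod ord x)"
      using that by (simp add: nat_pow_mult)
    then show ?thesis using that pow_eq_id[of x "ord x * (u div ord x)"] by simp
  qed
  have mods: "a [^] u \<otimes> b [^] v = a [^] (u mod ord a) \<otimes> b [^] (v mod ord a)" for u v :: nat
    using pm[OF ac(1), of u] pm[OF ac(2), of v] ord_eq by simp
  have one: "\<one> \<in> perp" using perp_subgroup by (rule subgroup.one_closed)
  {
    fix i j assume ij: "i < ord a" "j < ord a"
    have "{X_mat (ord a) (\<beta> a b) ^\<^sub>m u * Y_mat (ord a) ^\<^sub>m v | u v. a [^] u \<otimes> b [^] v = a [^] i \<otimes> b [^] j}
        = {W (ord a) (\<beta> a b) i j}" (is "?S = _")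
    proof
      show "?S \<subseteq> {W (ord a) (\<beta> a b) i j}"
      proof
        fix x assume "x \<in> ?S"
        then obtain u v :: nat where uv: "x = W (ord a) (\<beta> a b) u v" "a [^] u \<otimes> b [^] v = a [^] i \<otimes> b [^] j"
          by (auto simp: W_def[OF prim])
        \<comment> \<open>The factor \<open>\<one>\<close> from \<open>perp\<close> only serves to
          match the form of \<open>split_unique\<close>.\<close>
        have "a [^] (u mod ord a) \<otimes> b [^] (v mod ord a) \<otimes> \<one> = a [^] i \<otimes> b [^] j \<otimes> \<one>"
          using uv(2) mods[of u v] by simp
        then have "u mod ord a = i \<and> v mod ord a = j \<and> \<one> = \<one>"
          by (rule split_unique[OF one one mod_less_divisor[OF ord_pos] ij(1) mod_less_divisor[OF ord_pos] ij(2)])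
        then show "x \<in> {W (ord a) (\<beta> a b) i j}" unfolding uv(1) by (subst W_mod[OF prim]) simp
      qed
    qed (auto simp: W_def[OF prim])
    then show "XY_grading G (ord a) (\<beta> a b) a b (a [^] i \<otimes> b [^] j) = mat_span (ord a) {W (ord a) (\<beta> a b) i j}"
      by (simp add: XY_grading_def)
  }
  {
    assume h: "\<And>i j. i < ord a \<Longrightarrow> j < ord a \<Longrightarrow> h \<noteq> a [^] i \<otimes> b [^] j"
    have "{X_mat (ord a) (\<beta> a b) ^\<^sub>m u * Y_mat (ord a) ^\<^sub>m v | u v. a [^] u \<otimes> b [^] v = h} = {}"
    proof -
      have False if "a [^] u \<otimes> b [^] v = h" for u v :: nat
        using h[OF mod_less_divisor[OF ord_pos, of u] mod_less_divisor[OF ord_pos, of v]] mods[of u v] that by simp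
      then show ?thesis by blast
    qed
    then show "XY_grading G (ord a) (\<beta> a b) a b h = mat_span (ord a) {}" by (simp add: XY_grading_def)
  }
qed

text \<open>For \<open>t\<close> with coordinates \<open>i\<close>, \<open>j\<close>,
  \<open>z\<close> the generator is the tensor of the monomial \<open>?W i j\<close> with
  \<open>X' z\<close>. The new cocycle is the one on \<open>perp\<close> times the power of
  \<open>inverse (\<beta> a b)\<close> that arises from moving the clock past the shift
  matrix.\<close>

lemma (in hyperbolic_pair) realizes_tensor:
  fixes \<Delta> :: "'g \<Rightarrow> 'f mat set"
  assumes R: "realizes G perp \<beta> d \<Delta> X' \<sigma>'"
  shows "\<exists>X \<sigma>. realizes G T \<beta> (ord a * d)
    (tensor_grading G (ord a) (XY_grading G (ord a) (\<beta> a b) a b) d \<Delta>) X \<sigma>"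
proof -
  let ?l = "ord a" and ?\<epsilon> = "\<beta> a b"
  let ?W = "W ?l ?\<epsilon>"
  \<comment> \<open>Coordinates of \<open>t\<close> in the splitting of \<open>T\<close>;
    \<open>c_eq\<close> shows that the choice is unique.\<close>
  define c where "c t = (SOME (i, j, z). i < ?l \<and> j < ?l \<and> z \<in> perp \<and> t = a [^] (i::nat) \<otimes> b [^] (j::nat) \<otimes> z)" for t
  have c_eq: "c (a [^] i \<otimes> b [^] j \<otimes> z) = (i, j, z)" if "i < ?l" "j < ?l" "z \<in> perp" for i j :: nat and z
  proof -
    let ?P = "\<lambda>(i', j', z'). i' < ?l \<and> j' < ?l \<and> z' \<in> perp \<and> a [^] i \<otimes> b [^] j \<otimes> z = a [^] (i'::nat) \<otimes> b [^] (j'::nat) \<otimes> z'"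
    have "(SOME p. ?P p) = (i, j, z)"
    proof (rule some_equality)
      fix p assume "?P p"
      then obtain i' j' z' where p: "p = (i', j', z')" "i' < ?l" "j' < ?l" "z' \<in> perp"
        and eq: "a [^] i \<otimes> b [^] j \<otimes> z = a [^] i' \<otimes> b [^] j' \<otimes> z'" by (cases p) simp
      show "p = (i, j, z)" using split_unique[OF that(3) p(4) that(1) p(2) that(2) p(3) eq] p(1) by simp
    qed (use that in simp)
    then show ?thesis by (simp add: c_def)
  qed
  define X where "X t = (case c t of (i, j, z) \<Rightarrow> kronecker (?W i j) (X' z))" for t
  define \<sigma> where "\<sigma> s t = (case c s of (i, j, z) \<Rightarrow> case c t of (i', j', z') \<Rightarrow> inverse ?\<epsilon> ^ (i' * j) * \<sigma>' z z')" for s t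
  have ac: "a \<in> carrier G" "b \<in> carrier G" using a b by auto
  have card: "card perp = d * d" "0 < d" and X': "\<And>z. z \<in> perp \<Longrightarrow> X' z \<in> carrier_mat d d" "\<And>z. z \<in> perp \<Longrightarrow> X' z \<noteq> 0\<^sub>m d d"
    and X'_mult: "\<And>s t. s \<in> perp \<Longrightarrow> t \<in> perp \<Longrightarrow> X' s * X' t = \<sigma>' s t \<cdot>\<^sub>m X' (s \<otimes> t)"
    and \<sigma>'_nz: "\<And>s t. s \<in> perp \<Longrightarrow> t \<in> perp \<Longrightarrow> \<sigma>' s t \<noteq> 0"
    and \<sigma>'_comm: "\<And>s t. s \<in> perp \<Longrightarrow> t \<in> perp \<Longrightarrow> \<sigma>' s t = \<beta> s t * \<sigma>' t s"
    and \<Delta>: "\<And>g. g \<in> carrier G \<Longrightarrow> \<Delta> g = mat_span d (if g \<in> perp then {X' g} else {})"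
    using R unfolding realizes_def by blast+
  note Wc = W_carrier[OF prim] and Wnz = W_nz[OF prim] and Wmod = W_mod[OF prim] and Wmult = W_mult[OF prim]
  have perp_c: "z \<in> carrier G" if "z \<in> perp" for z using that perp_T by auto
  have X_eq: "X (a [^] i \<otimes> b [^] j \<otimes> z) = kronecker (?W i j) (X' z)" if "i < ?l" "j < ?l" "z \<in> perp" for i j z
    using c_eq[OF that] by (simp add: X_def)
  have Xc: "X t \<in> carrier_mat (?l * d) (?l * d)" "X t \<noteq> 0\<^sub>m (?l * d) (?l * d)" if t: "t \<in> T" for t
  proof -
    obtain i j z where ijz: "i < ?l" "j < ?l" "z \<in> perp" "t = a [^] (i::nat) \<otimes> b [^] (j::nat) \<otimes> z"
      by (rule split_exists[OF t])
    show "X t \<in> carrier_mat (?l * d) (?l * d)" "X t \<noteq> 0\<^sub>m (?l * d) (?l * d)"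
      using ijz X' kronecker_nz[OF Wc X'(1) Wnz X'(2)] by (simp_all add: X_eq Wc)
  qed
  have mult: "X s * X t = \<sigma> s t \<cdot>\<^sub>m X (s \<otimes> t) \<and> \<sigma> s t \<noteq> 0 \<and> \<sigma> s t = \<beta> s t * \<sigma> t s" if st: "s \<in> T" "t \<in> T" for s t
  proof -
    obtain i j z where s: "i < ?l" "j < ?l" "z \<in> perp" "s = a [^] (i::nat) \<otimes> b [^] (j::nat) \<otimes> z"
      by (rule split_exists[OF st(1)])
    obtain i' j' z' where t: "i' < ?l" "j' < ?l" "z' \<in> perp" "t = a [^] (i'::nat) \<otimes> b [^] (j'::nat) \<otimes> z'"
      by (rule split_exists[OF st(2)])
    have \<sigma>: "\<sigma> s t = inverse ?\<epsilon> ^ (i' * j) * \<sigma>' z z'" "\<sigma> t s = inverse ?\<epsilon> ^ (i * j') * \<sigma>' z' z"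
      using c_eq[OF s(1-3)] c_eq[OF t(1-3)] s(4) t(4) by (simp_all add: \<sigma>_def)
    have zz: "z \<otimes> z' \<in> perp" using s t perp_subgroup by (simp add: subgroup.m_closed)
    have pm: "x [^] u = x [^] (u mod ?l)" if "x \<in> carrier G" "ord x = ?l" for x and u :: nat
    proof -
      have "x [^] u = x [^] (?l * (u div ?l)) \<otimes> x [^] (u mod ?l)"
        using that by (simp add: nat_pow_mult)
      then show ?thesis using that pow_eq_id[of x "?l * (u div ?l)"] by simp
    qed
    have "s \<otimes> t = a [^] (i + i') \<otimes> b [^] (j + j') \<otimes> (z \<otimes> z')"
      unfolding s(4) t(4) using ac perp_c[OF s(3)] perp_c[OF t(3)] by (simp add: m_ac flip: nat_pow_mult)
    also have "\<dots> = a [^] ((i + i') mod ?l) \<otimes> b [^] ((j + j') mod ?l) \<otimes> (z \<otimes> z')"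
      using pm[OF ac(1), of "i + i'"] pm[OF ac(2), of "j + j'"] ord_eq by simp
    finally have "X (s \<otimes> t) = kronecker (?W ((i + i') mod ?l) ((j + j') mod ?l)) (X' (z \<otimes> z'))"
      using X_eq[OF _ _ zz] ord_pos by simp
    also have "\<dots> = kronecker (?W (i + i') (j + j')) (X' (z \<otimes> z'))" by (simp flip: Wmod)
    finally have Xst: "X (s \<otimes> t) = kronecker (?W (i + i') (j + j')) (X' (z \<otimes> z'))" .
    have "X s * X t = kronecker (?W i j * ?W i' j') (X' z * X' z')"
      using s t X_eq kronecker_mult[OF Wc Wc X'(1) X'(1)] by simp
    also have "\<dots> = \<sigma> s t \<cdot>\<^sub>m X (s \<otimes> t)"
      using s(1-3) t(1-3) by (simp add: Wmult X'_mult kronecker_smult[OF Wc X'(1)[OF zz]] \<sigma> Xst)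
    finally have 1: "X s * X t = \<sigma> s t \<cdot>\<^sub>m X (s \<otimes> t)" .
    have \<epsilon>nz: "?\<epsilon> \<noteq> 0" by (rule \<epsilon>_nz[OF prim])
    then have 2: "\<sigma> s t \<noteq> 0" using \<sigma>'_nz[OF s(3) t(3)] by (simp add: \<sigma>)
    have zT: "z \<in> T" "z' \<in> T" using s t perp_T by auto
    \<comment> \<open>The cross terms between the pair and \<open>perp\<close> are trivial, so
      \<open>\<beta> s t\<close> is the commutator of two monomials times the value on
      \<open>perp\<close>.\<close>
    have "\<beta> s t = \<beta> a t ^ i * \<beta> b t ^ j * \<beta> z t"
      unfolding s(4) using a b zT pow_T st by (simp add: bichar_mult(1)[OF bc] bichar_pow(1)[OF bc])
    also have "\<beta> z t = \<beta> z a ^ i' * \<beta> z b ^ j' * \<beta> z z'"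
      unfolding t(4) using a b zT pow_T by (simp add: bichar_mult(2)[OF bc] bichar_pow(2)[OF bc])
    also have "\<beta> z a = 1" using bichar_skew[OF bc zT(1) a] s(3) by (simp add: perp_def)
    also have "\<beta> z b = 1" using bichar_skew[OF bc zT(1) b] s(3) by (simp add: perp_def)
    also have "\<beta> a t = ?\<epsilon> ^ j'" unfolding t(4) by (rule beta_ab(1)[OF t(3)])
    also have "\<beta> b t = inverse ?\<epsilon> ^ i'" unfolding t(4) by (rule beta_ab(2)[OF t(3)])
    finally have "\<beta> s t = ?\<epsilon> ^ (i * j') * inverse ?\<epsilon> ^ (i' * j) * \<beta> z z'"
      by (simp add: mult.commute flip: power_mult)
    then have "\<beta> s t * \<sigma> t s = (?\<epsilon> ^ (i * j') * inverse ?\<epsilon> ^ (i * j')) * (inverse ?\<epsilon> ^ (i' * j) * (\<beta> z z' * \<sigma>' z' z))"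
      by (simp add: \<sigma> mult_ac)
    also have "\<dots> = \<sigma> s t" using \<epsilon>nz \<sigma>'_comm[OF s(3) t(3)] by (simp add: \<sigma> power_inverse)
    finally show ?thesis using 1 2 by simp
  qed
  have grading: "tensor_grading G ?l (XY_grading G ?l ?\<epsilon> a b) d \<Delta> g = mat_span (?l * d) (if g \<in> T then {X g} else {})"
    if g: "g \<in> carrier G" for g
  proof -
    let ?XY = "XY_grading G ?l ?\<epsilon> a b"
    define S where "S = {kronecker A B | A B h k. h \<in> carrier G \<and> k \<in> carrier G \<and> A \<in> ?XY h \<and> B \<in> \<Delta> k \<and> h \<otimes> k = g}"
    define S' where "S' = (if g \<in> T then {X g} else {})"
    have S'c: "S' \<subseteq> carrier_mat (?l * d) (?l * d)" using Xc by (simp add: S'_def)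
    have zero: "0\<^sub>m (?l * d) (?l * d) \<in> mat_span (?l * d) S'"
      using S'c by (simp add: mem_mat_span_iff emb_zero op.span_zero)
    \<comment> \<open>A pure tensor of homogeneous elements is 0 unless its left degree comes from
      the pair and its right degree lies in \<open>perp\<close>; then it is a multiple of
      \<open>X g\<close>, because \<open>i\<close>, \<open>j\<close>, \<open>k\<close> are the
      coordinates of \<open>g\<close>.\<close>
    have "S \<subseteq> mat_span (?l * d) S'"
    proof
      fix x assume "x \<in> S"
      then obtain A B h k where x: "x = kronecker A B" "h \<in> carrier G" "k \<in> carrier G" "A \<in> ?XY h" "B \<in> \<Delta> k" "h \<otimes> k = g"
        by (auto simp: S_def)
      have Bc: "B \<in> carrier_mat d d" using x(5) \<Delta>[OF x(3)] X' mat_span_carrier[of "if k \<in> perp then {X' k} else {}" d]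
        by (auto split: if_splits)
      show "x \<in> mat_span (?l * d) S'"
      proof (cases "\<exists>i j. i < ?l \<and> j < ?l \<and> h = a [^] (i::nat) \<otimes> b [^] (j::nat)")
        case False
        then have "A \<in> mat_span ?l {}" using x(4) XY_grading_eq(2)[of h] by blast
        then have "x = 0\<^sub>m (?l * d) (?l * d)" using x(1) Bc kronecker_zero(1)[OF Wc Bc] by (simp add: mat_span_empty)
        then show ?thesis using zero by simp
      next
        case True
        then obtain i j where ij: "i < ?l" "j < ?l" "h = a [^] (i::nat) \<otimes> b [^] (j::nat)" by blast
        then have "A \<in> mat_span ?l {?W i j}" using x(4) XY_grading_eq(1)[OF ij(1,2)] by simp
        then obtain \<mu> where A: "A = \<mu> \<cdot>\<^sub>m ?W i j" using mem_mat_span_singleton[OF Wc] by blast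
        show ?thesis
        proof (cases "k \<in> perp")
          case False
          then have "B = 0\<^sub>m d d" using x(5) \<Delta>[OF x(3)] by (simp add: mat_span_empty)
          moreover have "A \<in> carrier_mat ?l ?l" unfolding A using Wc by simp
          ultimately have "x = 0\<^sub>m (?l * d) (?l * d)" using x(1) kronecker_zero(2) Bc by blast
          then show ?thesis using zero by simp
        next
          case k: True
          then obtain \<nu> where B: "B = \<nu> \<cdot>\<^sub>m X' k"
            using x(5) \<Delta>[OF x(3)] mem_mat_span_singleton[OF X'(1)[OF k]] by auto
          have gT: "g \<in> T" using x(6) ij(3) k perp_T pow_T a b by auto
          have "X g = kronecker (?W i j) (X' k)" using X_eq[OF ij(1,2) k] x(6) ij(3) by simp
          then have "x = (\<mu> * \<nu>) \<cdot>\<^sub>m X g" unfolding x(1) A B using kronecker_smult[OF Wc X'(1)[OF k]] by simp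
          then show ?thesis unfolding S'_def using gT mem_mat_span_singleton[OF Xc(1)[OF gT]] by auto
        qed
      qed
    qed
    moreover have "S' \<subseteq> S"
    proof (cases "g \<in> T")
      case True
      obtain i j z where ijz: "i < ?l" "j < ?l" "z \<in> perp" "g = a [^] (i::nat) \<otimes> b [^] (j::nat) \<otimes> z"
        by (rule split_exists[OF True])
      have "?W i j \<in> ?XY (a [^] i \<otimes> b [^] j)"
        unfolding XY_grading_eq(1)[OF ijz(1,2)] by (rule mat_span_base) (simp_all add: Wc)
      moreover have "X' z \<in> \<Delta> z"
        using \<Delta>[OF perp_c[OF ijz(3)]] ijz(3) X'(1) mat_span_base[of "{X' z}" d "X' z"] by simp
      moreover have "a [^] i \<otimes> b [^] j \<in> carrier G" using ac by simp
      ultimately have "kronecker (?W i j) (X' z) \<in> S"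
        unfolding S_def using ijz(4) perp_c[OF ijz(3)] by blast
      then show ?thesis using X_eq[OF ijz(1-3)] ijz(4) by (simp add: S'_def)
    qed (simp add: S'_def)
    moreover have Sc: "S \<subseteq> carrier_mat (?l * d) (?l * d)"
      using \<open>S \<subseteq> mat_span (?l * d) S'\<close> mat_span_carrier[OF S'c] by blast
    moreover have "S' \<subseteq> mat_span (?l * d) S" using \<open>S' \<subseteq> S\<close> mat_span_base[OF Sc] by blast
    ultimately have "mat_span (?l * d) S = mat_span (?l * d) S'"
      using mat_span_subset[OF _ S'c, of S] mat_span_subset[OF _ Sc, of S'] by blast
    then show ?thesis unfolding tensor_grading_def S_def S'_def .
  qed
  have "realizes G T \<beta> (?l * d) (tensor_grading G ?l (XY_grading G ?l ?\<epsilon> a b) d \<Delta>) X \<sigma>"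
    unfolding realizes_def
  proof (intro conjI ballI)
    show "card T = ?l * d * (?l * d)" using card card_T by (simp add: mult_ac)
    show "0 < ?l * d" using card ord_pos by simp
  qed (use Xc mult grading in blast)+
  then show ?thesis by blast
qed

text \<open>The recursion of \<open>std_grading\<close> removes the first pair while the group
  shrinks to its orthogonal complement, hence \<open>T\<close> has to vary in the induction.\<close>

theorem std_grading_realizes:
  fixes G :: "('g, 'm) monoid_scheme" (structure) and \<beta> :: "'g \<Rightarrow> 'g \<Rightarrow> 'f::field"
  assumes G: "comm_group G"
  shows "subgroup T G \<Longrightarrow> alternating_bicharacter G T \<beta> \<Longrightarrow> symplectic_decomposition G T \<beta> ab \<Longrightarrow>
    \<exists>X \<sigma>. realizes G T \<beta> (std_dim G ab) (std_grading G \<beta> ab) X \<sigma>"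
proof (induction ab arbitrary: T)
  case Nil
  interpret comm_group G by (rule G)
  \<comment> \<open>The empty product map sends the only extensional function on the empty set to
    \<open>\<one>\<close>, so bijectivity forces the trivial group.\<close>
  have T: "T = {\<one>}" using Nil.prems(3) by (simp add: symplectic_decomposition_def bij_betw_def)
  have c1: "carrier_mat 1 1 = mat_span 1 {1\<^sub>m 1 :: 'f mat}"
  proof
    show "carrier_mat 1 1 \<subseteq> mat_span 1 {1\<^sub>m 1 :: 'f mat}"
    proof
      fix x :: "'f mat" assume "x \<in> carrier_mat 1 1"
      then have "x = (x $$ (0, 0)) \<cdot>\<^sub>m 1\<^sub>m 1" by (intro eq_matI) auto
      then show "x \<in> mat_span 1 {1\<^sub>m 1 :: 'f mat}" using mem_mat_span_singleton[of "1\<^sub>m 1" 1 x] by auto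
    qed
  qed (rule mat_span_carrier, simp)
  have one: "1\<^sub>m 1 \<noteq> (0\<^sub>m 1 1 :: 'f mat)"
  proof
    assume "1\<^sub>m 1 = (0\<^sub>m 1 1 :: 'f mat)"
    then have "1\<^sub>m 1 $$ (0, 0) = (0\<^sub>m 1 1 :: 'f mat) $$ (0, 0)" by simp
    then show False by simp
  qed
  have "\<beta> \<one> \<one> = 1" using Nil.prems(2) T by (simp add: alternating_bicharacter_def)
  moreover have "1\<^sub>m 1 \<in> mat_span 1 {1\<^sub>m 1 :: 'f mat}" by (rule mat_span_base) auto
  moreover have "1 \<cdot>\<^sub>m 1\<^sub>m 1 = (1\<^sub>m 1 :: 'f mat)" by (intro eq_matI) auto
  ultimately have "realizes G T \<beta> (std_dim G []) (std_grading G \<beta> []) (\<lambda>_. 1\<^sub>m 1) (\<lambda>_ _. 1)"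
    unfolding realizes_def using one c1 by (simp add: T mat_span_empty)
  then show ?case by blast
next
  case (Cons p ab)
  obtain a b where p: "p = (a, b)" by (cases p)
  interpret hyperbolic_pair G T \<beta> a b
    using symplectic_ConsD(1)[OF G Cons.prems(1,2)] Cons.prems(3) p by blast
  have "symplectic_decomposition G perp \<beta> ab"
    using symplectic_ConsD(2)[OF G Cons.prems(1,2)] Cons.prems(3) p by blast
  then obtain X' \<sigma>' where "realizes G perp \<beta> (std_dim G ab) (std_grading G \<beta> ab) X' \<sigma>'"
    using Cons.IH[OF perp_subgroup bichar_perp] by blast
  then show ?case using realizes_tensor unfolding p by simp
qed

section \<open>Full matrix algebras\<close>

text \<open>The matrix units are themselves a graded matrix basis, over the trivial group. This
  gives the dimension of a full matrix algebra as a case of \<open>dim_A\<close>.\<close>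

lemma corner_graded_matrix_basis:
  fixes G :: "('g, 'm) monoid_scheme" (structure)
  assumes G: "comm_group G" and n: "0 < n"
  shows "graded_matrix_basis scale_op G {\<one>} (\<lambda>_ _. 1 :: 'f::field) n (\<lambda>_. \<one>) (corner n)
    (\<lambda>h. op.span {emb n (unit_mat n p q) | p q t. p < n \<and> q < n \<and> t \<in> {\<one>} \<and> inv \<one> \<otimes> t \<otimes> \<one> = h})
    (\<lambda>p q _. emb n (unit_mat n p q)) (\<lambda>_ _. 1)"
proof -
  interpret comm_group G by (rule G)
  show ?thesis
  proof (intro graded_matrix_basis.intro graded_matrix_basis_axioms.intro)
    show "assoc_algebra (scale_op :: 'f \<Rightarrow> _)" by (rule op.assoc_algebra_axioms)
    show "comm_group G" by (rule G)
    show "subgroup {\<one>} G" by (rule triv_subgroup)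
    show "alternating_bicharacter G {\<one>} (\<lambda>_ _. 1 :: 'f)" by (simp add: alternating_bicharacter_def)
    show "nondegenerate G {\<one>} (\<lambda>_ _. 1 :: 'f)" by (simp add: nondegenerate_def)
    show "emb n (unit_mat n p q) * emb n (unit_mat n p' q')
        = (if q = p' then scale_op 1 (emb n (unit_mat n p q')) else (0 :: 'f op))"
      if "p < n" "q < n" "p' < n" "q' < n" for p q p' q'
      using unit_mat_mult[OF that(2,3), of p q', where ?'f = 'f] by (simp add: emb_zero flip: emb_mult)
    show "emb n (unit_mat n p q) \<noteq> (0 :: 'f op)" if "p < n" "q < n" for p q
      using unit_mat_nz[OF that, where ?'f = 'f] by (simp add: emb_eq_0_iff)
    show "(corner n :: 'f op set) = op.span {emb n (unit_mat n p q) | p q t. p < n \<and> q < n \<and> t \<in> {\<one>}}"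
      unfolding corner_eq_span by simp
  qed (use n in simp_all)
qed

lemma dim_corner:
  assumes "comm_group (G :: ('g, 'm) monoid_scheme)" "0 < n"
  shows "op.dim (corner n :: 'f::field op set) = n * n"
proof -
  interpret C: graded_matrix_basis "scale_op :: 'f \<Rightarrow> _" G "{\<one>\<^bsub>G\<^esub>}" "\<lambda>_ _. 1" n "\<lambda>_. \<one>\<^bsub>G\<^esub>" "corner n"
    "\<lambda>h. op.span {emb n (unit_mat n p q) | p q t. p < n \<and> q < n \<and> t \<in> {\<one>\<^bsub>G\<^esub>} \<and> inv\<^bsub>G\<^esub> \<one>\<^bsub>G\<^esub> \<otimes>\<^bsub>G\<^esub> t \<otimes>\<^bsub>G\<^esub> \<one>\<^bsub>G\<^esub> = h}"
    "\<lambda>p q _. emb n (unit_mat n p q)" "\<lambda>_ _. 1"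
    by (rule corner_graded_matrix_basis[OF assms])
  show ?thesis using C.dim_A by simp
qed

lemma finite_units: "finite {emb n (unit_mat n p q :: 'f::field mat) | p q. p < n \<and> q < n}"
proof -
  have "{emb n (unit_mat n p q :: 'f mat) | p q. p < n \<and> q < n}
      = (\<lambda>(p, q). emb n (unit_mat n p q)) ` ({..<n} \<times> {..<n})" by auto
  then show ?thesis by simp
qed

lemma subspace_corner: "op.subspace (corner n :: 'f::field op set)"
  unfolding corner_eq_span by (rule op.subspace_span)

lemma emb_in_corner: "X \<in> carrier_mat n n \<Longrightarrow> emb n X \<in> corner n"
  by (simp add: corner_def)

lemma corner_cases:
  assumes "x \<in> corner n"
  obtains X where "X \<in> carrier_mat n n" "x = emb n X"
  using assms unfolding corner_def by blast

lemma bij_betw_emb: "bij_betw (emb n) (carrier_mat n n) (corner n)"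
  using emb_inj by (simp add: bij_betw_def corner_def)

lemma mat_mult_index:
  assumes "A \<in> carrier_mat n n" "B \<in> carrier_mat n n" "i < n" "j < n"
  shows "(A * B) $$ (i, j) = (\<Sum>a = 0..<n. A $$ (i, a) * B $$ (a, j))"
  using assms by (auto simp: scalar_prod_def intro!: sum.cong)

text \<open>A matrix unit at \<open>j\<close>, \<open>k\<close> joins a nonzero entry of
  \<open>X\<close> at \<open>i\<close>, \<open>j\<close> with a nonzero entry of \<open>Y\<close> at
  \<open>k\<close>, \<open>l\<close>: the triple product has their product as its entry at
  \<open>i\<close>, \<open>l\<close>.\<close>

lemma corner_prime:
  fixes x y :: "'f::field op"
  assumes "x \<in> corner n" "y \<in> corner n" "x \<noteq> 0" "y \<noteq> 0"
  shows "\<exists>r\<in>corner n. x * r * y \<noteq> 0"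
proof -
  obtain X where X: "X \<in> carrier_mat n n" "x = emb n X" by (rule corner_cases[OF assms(1)])
  obtain Y where Y: "Y \<in> carrier_mat n n" "y = emb n Y" by (rule corner_cases[OF assms(2)])
  have "X \<noteq> 0\<^sub>m n n" "Y \<noteq> 0\<^sub>m n n" using assms X Y by (auto simp: emb_zero)
  then obtain i j k l where ij: "i < n" "j < n" "X $$ (i, j) \<noteq> 0" and kl: "k < n" "l < n" "Y $$ (k, l) \<noteq> 0"
    using X(1) Y(1) by (metis carrier_matD eq_matI index_zero_mat)
  define E where "E = (unit_mat n j k :: 'f mat)"
  have E: "E \<in> carrier_mat n n" by (simp add: E_def)
  have E_index: "E $$ (a, b) = (if a = j \<and> b = k then 1 else 0)" if "a < n" "b < n" for a b
    using that by (simp add: E_def unit_mat_def)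
  have XE: "(X * E) $$ (i, a) = (if a = k then X $$ (i, j) else 0)" if "a < n" for a
  proof -
    have "(X * E) $$ (i, a) = (\<Sum>b = 0..<n. X $$ (i, b) * E $$ (b, a))"
      by (rule mat_mult_index[OF X(1) E ij(1) that])
    also have "\<dots> = (\<Sum>b = 0..<n. if b = j then (if a = k then X $$ (i, j) else 0) else 0)"
      using that by (intro sum.cong) (auto simp: E_index)
    finally show ?thesis using ij by simp
  qed
  have XEc: "X * E \<in> carrier_mat n n" using X(1) E by (rule mult_carrier_mat)
  have "(X * E * Y) $$ (i, l) = (\<Sum>a = 0..<n. (X * E) $$ (i, a) * Y $$ (a, l))"
    by (rule mat_mult_index[OF XEc Y(1) ij(1) kl(2)])
  also have "\<dots> = (\<Sum>a = 0..<n. if a = k then X $$ (i, j) * Y $$ (k, l) else 0)"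
    by (intro sum.cong) (auto simp: XE)
  also have "\<dots> = X $$ (i, j) * Y $$ (k, l)" using kl by simp
  finally have "(X * E * Y) $$ (i, l) \<noteq> 0" using ij kl by simp
  then have "X * E * Y \<noteq> 0\<^sub>m n n" using ij kl by auto
  moreover have "X * E * Y \<in> carrier_mat n n" using XEc Y(1) by (rule mult_carrier_mat)
  ultimately have "emb n (X * E * Y) \<noteq> 0" by (simp add: emb_eq_0_iff)
  then have "x * emb n E * y \<noteq> 0" unfolding X(2) Y(2) by (simp add: emb_mult X(1) Y(1) E XEc)
  then show ?thesis using emb_in_corner[OF E] by blast
qed

lemma corner_mult: "x \<in> corner n \<Longrightarrow> y \<in> corner n \<Longrightarrow> x * y \<in> corner n"
  by (elim corner_cases) (simp add: emb_in_corner flip: emb_mult)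

lemma corner_one:
  assumes "x \<in> corner n"
  shows "emb n (1\<^sub>m n) * x = x" "x * emb n (1\<^sub>m n) = x"
  by (rule corner_cases[OF assms], simp flip: emb_mult)+

lemma matrix_subspaceD:
  fixes N :: "'f::field mat set"
  assumes "VectorSpace.subspace class_ring N (module_mat TYPE('f) n n)"
  shows "N \<subseteq> carrier_mat n n" "x \<in> N \<Longrightarrow> y \<in> N \<Longrightarrow> x + y \<in> N" "0\<^sub>m n n \<in> N" "x \<in> N \<Longrightarrow> c \<cdot>\<^sub>m x \<in> N"
proof -
  have "LinearCombinations.submodule class_ring N (module_mat TYPE('f) n n)"
    using assms unfolding VectorSpace.subspace_def by blast
  then interpret N: LinearCombinations.submodule class_ring N "module_mat TYPE('f) n n" .
  show "N \<subseteq> carrier_mat n n" "x \<in> N \<Longrightarrow> y \<in> N \<Longrightarrow> x + y \<in> N" "0\<^sub>m n n \<in> N" "x \<in> N \<Longrightarrow> c \<cdot>\<^sub>m x \<in> N"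
    using N.subset N.m_closed[of x y] N.zero_closed N.smult_closed[of c x]
    by (simp_all add: module_mat_simps class_ring_simps)
qed

text \<open>The grading is given by unique representations of elements, while \<open>direct\<close>
  is about vanishing finite sums; the link is that 0 is represented only by the zero family.\<close>

theorem graded_prime_algebra_corner:
  fixes R :: "'g \<Rightarrow> 'f::alg_closed_field mat set" and G :: "('g, 'm) monoid_scheme" (structure)
  assumes G: "comm_group G" and n: "0 < n" and R: "graded_algebra G class_ring (module_mat TYPE('f) n n) R"
  shows "graded_prime_algebra scale_op G (corner n) (\<lambda>h. emb n ` R h) (emb n (1\<^sub>m n))
    {emb n (unit_mat n p q) | p q. p < n \<and> q < n}"
proof -
  let ?V = "module_mat TYPE('f) n n"
  interpret comm_group G by (rule G)
  interpret V: abelian_group ?V by (rule abelian_group_mat)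
  have sub: "VectorSpace.subspace class_ring (R h) ?V" if "h \<in> carrier G" for h
    using R that by (simp add: graded_algebra_def)
  note Rc = matrix_subspaceD(1)[OF sub] and Radd = matrix_subspaceD(2)[OF sub]
    and Rzero = matrix_subspaceD(3)[OF sub] and Rsmult = matrix_subspaceD(4)[OF sub]
  have R_mult: "X * Y \<in> R (h \<otimes> h')" if "h \<in> carrier G" "h' \<in> carrier G" "X \<in> R h" "Y \<in> R h'" for X Y h h'
    using R that by (simp add: graded_algebra_def module_mat_simps)
  let ?P = "\<lambda>x f. f \<in> (\<Pi>\<^sub>E g\<in>carrier G. R g) \<and> finite {g \<in> carrier G. f g \<noteq> 0\<^sub>m n n} \<and>
        x = finsum ?V f {g \<in> carrier G. f g \<noteq> 0\<^sub>m n n}"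
  have ex1: "\<exists>!f. ?P x f" if "x \<in> carrier_mat n n" for x
    using R that by (simp add: graded_algebra_def module_mat_simps)
  show ?thesis
  proof (intro graded_prime_algebra.intro graded_prime_algebra_axioms.intro)
    show "assoc_algebra (scale_op :: 'f \<Rightarrow> _)" by (rule op.assoc_algebra_axioms)
    show "comm_group G" by (rule G)
    show "op.subspace (corner n :: 'f op set)" by (rule subspace_corner)
    show "finite {emb n (unit_mat n p q :: 'f mat) | p q. p < n \<and> q < n}" by (rule finite_units)
    show "corner n \<subseteq> op.span {emb n (unit_mat n p q :: 'f mat) | p q. p < n \<and> q < n}"
      using corner_eq_span by blast
    show "x * y \<in> corner n" if "x \<in> corner n" "y \<in> corner n" for x y :: "'f op" using that by (rule corner_mult)
    show "emb n (1\<^sub>m n) \<in> (corner n :: 'f op set)" by (simp add: emb_in_corner)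
    have "1\<^sub>m n \<noteq> (0\<^sub>m n n :: 'f mat)"
    proof
      assume "1\<^sub>m n = (0\<^sub>m n n :: 'f mat)"
      then have "1\<^sub>m n $$ (0, 0) = (0\<^sub>m n n :: 'f mat) $$ (0, 0)" by simp
      then show False using n by simp
    qed
    then show "emb n (1\<^sub>m n) \<noteq> (0 :: 'f op)" by (simp add: emb_eq_0_iff)
    show "emb n (1\<^sub>m n) * x = x" "x * emb n (1\<^sub>m n) = x" if "x \<in> corner n" for x :: "'f op"
      using that by (rule corner_one)+
    show "\<exists>r\<in>corner n. x * r * y \<noteq> 0" if "x \<in> corner n" "y \<in> corner n" "x \<noteq> 0" "y \<noteq> 0" for x y :: "'f op"
      using that by (rule corner_prime)
  next
    fix h assume h: "h \<in> carrier G"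
    show "op.subspace (emb n ` R h)"
      unfolding op.subspace_def
    proof (intro conjI ballI allI)
      show "0 \<in> emb n ` R h" using Rzero[OF h] emb_zero[of n] by (metis imageI)
      fix x assume "x \<in> emb n ` R h"
      then obtain X where X: "X \<in> R h" "x = emb n X" by blast
      have Xc: "X \<in> carrier_mat n n" using X(1) Rc[OF h] by blast
      show "scale_op c x \<in> emb n ` R h" for c
        unfolding X(2) emb_smult[OF Xc, symmetric] by (rule imageI) (rule Rsmult[OF h X(1)])
      fix y assume "y \<in> emb n ` R h"
      then obtain Y where Y: "Y \<in> R h" "y = emb n Y" by blast
      have Yc: "Y \<in> carrier_mat n n" using Y(1) Rc[OF h] by blast
      show "x + y \<in> emb n ` R h"
        unfolding X(2) Y(2) emb_add[OF Xc Yc, symmetric] by (rule imageI) (rule Radd[OF h X(1) Y(1)])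
    qed
    show "x \<in> corner n" if "x \<in> emb n ` R h" for x using that Rc[OF h] by (auto simp: corner_def)
    fix h' x y assume h': "h' \<in> carrier G" and "x \<in> emb n ` R h" "y \<in> emb n ` R h'"
    then obtain X Y where XY: "X \<in> R h" "x = emb n X" "Y \<in> R h'" "y = emb n Y" by blast
    then have "X \<in> carrier_mat n n" "Y \<in> carrier_mat n n" using Rc[OF h] Rc[OF h'] by blast+
    then have "x * y = emb n (X * Y)" unfolding XY(2,4) by (rule emb_mult[symmetric])
    then show "x * y \<in> emb n ` R (h \<otimes> h')" using R_mult[OF h h' XY(1,3)] by blast
  next
    fix x :: "'f op" assume "x \<in> corner n"
    then obtain X where X: "X \<in> carrier_mat n n" "x = emb n X" by (rule corner_cases)
    obtain f where f: "f \<in> (\<Pi>\<^sub>E g\<in>carrier G. R g)" "finite {g \<in> carrier G. f g \<noteq> 0\<^sub>m n n}"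
      "X = finsum ?V f {g \<in> carrier G. f g \<noteq> 0\<^sub>m n n}" using ex1[OF X(1)] by blast
    let ?H = "{g \<in> carrier G. f g \<noteq> 0\<^sub>m n n}"
    have fR: "f g \<in> R g" if "g \<in> carrier G" for g using f(1) that by (rule PiE_mem)
    have "f \<in> ?H \<rightarrow> carrier_mat n n" using fR Rc by fastforce
    then have "x = (\<Sum>g\<in>?H. emb n (f g))" unfolding X(2) f(3) by (rule emb_finsum[OF f(2)])
    moreover have "\<forall>h\<in>?H. emb n (f h) \<in> emb n ` R h" using fR by blast
    moreover have "?H \<subseteq> carrier G" by blast
    ultimately show "\<exists>H f. finite H \<and> H \<subseteq> carrier G \<and> (\<forall>h\<in>H. f h \<in> emb n ` R h) \<and> x = (\<Sum>h\<in>H. f h)"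
      using f(2) by (intro exI[of _ ?H] exI[of _ "\<lambda>g. emb n (f g)"]) simp
  next
    fix H :: "'g set" and f h assume H: "finite H" "H \<subseteq> carrier G" "\<forall>h\<in>H. f h \<in> emb n ` R h" "(\<Sum>h\<in>H. f h) = 0" "h \<in> H"
    have "\<forall>h\<in>H. \<exists>X. X \<in> R h \<and> f h = emb n X" using H(3) by blast
    then obtain f0 where f0: "\<And>h. h \<in> H \<Longrightarrow> f0 h \<in> R h" "\<And>h. h \<in> H \<Longrightarrow> f h = emb n (f0 h)" by metis
    \<comment> \<open>The summands are completed to an extensional family: zero matrices in the
      other degrees and \<open>undefined\<close> outside the group.\<close>
    define F where "F g = (if g \<in> H then f0 g else if g \<in> carrier G then 0\<^sub>m n n else undefined)" for g
    define F0 where "F0 g = (if g \<in> carrier G then 0\<^sub>m n n else undefined :: 'f mat)" for g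
    let ?S = "{g \<in> carrier G. F g \<noteq> 0\<^sub>m n n}"
    have S: "?S \<subseteq> H" by (auto simp: F_def split: if_splits)
    have finS: "finite ?S" using S H(1) by (rule finite_subset)
    have FR: "F g \<in> R g" if "g \<in> carrier G" for g using that f0(1) Rzero by (simp add: F_def)
    have FE: "F \<in> (\<Pi>\<^sub>E g\<in>carrier G. R g)" using FR H(2) by (intro PiE_I) (auto simp: F_def)
    have Fc: "F \<in> ?S \<rightarrow> carrier_mat n n" using FR Rc by fastforce
    have "emb n (finsum ?V F ?S) = (\<Sum>g\<in>?S. emb n (F g))" by (rule emb_finsum[OF finS Fc])
    also have "\<dots> = (\<Sum>g\<in>H. emb n (F g))"
      using H(2) by (intro sum.mono_neutral_left[OF H(1) S]) (auto simp: emb_zero)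
    also have "\<dots> = (\<Sum>g\<in>H. f g)" using f0(2) by (intro sum.cong) (simp_all add: F_def)
    finally have "emb n (finsum ?V F ?S) = 0" using H(4) by simp
    moreover have "finsum ?V F ?S \<in> carrier_mat n n"
      using V.finsum_closed[of F ?S] Fc by (simp add: module_mat_simps)
    ultimately have "0\<^sub>m n n = finsum ?V F ?S" by (simp add: emb_eq_0_iff)
    then have PF: "?P (0\<^sub>m n n) F" using FE finS by simp
    have empty: "{g \<in> carrier G. F0 g \<noteq> 0\<^sub>m n n} = {}" by (auto simp: F0_def)
    have "F0 \<in> (\<Pi>\<^sub>E g\<in>carrier G. R g)" using Rzero by (intro PiE_I) (auto simp: F0_def)
    then have PF0: "?P (0\<^sub>m n n) F0" unfolding empty by (simp add: V.finsum_empty module_mat_simps)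
    have "F = F0" using ex1[OF zero_carrier_mat] PF PF0 by blast
    then have "F h = F0 h" by simp
    then have "f0 h = 0\<^sub>m n n" using H(5) subsetD[OF H(2,5)] by (simp add: F_def F0_def)
    then show "f h = 0" using f0(2)[OF H(5)] by (simp add: emb_zero)
  qed
qed

text \<open>Isomorphisms of matrix algebras and of corners correspond to each other under
  \<open>emb\<close>. Preservation of the unit is not part of \<open>alg_iso\<close>; it follows
  from surjectivity and multiplicativity.\<close>

lemma graded_isomorphic_iff_alg_iso:
  fixes R R' :: "'g \<Rightarrow> 'f::field mat set"
  assumes R: "\<And>h. h \<in> carrier G \<Longrightarrow> R h \<subseteq> carrier_mat n n"
    and R': "\<And>h. h \<in> carrier G \<Longrightarrow> R' h \<subseteq> carrier_mat N N"
  shows "graded_isomorphic G class_ring (module_mat TYPE('f) n n) R (module_mat TYPE('f) N N) R' \<longleftrightarrow>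
    (\<exists>\<phi>. op.alg_iso \<phi> (corner n) (corner N) \<and> (\<forall>h\<in>carrier G. \<phi> ` emb n ` R h = emb N ` R' h))" (is "?L \<longleftrightarrow> ?R")
proof
  assume ?L
  then obtain \<psi> where \<psi>: "\<psi> \<in> ring_iso (module_mat TYPE('f) n n) (module_mat TYPE('f) N N)"
    "\<psi> \<in> module_hom class_ring (module_mat TYPE('f) n n) (module_mat TYPE('f) N N)"
    "\<And>h. h \<in> carrier G \<Longrightarrow> \<psi> ` R h = R' h"
    unfolding graded_isomorphic_def by blast
  have \<psi>c: "\<psi> A \<in> carrier_mat N N" if "A \<in> carrier_mat n n" for A
    using \<psi>(1) that bij_betwE[of \<psi> "carrier_mat n n" "carrier_mat N N"]
    by (simp add: ring_iso_def module_mat_simps)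
  have \<psi>hom: "\<psi> (A + B) = \<psi> A + \<psi> B" "\<psi> (A * B) = \<psi> A * \<psi> B" "\<psi> (c \<cdot>\<^sub>m A) = c \<cdot>\<^sub>m \<psi> A"
    if "A \<in> carrier_mat n n" "B \<in> carrier_mat n n" for A B c
    using \<psi>(1,2) that
    by (simp_all add: ring_iso_def Ring.ring_hom_def LinearCombinations.module_hom_def module_mat_simps class_ring_simps)
  define \<phi> where "\<phi> = emb N \<circ> (\<psi> \<circ> inv_into (carrier_mat n n) (emb n))"
  have \<phi>: "\<phi> (emb n A) = emb N (\<psi> A)" if "A \<in> carrier_mat n n" for A
    using inv_into_f_f[OF emb_inj that] by (simp add: \<phi>_def)
  have "bij_betw \<psi> (carrier_mat n n) (carrier_mat N N)"
    using \<psi>(1) by (simp add: ring_iso_def module_mat_simps)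
  note bij_betw_trans[OF bij_betw_trans[OF bij_betw_inv_into[OF bij_betw_emb] this] bij_betw_emb]
  then have bij: "bij_betw \<phi> (corner n) (corner N)" unfolding \<phi>_def .
  have am: "\<phi> (x + y) = \<phi> x + \<phi> y \<and> \<phi> (x * y) = \<phi> x * \<phi> y" if xy: "x \<in> corner n" "y \<in> corner n" for x y
  proof -
    obtain A where A: "A \<in> carrier_mat n n" "x = emb n A" by (rule corner_cases[OF xy(1)])
    obtain B where B: "B \<in> carrier_mat n n" "y = emb n B" by (rule corner_cases[OF xy(2)])
    have "\<phi> (x + y) = emb N (\<psi> (A + B))" "\<phi> (x * y) = emb N (\<psi> (A * B))"
      using \<phi>[of "A + B"] \<phi>[of "A * B"] A B by (simp_all add: emb_add emb_mult)
    then show ?thesis using A B \<psi>c by (simp add: \<phi> \<psi>hom emb_add emb_mult)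
  qed
  have sc: "\<phi> (scale_op c x) = scale_op c (\<phi> x)" if x: "x \<in> corner n" for c x
  proof -
    obtain A where A: "A \<in> carrier_mat n n" "x = emb n A" by (rule corner_cases[OF x])
    have "\<phi> (scale_op c x) = emb N (\<psi> (c \<cdot>\<^sub>m A))" using \<phi>[of "c \<cdot>\<^sub>m A"] A by (simp add: emb_smult)
    then show ?thesis using A \<psi>c by (simp add: \<phi> \<psi>hom emb_smult)
  qed
  have img: "\<phi> ` emb n ` R h = emb N ` R' h" if h: "h \<in> carrier G" for h
  proof -
    have "\<phi> ` emb n ` R h = (\<lambda>A. emb N (\<psi> A)) ` R h"
      unfolding image_image using R[OF h] \<phi> by (intro image_cong) auto
    then show ?thesis unfolding \<psi>(3)[OF h, symmetric] by (simp add: image_image)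
  qed
  have iso: "op.alg_iso \<phi> (corner n) (corner N)"
    unfolding op.alg_iso_def by (intro conjI ballI allI bij) (simp_all add: am sc)
  show ?R by (rule exI[of _ \<phi>], rule conjI, rule iso, rule ballI, rule img)
next
  assume ?R
  then obtain \<phi> where \<phi>_iso: "op.alg_iso \<phi> (corner n) (corner N) \<and> (\<forall>h\<in>carrier G. \<phi> ` emb n ` R h = emb N ` R' h)" ..
  note \<phi> = conjunct1[OF \<phi>_iso] bspec[OF conjunct2[OF \<phi>_iso]]
  have bij: "bij_betw \<phi> (corner n) (corner N)" using \<phi>(1) by (simp add: op.alg_iso_def)
  have hom: "\<phi> (x + y) = \<phi> x + \<phi> y" "\<phi> (x * y) = \<phi> x * \<phi> y" "\<phi> (scale_op c x) = scale_op c (\<phi> x)"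
    if "x \<in> corner n" "y \<in> corner n" for x y c using \<phi>(1) that by (auto simp: op.alg_iso_def)
  define \<psi> where "\<psi> = inv_into (carrier_mat N N) (emb N) \<circ> (\<phi> \<circ> emb n)"
  have bij\<psi>: "bij_betw \<psi> (carrier_mat n n) (carrier_mat N N)"
    unfolding \<psi>_def by (rule bij_betw_trans[OF bij_betw_trans[OF bij_betw_emb bij] bij_betw_inv_into[OF bij_betw_emb]])
  have \<psi>c: "\<psi> A \<in> carrier_mat N N" if "A \<in> carrier_mat n n" for A using bij_betwE[OF bij\<psi>] that by blast
  have \<psi>: "emb N (\<psi> A) = \<phi> (emb n A)" if A: "A \<in> carrier_mat n n" for A
  proof -
    have "\<phi> (emb n A) \<in> emb N ` carrier_mat N N"
      using bij_betwE[OF bij] emb_in_corner[OF A] unfolding corner_def by blast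
    then show ?thesis unfolding \<psi>_def comp_def by (rule f_inv_into_f)
  qed
  have eqI: "A = B" if "A \<in> carrier_mat N N" "B \<in> carrier_mat N N" "emb N A = emb N B" for A B :: "'f mat"
    using emb_inj that by (metis inj_onD)
  have add: "\<psi> (A + B) = \<psi> A + \<psi> B" and mult: "\<psi> (A * B) = \<psi> A * \<psi> B" and scale: "\<psi> (c \<cdot>\<^sub>m A) = c \<cdot>\<^sub>m \<psi> A"
    if AB: "A \<in> carrier_mat n n" "B \<in> carrier_mat n n" for A B c
  proof -
    note c = \<psi>c[OF AB(1)] \<psi>c[OF AB(2)] and e = emb_in_corner[OF AB(1)] emb_in_corner[OF AB(2)]
    have "A + B \<in> carrier_mat n n" "A * B \<in> carrier_mat n n" "c \<cdot>\<^sub>m A \<in> carrier_mat n n" using AB by simp_all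
    note c' = this
    show "\<psi> (A + B) = \<psi> A + \<psi> B"
      by (rule eqI[OF \<psi>c[OF c'(1)]]) (use c e AB c' in \<open>simp_all add: \<psi> emb_add hom\<close>)
    show "\<psi> (A * B) = \<psi> A * \<psi> B"
      by (rule eqI[OF \<psi>c[OF c'(2)] mult_carrier_mat[OF c]]) (use c e AB c' in \<open>simp add: \<psi> emb_mult hom\<close>)
    show "\<psi> (c \<cdot>\<^sub>m A) = c \<cdot>\<^sub>m \<psi> A"
      by (rule eqI[OF \<psi>c[OF c'(3)]]) (use c e AB c' in \<open>simp_all add: \<psi> emb_smult hom\<close>)
  qed
  \<comment> \<open>The identity of size \<open>N\<close> is some \<open>\<psi> A\<close>, and the
    image of the other identity fixes \<open>\<psi> A\<close> from the left.\<close>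
  have one: "\<psi> (1\<^sub>m n) = 1\<^sub>m N"
  proof -
    have "1\<^sub>m N \<in> \<psi> ` carrier_mat n n" using bij\<psi> by (simp add: bij_betw_def)
    then obtain A where A: "A \<in> carrier_mat n n" "1\<^sub>m N = \<psi> A" by blast
    have "\<psi> (1\<^sub>m n) * \<psi> A = \<psi> A" using mult[of "1\<^sub>m n" A] A(1) by simp
    then show ?thesis unfolding A(2)[symmetric] using \<psi>c[of "1\<^sub>m n"] by simp
  qed
  have "\<psi> \<in> Ring.ring_hom (module_mat TYPE('f) n n) (module_mat TYPE('f) N N)"
    by (rule Ring.ring_hom_memI) (simp_all add: module_mat_simps \<psi>c add mult one)
  then have 1: "\<psi> \<in> ring_iso (module_mat TYPE('f) n n) (module_mat TYPE('f) N N)"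
    using bij\<psi> by (simp add: ring_iso_def module_mat_simps)
  have 2: "\<psi> \<in> module_hom class_ring (module_mat TYPE('f) n n) (module_mat TYPE('f) N N)"
    unfolding LinearCombinations.module_hom_def by (auto simp: module_mat_simps \<psi>c add scale)
  have 3: "\<psi> ` R h = R' h" if h: "h \<in> carrier G" for h
  proof -
    have "emb N ` \<psi> ` R h = \<phi> ` emb n ` R h" unfolding image_image using R[OF h] \<psi> by (intro image_cong) auto
    then have "emb N ` \<psi> ` R h = emb N ` R' h" using \<phi>(2)[OF h] by simp
    moreover have "\<psi> ` R h \<subseteq> carrier_mat N N" using R[OF h] \<psi>c by blast
    ultimately show ?thesis using inj_on_image_eq_iff[OF emb_inj _ R'[OF h]] by blast
  qed
  show ?L unfolding graded_isomorphic_def by (intro bexI[of _ \<psi>] IntI ballI 1 2) (rule 3)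
qed

section \<open>Block structures\<close>

text \<open>Inverse to the block decomposition: through \<open>\<gamma> ! blk \<kappa> p\<close>
  each entry of \<open>\<gamma>\<close> is repeated as often as \<open>\<kappa>\<close> says, which
  gives the degree family \<open>g\<close> of a graded matrix basis.\<close>

definition blk :: "nat list \<Rightarrow> nat \<Rightarrow> nat"
  where "blk \<kappa> p = (LEAST i. p < sum_list (take (Suc i) \<kappa>))"

lemma sum_list_take_mono: "i \<le> j \<Longrightarrow> sum_list (take i \<kappa>) \<le> sum_list (take j (\<kappa> :: nat list))"
proof -
  assume "i \<le> j"
  then have "take j \<kappa> = take i \<kappa> @ take (j - i) (drop i \<kappa>)" by (metis le_add_diff_inverse take_add)
  then show ?thesis by simp
qed

lemma blk_less:
  assumes p: "p < sum_list \<kappa>"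
  shows "blk \<kappa> p < length \<kappa>" "sum_list (take (blk \<kappa> p) \<kappa>) \<le> p" "p < sum_list (take (Suc (blk \<kappa> p)) \<kappa>)"
proof -
  have ne: "0 < length \<kappa>" using p by (cases \<kappa>) auto
  then have ex: "p < sum_list (take (Suc (length \<kappa> - 1)) \<kappa>)" using p by simp
  then show "p < sum_list (take (Suc (blk \<kappa> p)) \<kappa>)" unfolding blk_def by (rule LeastI)
  have "blk \<kappa> p \<le> length \<kappa> - 1" unfolding blk_def using ex by (rule Least_le)
  then show "blk \<kappa> p < length \<kappa>" using ne by arith
  show "sum_list (take (blk \<kappa> p) \<kappa>) \<le> p"
  proof (cases "blk \<kappa> p")
    case (Suc i)
    then have "\<not> p < sum_list (take (Suc i) \<kappa>)"
      using not_less_Least[of i "\<lambda>i. p < sum_list (take (Suc i) \<kappa>)"] by (simp add: blk_def)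
    then show ?thesis using Suc by simp
  qed simp
qed

lemma blk_eq_iff:
  assumes p: "p < sum_list \<kappa>"
  shows "sum_list (take i \<kappa>) \<le> p \<and> p < sum_list (take (Suc i) \<kappa>) \<longleftrightarrow> blk \<kappa> p = i"
proof
  assume i: "sum_list (take i \<kappa>) \<le> p \<and> p < sum_list (take (Suc i) \<kappa>)"
  show "blk \<kappa> p = i"
  proof (rule linorder_cases[of "blk \<kappa> p" i])
    assume "blk \<kappa> p < i"
    then show ?thesis using sum_list_take_mono[of "Suc (blk \<kappa> p)" i \<kappa>] blk_less(3)[OF p] i by simp
  next
    assume "i < blk \<kappa> p"
    then show ?thesis using sum_list_take_mono[of "Suc i" "blk \<kappa> p" \<kappa>] blk_less(2)[OF p] i by simp
  qed
qed (use blk_less[OF p] in auto)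

lemma card_blk:
  assumes "i < length \<kappa>"
  shows "card {p. p < sum_list \<kappa> \<and> blk \<kappa> p = i} = \<kappa> ! i"
proof -
  have "sum_list (take (Suc i) \<kappa>) \<le> sum_list \<kappa>" using sum_list_take_mono[of "Suc i" "length \<kappa>" \<kappa>] assms by simp
  have "{p. p < sum_list \<kappa> \<and> blk \<kappa> p = i} = {sum_list (take i \<kappa>)..<sum_list (take (Suc i) \<kappa>)}"
    (is "?L = ?R")
  proof (rule Set.set_eqI)
    fix p
    show "p \<in> ?L \<longleftrightarrow> p \<in> ?R"
    proof (cases "p < sum_list \<kappa>")
      case True
      then show ?thesis using blk_eq_iff[OF True, of i] by auto
    next
      case False
      then show ?thesis using \<open>sum_list (take (Suc i) \<kappa>) \<le> sum_list \<kappa>\<close> by auto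
    qed
  qed
  then show ?thesis using assms by (simp add: take_Suc_conv_app_nth)
qed

lemma block_idem_mult_index:
  fixes A :: "'f::field mat"
  assumes A: "A \<in> carrier_mat (sum_list \<kappa>) (sum_list \<kappa>)" and pq: "p < sum_list \<kappa>" "q < sum_list \<kappa>"
  shows "(block_idem \<kappa> i * A * block_idem \<kappa> j) $$ (p, q) = (if blk \<kappa> p = i \<and> blk \<kappa> q = j then A $$ (p, q) else 0)"
proof -
  let ?k = "sum_list \<kappa>"
  let ?f = "\<lambda>i p. if sum_list (take i \<kappa>) \<le> p \<and> p < sum_list (take (Suc i) \<kappa>) then 1 else 0 :: 'f"
  have eq: "block_idem \<kappa> i * A * block_idem \<kappa> j = mat ?k ?k (\<lambda>(p, q). mat ?k ?k (\<lambda>(p, q). ?f i p * A $$ (p, q)) $$ (p, q) * ?f j q)"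
    unfolding block_idem_def mat_diag_mult_left[OF A] by (rule mat_diag_mult_right) simp
  show ?thesis unfolding eq blk_eq_iff[OF pq(1), symmetric] blk_eq_iff[OF pq(2), symmetric] using pq by simp
qed

lemma block_idem_mult_carrier:
  "A \<in> carrier_mat (sum_list \<kappa>) (sum_list \<kappa>) \<Longrightarrow>
    block_idem \<kappa> i * A * block_idem \<kappa> j \<in> carrier_mat (sum_list \<kappa>) (sum_list \<kappa>)"
  by (auto simp: block_idem_def mat_diag_def)

section \<open>The algebras \<open>M(G, T, \<beta>, \<kappa>, \<gamma>)\<close> as graded matrix algebras\<close>

lemma M_data_pos: "M_data G T \<beta> \<kappa> \<gamma> \<Longrightarrow> 0 < sum_list \<kappa>"
  by (cases \<kappa>) (auto simp: M_data_def)

text \<open>The tensors of matrix units with the generators \<open>X t\<close> satisfy the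
  multiplication rules directly. That they span the whole corner is a dimension count: they are
  independent, and their number is the square of \<open>N\<close> because \<open>card T\<close> is
  the square of \<open>std_dim G ab\<close>.\<close>

theorem M_grading_basis:
  fixes G :: "('g, 'm) monoid_scheme" (structure) and \<beta> :: "'g \<Rightarrow> 'g \<Rightarrow> 'f::field"
  assumes G: "comm_group G" and M: "M_data G T \<beta> \<kappa> \<gamma>" and ab: "symplectic_decomposition G T \<beta> ab"
  defines "N \<equiv> sum_list \<kappa> * std_dim G ab"
  shows "\<exists>B \<sigma>. graded_matrix_basis scale_op G T \<beta> (sum_list \<kappa>) (\<lambda>p. \<gamma> ! blk \<kappa> p) (corner N)
      (\<lambda>h. emb N ` M_grading G T \<beta> \<kappa> \<gamma> ab h) B \<sigma>"
    and "card T = std_dim G ab * std_dim G ab" and "0 < N"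
    and "\<And>h. M_grading G T \<beta> \<kappa> \<gamma> ab h \<subseteq> carrier_mat N N"
proof -
  interpret comm_group G by (rule G)
  define k where "k = sum_list \<kappa>"
  define d where "d = std_dim G ab"
  define g where "g p = \<gamma> ! blk \<kappa> p" for p
  have N: "N = k * d" by (simp add: N_def k_def d_def)
  have g_eq: "g = (\<lambda>p. \<gamma> ! blk \<kappa> p)" by (rule ext) (rule g_def)
  have T: "subgroup T G" and fin: "finite T" and bc: "alternating_bicharacter G T \<beta>" and nd: "nondegenerate G T \<beta>"
    and len: "length \<gamma> = length \<kappa>" and \<gamma>: "set \<gamma> \<subseteq> carrier G"
    using M by (auto simp: M_data_def)
  have k0: "0 < k" using M_data_pos[OF M] by (simp add: k_def)
  obtain X \<sigma> where "realizes G T \<beta> d (std_grading G \<beta> ab) X \<sigma>"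
    using std_grading_realizes[OF G T bc ab] unfolding d_def by blast
  then have card: "card T = d * d" "0 < d" and Xc: "\<And>t. t \<in> T \<Longrightarrow> X t \<in> carrier_mat d d"
    and Xnz: "\<And>t. t \<in> T \<Longrightarrow> X t \<noteq> 0\<^sub>m d d"
    and X_mult: "\<And>s t. s \<in> T \<Longrightarrow> t \<in> T \<Longrightarrow> X s * X t = \<sigma> s t \<cdot>\<^sub>m X (s \<otimes> t)"
    and \<sigma>_nz: "\<And>s t. s \<in> T \<Longrightarrow> t \<in> T \<Longrightarrow> \<sigma> s t \<noteq> 0"
    and \<sigma>_comm: "\<And>s t. s \<in> T \<Longrightarrow> t \<in> T \<Longrightarrow> \<sigma> s t = \<beta> s t * \<sigma> t s"
    and \<Delta>: "\<And>g. g \<in> carrier G \<Longrightarrow> std_grading G \<beta> ab g = mat_span d (if g \<in> T then {X g} else {})"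
    unfolding realizes_def by blast+
  have Tc: "t \<in> carrier G" if "t \<in> T" for t using subgroup.mem_carrier[OF T that] .
  have Tm: "s \<otimes> t \<in> T" if "s \<in> T" "t \<in> T" for s t using subgroup.m_closed[OF T that] .
  have D: "std_grading G \<beta> ab t = mat_span d {X t}" if "t \<in> T" for t using \<Delta>[OF Tc[OF that]] that by simp
  have blk: "blk \<kappa> p < length \<kappa>" if "p < k" for p using blk_less(1) that by (simp add: k_def)
  have gc: "g p \<in> carrier G" if "p < k" for p using blk[OF that] len \<gamma> by (auto simp: g_def)
  show "card T = std_dim G ab * std_dim G ab" "0 < N" using card k0 by (simp_all add: N d_def)
  define B where "B p q t = emb N (kronecker (unit_mat k p q) (X t))" for p q t
  have Kc: "kronecker U (X t) \<in> carrier_mat N N" if "U \<in> carrier_mat k k" "t \<in> T" for U t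
    using kronecker_carrier[OF that(1) Xc[OF that(2)]] by (simp add: N)
  let ?S = "\<lambda>h. {B p q t | p q t. p < k \<and> q < k \<and> t \<in> T \<and> inv (g p) \<otimes> t \<otimes> g q = h}"
  let ?A = "op.span {B p q t | p q t. p < k \<and> q < k \<and> t \<in> T}"
  have B_mult: "B p q s * B p' q' t = (if q = p' then scale_op (\<sigma> s t) (B p q' (s \<otimes> t)) else 0)"
    if "p < k" "q < k" "p' < k" "q' < k" "s \<in> T" "t \<in> T" for p q p' q' s t
  proof -
    have 1: "B p q s * B p' q' t = emb N (kronecker (unit_mat k p q * unit_mat k p' q') (X s * X t))"
      using that unfolding B_def
      by (simp add: Kc Xc kronecker_mult[OF unit_mat_carrier unit_mat_carrier, of _ d] flip: emb_mult)
    show ?thesis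
    proof (cases "q = p'")
      case True
      have "1 \<cdot>\<^sub>m unit_mat k p q' = (unit_mat k p q' :: 'f mat)" by (intro eq_matI) simp_all
      then have "kronecker (unit_mat k p q') (\<sigma> s t \<cdot>\<^sub>m X (s \<otimes> t)) = \<sigma> s t \<cdot>\<^sub>m kronecker (unit_mat k p q') (X (s \<otimes> t))"
        using kronecker_smult[OF unit_mat_carrier[of k p q'] Xc[OF Tm[OF that(5,6)]], of 1 "\<sigma> s t"] by simp
      then show ?thesis unfolding 1 unit_mat_mult[OF that(2,3)] X_mult[OF that(5,6)]
        using True emb_smult[OF Kc[OF unit_mat_carrier Tm[OF that(5,6)]]] by (simp add: B_def)
    next
      case False
      have XX: "X s * X t \<in> carrier_mat d d" using Xc that by (intro mult_carrier_mat)
      have "kronecker (0\<^sub>m k k) (X s * X t) = 0\<^sub>m N N"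
        unfolding N by (rule kronecker_zero(1)[OF zero_carrier_mat XX])
      then show ?thesis unfolding 1 unit_mat_mult[OF that(2,3)] using False by (simp add: emb_zero)
    qed
  qed
  have B_nz: "B p q t \<noteq> 0" if "p < k" "q < k" "t \<in> T" for p q t
  proof -
    have "kronecker (unit_mat k p q) (X t) \<noteq> 0\<^sub>m N N"
      unfolding N by (rule kronecker_nz[OF unit_mat_carrier Xc unit_mat_nz Xnz]) (use that in simp_all)
    then show ?thesis unfolding B_def using emb_eq_0_iff[OF Kc[OF unit_mat_carrier that(3)]] by simp
  qed
  \<comment> \<open>The basis is first declared for its own span, because the dimension of that span
    is needed to identify it with the corner.\<close>
  have M0: "graded_matrix_basis scale_op G T \<beta> k g ?A (\<lambda>h. op.span (?S h)) B \<sigma>"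
    by (intro graded_matrix_basis.intro graded_matrix_basis_axioms.intro op.assoc_algebra_axioms)
      (fact G T fin bc nd k0 gc B_mult \<sigma>_nz \<sigma>_comm B_nz | rule refl)+
  interpret M0: graded_matrix_basis scale_op G T \<beta> k g ?A "\<lambda>h. op.span (?S h)" B \<sigma> by (rule M0)
  have N0: "0 < N" using card k0 by (simp add: N)
  have A_eq: "?A = corner N"
  proof (rule op.subspace_eq_if_dim_le[OF finite_units])
    show "corner N \<subseteq> op.span {emb N (unit_mat N p q :: 'f mat) | p q. p < N \<and> q < N}"
      using corner_eq_span by blast
    show "op.subspace ?A" by (rule op.subspace_span)
    show "op.subspace (corner N :: 'f op set)" by (rule subspace_corner)
    have "B p q t \<in> corner N" if "t \<in> T" for p q t
      unfolding B_def by (rule emb_in_corner[OF Kc[OF unit_mat_carrier that]])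
    then show "?A \<subseteq> corner N" by (intro op.span_minimal subspace_corner) blast
    have "op.dim ?A = N * N" using M0.dim_A card by (simp add: N mult_ac)
    then show "op.dim (corner N :: 'f op set) \<le> op.dim ?A" using dim_corner[OF G N0, where ?'f = 'f] by simp
  qed
  let ?W = "\<lambda>h. {kronecker U d | U d i j t. i < length \<kappa> \<and> j < length \<kappa> \<and> t \<in> T \<and>
       U \<in> {block_idem \<kappa> i * A * block_idem \<kappa> j | A. A \<in> carrier_mat (sum_list \<kappa>) (sum_list \<kappa>)} \<and>
       d \<in> std_grading G \<beta> ab t \<and> inv (\<gamma> ! i) \<otimes> t \<otimes> (\<gamma> ! j) = h}"
  have Wc: "?W h \<subseteq> carrier_mat N N" for h
  proof
    fix x assume "x \<in> ?W h"
    then obtain A D i j t where x: "x = kronecker (block_idem \<kappa> i * A * block_idem \<kappa> j) D"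
      "A \<in> carrier_mat (sum_list \<kappa>) (sum_list \<kappa>)" "D \<in> std_grading G \<beta> ab t" "t \<in> T" by blast
    have "D \<in> carrier_mat d d" using x(3) D[OF x(4)] mat_span_carrier[of "{X t}" d] Xc[OF x(4)] by auto
    then show "x \<in> carrier_mat N N"
      unfolding x(1) N using block_idem_mult_carrier[OF x(2)] by (intro kronecker_carrier) (simp_all add: k_def)
  qed
  have W: "M_grading G T \<beta> \<kappa> \<gamma> ab h = mat_span N (?W h)" for h by (simp add: M_grading_def N_def)
  show "\<And>h. M_grading G T \<beta> \<kappa> \<gamma> ab h \<subseteq> carrier_mat N N" unfolding W by (rule mat_span_carrier[OF Wc])
  have \<Gamma>_eq: "emb N ` M_grading G T \<beta> \<kappa> \<gamma> ab h = op.span (?S h)" for h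
  proof -
    have "emb N ` ?W h \<subseteq> op.span (?S h)"
    proof
      fix y assume "y \<in> emb N ` ?W h"
      then obtain A D i j t where x: "y = emb N (kronecker (block_idem \<kappa> i * A * block_idem \<kappa> j) D)"
        "A \<in> carrier_mat (sum_list \<kappa>) (sum_list \<kappa>)" "D \<in> std_grading G \<beta> ab t" "t \<in> T"
        "inv (\<gamma> ! i) \<otimes> t \<otimes> (\<gamma> ! j) = h" by blast
      define U where "U = block_idem \<kappa> i * A * block_idem \<kappa> j"
      have Uc: "U \<in> carrier_mat k k" unfolding U_def k_def by (rule block_idem_mult_carrier[OF x(2)])
      obtain c where c: "D = c \<cdot>\<^sub>m X t" using x(3) D[OF x(4)] mem_mat_span_singleton[OF Xc[OF x(4)]] by auto
      have "1 \<cdot>\<^sub>m U = U" by (intro eq_matI) simp_all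
      then have "y = scale_op c (emb N (kronecker U (X t)))"
        unfolding x(1) c using kronecker_smult[OF Uc Xc[OF x(4)], of 1 c] emb_smult[OF Kc[OF Uc x(4)]] by (simp add: U_def)
      \<comment> \<open>In the expansion of the first tensor factor only positions with row in block
        \<open>i\<close> and column in block \<open>j\<close> carry a coefficient, and these all
        have degree \<open>h\<close>.\<close>
      also have "\<dots> = scale_op c (\<Sum>p<k. \<Sum>q<k. scale_op (U $$ (p, q)) (B p q t))"
        unfolding N B_def by (subst emb_kronecker_expand[OF Uc Xc[OF x(4)]]) (rule refl)
      also have "\<dots> \<in> op.span (?S h)"
      proof (rule op.span_scale, rule op.span_sum, rule op.span_sum)
        fix p q assume "p \<in> {..<k}" "q \<in> {..<k}"
        then have pq: "p < k" "q < k" by simp_all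
        have Upq: "U $$ (p, q) = (if blk \<kappa> p = i \<and> blk \<kappa> q = j then A $$ (p, q) else 0)"
          unfolding U_def using block_idem_mult_index[OF x(2)] pq by (simp add: k_def)
        show "scale_op (U $$ (p, q)) (B p q t) \<in> op.span (?S h)"
        proof (cases "blk \<kappa> p = i \<and> blk \<kappa> q = j")
          case True
          then have "B p q t \<in> ?S h" using pq x(4,5) unfolding g_def by blast
          then show ?thesis by (intro op.span_scale op.span_base)
        next
          case False
          then have "U $$ (p, q) = 0" unfolding Upq by (rule if_not_P)
          then show ?thesis by (simp add: op.span_zero)
        qed
      qed
      finally show "y \<in> op.span (?S h)" .
    qed
    moreover have "?S h \<subseteq> emb N ` ?W h"
    proof
      fix y assume "y \<in> ?S h"
      then obtain p q t where y: "y = B p q t" "p < k" "q < k" "t \<in> T" "inv (g p) \<otimes> t \<otimes> g q = h" by blast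
      let ?E = "unit_mat k p q :: 'f mat"
      have Ec: "?E \<in> carrier_mat (sum_list \<kappa>) (sum_list \<kappa>)" using unit_mat_carrier[of k p q] by (simp add: k_def)
      \<comment> \<open>A matrix unit is its own compression to the blocks containing its row and
        its column.\<close>
      have "block_idem \<kappa> (blk \<kappa> p) * ?E * block_idem \<kappa> (blk \<kappa> q) = ?E"
      proof (rule eq_matI)
        fix a b assume "a < dim_row ?E" "b < dim_col ?E"
        then have ab: "a < sum_list \<kappa>" "b < sum_list \<kappa>" using carrier_matD[OF Ec] by simp_all
        then show "(block_idem \<kappa> (blk \<kappa> p) * ?E * block_idem \<kappa> (blk \<kappa> q)) $$ (a, b) = ?E $$ (a, b)"
          unfolding block_idem_mult_index[OF Ec ab] by (simp add: unit_mat_def k_def)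
      qed (simp_all only: carrier_matD[OF Ec] carrier_matD[OF block_idem_mult_carrier[OF Ec]])
      then have UM: "?E \<in> {block_idem \<kappa> (blk \<kappa> p) * A * block_idem \<kappa> (blk \<kappa> q) | A. A \<in> carrier_mat (sum_list \<kappa>) (sum_list \<kappa>)}"
        by (intro CollectI exI[of _ ?E] conjI Ec) (rule sym)
      have Xt: "X t \<in> std_grading G \<beta> ab t"
        unfolding D[OF y(4)] by (rule mat_span_base) (simp_all add: Xc[OF y(4)])
      have deg: "inv (\<gamma> ! blk \<kappa> p) \<otimes> t \<otimes> (\<gamma> ! blk \<kappa> q) = h" using y(5) unfolding g_def .
      have "kronecker ?E (X t) \<in> ?W h"
        by (rule CollectI, rule exI[of _ ?E], rule exI[of _ "X t"], rule exI[of _ "blk \<kappa> p"],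
          rule exI[of _ "blk \<kappa> q"], rule exI[of _ t])
          (intro conjI refl blk[OF y(2)] blk[OF y(3)] y(4) UM Xt deg)
      then show "y \<in> emb N ` ?W h" unfolding y(1) B_def by (rule imageI)
    qed
    then have "?S h \<subseteq> op.span (emb N ` ?W h)" by (rule order_trans) (rule op.span_superset)
    ultimately have "op.span (emb N ` ?W h) = op.span (?S h)"
      by (intro antisym op.span_minimal op.subspace_span)
    then show ?thesis unfolding W emb_mat_span[OF Wc] .
  qed
  have "graded_matrix_basis scale_op G T \<beta> k g (corner N) (\<lambda>h. emb N ` M_grading G T \<beta> \<kappa> \<gamma> ab h) B \<sigma>"
    by (intro graded_matrix_basis.intro graded_matrix_basis_axioms.intro op.assoc_algebra_axioms)
      (fact G T fin bc nd k0 gc B_mult \<sigma>_nz \<sigma>_comm B_nz A_eq[symmetric] | rule \<Gamma>_eq)+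
  then show "\<exists>B \<sigma>. graded_matrix_basis scale_op G T \<beta> (sum_list \<kappa>) (\<lambda>p. \<gamma> ! blk \<kappa> p) (corner N)
      (\<lambda>h. emb N ` M_grading G T \<beta> \<kappa> \<gamma> ab h) B \<sigma>"
    unfolding k_def g_eq by (intro exI)
qed

section \<open>Coset multiplicities and equivalence of \<open>(\<kappa>, \<gamma>)\<close>\<close>

context comm_group
begin

lemma coset_mult_eq_card:
  assumes "subgroup T G" "u \<in> carrier G" "\<And>p. p < k \<Longrightarrow> g p \<in> carrier G"
  shows "coset_mult T k g u = card {p. p < k \<and> T #> g p = T #> u}"
proof -
  have "{p. p < k \<and> u \<otimes> inv (g p) \<in> T} = {p. p < k \<and> T #> g p = T #> u}"
    using rcos_eq_iff[OF assms(1,2)] assms(3) by metis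
  then show ?thesis by (simp add: coset_mult_def)
qed

lemma rcos_mult_cancel:
  assumes T: "subgroup T G" and "x \<in> carrier G" "y \<in> carrier G" "v \<in> carrier G"
  shows "T #> (x \<otimes> v) = T #> (y \<otimes> v) \<longleftrightarrow> T #> x = T #> y"
proof -
  have "x \<otimes> v \<otimes> inv (y \<otimes> v) = x \<otimes> inv y" using assms by (simp add: inv_mult_group m_assoc)
  then show ?thesis using assms by (simp add: rcos_eq_iff)
qed

lemma M_data_closed: "M_data G T \<beta> \<kappa> \<gamma> \<Longrightarrow> i < length \<kappa> \<Longrightarrow> \<gamma> ! i \<in> carrier G"
  by (auto simp: M_data_def)

lemma M_data_distinct:
  assumes M: "M_data G T \<beta> \<kappa> \<gamma>" and ij: "i < length \<kappa>" "j < length \<kappa>" "T #> \<gamma> ! i = T #> \<gamma> ! j"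
  shows "i = j"
proof (rule ccontr)
  assume "i \<noteq> j"
  have c: "\<gamma> ! i \<in> carrier G" "\<gamma> ! j \<in> carrier G" using M_data_closed[OF M ij(1)] M_data_closed[OF M ij(2)] by simp_all
  have "subgroup T G" using M by (simp add: M_data_def)
  then have "\<gamma> ! j \<otimes> inv (\<gamma> ! i) \<in> T" using c ij(3) rcos_eq_iff by metis
  then have "inv (\<gamma> ! i) \<otimes> \<gamma> ! j \<in> T" using c by (simp add: m_comm)
  then show False using M ij \<open>i \<noteq> j\<close> by (simp add: M_data_def)
qed

text \<open>The cosets of the entries of \<open>\<gamma>\<close> are distinct, so at most one block
  contributes, and it does so with its full size.\<close>

lemma coset_mult_blk:
  assumes M: "M_data G T \<beta> \<kappa> \<gamma>" and u: "u \<in> carrier G"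
  shows "i < length \<kappa> \<Longrightarrow> T #> \<gamma> ! i = T #> u \<Longrightarrow> coset_mult T (sum_list \<kappa>) (\<lambda>p. \<gamma> ! blk \<kappa> p) u = \<kappa> ! i"
    and "(\<And>i. i < length \<kappa> \<Longrightarrow> T #> \<gamma> ! i \<noteq> T #> u) \<Longrightarrow> coset_mult T (sum_list \<kappa>) (\<lambda>p. \<gamma> ! blk \<kappa> p) u = 0"
proof -
  have T: "subgroup T G" using M by (simp add: M_data_def)
  have eq: "coset_mult T (sum_list \<kappa>) (\<lambda>p. \<gamma> ! blk \<kappa> p) u = card {p. p < sum_list \<kappa> \<and> T #> \<gamma> ! blk \<kappa> p = T #> u}"
    by (rule coset_mult_eq_card[OF T u]) (rule M_data_closed[OF M blk_less(1)])
  {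
    assume i: "i < length \<kappa>" "T #> \<gamma> ! i = T #> u"
    then have "{p. p < sum_list \<kappa> \<and> T #> \<gamma> ! blk \<kappa> p = T #> u} = {p. p < sum_list \<kappa> \<and> blk \<kappa> p = i}"
      using M_data_distinct[OF M blk_less(1) i(1)] by auto
    then show "coset_mult T (sum_list \<kappa>) (\<lambda>p. \<gamma> ! blk \<kappa> p) u = \<kappa> ! i" using eq card_blk[OF i(1)] by simp
  }
  assume "\<And>i. i < length \<kappa> \<Longrightarrow> T #> \<gamma> ! i \<noteq> T #> u"
  then have "{p. p < sum_list \<kappa> \<and> T #> \<gamma> ! blk \<kappa> p = T #> u} = {}" using blk_less(1) by blast
  then show "coset_mult T (sum_list \<kappa>) (\<lambda>p. \<gamma> ! blk \<kappa> p) u = 0" using eq by simp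
qed

text \<open>As all entries of \<open>\<kappa>\<close> are positive, the support of the multiplicity
  function consists of the cosets of the entries of \<open>\<gamma>\<close>, and its values there
  are the block sizes. So equality up to a shift is the same as a matching of the blocks.\<close>

lemma M_equiv_iff_coset_mult:
  assumes M: "M_data G T \<beta> \<kappa> \<gamma>" and M': "M_data G T \<beta>' \<kappa>' \<gamma>'"
  shows "M_equiv G T \<kappa> \<gamma> \<kappa>' \<gamma>' \<longleftrightarrow> (\<exists>v\<in>carrier G. \<forall>u\<in>carrier G.
    coset_mult T (sum_list \<kappa>) (\<lambda>p. \<gamma> ! blk \<kappa> p) u = coset_mult T (sum_list \<kappa>') (\<lambda>p. \<gamma>' ! blk \<kappa>' p) (u \<otimes> v))"
    (is "_ \<longleftrightarrow> (\<exists>v\<in>carrier G. \<forall>u\<in>carrier G. ?m u = ?m' (u \<otimes> v))")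
proof
  have T: "subgroup T G" using M by (simp add: M_data_def)
  note c = M_data_closed[OF M] and c' = M_data_closed[OF M']
  {
    assume "M_equiv G T \<kappa> \<gamma> \<kappa>' \<gamma>'"
    then obtain v \<pi> where len: "length \<kappa> = length \<kappa>'" and v: "v \<in> carrier G" and \<pi>: "\<pi> permutes {..<length \<kappa>}"
      and eq: "\<And>i. i < length \<kappa> \<Longrightarrow> \<kappa>' ! i = \<kappa> ! \<pi> i"
        "\<And>i. i < length \<kappa> \<Longrightarrow> T #> (\<gamma>' ! i) = T #> (\<gamma> ! \<pi> i \<otimes> v)"
      unfolding M_equiv_def by blast
    have \<pi>_less: "\<pi> i < length \<kappa>" if "i < length \<kappa>" for i using permutes_in_image[OF \<pi>, of i] that by simp
    have "?m u = ?m' (u \<otimes> v)" if u: "u \<in> carrier G" for u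
    proof -
      have match: "T #> \<gamma>' ! i = T #> (u \<otimes> v) \<longleftrightarrow> T #> \<gamma> ! \<pi> i = T #> u" if i: "i < length \<kappa>" for i
        unfolding eq(2)[OF i] by (rule rcos_mult_cancel[OF T c[OF \<pi>_less[OF i]] u v])
      show ?thesis
      proof (cases "\<exists>i<length \<kappa>. T #> \<gamma> ! \<pi> i = T #> u")
        case True
        then obtain i where i: "i < length \<kappa>" "T #> \<gamma> ! \<pi> i = T #> u" by blast
        have "?m u = \<kappa> ! \<pi> i" by (rule coset_mult_blk(1)[OF M u \<pi>_less[OF i(1)] i(2)])
        moreover have "?m' (u \<otimes> v) = \<kappa>' ! i"
          using i match[OF i(1)] len u v by (intro coset_mult_blk(1)[OF M']) simp_all
        ultimately show ?thesis using eq(1)[OF i(1)] by simp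
      next
        case False
        have "T #> \<gamma> ! j \<noteq> T #> u" if j: "j < length \<kappa>" for j
        proof -
          have "j \<in> \<pi> ` {..<length \<kappa>}" using permutes_image[OF \<pi>] j by simp
          then show ?thesis using False by blast
        qed
        then have "?m u = 0" by (rule coset_mult_blk(2)[OF M u])
        moreover have "?m' (u \<otimes> v) = 0"
          using False match len u v by (intro coset_mult_blk(2)[OF M']) simp_all
        ultimately show ?thesis by simp
      qed
    qed
    then show "\<exists>v\<in>carrier G. \<forall>u\<in>carrier G. ?m u = ?m' (u \<otimes> v)" using v by blast
  }
  assume "\<exists>v\<in>carrier G. \<forall>u\<in>carrier G. ?m u = ?m' (u \<otimes> v)"
  then obtain v where v: "v \<in> carrier G" and m: "\<And>u. u \<in> carrier G \<Longrightarrow> ?m u = ?m' (u \<otimes> v)" by blast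
  have pos: "0 < \<kappa> ! j" if "j < length \<kappa>" for j using M that by (simp add: M_data_def)
  have pos': "0 < \<kappa>' ! i" if "i < length \<kappa>'" for i using M' that by (simp add: M_data_def)
  have ex: "\<exists>j<length \<kappa>. \<kappa>' ! i = \<kappa> ! j \<and> T #> \<gamma>' ! i = T #> (\<gamma> ! j \<otimes> v)" if i: "i < length \<kappa>'" for i
  proof -
    \<comment> \<open>Shifting back by \<open>v\<close> locates the coset of the first family that
      corresponds to block \<open>i\<close> of the second.\<close>
    define u where "u = \<gamma>' ! i \<otimes> inv v"
    have u: "u \<in> carrier G" "u \<otimes> v = \<gamma>' ! i" using c'[OF i] v by (simp_all add: u_def m_assoc)
    have mu: "?m u = \<kappa>' ! i" using m[OF u(1)] coset_mult_blk(1)[OF M' c'[OF i] i refl] u(2) by simp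
    then obtain j where j: "j < length \<kappa>" "T #> \<gamma> ! j = T #> u"
      using coset_mult_blk(2)[OF M u(1)] pos'[OF i] by fastforce
    then have "\<kappa>' ! i = \<kappa> ! j" using coset_mult_blk(1)[OF M u(1)] mu by simp
    moreover have "T #> (\<gamma> ! j \<otimes> v) = T #> \<gamma>' ! i"
      using rcos_mult_cancel[OF T c[OF j(1)] u(1) v] j(2) u(2) by simp
    ultimately show ?thesis using j(1) by auto
  qed
  have ex': "\<exists>i<length \<kappa>'. T #> \<gamma>' ! i = T #> (\<gamma> ! j \<otimes> v)" if j: "j < length \<kappa>" for j
  proof -
    have "?m' (\<gamma> ! j \<otimes> v) = \<kappa> ! j" using m[OF c[OF j]] coset_mult_blk(1)[OF M c[OF j] j refl] by simp
    moreover have "\<gamma> ! j \<otimes> v \<in> carrier G" using c[OF j] v by simp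
    ultimately show ?thesis using coset_mult_blk(2)[OF M', of "\<gamma> ! j \<otimes> v"] pos[OF j] by fastforce
  qed
  obtain \<pi>0 where \<pi>0: "\<And>i. i < length \<kappa>' \<Longrightarrow> \<pi>0 i < length \<kappa> \<and> \<kappa>' ! i = \<kappa> ! \<pi>0 i \<and> T #> \<gamma>' ! i = T #> (\<gamma> ! \<pi>0 i \<otimes> v)"
    using ex by metis
  have "bij_betw \<pi>0 {..<length \<kappa>'} {..<length \<kappa>}"
  proof (rule bij_betw_imageI)
    show "inj_on \<pi>0 {..<length \<kappa>'}"
    proof (rule inj_onI)
      fix i j assume ij: "i \<in> {..<length \<kappa>'}" "j \<in> {..<length \<kappa>'}" "\<pi>0 i = \<pi>0 j"
      then have "T #> \<gamma>' ! i = T #> \<gamma>' ! j" using \<pi>0 by simp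
      then show "i = j" using M_data_distinct[OF M'] ij by simp
    qed
    show "\<pi>0 ` {..<length \<kappa>'} = {..<length \<kappa>}"
    proof
      show "{..<length \<kappa>} \<subseteq> \<pi>0 ` {..<length \<kappa>'}"
      proof
        fix j assume "j \<in> {..<length \<kappa>}"
        then have j: "j < length \<kappa>" by simp
        obtain i where i: "i < length \<kappa>'" "T #> \<gamma>' ! i = T #> (\<gamma> ! j \<otimes> v)" using ex'[OF j] by blast
        have p: "\<pi>0 i < length \<kappa>" "T #> (\<gamma> ! \<pi>0 i \<otimes> v) = T #> (\<gamma> ! j \<otimes> v)" using \<pi>0[OF i(1)] i(2) by simp_all
        then have "T #> \<gamma> ! \<pi>0 i = T #> \<gamma> ! j" using rcos_mult_cancel[OF T c[OF p(1)] c[OF j] v] by simp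
        then have "\<pi>0 i = j" by (rule M_data_distinct[OF M p(1) j])
        then show "j \<in> \<pi>0 ` {..<length \<kappa>'}" using i(1) by blast
      qed
    qed (use \<pi>0 in auto)
  qed
  moreover from this have len: "length \<kappa> = length \<kappa>'" using bij_betw_same_card by fastforce
  ultimately have bij: "bij_betw \<pi>0 {..<length \<kappa>} {..<length \<kappa>}" by simp
  \<comment> \<open>\<open>permutes\<close> asks for the identity outside the index set.\<close>
  define \<pi> where "\<pi> i = (if i < length \<kappa> then \<pi>0 i else i)" for i
  have "bij_betw \<pi> {..<length \<kappa>} {..<length \<kappa>} \<longleftrightarrow> bij_betw \<pi>0 {..<length \<kappa>} {..<length \<kappa>}"
    by (rule bij_betw_cong) (simp add: \<pi>_def)
  then have "\<pi> permutes {..<length \<kappa>}" using bij by (intro bij_imp_permutes) (simp_all add: \<pi>_def)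
  then show "M_equiv G T \<kappa> \<gamma> \<kappa>' \<gamma>'"
    unfolding M_equiv_def using len v \<pi>0
    by (intro conjI bexI[of _ v] exI[of _ \<pi>]) (simp_all add: \<pi>_def)
qed

text \<open>Rows with the same coset are gathered into one block, in an arbitrary order of the
  cosets; the representative of a coset is the degree of one of its rows.\<close>

lemma ex_M_data:
  fixes \<beta> :: "'a \<Rightarrow> 'a \<Rightarrow> 'f::field"
  assumes T: "subgroup T G" and fin: "finite T" and bc: "alternating_bicharacter G T \<beta>" and nd: "nondegenerate G T \<beta>"
    and k: "0 < k" and g: "\<And>p. p < k \<Longrightarrow> g p \<in> carrier G"
  shows "\<exists>\<kappa> \<gamma>. M_data G T \<beta> \<kappa> \<gamma> \<and>
    (\<forall>u\<in>carrier G. coset_mult T k g u = coset_mult T (sum_list \<kappa>) (\<lambda>p. \<gamma> ! blk \<kappa> p) u)"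
proof -
  let ?C = "(\<lambda>p. T #> g p) ` {..<k}"
  obtain cs where cs: "set cs = ?C" "distinct cs" using finite_distinct_list[of ?C] by auto
  define r where "r C = (SOME p. p < k \<and> T #> g p = C)" for C
  have r: "r C < k" "T #> g (r C) = C" if "C \<in> set cs" for C
  proof -
    have "\<exists>p. p < k \<and> T #> g p = C" using that unfolding cs(1) by blast
    then have "r C < k \<and> T #> g (r C) = C" unfolding r_def by (rule someI_ex)
    then show "r C < k" "T #> g (r C) = C" by simp_all
  qed
  define n where "n C = card {p. p < k \<and> T #> g p = C}" for C
  define \<gamma> where "\<gamma> = map (\<lambda>C. g (r C)) cs"
  define \<kappa> where "\<kappa> = map n cs"
  have npos: "0 < n C" if "C \<in> set cs" for C
    unfolding n_def using r[OF that] by (auto simp: card_gt_0_iff)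
  have \<gamma>i: "T #> \<gamma> ! i = cs ! i" "\<gamma> ! i \<in> carrier G" if "i < length cs" for i
    using r[OF nth_mem[OF that]] that g by (simp_all add: \<gamma>_def)
  have dist: "inv (\<gamma> ! i) \<otimes> \<gamma> ! j \<notin> T" if ij: "i < length cs" "j < length cs" "i \<noteq> j" for i j
  proof
    assume "inv (\<gamma> ! i) \<otimes> \<gamma> ! j \<in> T"
    then have "\<gamma> ! j \<otimes> inv (\<gamma> ! i) \<in> T" using \<gamma>i(2) ij by (simp add: m_comm)
    then have "T #> \<gamma> ! j = T #> \<gamma> ! i" using \<gamma>i(2) ij rcos_eq_iff[OF T] by simp
    then show False using \<gamma>i(1) ij cs(2) by (simp add: nth_eq_iff_index_eq)
  qed
  have ne: "cs \<noteq> []" using cs(1) k by auto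
  have M: "M_data G T \<beta> \<kappa> \<gamma>"
    unfolding M_data_def
  proof (intro conjI ballI allI impI)
    show "\<kappa> \<noteq> []" "length \<gamma> = length \<kappa>" using ne by (simp_all add: \<gamma>_def \<kappa>_def)
    show "0 < m" if "m \<in> set \<kappa>" for m using that npos by (auto simp: \<kappa>_def)
    show "set \<gamma> \<subseteq> carrier G" using r(1) g by (auto simp: \<gamma>_def)
    show "inv (\<gamma> ! i) \<otimes> \<gamma> ! j \<notin> T" if "i < length \<gamma>" "j < length \<gamma>" "i \<noteq> j" for i j
      using dist that by (simp add: \<gamma>_def)
  qed (fact T fin bc nd)+
  have "coset_mult T k g u = coset_mult T (sum_list \<kappa>) (\<lambda>p. \<gamma> ! blk \<kappa> p) u" if u: "u \<in> carrier G" for u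
  proof -
    have 1: "coset_mult T k g u = n (T #> u)" unfolding n_def using g by (intro coset_mult_eq_card[OF T u])
    show ?thesis
    proof (cases "T #> u \<in> set cs")
      case True
      then obtain i where i: "i < length cs" "cs ! i = T #> u" by (auto simp: in_set_conv_nth)
      then have "coset_mult T (sum_list \<kappa>) (\<lambda>p. \<gamma> ! blk \<kappa> p) u = \<kappa> ! i"
        using \<gamma>i(1)[OF i(1)] by (intro coset_mult_blk(1)[OF M u]) (simp_all add: \<kappa>_def)
      then show ?thesis using 1 i by (simp add: \<kappa>_def)
    next
      case False
      then have "{p. p < k \<and> T #> g p = T #> u} = {}" unfolding cs(1) by blast
      then have "n (T #> u) = 0" by (simp only: n_def card.empty)
      moreover have "T #> \<gamma> ! i \<noteq> T #> u" if "i < length \<kappa>" for i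
      proof -
        have i: "i < length cs" using that by (simp add: \<kappa>_def)
        show ?thesis using nth_mem[OF i] False unfolding \<gamma>i(1)[OF i] by metis
      qed
      then have "coset_mult T (sum_list \<kappa>) (\<lambda>p. \<gamma> ! blk \<kappa> p) u = 0" by (rule coset_mult_blk(2)[OF M u])
      ultimately show ?thesis using 1 by simp
    qed
  qed
  then show ?thesis using M by blast
qed

end

section \<open>The classification\<close>

lemma ex_M_grading_iso:
  fixes R :: "'g \<Rightarrow> 'f::alg_closed_field mat set" and G :: "('g, 'm) monoid_scheme"
  assumes G: "comm_group G" and n: "0 < n" and R: "graded_algebra G class_ring (module_mat TYPE('f) n n) R"
  shows "\<exists>T (\<beta> :: 'g \<Rightarrow> 'g \<Rightarrow> 'f) \<kappa> \<gamma> ab.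
     M_data G T \<beta> \<kappa> \<gamma> \<and> symplectic_decomposition G T \<beta> ab \<and>
     real (sum_list \<kappa>) * sqrt (real (card T)) = real n \<and>
     graded_isomorphic G class_ring (module_mat TYPE('f) n n) R (M_algebra G \<kappa> ab) (M_grading G T \<beta> \<kappa> \<gamma> ab)"
proof -
  interpret comm_group G by (rule G)
  interpret P: graded_prime_algebra scale_op G "corner n" "\<lambda>h. emb n ` R h" "emb n (1\<^sub>m n)"
    "{emb n (unit_mat n p q) | p q. p < n \<and> q < n}" by (rule graded_prime_algebra_corner[OF G n R])
  obtain T and \<beta> :: "'g \<Rightarrow> 'g \<Rightarrow> 'f" and k g B \<sigma>
    where M: "graded_matrix_basis scale_op G T \<beta> k g (corner n) (\<lambda>h. emb n ` R h) B \<sigma>"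
    using P.ex_graded_matrix_basis by blast
  interpret M: graded_matrix_basis scale_op G T \<beta> k g "corner n" "\<lambda>h. emb n ` R h" B \<sigma> by (rule M)
  obtain \<kappa> \<gamma> where D: "M_data G T \<beta> \<kappa> \<gamma>"
    and m: "\<And>u. u \<in> carrier G \<Longrightarrow> coset_mult T k g u = coset_mult T (sum_list \<kappa>) (\<lambda>p. \<gamma> ! blk \<kappa> p) u"
    using ex_M_data[OF M.subgroup_T M.finite_T M.bichar M.nondeg M.k_pos, where g = g, OF M.g_closed] by blast
  obtain ab where ab: "symplectic_decomposition G T \<beta> ab"
    using ex_symplectic_decomposition[OF G M.subgroup_T M.finite_T M.bichar M.nondeg] by blast
  define N where "N = sum_list \<kappa> * std_dim G ab"
  note model = M_grading_basis[OF G D ab, folded N_def]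
  obtain B' \<sigma>' where M': "graded_matrix_basis scale_op G T \<beta> (sum_list \<kappa>) (\<lambda>p. \<gamma> ! blk \<kappa> p) (corner N)
      (\<lambda>h. emb N ` M_grading G T \<beta> \<kappa> \<gamma> ab h) B' \<sigma>'" using model(1) by blast
  \<comment> \<open>The model was built from the multiplicities of \<open>g\<close> themselves, so
    the shift is \<open>\<one>\<close>.\<close>
  have m': "coset_mult T k g u = coset_mult T (sum_list \<kappa>) (\<lambda>p. \<gamma> ! blk \<kappa> p) (u \<otimes>\<^bsub>G\<^esub> \<one>\<^bsub>G\<^esub>)" if "u \<in> carrier G" for u
    using m[OF that] that by simp
  have "\<exists>\<phi>. op.alg_iso \<phi> (corner n) (corner N) \<and>
    (\<forall>h\<in>carrier G. \<phi> ` emb n ` R h = emb N ` M_grading G T \<beta> \<kappa> \<gamma> ab h)"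
    by (rule alg_iso_if_same_data[OF M M' one_closed m'])
  then obtain \<phi> where \<phi>_iso: "op.alg_iso \<phi> (corner n) (corner N) \<and>
    (\<forall>h\<in>carrier G. \<phi> ` emb n ` R h = emb N ` M_grading G T \<beta> \<kappa> \<gamma> ab h)" ..
  note \<phi> = conjunct1[OF \<phi>_iso] conjunct2[OF \<phi>_iso]
  have "VectorSpace.subspace class_ring (R h) (module_mat TYPE('f) n n)" if "h \<in> carrier G" for h
    using R that by (simp add: graded_algebra_def)
  then have Rc: "R h \<subseteq> carrier_mat n n" if "h \<in> carrier G" for h using matrix_subspaceD(1) that by blast
  have iso: "graded_isomorphic G class_ring (module_mat TYPE('f) n n) R (module_mat TYPE('f) N N) (M_grading G T \<beta> \<kappa> \<gamma> ab)"
  proof (rule iffD2[OF graded_isomorphic_iff_alg_iso])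
    show "R h \<subseteq> carrier_mat n n" if "h \<in> carrier G" for h by (rule Rc[OF that])
    show "M_grading G T \<beta> \<kappa> \<gamma> ab h \<subseteq> carrier_mat N N" for h by (rule model(4))
    show "\<exists>\<phi>. op.alg_iso \<phi> (corner n) (corner N) \<and>
        (\<forall>h\<in>carrier G. \<phi> ` emb n ` R h = emb N ` M_grading G T \<beta> \<kappa> \<gamma> ab h)"
      by (rule exI, rule \<phi>_iso)
  qed
  \<comment> \<open>Isomorphic corners have equal dimensions \<open>n * n\<close> and
    \<open>N * N\<close>, and \<open>card T\<close> is the square of \<open>std_dim G ab\<close>, so
    its root is that number.\<close>
  have size: "real (sum_list \<kappa>) * sqrt (real (card T)) = real n"
  proof -
    have zero: "0 \<in> (corner m :: 'f op set)" for m by (rule op.subspace_0[OF subspace_corner])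
    have dim_le: "op.dim (corner m :: 'f op set) \<le> op.dim (corner m' :: 'f op set)"
      if \<psi>: "op.alg_iso \<psi> (corner m) (corner m')" for \<psi> :: "'f op \<Rightarrow> 'f op" and m m'
    proof (rule op.dim_le_of_inj[where f = \<psi>, OF finite_units _ subspace_corner subspace_corner])
      have bij: "bij_betw \<psi> (corner m) (corner m')" using \<psi> by (simp add: op.alg_iso_def)
      show scale: "\<psi> (scale_op c x) = scale_op c (\<psi> x)" if "x \<in> corner m" for c x
        using \<psi> that by (simp add: op.alg_iso_def)
      show "\<psi> (x + y) = \<psi> x + \<psi> y" if "x \<in> corner m" "y \<in> corner m" for x y
        using \<psi> that by (simp add: op.alg_iso_def)
      show "corner m' \<subseteq> op.span {emb m' (unit_mat m' p q :: 'f mat) | p q. p < m' \<and> q < m'}"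
        using corner_eq_span by blast
      have "\<psi> 0 = 0" using scale[OF zero, of 0] by simp
      then show "x = 0" if "x \<in> corner m" "\<psi> x = 0" for x
        using inj_onD[OF bij_betw_imp_inj_on[OF bij] _ that(1) zero] that(2) by simp
      show "\<psi> ` corner m \<subseteq> corner m'" using bij by (simp add: bij_betw_def)
    qed
    have iso': "op.alg_iso (inv_into (corner n) \<phi>) (corner N) (corner n)"
      by (rule op.alg_iso_inverse[OF \<phi>(1) subspace_corner corner_mult])
    have "op.dim (corner n :: 'f op set) = op.dim (corner N :: 'f op set)"
      by (rule antisym[OF dim_le[OF \<phi>(1)] dim_le[OF iso']])
    then have "n * n = N * N"
      using dim_corner[OF G n, where ?'f = 'f] dim_corner[OF G model(3), where ?'f = 'f] by simp
    then have "n\<^sup>2 = N\<^sup>2" by (simp add: power2_eq_square)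
    then have "n = N" by (rule power2_eq_imp_eq) simp_all
    then show ?thesis unfolding model(2) by (simp add: N_def)
  qed
  have "graded_isomorphic G class_ring (module_mat TYPE('f) n n) R (M_algebra G \<kappa> ab) (M_grading G T \<beta> \<kappa> \<gamma> ab)"
    using iso unfolding M_algebra_def N_def .
  then show ?thesis using D ab size by (intro exI[of _ T] exI[of _ \<beta>] exI[of _ \<kappa>] exI[of _ \<gamma>] exI[of _ ab] conjI)
qed

lemma M_grading_iso_iff:
  fixes G :: "('g, 'm) monoid_scheme" and \<beta> \<beta>' :: "'g \<Rightarrow> 'g \<Rightarrow> 'f::alg_closed_field"
  assumes G: "comm_group G"
    and D: "M_data G T \<beta> \<kappa> \<gamma>" and ab: "symplectic_decomposition G T \<beta> ab"
    and D': "M_data G T' \<beta>' \<kappa>' \<gamma>'" and ab': "symplectic_decomposition G T' \<beta>' ab'"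
  shows "graded_isomorphic G class_ring (M_algebra G \<kappa> ab) (M_grading G T \<beta> \<kappa> \<gamma> ab)
      (M_algebra G \<kappa>' ab') (M_grading G T' \<beta>' \<kappa>' \<gamma>' ab') \<longleftrightarrow>
    T = T' \<and> (\<forall>s\<in>T. \<forall>t\<in>T. \<beta> s t = \<beta>' s t) \<and> M_equiv G T \<kappa> \<gamma> \<kappa>' \<gamma>'" (is "?L \<longleftrightarrow> ?R")
proof -
  interpret comm_group G by (rule G)
  define N where "N = sum_list \<kappa> * std_dim G ab"
  define N' where "N' = sum_list \<kappa>' * std_dim G ab'"
  note model = M_grading_basis[OF G D ab, folded N_def]
  note model' = M_grading_basis[OF G D' ab', folded N'_def]
  obtain B \<sigma> where M: "graded_matrix_basis scale_op G T \<beta> (sum_list \<kappa>) (\<lambda>p. \<gamma> ! blk \<kappa> p) (corner N)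
      (\<lambda>h. emb N ` M_grading G T \<beta> \<kappa> \<gamma> ab h) B \<sigma>" using model(1) by blast
  obtain B' \<sigma>' where M': "graded_matrix_basis scale_op G T' \<beta>' (sum_list \<kappa>') (\<lambda>p. \<gamma>' ! blk \<kappa>' p) (corner N')
      (\<lambda>h. emb N' ` M_grading G T' \<beta>' \<kappa>' \<gamma>' ab' h) B' \<sigma>'" using model'(1) by blast
  have L: "?L \<longleftrightarrow> (\<exists>\<phi>. op.alg_iso \<phi> (corner N) (corner N') \<and>
      (\<forall>h\<in>carrier G. \<phi> ` emb N ` M_grading G T \<beta> \<kappa> \<gamma> ab h = emb N' ` M_grading G T' \<beta>' \<kappa>' \<gamma>' ab' h))"
    unfolding M_algebra_def N_def[symmetric] N'_def[symmetric]
    by (rule graded_isomorphic_iff_alg_iso[OF model(4) model'(4)])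
  interpret M: graded_matrix_basis scale_op G T \<beta> "sum_list \<kappa>" "\<lambda>p. \<gamma> ! blk \<kappa> p" "corner N"
    "\<lambda>h. emb N ` M_grading G T \<beta> \<kappa> \<gamma> ab h" B \<sigma> by (rule M)
  interpret M': graded_matrix_basis scale_op G T' \<beta>' "sum_list \<kappa>'" "\<lambda>p. \<gamma>' ! blk \<kappa>' p" "corner N'"
    "\<lambda>h. emb N' ` M_grading G T' \<beta>' \<kappa>' \<gamma>' ab' h" B' \<sigma>' by (rule M')
  show ?thesis
  proof
    assume ?L
    then obtain \<phi> where \<phi>_iso: "op.alg_iso \<phi> (corner N) (corner N') \<and>
      (\<forall>h\<in>carrier G. \<phi> ` emb N ` M_grading G T \<beta> \<kappa> \<gamma> ab h = emb N' ` M_grading G T' \<beta>' \<kappa>' \<gamma>' ab' h)"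
      unfolding L ..
    note \<phi> = conjunct1[OF \<phi>_iso] conjunct2[OF \<phi>_iso]
    have pair: "graded_matrix_basis_pair scale_op G T \<beta> (sum_list \<kappa>) (\<lambda>p. \<gamma> ! blk \<kappa> p) (corner N)
      (\<lambda>h. emb N ` M_grading G T \<beta> \<kappa> \<gamma> ab h) B \<sigma> T' \<beta>' (sum_list \<kappa>') (\<lambda>p. \<gamma>' ! blk \<kappa>' p) (corner N')
      (\<lambda>h. emb N' ` M_grading G T' \<beta>' \<kappa>' \<gamma>' ab' h) B' \<sigma>'" by intro_locales
    note same = graded_matrix_basis_pair.same_data_if_iso[OF pair \<phi>]
    have D'': "M_data G T \<beta>' \<kappa>' \<gamma>'" using D' same(1) by simp
    show ?R using same M_equiv_iff_coset_mult[OF D D''] by simp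
  next
    assume R: ?R
    then have TT: "T' = T" and \<beta>\<beta>: "\<And>s t. s \<in> T \<Longrightarrow> t \<in> T \<Longrightarrow> \<beta>' s t = \<beta> s t" by auto
    have D'': "M_data G T \<beta>' \<kappa>' \<gamma>'" using D' TT by simp
    \<comment> \<open>\<open>\<beta>'\<close> agrees with \<open>\<beta>\<close> only on
      \<open>T\<close>, so the second basis is declared anew with \<open>\<beta>\<close> to bring
      both algebras under the same data.\<close>
    have M'': "graded_matrix_basis scale_op G T \<beta> (sum_list \<kappa>') (\<lambda>p. \<gamma>' ! blk \<kappa>' p) (corner N')
      (\<lambda>h. emb N' ` M_grading G T' \<beta>' \<kappa>' \<gamma>' ab' h) B' \<sigma>'"
    proof (intro graded_matrix_basis.intro graded_matrix_basis_axioms.intro op.assoc_algebra_axioms)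
      show "\<sigma>' s t = \<beta> s t * \<sigma>' t s" if "s \<in> T" "t \<in> T" for s t
        using M'.\<sigma>_comm[unfolded TT, OF that] \<beta>\<beta>[OF that] by metis
      show "emb N' ` M_grading G T' \<beta>' \<kappa>' \<gamma>' ab' h = op.span {B' p q t | p q t.
          p < sum_list \<kappa>' \<and> q < sum_list \<kappa>' \<and> t \<in> T \<and>
          inv\<^bsub>G\<^esub> (\<gamma>' ! blk \<kappa>' p) \<otimes>\<^bsub>G\<^esub> t \<otimes>\<^bsub>G\<^esub> (\<gamma>' ! blk \<kappa>' q) = h}" if "h \<in> carrier G" for h
        using M'.\<Gamma>_span[OF that] by (simp only: TT)
    qed (fact G M.subgroup_T M.finite_T M.bichar M.nondeg M'.k_pos M'.g_closed M'.B_mult[unfolded TT]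
        M'.\<sigma>_nz[unfolded TT] M'.B_nz[unfolded TT] M'.A_span[unfolded TT])+
    obtain v where v: "v \<in> carrier G" and m: "\<And>u. u \<in> carrier G \<Longrightarrow>
      coset_mult T (sum_list \<kappa>) (\<lambda>p. \<gamma> ! blk \<kappa> p) u = coset_mult T (sum_list \<kappa>') (\<lambda>p. \<gamma>' ! blk \<kappa>' p) (u \<otimes>\<^bsub>G\<^esub> v)"
      using R M_equiv_iff_coset_mult[OF D D''] by blast
    show ?L unfolding L by (rule alg_iso_if_same_data[OF M M'' v m])
  qed
qed

theorem theorem2p6:
  fixes G :: "('g, 'm) monoid_scheme"
  assumes "comm_group G"
  shows
    "(\<forall>n (R :: 'g \<Rightarrow> 'f::alg_closed_field mat set).
        0 < n \<and> graded_algebra G class_ring (module_mat TYPE('f) n n) R \<longrightarrow>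
        (\<exists>T (\<beta> :: 'g \<Rightarrow> 'g \<Rightarrow> 'f) \<kappa> \<gamma> ab.
           M_data G T \<beta> \<kappa> \<gamma> \<and> symplectic_decomposition G T \<beta> ab \<and>
           real (sum_list \<kappa>) * sqrt (real (card T)) = real n \<and>
           graded_isomorphic G class_ring (module_mat TYPE('f) n n) R
             (M_algebra G \<kappa> ab) (M_grading G T \<beta> \<kappa> \<gamma> ab))) \<and>
     (\<forall>T\<^sub>1 (\<beta>\<^sub>1 :: 'g \<Rightarrow> 'g \<Rightarrow> 'f) \<kappa>\<^sub>1 \<gamma>\<^sub>1 ab\<^sub>1 T\<^sub>2 (\<beta>\<^sub>2 :: 'g \<Rightarrow> 'g \<Rightarrow> 'f) \<kappa>\<^sub>2 \<gamma>\<^sub>2 ab\<^sub>2.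
        M_data G T\<^sub>1 \<beta>\<^sub>1 \<kappa>\<^sub>1 \<gamma>\<^sub>1 \<and> symplectic_decomposition G T\<^sub>1 \<beta>\<^sub>1 ab\<^sub>1 \<and>
        M_data G T\<^sub>2 \<beta>\<^sub>2 \<kappa>\<^sub>2 \<gamma>\<^sub>2 \<and> symplectic_decomposition G T\<^sub>2 \<beta>\<^sub>2 ab\<^sub>2 \<longrightarrow>
        (graded_isomorphic G class_ring
            (M_algebra G \<kappa>\<^sub>1 ab\<^sub>1) (M_grading G T\<^sub>1 \<beta>\<^sub>1 \<kappa>\<^sub>1 \<gamma>\<^sub>1 ab\<^sub>1)
            (M_algebra G \<kappa>\<^sub>2 ab\<^sub>2) (M_grading G T\<^sub>2 \<beta>\<^sub>2 \<kappa>\<^sub>2 \<gamma>\<^sub>2 ab\<^sub>2) \<longleftrightarrow>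
         T\<^sub>1 = T\<^sub>2 \<and> (\<forall>s\<in>T\<^sub>1. \<forall>t\<in>T\<^sub>1. \<beta>\<^sub>1 s t = \<beta>\<^sub>2 s t) \<and> M_equiv G T\<^sub>1 \<kappa>\<^sub>1 \<gamma>\<^sub>1 \<kappa>\<^sub>2 \<gamma>\<^sub>2))"
proof (intro conjI allI impI; (elim conjE)?)
  fix n and R :: "'g \<Rightarrow> 'f mat set"
  assume "0 < n" "graded_algebra G class_ring (module_mat TYPE('f) n n) R"
  with assms show "\<exists>T (\<beta> :: 'g \<Rightarrow> 'g \<Rightarrow> 'f) \<kappa> \<gamma> ab.
      M_data G T \<beta> \<kappa> \<gamma> \<and> symplectic_decomposition G T \<beta> ab \<and>
      real (sum_list \<kappa>) * sqrt (real (card T)) = real n \<and>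
      graded_isomorphic G class_ring (module_mat TYPE('f) n n) R (M_algebra G \<kappa> ab) (M_grading G T \<beta> \<kappa> \<gamma> ab)"
    by (rule ex_M_grading_iso)
qed (rule M_grading_iso_iff[OF assms])

end
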